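(* Let $d\in\mathbb{N}$, let $A\in\mathrm{Sym}_+(d)$ and let $K(x,y)=x^{\mathrm T}Ay+1$ for $x,y\in\mathbb{R}^d$ (the generalized bilinear kernel). Let $\rho_0\sim\mathcal N(\mu_0,\Sigma_0)$ and $\rho^*\sim\mathcal N(b,Q)$ be Gaussian distributions with means $\mu_0,b\in\mathbb{R}^d$ and covariance matrices $\Sigma_0,Q\in\mathrm{Sym}_+(d)$. Let $(\rho_t)_{t\ge 0}$ be the Stein gradient flow with respect to the kernel $K$ of $E=\mathrm{KL}(\cdot\mid\rho^* )$ starting at $\rho_0$. 1. Then $\rho_t\sim\mathcal N(\mu_t,\Sigma_t)$ for all $t\ge 0$, where $$\dot\mu_t=(\mathrm{id}-Q^{-1}\Sigma_t)A\mu_t-K(\mu_t,\mu_t)Q^{-1}(\mu_t-b),$$ $$\dot\Sigma_t=2\,\mathrm{Sym}(\Sigma_tA)-2\,\mathrm{Sym}\big(\Sigma_tA(\Sigma_t+\mu_t(\mu_t-b)^{\mathrm T})Q^{-1}\big).\qquad ( * )$$ 2. For any $\mu_0\in\mathbb{R}^d$ and $\Sigma_0\in\mathrm{Sym}_+(d)$ the system $( * )$ (both equations) has a unique solution on $[0,\infty)$. For $t\to\infty$ we have $\rho_t\rightharpoonup\rho^*$ (weak convergence), and $\|\mu_t-b\|,\ \|\Sigma_t-Q\|\in O(\exp(-2(\gamma-\varepsilon)t))$ for any $\varepsilon>0$, where $$\gamma:=\lambda_{\min}\begin{pmatrix}A\otimes \mathrm{id}_{d\times d} & \frac1{\sqrt2}(Ab)\otimes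 Q^{-1/2}\\ \frac1{\sqrt2}(b^{\mathrm T}A)\otimes Q^{-1/2} & \frac12K(b,b)Q^{-1}\end{pmatrix}>\frac{1}{K(b,b)+2\lambda_{\min}(A)\lambda_{\max}(Q)}.$$ 3. If $\mu_0=b=0$, then $( * )$ reduces to $\dot\Sigma_t=2\,\mathrm{Sym}\big(\Sigma_tA(\mathrm{id}-\Sigma_tQ^{-1})\big)$, which is called the Stein variational gradient Lyapunov equation. If additionally $\Sigma_0Q=Q\Sigma_0$ and $A$ is a diagonal matrix with $AV=VA$, where $V$ simultaneously diagonalizes $\Sigma_0$ and $Q$, then $\Sigma_tQ=Q\Sigma_t$ for all $t\ge0$ and thus we have the closed form solution $$\Sigma_t^{-1}=Q^{-1}+e^{-2tA}(\Sigma_0^{-1}-Q^{-1}).$$ 4. Now let $(\rho_t,\Phi_t)_{t>0}$ be the accelerated Stein gradient flow (with damping $\alpha_t$) of $E=\mathrm{KL}(\cdot\mid\rho^* )$ with respect to $K$, started at $\rho_0$ and $\Phi_0=0$. Then $\rho_t\sim\mathcal N(\mu_t,\Sigma_t)$, where $$\begin{cases}\dot\mu_t=2S_t\Sigma_tA\mu_t+(\mu_t^{\mathrm T}A\mu_t+1)\nu_t, & \mu_t|_{t=0}=\mu_0,\\ \dot\Sigma_t=\nu_t\mu_t^{\mathrm T}A\Sigma_t+\mathrm{Sym}\big(\Sigma_tA(2\Sigma_tS_t+\mu_t\nu_t^{\mathrm T})\big)+2\,\mathrm{Sym}(\Sigma_tA\Sigma_tS_t), & \Sigma_t|_{t=0}=\Sigma_0,\\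 \dot\nu_t=-\alpha_t\nu_t-2A\Sigma_tS_t\nu_t-A\mu_t\|\nu_t\|_2^2-Q^{-1}(\mu_t-b), & \nu_0=0,\\ \dot S_t=-\alpha_tS_t-2S_t\nu_t\mu_t^{\mathrm T}A-4\,\mathrm{Sym}(S_t^2\Sigma_tA)-\frac12(Q^{-1}-\Sigma_t^{-1}), & S_0=0.\end{cases}$$
   Context: $\mathrm{Sym}(d)$ denotes the real symmetric $d\times d$ matrices, $\mathrm{Sym}_+(d)$ the symmetric positive definite ones, and $\mathrm{Sym}(B)=\frac12(B+B^{\mathrm T})$ is the symmetrization of a square matrix. $\mathrm{id}$ is the identity matrix, $\lambda_{\min},\lambda_{\max}$ are the smallest and largest eigenvalue, $\otimes$ is the Kronecker product, $\|\cdot\|$ is the Euclidean norm of a vector (also written $\|\cdot\|_2$) or the Frobenius norm of a matrix, and a dot is the derivative in $t$. "$V$ simultaneously diagonalizes $\Sigma_0$ and $Q$" means that $V^{-1}\Sigma_0V$ and $V^{-1}QV$ are diagonal. Distributions on $\mathbb{R}^d$ are identified with their smooth positive Lebesgue densities. $\mathrm{KL}(\rho\mid\rho^* )=\int\rho\ln(\rho/\rho^* )\,dx$ is the Kullback-Leibler divergence, with first variation $\delta E(\rho)=\ln(\rho/\rho^* )+1$. For a density $\rho$ and a function $\Phi$ (modulo additive constants) let $$(G_\rho^{(K)})^{-1}[\Phi](x)=-\nabla_x\cdot\Big(\rho(x)\int_{\mathbb{R}^d}K(x,y)\rho(y)\nabla\Phi(y)\,dy\Big).$$ The Stein gradient flow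 of $E$ starting at $\rho_0$ is the smooth curve $t\mapsto\rho_t$ of densities with $\partial_t\rho_t=-(G_{\rho_t}^{(K)})^{-1}[\delta E(\rho_t)]$ and initial value $\rho_0$. Given a damping function $\alpha:[0,\infty)\to[0,\infty)$, the accelerated Stein gradient flow of $E$ is the solution $(\rho_t,\Phi_t)$ (with $\Phi_t$ understood modulo additive constants) of $$\partial_t\rho_t+\nabla\cdot\Big(\rho_t\int_{\mathbb{R}^d} K(\cdot,y)\rho_t(y)\nabla\Phi_t(y)\,dy\Big)=0,$$ $$\partial_t\Phi_t+\alpha_t\Phi_t+\int_{\mathbb{R}^d} K(y,\cdot)\langle\nabla\Phi_t(y),\nabla\Phi_t(\cdot)\rangle\rho_t(y)\,dy+\delta E(\rho_t)=0,$$ with initial density $\rho_0$ and $\Phi_0=0$.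
   Formalization: The lower bound for γ has numerator λ_min(A) instead of 1, and in the accelerated system the terms ν μ^T A Σ (in the Σ equation) and S ν μ^T A (in the S equation) are replaced by their symmetrizations Sym(·); the printed formulas fail in general. *)

theory Defs
  imports "HOL-Analysis.Analysis" "HOL-Library.Landau_Symbols"
begin

section \<open>Matrices\<close>

definition Sym_plus :: "(real^'n^'n) set" where
  "Sym_plus = {M. transpose M = M \<and> (\<forall>v. v \<noteq> 0 \<longrightarrow> v \<bullet> (M *v v) > 0)}"

definition Sym :: "real^'n^'n \<Rightarrow> real^'n^'n" where
  "Sym B = (1/2) *\<^sub>R (B + transpose B)"

text \<open>The rank-one matrix \<open>u v\<^sup>T\<close>.\<close>
definition outer :: "real^'m \<Rightarrow> real^'n \<Rightarrow> real^'n^'m" where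
  "outer u v = (\<chi> i j. u $ i * v $ j)"

definition is_diagonal :: "real^'n^'n \<Rightarrow> bool" where
  "is_diagonal M \<longleftrightarrow> (\<forall>i j. i \<noteq> j \<longrightarrow> M $ i $ j = 0)"

definition eigenvalues :: "real^'n^'n \<Rightarrow> real set" where
  "eigenvalues M = {l. \<exists>v. v \<noteq> 0 \<and> M *v v = l *\<^sub>R v}"

text \<open>Only meaningful for symmetric matrices, for which the set of real eigenvalues is
  (finite and) nonempty.\<close>
definition lambda_min :: "real^'n^'n \<Rightarrow> real" where
  "lambda_min M = Min (eigenvalues M)"

definition lambda_max :: "real^'n^'n \<Rightarrow> real" where
  "lambda_max M = Max (eigenvalues M)"

text \<open>The symmetric positive definite square root of a symmetric positive definite matrix.\<close>
definition mat_sqrt :: "real^'n^'n \<Rightarrow> real^'n^'n" where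
  "mat_sqrt M = (THE R. R \<in> Sym_plus \<and> R ** R = M)"

text \<open>Multiplication in the type class sense is componentwise on \<open>real^'n^'n\<close>, so the class
  constant \<open>exp\<close> is not the matrix exponential.\<close>
definition mat_exp :: "real^'n^'n \<Rightarrow> real^'n^'n" where
  "mat_exp M = (\<Sum>k. (1 / fact k) *\<^sub>R ((\<lambda>N. M ** N) ^^ k) (mat 1))"

text \<open>Kronecker product; the product of the index types carries the pair index.\<close>
definition kron :: "real^'n^'m \<Rightarrow> real^'q^'p \<Rightarrow> real^('n \<times> 'q)^('m \<times> 'p)" where
  "kron M N = (\<chi> i j. M $ fst i $ fst j * N $ snd i $ snd j)"

definition block_matrix ::
  "real^'n^'m \<Rightarrow> real^'q^'m \<Rightarrow> real^'n^'p \<Rightarrow> real^'q^'p \<Rightarrow> real^('n + 'q)^('m + 'p)" where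
  "block_matrix M11 M12 M21 M22 = (\<chi> i j.
     case i of
       Inl i' \<Rightarrow> (case j of Inl j' \<Rightarrow> M11 $ i' $ j' | Inr j' \<Rightarrow> M12 $ i' $ j')
     | Inr i' \<Rightarrow> (case j of Inl j' \<Rightarrow> M21 $ i' $ j' | Inr j' \<Rightarrow> M22 $ i' $ j'))"

section \<open>Densities, kernels and differential operators\<close>

definition bilinear_kernel :: "real^'n^'n \<Rightarrow> real^'n \<Rightarrow> real^'n \<Rightarrow> real" where
  "bilinear_kernel A x y = x \<bullet> (A *v y) + 1"

definition gaussian :: "real^'n \<Rightarrow> real^'n^'n \<Rightarrow> real^'n \<Rightarrow> real" where
  "gaussian m C x =
     exp (- (1/2) * ((x - m) \<bullet> (matrix_inv C *v (x - m)))) / sqrt ((2 * pi) ^ CARD('n) * det C)"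

text \<open>\<open>k\<close> times continuous differentiability on \<open>S\<close>, with derivatives relative to \<open>S\<close>.
  It is used for \<open>S = UNIV\<close> and for \<open>[0,\<infinity>) \<times> \<real>\<^sup>d\<close>, where it amounts to one-sided time
  derivatives at time 0. The function \<open>g e\<close> is the partial derivative in direction \<open>e\<close>.\<close>
primrec C_k_on :: "nat \<Rightarrow> 'a set \<Rightarrow> ('a::euclidean_space \<Rightarrow> real) \<Rightarrow> bool" where
  "C_k_on 0 S f \<longleftrightarrow> continuous_on S f"
| "C_k_on (Suc k) S f \<longleftrightarrow> (\<exists>g.
     (\<forall>x\<in>S. (f has_derivative (\<lambda>h. \<Sum>e\<in>Basis. (h \<bullet> e) * g e x)) (at x within S)) \<and>
     (\<forall>e\<in>Basis. C_k_on k S (g e)))"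

definition smooth_on :: "'a set \<Rightarrow> ('a::euclidean_space \<Rightarrow> real) \<Rightarrow> bool" where
  "smooth_on S f \<longleftrightarrow> (\<forall>k. C_k_on k S f)"

definition smooth_positive_density :: "(real^'n \<Rightarrow> real) \<Rightarrow> bool" where
  "smooth_positive_density \<rho> \<longleftrightarrow>
     smooth_on UNIV \<rho> \<and> (\<forall>x. \<rho> x > 0) \<and> has_bochner_integral lborel \<rho> 1"

definition grad :: "(real^'n \<Rightarrow> real) \<Rightarrow> real^'n \<Rightarrow> real^'n" where
  "grad f x = (\<chi> i. frechet_derivative f (at x) (axis i 1))"

definition divergence :: "(real^'n \<Rightarrow> real^'n) \<Rightarrow> real^'n \<Rightarrow> real" where
  "divergence F x = trace (jacobian F (at x))"

definition converges_weakly ::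
  "(real \<Rightarrow> real^'n \<Rightarrow> real) \<Rightarrow> (real^'n \<Rightarrow> real) \<Rightarrow> real filter \<Rightarrow> bool" where
  "converges_weakly \<rho> \<rho>' F \<longleftrightarrow>
     (\<forall>f :: real^'n \<Rightarrow> real. continuous_on UNIV f \<and> bounded (range f) \<longrightarrow>
        ((\<lambda>t. \<integral>x. f x * \<rho> t x \<partial>lborel) \<longlongrightarrow> (\<integral>x. f x * \<rho>' x \<partial>lborel)) F)"

section \<open>Stein gradient flows\<close>

text \<open>First variation of \<open>KL(\<cdot> | \<rho>')\<close>, where \<open>KL(\<rho> | \<rho>') = \<integral> \<rho> ln (\<rho> / \<rho>')\<close>. The flows below
  depend on the energy only through its first variation.\<close>
definition KL_first_variation ::
  "(real^'n \<Rightarrow> real) \<Rightarrow> (real^'n \<Rightarrow> real) \<Rightarrow> real^'n \<Rightarrow> real" where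
  "KL_first_variation \<rho>' \<rho> x = ln (\<rho> x / \<rho>' x) + 1"

definition kernel_field ::
  "(real^'n \<Rightarrow> real^'n \<Rightarrow> real) \<Rightarrow> (real^'n \<Rightarrow> real) \<Rightarrow> (real^'n \<Rightarrow> real) \<Rightarrow> real^'n \<Rightarrow> real^'n" where
  "kernel_field K \<rho> \<Phi> x = (\<integral>y. (K x y * \<rho> y) *\<^sub>R grad \<Phi> y \<partial>lborel)"

definition stein_inverse_metric ::
  "(real^'n \<Rightarrow> real^'n \<Rightarrow> real) \<Rightarrow> (real^'n \<Rightarrow> real) \<Rightarrow> (real^'n \<Rightarrow> real) \<Rightarrow> real^'n \<Rightarrow> real" where
  "stein_inverse_metric K \<rho> \<Phi> x = - divergence (\<lambda>z. \<rho> z *\<^sub>R kernel_field K \<rho> \<Phi> z) x"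

text \<open>Here \<open>\<delta>E\<close> maps a density to the first variation of the energy at that density. The Bochner
  integral of a non-integrable function is 0, hence the explicit integrability condition. The curve
  is smooth as a function of time and space, and its velocity field is continuous in both.\<close>
definition stein_gradient_flow ::
  "(real^'n \<Rightarrow> real^'n \<Rightarrow> real) \<Rightarrow> ((real^'n \<Rightarrow> real) \<Rightarrow> real^'n \<Rightarrow> real) \<Rightarrow> (real^'n \<Rightarrow> real) \<Rightarrow>
     (real \<Rightarrow> real^'n \<Rightarrow> real) \<Rightarrow> bool" where
  "stein_gradient_flow K \<delta>E \<rho>0 \<rho> \<longleftrightarrow>
     \<rho> 0 = \<rho>0 \<and>
     (\<forall>t\<ge>0. smooth_positive_density (\<rho> t)) \<and>
     smooth_on ({0..} \<times> UNIV) (\<lambda>(t, x). \<rho> t x) \<and>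
     (\<forall>t\<ge>0. \<forall>x. integrable lborel (\<lambda>y. (K x y * \<rho> t y) *\<^sub>R grad (\<delta>E (\<rho> t)) y)) \<and>
     continuous_on ({0..} \<times> UNIV) (\<lambda>(t, x). kernel_field K (\<rho> t) (\<delta>E (\<rho> t)) x) \<and>
     (\<forall>t\<ge>0. \<forall>x. ((\<lambda>s. \<rho> s x) has_real_derivative
        - stein_inverse_metric K (\<rho> t) (\<delta>E (\<rho> t)) x) (at t within {0..}))"

text \<open>The equations are required for positive times, with continuity up to time 0, and without
  any regularity of the damping \<open>\<alpha>\<close>; therefore only differentiability, not smoothness, is
  imposed in time. Identifying \<open>\<Phi> t\<close> modulo additive constants means that the initial
  condition and the second equation hold up to a constant in space, called \<open>c\<close>.\<close>
definition accelerated_stein_gradient_flow ::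
  "(real^'n \<Rightarrow> real^'n \<Rightarrow> real) \<Rightarrow> ((real^'n \<Rightarrow> real) \<Rightarrow> real^'n \<Rightarrow> real) \<Rightarrow> (real \<Rightarrow> real) \<Rightarrow>
     (real^'n \<Rightarrow> real) \<Rightarrow> (real \<Rightarrow> real^'n \<Rightarrow> real) \<Rightarrow> (real \<Rightarrow> real^'n \<Rightarrow> real) \<Rightarrow> bool" where
  "accelerated_stein_gradient_flow K \<delta>E \<alpha> \<rho>0 \<rho> \<Phi> \<longleftrightarrow>
     \<rho> 0 = \<rho>0 \<and> (\<exists>c. \<forall>x. \<Phi> 0 x = c) \<and>
     (\<forall>t\<ge>0. smooth_positive_density (\<rho> t) \<and> smooth_on UNIV (\<Phi> t)) \<and>
     continuous_on ({0..} \<times> UNIV) (\<lambda>(t, x). \<rho> t x) \<and>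
     continuous_on ({0..} \<times> UNIV) (\<lambda>(t, x). \<Phi> t x) \<and>
     (\<lambda>(t, x). \<rho> t x) differentiable_on ({0<..} \<times> UNIV) \<and>
     (\<lambda>(t, x). \<Phi> t x) differentiable_on ({0<..} \<times> UNIV) \<and>
     (\<forall>t\<ge>0. \<forall>x. integrable lborel (\<lambda>y. (K x y * \<rho> t y) *\<^sub>R grad (\<Phi> t) y)) \<and>
     (\<forall>t\<ge>0. \<forall>x. integrable lborel
        (\<lambda>y. K y x * (grad (\<Phi> t) y \<bullet> grad (\<Phi> t) x) * \<rho> t y)) \<and>
     continuous_on ({0..} \<times> UNIV) (\<lambda>(t, x). kernel_field K (\<rho> t) (\<Phi> t) x) \<and>
     (\<forall>t>0. \<forall>x. ((\<lambda>s. \<rho> s x) has_real_derivative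
        - divergence (\<lambda>z. \<rho> t z *\<^sub>R kernel_field K (\<rho> t) (\<Phi> t) z) x) (at t)) \<and>
     (\<forall>t>0. \<exists>c. \<forall>x. ((\<lambda>s. \<Phi> s x) has_real_derivative
        c - \<alpha> t * \<Phi> t x
          - (\<integral>y. K y x * (grad (\<Phi> t) y \<bullet> grad (\<Phi> t) x) * \<rho> t y \<partial>lborel)
          - \<delta>E (\<rho> t) x) (at t))"

section \<open>The systems for mean and covariance\<close>

definition stein_gaussian_system ::
  "real^'n^'n \<Rightarrow> real^'n \<Rightarrow> real^'n^'n \<Rightarrow> real^'n \<Rightarrow> real^'n^'n \<Rightarrow>
     (real \<Rightarrow> real^'n) \<Rightarrow> (real \<Rightarrow> real^'n^'n) \<Rightarrow> bool" where
  "stein_gaussian_system A b Q \<mu>0 \<Sigma>0 \<mu> \<Sigma> \<longleftrightarrow>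
     \<mu> 0 = \<mu>0 \<and> \<Sigma> 0 = \<Sigma>0 \<and>
     (\<forall>t\<ge>0. (\<mu> has_vector_derivative
        ((mat 1 - matrix_inv Q ** \<Sigma> t) ** A) *v \<mu> t
          - bilinear_kernel A (\<mu> t) (\<mu> t) *\<^sub>R (matrix_inv Q *v (\<mu> t - b))) (at t within {0..})) \<and>
     (\<forall>t\<ge>0. (\<Sigma> has_vector_derivative
        2 *\<^sub>R Sym (\<Sigma> t ** A)
          - 2 *\<^sub>R Sym (\<Sigma> t ** A ** (\<Sigma> t + outer (\<mu> t) (\<mu> t - b)) ** matrix_inv Q))
        (at t within {0..}))"

definition stein_lyapunov_equation ::
  "real^'n^'n \<Rightarrow> real^'n^'n \<Rightarrow> real^'n^'n \<Rightarrow> (real \<Rightarrow> real^'n^'n) \<Rightarrow> bool" where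
  "stein_lyapunov_equation A Q \<Sigma>0 \<Sigma> \<longleftrightarrow>
     \<Sigma> 0 = \<Sigma>0 \<and>
     (\<forall>t\<ge>0. (\<Sigma> has_vector_derivative
        2 *\<^sub>R Sym (\<Sigma> t ** A ** (mat 1 - \<Sigma> t ** matrix_inv Q))) (at t within {0..}))"

definition stein_rate_matrix ::
  "real^'n^'n \<Rightarrow> real^'n \<Rightarrow> real^'n^'n \<Rightarrow>
     real^(('n \<times> 'n) + (1 \<times> 'n))^(('n \<times> 'n) + (1 \<times> 'n))" where
  "stein_rate_matrix A b Q = block_matrix
     (kron A (mat 1))
     ((1 / sqrt 2) *\<^sub>R kron (columnvector (A *v b)) (matrix_inv (mat_sqrt Q)))
     ((1 / sqrt 2) *\<^sub>R kron (rowvector (b v* A)) (matrix_inv (mat_sqrt Q)))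
     (kron (mat 1) ((1/2 * bilinear_kernel A b b) *\<^sub>R matrix_inv Q))"

text \<open>The source writes the terms \<open>\<nu> \<mu>\<^sup>T A \<Sigma>\<close> (in the equation for \<open>\<Sigma>\<close>) and \<open>S \<nu> \<mu>\<^sup>T A\<close> (in the
  equation for \<open>S\<close>) without symmetrization. Both right-hand sides have to be symmetric matrices, and
  the moment equations of the flow contain the symmetrized terms; in dimension one the two versions
  coincide.\<close>
definition accelerated_gaussian_system ::
  "real^'n^'n \<Rightarrow> real^'n \<Rightarrow> real^'n^'n \<Rightarrow> (real \<Rightarrow> real) \<Rightarrow> real^'n \<Rightarrow> real^'n^'n \<Rightarrow>
     (real \<Rightarrow> real^'n) \<Rightarrow> (real \<Rightarrow> real^'n^'n) \<Rightarrow> (real \<Rightarrow> real^'n) \<Rightarrow> (real \<Rightarrow> real^'n^'n) \<Rightarrow> bool" where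
  "accelerated_gaussian_system A b Q \<alpha> \<mu>0 \<Sigma>0 \<mu> \<Sigma> \<nu> S \<longleftrightarrow>
     \<mu> 0 = \<mu>0 \<and> \<Sigma> 0 = \<Sigma>0 \<and> \<nu> 0 = 0 \<and> S 0 = 0 \<and>
     continuous_on {0..} \<mu> \<and> continuous_on {0..} \<Sigma> \<and>
     continuous_on {0..} \<nu> \<and> continuous_on {0..} S \<and>
     (\<forall>t>0. (\<mu> has_vector_derivative
        2 *\<^sub>R ((S t ** \<Sigma> t ** A) *v \<mu> t)
          + (\<mu> t \<bullet> (A *v \<mu> t) + 1) *\<^sub>R \<nu> t) (at t)) \<and>
     (\<forall>t>0. (\<Sigma> has_vector_derivative
        Sym (outer (\<nu> t) (\<mu> t) ** A ** \<Sigma> t)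
          + Sym (\<Sigma> t ** A ** (2 *\<^sub>R (\<Sigma> t ** S t) + outer (\<mu> t) (\<nu> t)))
          + 2 *\<^sub>R Sym (\<Sigma> t ** A ** \<Sigma> t ** S t)) (at t)) \<and>
     (\<forall>t>0. (\<nu> has_vector_derivative
        - (\<alpha> t *\<^sub>R \<nu> t)
          - 2 *\<^sub>R ((A ** \<Sigma> t ** S t) *v \<nu> t)
          - (norm (\<nu> t))\<^sup>2 *\<^sub>R (A *v \<mu> t)
          - matrix_inv Q *v (\<mu> t - b)) (at t)) \<and>
     (\<forall>t>0. (S has_vector_derivative
        - (\<alpha> t *\<^sub>R S t)
          - 2 *\<^sub>R Sym (S t ** outer (\<nu> t) (\<mu> t) ** A)
          - 4 *\<^sub>R Sym (S t ** S t ** \<Sigma> t ** A)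
          - (1/2) *\<^sub>R (matrix_inv Q - matrix_inv (\<Sigma> t))) (at t))"

end

theory Submission
  imports Defs "HOL-Probability.Distributions"
begin

text \<open>The kernel \<open>x \<bullet> A y + 1\<close> is affine in each argument. Therefore the velocity field
\<open>\<integral> K(\<cdot>,y) \<rho>(y) \<nabla>\<Phi>(y) dy\<close> is affine for every density \<open>\<rho>\<close> and every potential \<open>\<Phi>\<close>, and both flows transport the initial
Gaussian by affine maps \<open>x \<mapsto> P x + p\<close> obtained from a linear differential equation (\<open>kernel_field_affine\<close>,
\<open>affine_flow\<close>, \<open>affine_transport_gaussian\<close>). So the densities stay Gaussian. Once this is known, the velocity field
is a Gaussian integral of a polynomial of degree two (\<open>kernel_field_gaussian\<close>), and the equations for mean and
covariance can be read off from \<open>P\<close> and \<open>p\<close>.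

For the accelerated flow it remains to see that the potential is quadratic. Along the characteristics it obeys a damped
linear equation whose right-hand side is quadratic in space, so the error of quadratic interpolation solves the
homogeneous equation with initial value 0. Nonnegativity of the damping alone forces it to vanish
(\<open>damped_zero\<close>), and comparing coefficients yields the system for the mean, the covariance, \<open>\<nu>\<close> and \<open>S\<close>
(\<open>accelerated_flow_gaussian\<close>).

The moment system is the gradient flow of the Kullback-Leibler divergence between Gaussians: its derivative is
minus the dissipation \<open>D\<close>, a sum of two squares (\<open>gaussian_KL_derivative\<close>). The divergence bounds mean
and covariance, which gives global existence (\<open>stein_system_exists\<close>). The rate matrix enters because its quadratic form,
by completion of the square, is half of the dissipation with the mean frozen at \<open>b\<close> (\<open>rate_matrix_form\<close>), while the
divergence is, to second order at the target, at most half of the squared norm of the vector at which this form is evaluated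
(\<open>gaussian_KL_bounds\<close>, \<open>cov_gap_le\<close>). So near the target \<open>D\<close> is at least \<open>4 (\<gamma> - \<epsilon>)\<close> times the divergence,
and further away it is at least some positive multiple of it
(\<open>stein_system_convergence\<close>). The lower bound for \<open>\<gamma>\<close> is Young's inequality in the same completed square
(\<open>rate_lower_bound\<close>).

In the centered case with commuting matrices, the covariance equation decouples into logistic equations in a common
eigenbasis (\<open>stein_lyapunov_closed_form\<close>).\<close>

section \<open>Matrices and the Frobenius inner product\<close>

lemma bounded_bilinear_matrix_mult:
  "bounded_bilinear ((**) :: real^'n^'m \<Rightarrow> real^'p^'n \<Rightarrow> real^'p^'m)"
  unfolding bilinear_conv_bounded_bilinear [symmetric] bilinear_def
  by (auto intro!: linearI simp:
      matrix_matrix_mult_def vec_eq_iff algebra_simps sum.distrib sum_distrib_left)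

lemma bounded_bilinear_matrix_vector_mult:
  "bounded_bilinear ((*v) :: real^'n^'m \<Rightarrow> real^'n \<Rightarrow> real^'m)"
  unfolding bilinear_conv_bounded_bilinear [symmetric] bilinear_def
  by (auto intro!: linearI simp: matrix_vector_mult_def vec_eq_iff algebra_simps sum.distrib sum_distrib_left)

lemma bounded_bilinear_outer:
  "bounded_bilinear (outer :: real^'m \<Rightarrow> real^'n \<Rightarrow> real^'n^'m)"
  unfolding bilinear_conv_bounded_bilinear [symmetric] bilinear_def
  by (auto intro!: linearI simp: outer_def vec_eq_iff algebra_simps)

lemma bounded_linear_transpose: "bounded_linear (transpose :: real^'n^'m \<Rightarrow> real^'m^'n)"
  unfolding linear_conv_bounded_linear [symmetric]
  by (auto intro!: linearI simp: transpose_def vec_eq_iff)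

lemma bounded_linear_trace: "bounded_linear (trace :: real^'n^'n \<Rightarrow> real)"
  unfolding linear_conv_bounded_linear [symmetric]
  by (auto intro!: linearI simp: trace_def sum.distrib sum_distrib_left)

text \<open>Expansion rules for the matrix product, the action on vectors, the outer product,
  transposition and trace. The rules collected in \<open>algebra_simps\<close> concern the
  multiplication of the type class, which acts entrywise on matrices.\<close>

lemmas matrix_algebra =
  bounded_bilinear.add_left[OF bounded_bilinear_matrix_mult] bounded_bilinear.add_right[OF bounded_bilinear_matrix_mult]
  bounded_bilinear.diff_left[OF bounded_bilinear_matrix_mult] bounded_bilinear.diff_right[OF bounded_bilinear_matrix_mult]
  bounded_bilinear.minus_left[OF bounded_bilinear_matrix_mult] bounded_bilinear.minus_right[OF bounded_bilinear_matrix_mult]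
  bounded_bilinear.scaleR_left[OF bounded_bilinear_matrix_mult] bounded_bilinear.scaleR_right[OF bounded_bilinear_matrix_mult]
  bounded_bilinear.zero_left[OF bounded_bilinear_matrix_mult] bounded_bilinear.zero_right[OF bounded_bilinear_matrix_mult]
  bounded_bilinear.add_left[OF bounded_bilinear_matrix_vector_mult] bounded_bilinear.add_right[OF bounded_bilinear_matrix_vector_mult]
  bounded_bilinear.diff_left[OF bounded_bilinear_matrix_vector_mult] bounded_bilinear.diff_right[OF bounded_bilinear_matrix_vector_mult]
  bounded_bilinear.minus_left[OF bounded_bilinear_matrix_vector_mult] bounded_bilinear.minus_right[OF bounded_bilinear_matrix_vector_mult]
  bounded_bilinear.scaleR_left[OF bounded_bilinear_matrix_vector_mult] bounded_bilinear.scaleR_right[OF bounded_bilinear_matrix_vector_mult]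
  bounded_bilinear.zero_left[OF bounded_bilinear_matrix_vector_mult] bounded_bilinear.zero_right[OF bounded_bilinear_matrix_vector_mult]
  bounded_bilinear.add_left[OF bounded_bilinear_outer] bounded_bilinear.add_right[OF bounded_bilinear_outer]
  bounded_bilinear.diff_left[OF bounded_bilinear_outer] bounded_bilinear.diff_right[OF bounded_bilinear_outer]
  bounded_bilinear.scaleR_left[OF bounded_bilinear_outer] bounded_bilinear.scaleR_right[OF bounded_bilinear_outer]
  bounded_bilinear.zero_left[OF bounded_bilinear_outer] bounded_bilinear.zero_right[OF bounded_bilinear_outer]
  linear_add[OF bounded_linear.linear[OF bounded_linear_transpose]] linear_diff[OF bounded_linear.linear[OF bounded_linear_transpose]]
  linear_neg[OF bounded_linear.linear[OF bounded_linear_transpose]] linear_scale[OF bounded_linear.linear[OF bounded_linear_transpose]]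
  linear_add[OF bounded_linear.linear[OF bounded_linear_trace]] linear_diff[OF bounded_linear.linear[OF bounded_linear_trace]]
  linear_neg[OF bounded_linear.linear[OF bounded_linear_trace]] linear_scale[OF bounded_linear.linear[OF bounded_linear_trace]]
  linear_0[OF bounded_linear.linear[OF bounded_linear_transpose]] linear_0[OF bounded_linear.linear[OF bounded_linear_trace]]
  matrix_transpose_mul matrix_mul_assoc matrix_vector_mul_assoc matrix_mul_lid matrix_mul_rid

lemma inner_matrix_vector:
  fixes M :: "real^'n^'m"
  shows "x \<bullet> (M *v y) = (transpose M *v x) \<bullet> y"
  by (simp add: dot_lmul_matrix)

lemma inner_matrix_eq_trace:
  fixes M N :: "real^'n^'m"
  shows "M \<bullet> N = trace (transpose M ** N)"
  unfolding inner_vec_def trace_def transpose_def matrix_matrix_mult_def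
  by (simp, subst sum.swap, simp)

lemma trace_transpose: "trace (transpose M) = trace (M :: real^'n^'n)"
  by (simp add: trace_def transpose_def)

lemma inner_matrix_mult_right:
  fixes X :: "real^'n^'m" and B :: "real^'n^'p" and Y :: "real^'p^'m"
  shows "X \<bullet> (Y ** B) = (X ** transpose B) \<bullet> Y"
proof -
  have "X \<bullet> (Y ** B) = trace ((transpose X ** Y) ** B)" by (simp add: inner_matrix_eq_trace matrix_mul_assoc)
  also have "\<dots> = trace (B ** (transpose X ** Y))" by (rule trace_mul_sym)
  finally show ?thesis by (simp add: inner_matrix_eq_trace matrix_transpose_mul matrix_mul_assoc)
qed

lemma inner_transpose: "transpose X \<bullet> transpose Y = X \<bullet> (Y :: real^'n^'m)"
  unfolding inner_vec_def transpose_def by (simp, subst sum.swap, simp)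

lemma norm_transpose: "norm (transpose X) = norm (X :: real^'n^'m)"
  by (simp add: norm_eq_sqrt_inner inner_transpose)

lemma inner_outer: "X \<bullet> outer u v = u \<bullet> (X *v v)"
  unfolding inner_vec_def outer_def matrix_vector_mult_def
  by (simp add: sum_distrib_left ac_simps)

lemma outer_mult_vector: "outer u v *v x = (v \<bullet> x) *\<^sub>R u"
  by (simp add: outer_def matrix_vector_mult_def inner_vec_def vec_eq_iff sum_distrib_left sum_distrib_right ac_simps)

lemma matrix_mult_outer: "M ** outer u v = outer (M *v u) v"
  by (simp add: outer_def matrix_vector_mult_def matrix_matrix_mult_def vec_eq_iff sum_distrib_left sum_distrib_right ac_simps)

lemma outer_matrix_mult: "outer u v ** M = outer u (transpose M *v v)"
  by (simp add: outer_def matrix_matrix_mult_def vec_eq_iff vector_matrix_mult_def sum_distrib_left sum_distrib_right ac_simps)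

lemma transpose_outer: "transpose (outer u v) = outer v u"
  by (simp add: outer_def transpose_def vec_eq_iff)

lemma norm_outer: "norm (outer u v) = norm u * norm v"
proof -
  have "outer u v \<bullet> outer u v = (u \<bullet> u) * (v \<bullet> v)"
    by (simp add: inner_outer outer_mult_vector)
  thus ?thesis by (simp add: norm_eq_sqrt_inner real_sqrt_mult)
qed

text \<open>The norm is the Frobenius norm. Testing \<open>M\<close> against the rank-one matrix
  \<open>(M x) x\<^sup>T\<close> reduces the bound to the Cauchy-Schwarz inequality.\<close>

lemma norm_matrix_vector_le:
  fixes M :: "real^'n^'m" shows "norm (M *v x) \<le> norm M * norm x"
proof -
  have "(norm (M *v x))\<^sup>2 = M \<bullet> outer (M *v x) x"
    by (simp add: inner_outer power2_norm_eq_inner)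
  also have "\<dots> \<le> norm M * (norm (M *v x) * norm x)"
    using norm_cauchy_schwarz[of M "outer (M *v x) x"] by (simp add: norm_outer)
  finally have "norm (M *v x) * norm (M *v x) \<le> (norm M * norm x) * norm (M *v x)"
    by (simp add: power2_eq_square ac_simps)
  thus ?thesis by (cases "norm (M *v x) = 0") (auto simp: mult_le_cancel_right)
qed

lemma norm_matrix_mult_le:
  fixes M :: "real^'n^'m" and N :: "real^'p^'n" shows "norm (M ** N) \<le> norm M * norm N"
proof -
  have row: "(M ** N) $ i = transpose N *v (M $ i)" for i
    by (simp add: vec_eq_iff matrix_matrix_mult_def vector_matrix_mult_def ac_simps)
  have "(norm (M ** N))\<^sup>2 = (\<Sum>i\<in>UNIV. (norm ((M ** N) $ i))\<^sup>2)"
    by (simp add: norm_vec_def L2_set_def sum_nonneg)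
  also have "\<dots> \<le> (\<Sum>i\<in>UNIV. (norm N * norm (M $ i))\<^sup>2)"
    unfolding row by (intro sum_mono power_mono norm_ge_zero order_trans[OF norm_matrix_vector_le]) (simp add: norm_transpose)
  also have "\<dots> = (norm N)\<^sup>2 * (norm M)\<^sup>2"
    by (simp add: norm_vec_def L2_set_def sum_nonneg power_mult_distrib sum_distrib_left)
  finally have "(norm (M ** N))\<^sup>2 \<le> (norm M * norm N)\<^sup>2" by (simp add: power_mult_distrib ac_simps)
  thus ?thesis by (rule power2_le_imp_le) simp
qed

lemma matrix_inv_inverse:
  assumes "invertible (M :: real^'n^'n)"
  shows "M ** matrix_inv M = mat 1" "matrix_inv M ** M = mat 1"
  using someI_ex[OF assms[unfolded invertible_def]] unfolding matrix_inv_def by auto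

lemma matrix_inv_unique:
  fixes M N :: "real^'n^'n"
  assumes "M ** N = mat 1"
  shows "invertible M" "matrix_inv M = N"
proof -
  show inv: "invertible M" using assms invertible_right_inverse by blast
  have "matrix_inv M = matrix_inv M ** (M ** N)" by (simp add: assms)
  also have "\<dots> = N" using matrix_inv_inverse[OF inv] by (simp add: matrix_mul_assoc)
  finally show "matrix_inv M = N" .
qed

lemma Sym_plusD:
  assumes "M \<in> Sym_plus"
  shows "transpose M = M" "v \<noteq> 0 \<Longrightarrow> 0 < v \<bullet> (M *v v)" "0 \<le> v \<bullet> (M *v v)"
  using assms by (auto simp: Sym_plus_def intro: less_imp_le) (metis inner_zero_left less_imp_le order_refl)

lemma Sym_plus_invertible:
  assumes "M \<in> Sym_plus" shows "invertible M"
proof -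
  have "x = 0" if "M *v x = 0" for x
    using Sym_plusD(2)[OF assms, of x] that by (cases "x = 0") auto
  thus ?thesis by (simp add: invertible_left_inverse matrix_left_invertible_ker)
qed

lemmas Sym_plus_inv = matrix_inv_inverse[OF Sym_plus_invertible]

lemma transpose_matrix_inv:
  assumes "invertible (M :: real^'n^'n)"
  shows "transpose (matrix_inv M) = matrix_inv (transpose M)"
  using matrix_inv_inverse[OF assms] matrix_inv_unique(2)[of "transpose M" "transpose (matrix_inv M)"]
  by (metis matrix_transpose_mul transpose_mat)

lemma matrix_inv_mult:
  assumes "invertible (M :: real^'n^'n)" "invertible (N :: real^'n^'n)"
  shows "matrix_inv (M ** N) = matrix_inv N ** matrix_inv M"
proof -
  have "M ** N ** (matrix_inv N ** matrix_inv M) = M ** (N ** matrix_inv N) ** matrix_inv M"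
    by (simp only: matrix_mul_assoc)
  also have "\<dots> = mat 1" by (simp add: assms matrix_inv_inverse)
  finally show ?thesis by (rule matrix_inv_unique(2))
qed

lemma Sym_plus_matrix_inv:
  assumes "M \<in> Sym_plus" shows "matrix_inv M \<in> Sym_plus"
proof -
  have t: "transpose (matrix_inv M) = matrix_inv M"
    using transpose_matrix_inv[OF Sym_plus_invertible[OF assms]] Sym_plusD(1)[OF assms] by simp
  moreover have "0 < v \<bullet> (matrix_inv M *v v)" if "v \<noteq> 0" for v
  proof -
    have eq: "M *v (matrix_inv M *v v) = v" using Sym_plus_inv[OF assms] by (simp add: matrix_vector_mul_assoc)
    hence "matrix_inv M *v v \<noteq> 0" using that by auto
    from Sym_plusD(2)[OF assms this] show ?thesis unfolding eq by (simp add: inner_commute)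
  qed
  ultimately show ?thesis by (simp add: Sym_plus_def)
qed

lemma Sym_plus_congruence:
  assumes "M \<in> Sym_plus" "invertible (P :: real^'n^'n)"
  shows "P ** M ** transpose P \<in> Sym_plus"
proof -
  have "0 < v \<bullet> ((P ** M ** transpose P) *v v)" if "v \<noteq> 0" for v
  proof -
    have "transpose P *v v \<noteq> 0"
      using that assms(2) by (metis invertible_left_inverse matrix_left_invertible_ker transpose_invertible)
    moreover have "v \<bullet> ((P ** M ** transpose P) *v v) = (transpose P *v v) \<bullet> (M *v (transpose P *v v))"
      by (metis inner_matrix_vector matrix_vector_mul_assoc)
    ultimately show ?thesis using Sym_plusD(2)[OF assms(1)] by metis
  qed
  thus ?thesis using Sym_plusD(1)[OF assms(1)] by (simp add: Sym_plus_def matrix_transpose_mul matrix_mul_assoc)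
qed

section \<open>Spectral theorem\<close>

text \<open>A maximizer \<open>v\<close> of the Rayleigh quotient on the unit sphere of the
  subspace is an eigenvector: otherwise moving from \<open>v\<close> in the direction of the
  residual \<open>w = M v - l v\<close> would increase the quotient to first order.\<close>

lemma symmetric_eigenvector_in_subspace:
  fixes M :: "real^'n^'n"
  assumes sym: "transpose M = M" and S: "subspace S" "\<exists>x\<in>S. x \<noteq> 0" and inv: "\<And>x. x \<in> S \<Longrightarrow> M *v x \<in> S"
  shows "\<exists>v\<in>S. \<exists>l. norm v = 1 \<and> M *v v = l *\<^sub>R v"
proof -
  let ?K = "S \<inter> sphere 0 1"
  obtain x0 where x0: "x0 \<in> S" "x0 \<noteq> 0" using S(2) by blast
  hence ne: "(1 / norm x0) *\<^sub>R x0 \<in> ?K" using S(1) by (simp add: subspace_scale)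
  have "compact ?K" by (intro closed_Int_compact closed_subspace S compact_sphere)
  moreover have "continuous_on ?K (\<lambda>x. x \<bullet> (M *v x))"
    by (intro continuous_intros bounded_linear.continuous_on[OF bounded_bilinear.bounded_linear_right[OF bounded_bilinear_matrix_vector_mult]])
  ultimately obtain v where v: "v \<in> ?K" and max: "\<And>y. y \<in> ?K \<Longrightarrow> y \<bullet> (M *v y) \<le> v \<bullet> (M *v v)"
    using continuous_attains_sup[of ?K] ne by blast
  define l where "l = v \<bullet> (M *v v)"
  have vv: "v \<bullet> v = 1" "norm v = 1" "v \<in> S" using v by (auto simp: norm_eq_1)
  have quad: "y \<bullet> (M *v y) \<le> l * (y \<bullet> y)" if "y \<in> S" for y
  proof (cases "y = 0")
    case False
    hence "(1 / norm y) *\<^sub>R y \<in> ?K" using S(1) that by (simp add: subspace_scale)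
    from max[OF this] have "(y \<bullet> (M *v y)) / (norm y)\<^sup>2 \<le> l"
      by (simp add: l_def matrix_vector_mult_scaleR power2_eq_square field_simps)
    thus ?thesis using False by (simp add: power2_norm_eq_inner pos_divide_le_eq inner_gt_zero_iff)
  qed auto
  define w where "w = M *v v - l *\<^sub>R v"
  have wS: "w \<in> S" unfolding w_def using S(1) inv vv(3) by (intro subspace_diff subspace_scale) auto
  have vw: "v \<bullet> w = 0" by (simp add: w_def inner_diff_right vv l_def)
  have wMv: "w \<bullet> (M *v v) = w \<bullet> w"
    using vw by (simp add: w_def inner_diff_right inner_diff_left inner_commute)
  have vMw: "v \<bullet> (M *v w) = w \<bullet> w"
    using wMv sym inner_matrix_vector[of v M w] by (simp add: inner_commute)
  have "w \<bullet> w = 0"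
  proof (rule ccontr)
    assume "w \<bullet> w \<noteq> 0" hence pos: "w \<bullet> w > 0" by (simp add: inner_gt_zero_iff)
    define c where "c = l * (w \<bullet> w) - w \<bullet> (M *v w)"
    have ineq: "2 * t * (w \<bullet> w) \<le> t * t * c" for t
    proof -
      have "v + t *\<^sub>R w \<in> S" using vv wS S(1) by (intro subspace_add subspace_scale) auto
      from quad[OF this] show ?thesis
        by (simp add: matrix_vector_right_distrib matrix_vector_mult_scaleR inner_add_left inner_add_right vv vw vw[unfolded inner_commute[of v]] wMv vMw l_def[symmetric] c_def algebra_simps)
    qed
    define t where "t = (w \<bullet> w) / (\<bar>c\<bar> + 1)"
    have t: "t > 0" using pos by (simp add: t_def add_nonneg_pos)
    have "2 * (w \<bullet> w) \<le> t * c" using ineq[of t] t by (simp add: mult.assoc)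
    also have "\<dots> \<le> t * (\<bar>c\<bar> + 1)" using t by (intro mult_left_mono) auto
    also have "\<dots> = w \<bullet> w" by (simp add: t_def)
    finally show False using pos by simp
  qed
  hence "M *v v = l *\<^sub>R v" by (simp add: w_def)
  thus ?thesis using vv by blast
qed

definition diag :: "('n \<Rightarrow> real) \<Rightarrow> real^'n^'n" where
  "diag d = (\<chi> i j. if i = j then d i else 0)"

lemma diag_mult: "(diag d ** M) $ i $ j = d i * M $ i $ j"
proof -
  have "(diag d ** M) $ i $ j = (\<Sum>k\<in>UNIV. if k = i then d i * M $ i $ j else 0)"
    unfolding matrix_matrix_mult_def diag_def vec_lambda_beta by (rule sum.cong) auto
  thus ?thesis by simp
qed

lemma mult_diag: "(M ** diag d) $ i $ j = M $ i $ j * d j"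
proof -
  have "(M ** diag d) $ i $ j = (\<Sum>k\<in>UNIV. if k = j then M $ i $ j * d j else 0)"
    unfolding matrix_matrix_mult_def diag_def vec_lambda_beta by (rule sum.cong) auto
  thus ?thesis by simp
qed

lemma diag_mult_diag: "diag d ** diag e = diag (\<lambda>i. d i * e i)"
  by (simp add: vec_eq_iff diag_mult) (simp add: diag_def)

lemma transpose_diag [simp]: "transpose (diag d) = diag d"
  by (simp add: diag_def transpose_def vec_eq_iff)

lemma diag_1: "diag (\<lambda>_. 1) = mat 1"
  by (simp add: diag_def mat_def vec_eq_iff)

lemma diag_mult_vec: "(diag d *v x) $ i = d i * x $ i"
proof -
  have "(diag d *v x) $ i = (\<Sum>k\<in>UNIV. if k = i then d i * x $ i else 0)"
    unfolding matrix_vector_mult_def diag_def vec_lambda_beta by (rule sum.cong) auto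
  thus ?thesis by simp
qed

lemma det_diag: "det (diag d) = prod d UNIV"
  using det_diagonal[of "diag d"] by (simp add: diag_def)

lemma trace_diag: "trace (diag d) = sum d UNIV"
  by (simp add: trace_def diag_def)

text \<open>An orthonormal set of eigenvectors of maximal cardinality spans the space, because its
  orthogonal complement is invariant under \<open>M\<close> and would contain one more
  eigenvector.\<close>

theorem spectral_theorem:
  fixes M :: "real^'n^'n"
  assumes sym: "transpose M = M"
  obtains U d where "orthogonal_matrix U" "M = U ** diag d ** transpose U"
proof -
  define good where "good B \<longleftrightarrow> pairwise orthogonal B \<and> (\<forall>v\<in>B. norm v = 1 \<and> (\<exists>l. M *v v = l *\<^sub>R v))" for B :: "(real^'n) set"
  have indep: "independent B" if "good B" for B
    using that by (intro pairwise_orthogonal_independent) (auto simp: good_def)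
  have bound: "finite B \<and> card B \<le> CARD('n)" if "good B" for B
    using independent_bound[OF indep[OF that]] by simp
  have "\<exists>B. good B \<and> (\<forall>B'. good B' \<longrightarrow> card B' \<le> card B)"
  proof (rule ex_has_greatest_nat[of good "{}" card "Suc CARD('n)"])
    show "good {}" by (simp add: good_def)
    show "\<forall>y. good y \<longrightarrow> card y < Suc CARD('n)" using bound by (auto simp: less_Suc_eq_le)
  qed
  then obtain B where B: "good B" and max0: "\<forall>B'. good B' \<longrightarrow> card B' \<le> card B" by (elim exE conjE)
  have max: "card B' \<le> card B" if "good B'" for B' using max0 that by auto
  have finB: "finite B" using bound B by blast
  have span: "span B = UNIV"
  proof (rule ccontr)
    assume "span B \<noteq> UNIV"
    define S where "S = {x. \<forall>v\<in>B. orthogonal v x}"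
    have sub: "subspace S" unfolding S_def
      by (auto simp: subspace_def orthogonal_def inner_add_right)
    obtain a where a: "a \<noteq> 0" "\<And>x. x \<in> span B \<Longrightarrow> orthogonal a x"
      using orthogonal_to_subspace_exists_gen[of B UNIV] \<open>span B \<noteq> UNIV\<close> by (auto simp: psubset_eq)
    hence "a \<in> S" by (auto simp: S_def orthogonal_commute span_base)
    have inv: "M *v x \<in> S" if x: "x \<in> S" for x
      unfolding S_def
    proof safe
      fix v assume "v \<in> B"
      then obtain l where "M *v v = l *\<^sub>R v" using B by (auto simp: good_def)
      thus "orthogonal v (M *v x)"
        using sym inner_matrix_vector[of v M x] x \<open>v \<in> B\<close> by (simp add: orthogonal_def S_def)
    qed
    obtain v l where v: "v \<in> S" "norm v = 1" "M *v v = l *\<^sub>R v"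
      using symmetric_eigenvector_in_subspace[OF sym sub _ inv] \<open>a \<in> S\<close> a(1) by blast
    have "v \<notin> B" using v by (auto simp: S_def orthogonal_def norm_eq_1)
    moreover have "good (insert v B)"
      using B v by (auto simp: good_def pairwise_insert S_def orthogonal_commute)
    ultimately show False using max[of "insert v B"] finB by simp
  qed
  have "card B = CARD('n)" using basis_card_eq_dim[of B UNIV] indep[OF B] span by (simp add: finB dim_UNIV)
  then obtain f where f: "bij_betw f (UNIV :: 'n set) B"
    using finB finite_same_card_bij[of "UNIV :: 'n set" B] by auto
  have "\<forall>i. \<exists>l. M *v f i = l *\<^sub>R f i" using bij_betwE[OF f] B by (auto simp: good_def)
  then obtain d where d: "\<And>i. M *v f i = d i *\<^sub>R f i" by metis
  define U :: "real^'n^'n" where "U = (\<chi> i j. f j $ i)"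
  have col: "column j U = f j" for j by (simp add: U_def column_def)
  have orth: "orthogonal_matrix U"
    unfolding orthogonal_matrix_orthonormal_columns col
  proof (intro conjI allI impI)
    fix i show "norm (f i) = 1" using B bij_betwE[OF f] by (simp add: good_def)
    fix j :: 'n assume "i \<noteq> j"
    hence "f i \<noteq> f j" using f by (simp add: bij_betw_def inj_eq)
    thus "orthogonal (f i) (f j)" using B bij_betwE[OF f] by (simp add: good_def pairwise_def)
  qed
  have "M ** U = U ** diag d"
  proof -
    have "(M ** U) $ i $ j = (U ** diag d) $ i $ j" for i j
    proof -
      have "(M ** U) $ i $ j = (M *v f j) $ i"
        by (simp add: matrix_matrix_mult_def matrix_vector_mult_def U_def)
      also have "\<dots> = d j * f j $ i" by (simp add: d)
      also have "\<dots> = (U ** diag d) $ i $ j"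
        by (simp add: mult_diag U_def)
      finally show ?thesis .
    qed
    thus ?thesis by (simp add: vec_eq_iff)
  qed
  hence "M ** U ** transpose U = U ** diag d ** transpose U" by simp
  hence "M = U ** diag d ** transpose U" using orth by (simp add: matrix_mul_assoc[symmetric] orthogonal_matrix_def)
  thus ?thesis using that orth by blast
qed

section \<open>Eigenvalues and square roots\<close>

lemma orthogonal_matrixD:
  assumes "orthogonal_matrix U"
  shows "transpose U ** U = mat 1" "U ** transpose U = mat 1"
  using assms by (auto simp: orthogonal_matrix_def)

lemma cancel_orthogonal:
  assumes "orthogonal_matrix (U :: real^'n^'n)"
  shows "transpose U ** (U ** (X :: real^'m^'n)) = X" "U ** (transpose U ** X) = X"
    "transpose U *v (U *v x) = x" "U *v (transpose U *v x) = x"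
  using orthogonal_matrixD[OF assms] by (auto simp: matrix_mul_assoc matrix_vector_mul_assoc simp del: transpose_matrix_vector)

lemma norm_orthogonal:
  assumes "orthogonal_matrix (U :: real^'n^'n)"
  shows "norm (U *v x) = norm x"
  using cancel_orthogonal(3)[OF assms, of x]
  by (simp add: norm_eq_sqrt_inner inner_matrix_vector[of "U *v x" U x])

lemma eigen_column:
  fixes U :: "real^'n^'n"
  assumes U: "orthogonal_matrix U" and M: "M = U ** diag d ** transpose U"
  shows "M *v (U *v axis i 1) = d i *\<^sub>R (U *v axis i 1)" "U *v axis i 1 \<noteq> 0"
proof -
  have "diag d *v axis i 1 = d i *\<^sub>R (axis i 1 :: real^'n)"
    by (simp add: vec_eq_iff diag_mult_vec axis_def)
  moreover have "M *v (U *v axis i 1) = U *v (diag d *v (transpose U *v (U *v axis i 1)))"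
    by (simp only: M matrix_vector_mul_assoc matrix_mul_assoc)
  ultimately show "M *v (U *v axis i 1) = d i *\<^sub>R (U *v axis i 1)"
    by (simp only: cancel_orthogonal[OF U] matrix_vector_mult_scaleR)
  have "norm (U *v axis i 1) = 1" using norm_orthogonal[OF U] by simp
  thus "U *v axis i 1 \<noteq> 0" by auto
qed

lemma quadratic_form_diag:
  fixes U :: "real^'n^'n"
  assumes M: "M = U ** diag d ** transpose U"
  shows "x \<bullet> (M *v y) = (\<Sum>i\<in>UNIV. d i * (transpose U *v x) $ i * (transpose U *v y) $ i)"
proof -
  have "x \<bullet> (M *v y) = (transpose U *v x) \<bullet> (diag d *v (transpose U *v y))"
    by (simp only: M matrix_vector_mul_assoc[symmetric] matrix_mul_assoc[symmetric] inner_matrix_vector[of x])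
  thus ?thesis by (simp add: inner_vec_def diag_mult_vec ac_simps del: transpose_matrix_vector)
qed

lemma eigenvalues_diag:
  fixes U :: "real^'n^'n"
  assumes U: "orthogonal_matrix U" and M: "M = U ** diag d ** transpose U"
  shows "eigenvalues M = range d"
proof
  show "range d \<subseteq> eigenvalues M" using eigen_column[OF assms] by (auto simp: eigenvalues_def)
  show "eigenvalues M \<subseteq> range d"
  proof
    fix l assume "l \<in> eigenvalues M"
    then obtain v where v: "v \<noteq> 0" "M *v v = l *\<^sub>R v" by (auto simp: eigenvalues_def)
    define w where "w = transpose U *v v"
    have "w \<noteq> 0" using v(1) cancel_orthogonal(4)[OF U, of v] unfolding w_def by (metis matrix_vector_mult_0_right)
    then obtain i where i: "w $ i \<noteq> 0" by (auto simp: vec_eq_iff)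
    have "diag d *v w = transpose U *v (M *v v)"
      by (simp only: M w_def matrix_vector_mul_assoc[symmetric] matrix_mul_assoc[symmetric] cancel_orthogonal[OF U])
    hence "diag d *v w = l *\<^sub>R w" by (simp only: v(2) w_def matrix_vector_mult_scaleR)
    from arg_cong[OF this, of "\<lambda>v. v $ i"] have "d i * w $ i = l * w $ i"
      by (simp only: diag_mult_vec vector_scaleR_component real_scaleR_def)
    thus "l \<in> range d" using i by (metis mult_cancel_right rangeI)
  qed
qed

lemma Sym_plus_spectral:
  fixes M :: "real^'n^'n"
  assumes "M \<in> Sym_plus"
  obtains U d where "orthogonal_matrix U" "M = U ** diag d ** transpose U" "\<And>i. 0 < d i"
proof -
  obtain U d where U: "orthogonal_matrix U" "M = U ** diag d ** transpose U"
    using spectral_theorem[OF Sym_plusD(1)[OF assms]] by blast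
  have "0 < d i" for i
  proof -
    let ?v = "U *v axis i 1"
    have "0 < ?v \<bullet> (M *v ?v)" using Sym_plusD(2)[OF assms eigen_column(2)[OF U]] .
    also have "\<dots> = d i * (?v \<bullet> ?v)" unfolding eigen_column(1)[OF U] by simp
    finally show ?thesis using inner_ge_zero[of ?v] by (auto simp: zero_less_mult_iff)
  qed
  thus ?thesis using that U by blast
qed

lemma orthogonal_diag_Sym_plus:
  fixes U :: "real^'n^'n"
  assumes U: "orthogonal_matrix U" and d: "\<And>i. 0 < d i"
  shows "U ** diag d ** transpose U \<in> Sym_plus"
proof -
  have "diag d \<in> (Sym_plus :: (real^'n^'n) set)"
  proof -
    have "0 < v \<bullet> (diag d *v v)" if v: "v \<noteq> 0" for v :: "real^'n"
    proof -
      obtain i where i: "v $ i \<noteq> 0" using v by (auto simp: vec_eq_iff)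
      have "v \<bullet> (diag d *v v) = (\<Sum>i\<in>UNIV. d i * (v $ i)\<^sup>2)"
        by (simp add: inner_vec_def diag_mult_vec power2_eq_square ac_simps)
      also have "\<dots> > 0" using i d by (intro sum_pos2[of _ i]) (auto simp: less_imp_le)
      finally show ?thesis .
    qed
    thus ?thesis by (simp add: Sym_plus_def)
  qed
  thus ?thesis using Sym_plus_congruence U orthogonal_matrixD(2)[OF U] matrix_inv_unique(1) by blast
qed

lemma matrix_eq_0_if_eigenvalues_0:
  fixes M :: "real^'n^'n"
  assumes "transpose M = M" "\<And>v l. v \<noteq> 0 \<Longrightarrow> M *v v = l *\<^sub>R v \<Longrightarrow> l = 0"
  shows "M = 0"
proof -
  obtain U d where U: "orthogonal_matrix U" "M = U ** diag d ** transpose U"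
    using spectral_theorem[OF assms(1)] by blast
  have "d i = 0" for i using assms(2) eigen_column[OF U, of i] by blast
  hence "diag d = 0" by (simp add: diag_def vec_eq_iff)
  thus ?thesis by (simp add: U matrix_algebra)
qed

text \<open>If \<open>v\<close> is an eigenvector of the difference \<open>D = R - S\<close> with
  eigenvalue \<open>l\<close>, then \<open>D (R + S) + (R + S) D = 2 (R\<^sup>2 - S\<^sup>2) =
  0\<close> gives \<open>2 l (v \<bullet> (R + S) v) = 0\<close>, and positivity of \<open>R +
  S\<close> forces \<open>l = 0\<close>.\<close>

lemma Sym_plus_sqrt_unique:
  fixes R S :: "real^'n^'n"
  assumes R: "R \<in> Sym_plus" and S: "S \<in> Sym_plus" and eq: "R ** R = S ** S"
  shows "R = S"
proof -
  let ?D = "R - S"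
  have "?D = 0"
  proof (rule matrix_eq_0_if_eigenvalues_0)
    show sym: "transpose ?D = ?D" using Sym_plusD(1)[OF R] Sym_plusD(1)[OF S] by (simp add: matrix_algebra)
    fix v :: "real^'n" and l assume v: "v \<noteq> 0" "?D *v v = l *\<^sub>R v"
    have "?D ** (R + S) + (R + S) ** ?D = 0" using eq by (simp add: matrix_algebra)
    hence "0 = v \<bullet> ((?D ** (R + S) + (R + S) ** ?D) *v v)" by simp
    also have "\<dots> = v \<bullet> (?D *v ((R + S) *v v)) + v \<bullet> ((R + S) *v (?D *v v))"
      by (simp only: matrix_vector_mult_add_rdistrib matrix_vector_mul_assoc[symmetric] inner_add_right)
    also have "v \<bullet> (?D *v ((R + S) *v v)) = (?D *v v) \<bullet> ((R + S) *v v)"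
      by (subst inner_matrix_vector) (simp only: sym)
    finally have "0 = 2 * l * (v \<bullet> ((R + S) *v v))" by (simp add: v(2) matrix_vector_mult_scaleR)
    moreover have "v \<bullet> ((R + S) *v v) > 0"
      using Sym_plusD(2)[OF R v(1)] Sym_plusD(2)[OF S v(1)] by (simp add: matrix_vector_mult_add_rdistrib inner_add_right)
    ultimately show "l = 0" by simp
  qed
  thus ?thesis by simp
qed

lemma mat_sqrt_square:
  fixes M :: "real^'n^'n"
  assumes "M \<in> Sym_plus"
  shows "mat_sqrt M \<in> Sym_plus" "mat_sqrt M ** mat_sqrt M = M"
proof -
  obtain U d where U: "orthogonal_matrix U" "M = U ** diag d ** transpose U" and d: "\<And>i. 0 < d i"
    using Sym_plus_spectral[OF assms] by blast
  let ?R = "U ** diag (\<lambda>i. sqrt (d i)) ** transpose U"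
  have "?R ** ?R = U ** (diag (\<lambda>i. sqrt (d i)) ** (transpose U ** (U ** (diag (\<lambda>i. sqrt (d i)) ** transpose U))))"
    by (simp only: matrix_mul_assoc)
  also have "\<dots> = U ** (diag (\<lambda>i. sqrt (d i)) ** diag (\<lambda>i. sqrt (d i))) ** transpose U"
 unfolding cancel_orthogonal[OF U(1)] by (simp only: matrix_mul_assoc)
  also have "\<dots> = M" using d by (simp add: diag_mult_diag U(2) less_imp_le)
  finally have "?R ** ?R = M" .
  moreover have "?R \<in> Sym_plus" using U(1) d by (intro orthogonal_diag_Sym_plus) auto
  ultimately have "\<exists>!R. R \<in> Sym_plus \<and> R ** R = M" using Sym_plus_sqrt_unique by metis
  from theI'[OF this] show "mat_sqrt M \<in> Sym_plus" "mat_sqrt M ** mat_sqrt M = M"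
    by (auto simp: mat_sqrt_def)
qed

lemma lambda_min_rayleigh:
  fixes M :: "real^'n^'n"
  assumes "transpose M = M"
  shows "lambda_min M * (x \<bullet> x) \<le> x \<bullet> (M *v x)"
    and "\<exists>v. v \<noteq> 0 \<and> M *v v = lambda_min M *\<^sub>R v"
proof -
  obtain U d where U: "orthogonal_matrix U" "M = U ** diag d ** transpose U"
    using spectral_theorem[OF assms] by blast
  have eq: "lambda_min M = Min (range d)" by (simp add: lambda_min_def eigenvalues_diag[OF U])
  have "lambda_min M \<in> eigenvalues M" unfolding eq eigenvalues_diag[OF U] by (intro Min_in) auto
  thus "\<exists>v. v \<noteq> 0 \<and> M *v v = lambda_min M *\<^sub>R v" by (auto simp: eigenvalues_def)
  let ?w = "transpose U *v x"
  have "norm ?w = norm x" using norm_orthogonal[of "transpose U" x] U(1) by simp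
  hence "x \<bullet> x = ?w \<bullet> ?w" by (metis power2_norm_eq_inner)
  hence "lambda_min M * (x \<bullet> x) = (\<Sum>i\<in>UNIV. lambda_min M * (?w $ i * ?w $ i))"
    by (simp add: inner_vec_def sum_distrib_left)
  also have "\<dots> \<le> (\<Sum>i\<in>UNIV. d i * (?w $ i * ?w $ i))"
    unfolding eq by (intro sum_mono mult_right_mono) auto
  also have "\<dots> = x \<bullet> (M *v x)" by (simp add: quadratic_form_diag[OF U(2)] ac_simps)
  finally show "lambda_min M * (x \<bullet> x) \<le> x \<bullet> (M *v x)" .
qed

lemma lambda_max_rayleigh:
  fixes M :: "real^'n^'n"
  assumes "transpose M = M"
  shows "x \<bullet> (M *v x) \<le> lambda_max M * (x \<bullet> x)"
    and "\<exists>v. v \<noteq> 0 \<and> M *v v = lambda_max M *\<^sub>R v"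
proof -
  obtain U d where U: "orthogonal_matrix U" "M = U ** diag d ** transpose U"
    using spectral_theorem[OF assms] by blast
  have eq: "lambda_max M = Max (range d)" by (simp add: lambda_max_def eigenvalues_diag[OF U])
  have "lambda_max M \<in> eigenvalues M" unfolding eq eigenvalues_diag[OF U] by (intro Max_in) auto
  thus "\<exists>v. v \<noteq> 0 \<and> M *v v = lambda_max M *\<^sub>R v" by (auto simp: eigenvalues_def)
  let ?w = "transpose U *v x"
  have "norm ?w = norm x" using norm_orthogonal[of "transpose U" x] U(1) by simp
  hence n: "x \<bullet> x = ?w \<bullet> ?w" by (metis power2_norm_eq_inner)
  have "x \<bullet> (M *v x) = (\<Sum>i\<in>UNIV. d i * (?w $ i * ?w $ i))" by (simp add: quadratic_form_diag[OF U(2)] ac_simps)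
  also have "\<dots> \<le> (\<Sum>i\<in>UNIV. lambda_max M * (?w $ i * ?w $ i))"
    unfolding eq by (intro sum_mono mult_right_mono) auto
  also have "\<dots> = lambda_max M * (x \<bullet> x)"
    unfolding n by (simp add: inner_vec_def sum_distrib_left)
  finally show "x \<bullet> (M *v x) \<le> lambda_max M * (x \<bullet> x)" .
qed

lemma lambda_min_pos:
  assumes "M \<in> Sym_plus" shows "0 < lambda_min M"
proof -
  obtain v where v: "v \<noteq> 0" "M *v v = lambda_min M *\<^sub>R v" using lambda_min_rayleigh(2)[OF Sym_plusD(1)[OF assms]] by blast
  from Sym_plusD(2)[OF assms v(1)] show ?thesis using inner_ge_zero[of v] by (auto simp: v(2) zero_less_mult_iff)
qed

lemma lambda_max_pos:
  assumes "M \<in> Sym_plus" shows "0 < lambda_max M"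
proof -
  obtain v where v: "v \<noteq> 0" "M *v v = lambda_max M *\<^sub>R v" using lambda_max_rayleigh(2)[OF Sym_plusD(1)[OF assms]] by blast
  from Sym_plusD(2)[OF assms v(1)] show ?thesis using inner_ge_zero[of v] by (auto simp: v(2) zero_less_mult_iff)
qed

text \<open>The form weighted by \<open>A\<close> is the square of a norm, so that the triangle
  inequality is available for it.\<close>

lemma norm_mult_sqrt:
  assumes "A \<in> Sym_plus"
  shows "(Y ** A) \<bullet> Y = (norm (Y ** mat_sqrt A))\<^sup>2" "b \<bullet> (A *v b) = (norm (mat_sqrt A *v b))\<^sup>2"
proof -
  note R = mat_sqrt_square[OF assms]
  have "Y ** A = Y ** mat_sqrt A ** mat_sqrt A" using R(2) by (simp add: matrix_mul_assoc[symmetric])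
  thus "(Y ** A) \<bullet> Y = (norm (Y ** mat_sqrt A))\<^sup>2"
    using inner_matrix_mult_right[of "Y" "Y ** mat_sqrt A" "mat_sqrt A"] Sym_plusD(1)[OF R(1)]
    by (simp add: power2_norm_eq_inner inner_commute)
  have "A *v b = mat_sqrt A *v (mat_sqrt A *v b)" using R(2) by (simp add: matrix_vector_mul_assoc)
  thus "b \<bullet> (A *v b) = (norm (mat_sqrt A *v b))\<^sup>2"
    using inner_matrix_vector[of b "mat_sqrt A" "mat_sqrt A *v b"] Sym_plusD(1)[OF R(1)]
    by (simp add: power2_norm_eq_inner)
qed

lemma Sym_plus_form_nonneg: "A \<in> Sym_plus \<Longrightarrow> 0 \<le> (Y ** A) \<bullet> Y"
  by (simp add: norm_mult_sqrt)

lemma lambda_min_form: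
  fixes Y :: "real^'n^'m"
  assumes A: "A \<in> Sym_plus"
  shows "lambda_min A * (norm Y)\<^sup>2 \<le> (Y ** A) \<bullet> Y"
proof -
  have row: "(Y ** A) $ i = A *v (Y $ i)" for i
  proof -
    have "(Y ** A) $ i = transpose A *v (Y $ i)"
      by (simp add: vec_eq_iff matrix_matrix_mult_def vector_matrix_mult_def ac_simps)
    thus ?thesis using Sym_plusD(1)[OF A] by simp
  qed
  have "lambda_min A * (norm Y)\<^sup>2 = (\<Sum>i\<in>UNIV. lambda_min A * (Y $ i \<bullet> Y $ i))"
    by (simp add: power2_norm_eq_inner inner_vec_def[of Y] sum_distrib_left)
  also have "\<dots> \<le> (\<Sum>i\<in>UNIV. (Y ** A) $ i \<bullet> Y $ i)"
    unfolding row by (intro sum_mono) (simp add: inner_commute lambda_min_rayleigh[OF Sym_plusD(1)[OF A]])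
  finally show ?thesis by (simp add: inner_vec_def[of "Y ** A"])
qed

section \<open>The rate matrix\<close>

text \<open>A linear isometry from pairs to vectors over the block index type. The matrix is
  transposed because the Kronecker product lets \<open>A\<close> act on the first index, whereas
  in the dissipation of entropy \<open>A\<close> multiplies from the right.\<close>

definition rate_vec :: "real^'n^'n \<Rightarrow> real^'n \<Rightarrow> real^(('n \<times> 'n) + (1 \<times> 'n))" where
  "rate_vec z u = (\<chi> p. case p of Inl q \<Rightarrow> z $ snd q $ fst q | Inr q \<Rightarrow> u $ snd q)"

lemma sum_block_index:
  fixes f :: "('n::finite \<times> 'n) + (1 \<times> 'n) \<Rightarrow> real"
  shows "(\<Sum>p\<in>UNIV. f p) = (\<Sum>i\<in>UNIV. \<Sum>j\<in>UNIV. f (Inl (i, j))) + (\<Sum>j\<in>UNIV. f (Inr (1, j)))"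
proof -
  have "(\<Sum>p\<in>UNIV. f p) = (\<Sum>q\<in>UNIV. f (Inl q)) + (\<Sum>q\<in>UNIV. f (Inr q))"
    unfolding UNIV_Plus_UNIV[symmetric] by (subst sum.Plus) auto
  moreover have "(\<Sum>q\<in>UNIV. f (Inl q)) = (\<Sum>i\<in>UNIV. \<Sum>j\<in>UNIV. f (Inl (i, j)))"
    unfolding UNIV_Times_UNIV[symmetric] by (simp add: sum.cartesian_product)
  moreover have "(\<Sum>q\<in>UNIV. f (Inr q)) = (\<Sum>i\<in>(UNIV :: 1 set). \<Sum>j\<in>UNIV. f (Inr (i, j)))"
    unfolding UNIV_Times_UNIV[symmetric] by (simp add: sum.cartesian_product)
  ultimately show ?thesis by (simp add: UNIV_1)
qed

lemma inner_rate_vec: "rate_vec z u \<bullet> rate_vec z' u' = z \<bullet> z' + u \<bullet> u'"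
  unfolding inner_vec_def sum_block_index rate_vec_def
  by (simp, subst sum.swap, simp)

lemma rate_vec_surj: obtains z u where "v = rate_vec z u"
proof
  show "v = rate_vec (\<chi> i j. v $ Inl (j, i)) (\<chi> j. v $ Inr (1, j))"
    by (auto simp: vec_eq_iff rate_vec_def split: sum.splits)
qed

lemma rate_matrix_mult:
  fixes A Q :: "real^'n^'n"
  assumes A: "transpose A = A"
  defines "H \<equiv> matrix_inv (mat_sqrt Q)"
  shows "stein_rate_matrix A b Q *v rate_vec z u =
    rate_vec (z ** A + (1 / sqrt 2) *\<^sub>R outer (H *v u) (A *v b))
      ((1 / sqrt 2) *\<^sub>R (H *v (z *v (A *v b))) + (1/2 * bilinear_kernel A b b) *\<^sub>R (matrix_inv Q *v u))"
proof -
  have bA: "b v* A = A *v b" using A transpose_matrix_vector[of A b] by simp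
  have As: "A $ i $ j = A $ j $ i" for i j using A by (metis (no_types) transpose_def vec_lambda_beta)
  have delta: "(\<Sum>x\<in>UNIV. \<Sum>y\<in>UNIV. c x * (mat 1 :: real^'n^'n) $ l $ y * z $ y $ x) = (\<Sum>x\<in>UNIV. c x * z $ l $ x)"
    for c :: "'n \<Rightarrow> real" and l
  proof (rule sum.cong[OF refl])
    fix x
    have "(\<Sum>y\<in>UNIV. c x * (mat 1 :: real^'n^'n) $ l $ y * z $ y $ x) = (\<Sum>y\<in>UNIV. if y = l then c x * z $ l $ x else 0)"
      unfolding mat_def vec_lambda_beta by (rule sum.cong) auto
    thus "(\<Sum>y\<in>UNIV. c x * (mat 1 :: real^'n^'n) $ l $ y * z $ y $ x) = c x * z $ l $ x" by simp
  qed
  have "(stein_rate_matrix A b Q *v rate_vec z u) $ p =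
    rate_vec (z ** A + (1 / sqrt 2) *\<^sub>R outer (H *v u) (A *v b))
      ((1 / sqrt 2) *\<^sub>R (H *v (z *v (A *v b))) + (1/2 * bilinear_kernel A b b) *\<^sub>R (matrix_inv Q *v u)) $ p" for p
  proof (cases p)
    case (Inl q)
    obtain i j where q: "q = (i, j)" by (cases q)
    have "(stein_rate_matrix A b Q *v rate_vec z u) $ p =
      (\<Sum>x\<in>UNIV. \<Sum>y\<in>UNIV. A $ i $ x * (mat 1 :: real^'n^'n) $ j $ y * z $ y $ x) + (\<Sum>y\<in>UNIV. 1 / sqrt 2 * ((A *v b) $ i * H $ j $ y) * u $ y)"
      unfolding matrix_vector_mult_def[of "stein_rate_matrix A b Q"] sum_block_index
      unfolding stein_rate_matrix_def block_matrix_def kron_def rate_vec_def H_def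
      by (simp add: Inl q columnvector_def)
    also have "\<dots> = (\<Sum>x\<in>UNIV. z $ j $ x * A $ x $ i) + 1 / sqrt 2 * ((H *v u) $ j * (A *v b) $ i)"
      unfolding delta by (simp add: matrix_vector_mult_def[of H] sum_distrib_left sum_distrib_right As[of i] ac_simps)
    also have "\<dots> = rate_vec (z ** A + (1 / sqrt 2) *\<^sub>R outer (H *v u) (A *v b))
      ((1 / sqrt 2) *\<^sub>R (H *v (z *v (A *v b))) + (1/2 * bilinear_kernel A b b) *\<^sub>R (matrix_inv Q *v u)) $ p"
      by (simp add: rate_vec_def Inl q matrix_matrix_mult_def outer_def)
    finally show ?thesis .
  next
    case (Inr q)
    obtain i j where q: "q = (i, j)" by (cases q)
    have i: "i = 1" by (rule num1_eq1)
    have "(stein_rate_matrix A b Q *v rate_vec z u) $ p =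
      (\<Sum>x\<in>UNIV. \<Sum>y\<in>UNIV. 1 / sqrt 2 * ((A *v b) $ x * H $ j $ y) * z $ y $ x) + (\<Sum>y\<in>UNIV. 1/2 * bilinear_kernel A b b * matrix_inv Q $ j $ y * u $ y)"
      unfolding matrix_vector_mult_def[of "stein_rate_matrix A b Q"] sum_block_index
      unfolding stein_rate_matrix_def block_matrix_def kron_def rate_vec_def H_def
      by (simp add: Inr q i rowvector_def bA mat_def)
    also have "(\<Sum>x\<in>UNIV. \<Sum>y\<in>UNIV. 1 / sqrt 2 * ((A *v b) $ x * H $ j $ y) * z $ y $ x) = 1 / sqrt 2 * (H *v (z *v (A *v b))) $ j"
      by (subst sum.swap) (simp add: matrix_vector_mult_def[of H] matrix_vector_mult_def[of z] sum_distrib_left sum_distrib_right ac_simps)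
    also have "(\<Sum>y\<in>UNIV. 1/2 * bilinear_kernel A b b * matrix_inv Q $ j $ y * u $ y) = 1/2 * bilinear_kernel A b b * (matrix_inv Q *v u) $ j"
      by (simp add: matrix_vector_mult_def[of "matrix_inv Q"] sum_distrib_left ac_simps)
    finally show ?thesis by (simp add: rate_vec_def Inr q)
  qed
  thus ?thesis by (simp add: vec_eq_iff)
qed

lemma transpose_eqI:
  fixes M :: "real^'n^'n"
  assumes "\<And>x y. x \<bullet> (M *v y) = y \<bullet> (M *v x)"
  shows "transpose M = M"
proof -
  have entry: "axis i 1 \<bullet> (M *v axis j 1) = M $ i $ j" for i j
    by (simp add: inner_axis' matrix_vector_mult_basis column_def)
  show ?thesis using assms[of "axis _ 1" "axis _ 1"] by (simp add: entry vec_eq_iff transpose_def)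
qed

lemma inverse_sqrt:
  assumes "Q \<in> Sym_plus"
  shows "matrix_inv (mat_sqrt Q) \<in> Sym_plus"
    "matrix_inv (mat_sqrt Q) ** matrix_inv (mat_sqrt Q) = matrix_inv Q"
    "mat_sqrt Q ** matrix_inv (mat_sqrt Q) = mat 1" "matrix_inv (mat_sqrt Q) ** mat_sqrt Q = mat 1"
  using mat_sqrt_square[OF assms] Sym_plus_matrix_inv Sym_plus_inv matrix_inv_mult[of "mat_sqrt Q" "mat_sqrt Q"]
  by (auto simp: Sym_plus_invertible)

text \<open>Completing the square. With \<open>w = Q\<^sup>-\<^sup>1\<^sup>/\<^sup>2 u\<close> the
  mixed blocks of the rate matrix produce the mixed term of the square of \<open>\<surd>2 z + w
  b\<^sup>T\<close> in the norm weighted by \<open>A\<close>, and the lower right block the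
  remaining part \<open>(b \<bullet> A b) \<bar>w\<bar>\<^sup>2\<close> of this square together
  with \<open>\<bar>w\<bar>\<^sup>2\<close>.\<close>

lemma rate_matrix_form:
  fixes A Q :: "real^'n^'n"
  assumes A: "A \<in> Sym_plus" and Q: "Q \<in> Sym_plus"
  defines "H \<equiv> matrix_inv (mat_sqrt Q)"
  shows "2 * (rate_vec z u \<bullet> (stein_rate_matrix A b Q *v rate_vec z u)) =
     ((sqrt 2 *\<^sub>R z + outer (H *v u) b) ** A) \<bullet> (sqrt 2 *\<^sub>R z + outer (H *v u) b) + (H *v u) \<bullet> (H *v u)"
    and "transpose (stein_rate_matrix A b Q) = stein_rate_matrix A b Q"
proof -
  note As = Sym_plusD(1)[OF A]
  note H = inverse_sqrt[OF Q, folded H_def]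
  have Hs: "x \<bullet> (H *v y) = (H *v x) \<bullet> y" for x y using inner_matrix_vector[of x H y] Sym_plusD(1)[OF H(1)] by simp
  have Qi: "matrix_inv Q *v u = H *v (H *v u)" for u using H(2) by (simp add: matrix_vector_mul_assoc)
  have form: "rate_vec z u \<bullet> (stein_rate_matrix A b Q *v rate_vec z' u') =
     (z' ** A) \<bullet> z + (1 / sqrt 2) * ((H *v u') \<bullet> (z *v (A *v b)) + (H *v u) \<bullet> (z' *v (A *v b)))
     + 1/2 * bilinear_kernel A b b * ((H *v u) \<bullet> (H *v u'))" for z u z' u'
    unfolding rate_matrix_mult[OF As] H_def[symmetric] inner_rate_vec
    by (simp add: inner_add_right inner_outer Hs Qi algebra_simps inner_commute[of z])
  have "(X ** A) \<bullet> Y = (Y ** A) \<bullet> X" for X Y :: "real^'n^'n"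
    using inner_matrix_mult_right[of X Y A] As by (simp add: inner_commute)
  hence sym: "rate_vec z u \<bullet> (stein_rate_matrix A b Q *v rate_vec z' u') = rate_vec z' u' \<bullet> (stein_rate_matrix A b Q *v rate_vec z u)" for z u z' u'
    unfolding form by (simp add: inner_commute algebra_simps)
  show "transpose (stein_rate_matrix A b Q) = stein_rate_matrix A b Q"
  proof (rule transpose_eqI)
    fix x y
    show "x \<bullet> (stein_rate_matrix A b Q *v y) = y \<bullet> (stein_rate_matrix A b Q *v x)"
      by (rule rate_vec_surj[of x], rule rate_vec_surj[of y]) (simp add: sym)
  qed
  define w where "w = H *v u"
  have 1: "(outer w b ** A) \<bullet> z = w \<bullet> (z *v (A *v b))"
    by (simp only: outer_matrix_mult As inner_commute[of _ z] inner_outer)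
  have 2: "(z ** A) \<bullet> outer w b = w \<bullet> (z *v (A *v b))"
    by (simp add: inner_outer matrix_vector_mul_assoc)
  have 3: "(outer w b ** A) \<bullet> outer w b = (w \<bullet> w) * (b \<bullet> (A *v b))"
    by (simp only: outer_matrix_mult As inner_outer outer_mult_vector) (simp add: inner_commute)
  have s: "2 / sqrt 2 = sqrt (2::real)" by (simp add: real_div_sqrt)
  have "2 * (rate_vec z u \<bullet> (stein_rate_matrix A b Q *v rate_vec z u)) =
    2 * ((z ** A) \<bullet> z) + 2 * (2 / sqrt 2) * (w \<bullet> (z *v (A *v b))) + bilinear_kernel A b b * (w \<bullet> w)"
    unfolding form w_def by (simp add: algebra_simps)
  also have "\<dots> = ((sqrt 2 *\<^sub>R z + outer w b) ** A) \<bullet> (sqrt 2 *\<^sub>R z + outer w b) + w \<bullet> w"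
    unfolding s by (simp add: matrix_algebra inner_add_left inner_add_right 1 2 3 bilinear_kernel_def algebra_simps)
  finally show "2 * (rate_vec z u \<bullet> (stein_rate_matrix A b Q *v rate_vec z u)) =
     ((sqrt 2 *\<^sub>R z + outer (H *v u) b) ** A) \<bullet> (sqrt 2 *\<^sub>R z + outer (H *v u) b) + (H *v u) \<bullet> (H *v u)"
    by (simp only: w_def)
qed

text \<open>For \<open>Z = Q\<^sup>-\<^sup>1 S - id\<close> and \<open>w = Q\<^sup>-\<^sup>1 (m -
  b)\<close> this is the squared norm of the velocity field of the Gaussian with mean
  \<open>m\<close> and covariance \<open>S\<close> in the reproducing kernel Hilbert space of the
  kernel. It is the rate at which the divergence from the target decreases along the flow.\<close>

definition dissipation :: "real^'n^'n \<Rightarrow> real^'n \<Rightarrow> real^'n^'n \<Rightarrow> real^'n \<Rightarrow> real" where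
  "dissipation A m Z w = ((Z + outer w m) ** A) \<bullet> (Z + outer w m) + w \<bullet> w"

lemma dissipation_lower_bound:
  fixes A Q :: "real^'n^'n"
  assumes A: "A \<in> Sym_plus" and Q: "Q \<in> Sym_plus"
  shows "lambda_min (stein_rate_matrix A m Q) * ((norm Z)\<^sup>2 + 2 * (w \<bullet> (Q *v w))) \<le> dissipation A m Z w"
proof -
  define H where "H = matrix_inv (mat_sqrt Q)"
  note H = inverse_sqrt[OF Q, folded H_def]
  define u where "u = mat_sqrt Q *v w"
  have w: "H *v u = w" using H(4) by (simp add: u_def matrix_vector_mul_assoc)
  have uu: "u \<bullet> u = w \<bullet> (Q *v w)" using norm_mult_sqrt(2)[OF Q, of w] by (simp add: u_def power2_norm_eq_inner)
  define z where "z = (1 / sqrt 2) *\<^sub>R Z"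
  have Z: "sqrt 2 *\<^sub>R z = Z" by (simp add: z_def)
  have zz: "2 * (z \<bullet> z) = (norm Z)\<^sup>2" by (simp add: z_def power2_norm_eq_inner)
  have "2 * (lambda_min (stein_rate_matrix A m Q) * (rate_vec z u \<bullet> rate_vec z u)) \<le> dissipation A m Z w"
    using lambda_min_rayleigh(1)[OF rate_matrix_form(2)[OF A Q], of m "rate_vec z u"] rate_matrix_form(1)[OF A Q, of z u m]
    by (simp add: H_def[symmetric] w Z dissipation_def)
  thus ?thesis by (simp add: inner_rate_vec uu zz[symmetric] algebra_simps)
qed

text \<open>Let \<open>v\<close> be an eigenvector for the smallest eigenvalue \<open>g\<close>,
  given by \<open>Z = \<surd>2 z\<close> and \<open>u\<close>, and put \<open>w =
  Q\<^sup>-\<^sup>1\<^sup>/\<^sup>2 u\<close>, \<open>Y = Z + w m\<^sup>T\<close>. Completing the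
  square turns the eigenvalue equation into \<open>g X = N + \<bar>w\<bar>\<^sup>2\<close> with
  \<open>X = \<bar>Z\<bar>\<^sup>2 + 2 \<bar>u\<bar>\<^sup>2\<close> and \<open>N\<close> the
  square of \<open>Y\<close> in the norm weighted by \<open>A\<close>. Expanding \<open>Z = Y - w
  m\<^sup>T\<close>, with Young's inequality for the mixed term \<open>c\<close>, gives \<open>a
  \<bar>Z\<bar>\<^sup>2 \<le> k (N + \<bar>w\<bar>\<^sup>2)\<close>, and
  \<open>\<bar>u\<bar>\<^sup>2 \<le> q \<bar>w\<bar>\<^sup>2\<close>. Together \<open>a X \<le> (k
  + 2 a q) (N + \<bar>w\<bar>\<^sup>2)\<close>. The inequality is strict: for \<open>N > 0\<close>
  a term \<open>2 a q N\<close> is left over, and for \<open>N = 0\<close> the matrix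
  \<open>Y\<close> and hence \<open>c\<close> vanish, so that Young's inequality is
  wasteful.\<close>

lemma rate_lower_bound:
  fixes A Q :: "real^'n^'n" and m :: "real^'n"
  assumes A: "A \<in> Sym_plus" and Q: "Q \<in> Sym_plus"
  defines "a \<equiv> lambda_min A" and "q \<equiv> lambda_max Q" and "k \<equiv> bilinear_kernel A m m"
  shows "a / (k + 2 * a * q) < lambda_min (stein_rate_matrix A m Q)"
proof -
  define H where "H = matrix_inv (mat_sqrt Q)"
  note H = inverse_sqrt[OF Q, folded H_def]
  define g where "g = lambda_min (stein_rate_matrix A m Q)"
  have a: "a > 0" unfolding a_def by (rule lambda_min_pos[OF A])
  have q: "q > 0" unfolding q_def by (rule lambda_max_pos[OF Q])
  define \<beta> where "\<beta> = m \<bullet> (A *v m)"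
  have \<beta>: "\<beta> \<ge> 0" unfolding \<beta>_def by (rule Sym_plusD(3)[OF A])
  have k: "k = \<beta> + 1" by (simp add: k_def \<beta>_def bilinear_kernel_def)
  obtain v where v: "v \<noteq> 0" "stein_rate_matrix A m Q *v v = g *\<^sub>R v"
    using lambda_min_rayleigh(2)[OF rate_matrix_form(2)[OF A Q]] g_def by blast
  obtain z u where zu: "v = rate_vec z u" by (rule rate_vec_surj)
  define Z where "Z = sqrt 2 *\<^sub>R z"
  define w where "w = H *v u"
  define Y where "Y = Z + outer w m"
  define N where "N = (Y ** A) \<bullet> Y"
  define X where "X = (norm Z)\<^sup>2 + 2 * (u \<bullet> u)"
  have uw: "u = mat_sqrt Q *v w" using H(3) by (simp add: w_def matrix_vector_mul_assoc)
  have uu: "u \<bullet> u \<le> q * (w \<bullet> w)"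
    using norm_mult_sqrt(2)[OF Q, of w] lambda_max_rayleigh(1)[OF Sym_plusD(1)[OF Q], of w] by (simp add: uw power2_norm_eq_inner q_def)
  have "2 * (v \<bullet> (stein_rate_matrix A m Q *v v)) = N + w \<bullet> w"
    unfolding zu rate_matrix_form(1)[OF A Q] by (simp add: N_def Y_def Z_def w_def H_def)
  moreover have "2 * (v \<bullet> v) = X" unfolding zu inner_rate_vec by (simp add: X_def Z_def power2_norm_eq_inner[symmetric] power_mult_distrib)
  ultimately have gX: "g * X = N + w \<bullet> w" by (auto simp: v(2))
  have X: "X > 0" using \<open>2 * (v \<bullet> v) = X\<close> v(1) inner_gt_zero_iff[of v] by linarith
  have N0: "N \<ge> 0" unfolding N_def by (rule Sym_plus_form_nonneg[OF A])
  define c where "c = w \<bullet> (Y *v (A *v m))"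
  have oA: "(outer w m ** A) \<bullet> Y = c" "(Y ** A) \<bullet> outer w m = c" "(outer w m ** A) \<bullet> outer w m = (w \<bullet> w) * \<beta>"
    using Sym_plusD(1)[OF A]
    by (simp_all only: outer_matrix_mult inner_commute[of _ Y] inner_outer outer_mult_vector c_def \<beta>_def matrix_vector_mul_assoc)
       (simp_all add: inner_commute)
  have "a * (norm Z)\<^sup>2 \<le> ((Y - outer w m) ** A) \<bullet> (Y - outer w m)"
    using lambda_min_form[OF A, of Z] by (simp add: a_def Y_def)
  also have "\<dots> = N - 2 * c + (w \<bullet> w) * \<beta>"
    by (simp add: matrix_algebra inner_diff_left inner_diff_right oA N_def)
  finally have aZ: "a * (norm Z)\<^sup>2 \<le> N - 2 * c + (w \<bullet> w) * \<beta>" .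
  have YAm: "(norm (Y *v (A *v m)))\<^sup>2 \<le> N * \<beta>"
  proof -
    note R = mat_sqrt_square[OF A]
    have "Y *v (A *v m) = (Y ** mat_sqrt A) *v (mat_sqrt A *v m)"
      using R(2) by (simp add: matrix_vector_mul_assoc matrix_mul_assoc[symmetric])
    hence "(norm (Y *v (A *v m)))\<^sup>2 \<le> (norm (Y ** mat_sqrt A) * norm (mat_sqrt A *v m))\<^sup>2"
      by (metis norm_matrix_vector_le norm_ge_zero power_mono)
    thus ?thesis by (simp add: power_mult_distrib N_def \<beta>_def norm_mult_sqrt[OF A])
  qed
  have "0 \<le> (w + Y *v (A *v m)) \<bullet> (w + Y *v (A *v m))" by simp
  also have "\<dots> = w \<bullet> w + 2 * c + (norm (Y *v (A *v m)))\<^sup>2"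
    by (simp add: inner_add_left inner_add_right c_def power2_norm_eq_inner inner_commute)
  finally have c: "- 2 * c \<le> w \<bullet> w + N * \<beta>" using YAm by simp
  have aX: "a * X = a * (norm Z)\<^sup>2 + 2 * (a * (u \<bullet> u))" by (simp add: X_def algebra_simps)
  have auu: "a * (u \<bullet> u) \<le> a * (q * (w \<bullet> w))" using mult_left_mono[OF uu, of a] a by linarith
  have strict: "a * X < (k + 2 * a * q) * (N + w \<bullet> w)"
  proof (cases "N = 0")
    case True
    hence "a * (norm Y)\<^sup>2 \<le> 0" using lambda_min_form[OF A, of Y] by (simp add: N_def a_def)
    hence "Y = 0" using a by (simp add: mult_le_0_iff)
    hence "c = 0" by (simp add: c_def matrix_algebra)
    have Zw: "Z = - outer w m" using \<open>Y = 0\<close> by (simp add: Y_def eq_neg_iff_add_eq_0)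
    have "w \<noteq> 0"
    proof
      assume "w = 0"
      hence "Z = 0" "u = 0" using Zw uw by (simp_all add: matrix_algebra)
      thus False using X by (simp add: X_def)
    qed
    hence "0 < w \<bullet> w" by (simp add: inner_gt_zero_iff)
    have "a * X \<le> (w \<bullet> w) * \<beta> + 2 * a * (q * (w \<bullet> w))"
      using aZ auu unfolding aX True \<open>c = 0\<close> by linarith
    also have "\<dots> < (k + 2 * a * q) * (N + w \<bullet> w)" using \<open>0 < w \<bullet> w\<close> by (simp add: k True algebra_simps)
    finally show ?thesis .
  next
    case False
    hence "0 < a * q * N" using N0 a q by simp
    have "a * X \<le> N + (w \<bullet> w + N * \<beta>) + (w \<bullet> w) * \<beta> + 2 * a * (q * (w \<bullet> w))"
      using aZ c auu unfolding aX by linarith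
    also have "\<dots> < (k + 2 * a * q) * (N + w \<bullet> w)" using \<open>0 < a * q * N\<close> by (simp add: k algebra_simps)
    finally show ?thesis .
  qed
  have pos: "k + 2 * a * q > 0" using a q \<beta> k by (simp add: add_pos_pos add_nonneg_pos)
  have "a / (k + 2 * a * q) * X < g * X"
    unfolding gX using strict pos by (simp add: field_simps)
  thus ?thesis using X unfolding g_def by (simp only: mult_less_cancel_right_pos)
qed

section \<open>Ordinary differential equations\<close>

lemma gronwall:
  fixes e :: "real \<Rightarrow> real"
  assumes "a \<le> b" and cont: "continuous_on {a..b} e"
    and der: "\<And>t. a < t \<Longrightarrow> t < b \<Longrightarrow> (e has_real_derivative e' t) (at t)"
    and le: "\<And>t. a < t \<Longrightarrow> t < b \<Longrightarrow> e' t \<le> C * e t"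
  shows "e b \<le> e a * exp (C * (b - a))"
proof -
  have "e b * exp (- C * b) \<le> e a * exp (- C * a)"
  proof (rule DERIV_nonpos_imp_decreasing_open[OF \<open>a \<le> b\<close>])
    fix t assume t: "a < t" "t < b"
    have "((\<lambda>t. e t * exp (- C * t)) has_real_derivative e' t * exp (- C * t) + e t * (exp (- C * t) * (- C))) (at t)"
      by (rule derivative_eq_intros der[OF t] refl | simp)+
    moreover have "e' t * exp (- C * t) + e t * (exp (- C * t) * (- C)) \<le> 0"
      using mult_right_mono[OF le[OF t], of "exp (- C * t)"] by (simp add: algebra_simps)
    ultimately show "\<exists>y. ((\<lambda>t. e t * exp (- C * t)) has_real_derivative y) (at t) \<and> y \<le> 0" by blast
  qed (intro continuous_intros cont)
  hence "e b * (exp (- C * b) * exp (C * b)) \<le> e a * (exp (- C * a) * exp (C * b))"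
    using mult_right_mono[of "e b * exp (- C * b)" "e a * exp (- C * a)" "exp (C * b)"] by (simp add: mult.assoc)
  thus ?thesis by (simp add: exp_add[symmetric] algebra_simps)
qed

lemma ode_unique:
  fixes x y :: "real \<Rightarrow> 'a::real_inner"
  assumes "0 \<le> T" and cont: "continuous_on {0..T} x" "continuous_on {0..T} y"
    and x: "\<And>t. 0 < t \<Longrightarrow> t < T \<Longrightarrow> (x has_vector_derivative x' t) (at t)"
    and y: "\<And>t. 0 < t \<Longrightarrow> t < T \<Longrightarrow> (y has_vector_derivative y' t) (at t)"
    and lip: "\<And>t. 0 < t \<Longrightarrow> t < T \<Longrightarrow> norm (x' t - y' t) \<le> C * norm (x t - y t)"
    and eq: "x 0 = y 0"
  shows "x T = y T"
proof -
  define e where "e t = (x t - y t) \<bullet> (x t - y t)" for t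
  have "e T \<le> e 0 * exp ((2 * C) * (T - 0))"
  proof (rule gronwall[OF \<open>0 \<le> T\<close>])
    show "continuous_on {0..T} e" unfolding e_def by (intro continuous_intros cont)
    fix t assume t: "0 < t" "t < T"
    have "((\<lambda>t. x t - y t) has_derivative (\<lambda>h. h *\<^sub>R (x' t - y' t))) (at t)"
      using has_vector_derivative_diff[OF x[OF t] y[OF t]] by (simp add: has_vector_derivative_def)
    from has_derivative_inner[OF this this]
    show "(e has_real_derivative 2 * ((x t - y t) \<bullet> (x' t - y' t))) (at t)"
      unfolding e_def has_field_derivative_def by (rule back_subst[of "\<lambda>f. (_ has_derivative f) _"]) (auto simp: inner_commute algebra_simps)
    have "(x t - y t) \<bullet> (x' t - y' t) \<le> norm (x t - y t) * norm (x' t - y' t)" by (rule norm_cauchy_schwarz)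
    also have "\<dots> \<le> norm (x t - y t) * (C * norm (x t - y t))" by (intro mult_left_mono lip t) auto
    also have "\<dots> = C * e t" by (simp add: e_def dot_square_norm power2_eq_square)
    finally show "2 * ((x t - y t) \<bullet> (x' t - y' t)) \<le> (2 * C) * e t" by simp
  qed
  hence "(x T - y T) \<bullet> (x T - y T) \<le> 0" by (simp add: e_def eq)
  thus ?thesis by (metis eq_iff_diff_eq_0 inner_eq_zero_iff inner_ge_zero order_antisym)
qed

lemma has_vector_derivative_within_atLeast_0:
  assumes "(f has_vector_derivative D) (at t within {0..})" "0 < (t::real)"
  shows "(f has_vector_derivative D) (at t)"
proof -
  have "at t within {0..} = at t" using assms(2) by (intro at_within_interior) (simp add: interior_Ici[of "-1"])
  thus ?thesis using assms(1) by simp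
qed

lemma has_vector_derivative_continuous_on:
  assumes "\<And>t. t \<in> S \<Longrightarrow> (f has_vector_derivative f' t) (at t within S)"
  shows "continuous_on S f"
  unfolding continuous_on_eq_continuous_within using has_vector_derivative_continuous[OF assms] by blast

lemma integral_derivative_atLeast_0:
  fixes h :: "real \<Rightarrow> 'a::banach"
  assumes h: "continuous_on {0..} h" and t: "0 \<le> t"
  shows "((\<lambda>t. integral {0..t} h) has_vector_derivative h t) (at t within {0..})"
proof -
  have "((\<lambda>t. integral {0..t} h) has_vector_derivative h t) (at t within {0..t+1})"
    using t by (intro integral_has_vector_derivative continuous_on_subset[OF h]) auto
  moreover have "at t within {0..t+1} = at t within {0..}"
    by (rule at_within_nhd[of _ "{..<t+1}"]) (use t in auto)
  ultimately show ?thesis by simp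
qed

lemma norm_integral_le:
  fixes g :: "'a::euclidean_space \<Rightarrow> 'b::euclidean_space"
  assumes "g integrable_on S" "(k has_integral I) S" "\<And>x. x \<in> S \<Longrightarrow> norm (g x) \<le> k x"
  shows "norm (integral S g) \<le> I"
  using integral_norm_bound_integral[OF assms(1) has_integral_integrable[OF assms(2)] assms(3)] integral_unique[OF assms(2)]
  by simp

text \<open>Picard iteration in the weighted variable \<open>y t = exp (- 2 * \<Lambda> t)
  *\<^sub>R x t\<close>, where \<open>\<Lambda>\<close> is a primitive of the Lipschitz bound
  \<open>L\<close>. The weight turns the integral operator into a contraction of the bounded
  continuous functions on all of \<open>[0,\<infinity>)\<close> at once, so that no local
  solutions have to be glued.\<close>

theorem global_ode_solution:
  fixes f :: "real \<Rightarrow> 'a::euclidean_space \<Rightarrow> 'a"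
  assumes f: "continuous_on ({0..} \<times> UNIV) (\<lambda>(t, x). f t x)"
    and L: "continuous_on {0..} L"
    and lip: "\<And>t x y. 0 \<le> t \<Longrightarrow> norm (f t x - f t y) \<le> L t * norm (x - y)"
    and f0: "\<And>t. 0 \<le> t \<Longrightarrow> norm (f t 0) \<le> L t"
  obtains x where "x 0 = x0" "\<And>t. 0 \<le> t \<Longrightarrow> (x has_vector_derivative f t (x t)) (at t within {0..})"
proof -
  define \<Lambda> where "\<Lambda> t = integral {0..t} L" for t
  have L0: "0 \<le> L t" if "0 \<le> t" for t using f0[OF that] norm_ge_zero order_trans by blast
  have d\<Lambda>: "(\<Lambda> has_vector_derivative L t) (at t within {0..})" if "0 \<le> t" for t
    unfolding \<Lambda>_def by (rule integral_derivative_atLeast_0[OF L that])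
  have c\<Lambda>: "continuous_on {0..} \<Lambda>" by (rule has_vector_derivative_continuous_on[OF d\<Lambda>]) auto
  have \<Lambda>0: "0 \<le> \<Lambda> t" for t
    unfolding \<Lambda>_def by (rule Henstock_Kurzweil_Integration.integral_nonneg) (auto intro!: L0 integrable_continuous_real continuous_on_subset[OF L])
  define E where "E t = exp (2 * \<Lambda> t)" for t
  have cE: "continuous_on {0..} E" unfolding E_def by (intro continuous_intros c\<Lambda>)
  have E1: "1 \<le> E t" for t using \<Lambda>0[of t] by (simp add: E_def)
  have Epos: "0 < E t" for t by (simp add: E_def)
  \<comment> \<open>This integral makes the contraction factor 1/2.\<close>
  have intLE: "((\<lambda>s. L s * E s) has_integral ((E t - 1) / 2)) {0..t}" if "0 \<le> t" for t
  proof -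
    have "((\<lambda>s. L s * E s) has_integral (E t / 2 - E 0 / 2)) {0..t}"
    proof (rule fundamental_theorem_of_calculus[OF that])
      fix s assume s: "s \<in> {0..t}"
      have "(\<Lambda> has_real_derivative L s) (at s within {0..t})"
        using d\<Lambda>[of s] s by (auto simp: has_real_derivative_iff_has_vector_derivative intro: has_vector_derivative_within_subset)
      hence "((\<lambda>t. E t / 2) has_real_derivative L s * E s) (at s within {0..t})"
        unfolding E_def by (auto intro!: derivative_eq_intros)
      thus "((\<lambda>t. E t / 2) has_vector_derivative L s * E s) (at s within {0..t})"
        by (simp add: has_real_derivative_iff_has_vector_derivative)
    qed
    moreover have "E 0 = 1" by (simp add: E_def \<Lambda>_def)
    ultimately show ?thesis by (simp add: diff_divide_distrib)
  qed
  define h where "h y s = f s (E s *\<^sub>R apply_bcontfun y s)" for y :: "real \<Rightarrow>\<^sub>C 'a" and s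
  have ch: "continuous_on {0..} (h y)" for y
  proof -
    have "continuous_on {0..} (\<lambda>s. (\<lambda>(t, x). f t x) (s, E s *\<^sub>R apply_bcontfun y s))"
      by (rule continuous_on_compose2[OF f]) (auto intro!: continuous_intros cE)
    thus ?thesis by (simp add: h_def[abs_def])
  qed
  have ih: "h y integrable_on {0..t}" for y t
    by (intro integrable_continuous_real continuous_on_subset[OF ch]) auto
  \<comment> \<open>Bounded continuous functions live on the whole line; negative times are clipped to 0.\<close>
  define G where "G y t = (1 / E (max 0 t)) *\<^sub>R (x0 + integral {0..max 0 t} (h y))" for y t
  have cG: "continuous_on UNIV (G y)" for y
  proof -
    have "continuous_on {0..} (\<lambda>t. integral {0..t} (h y))"
      by (rule has_vector_derivative_continuous_on[OF integral_derivative_atLeast_0[OF ch]]) auto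
    hence "continuous_on {0..} (\<lambda>t. (1 / E t) *\<^sub>R (x0 + integral {0..t} (h y)))"
      by (intro continuous_intros cE) (auto simp: less_imp_neq[OF Epos, symmetric])
    hence "continuous_on UNIV (\<lambda>t. (1 / E (max 0 t)) *\<^sub>R (x0 + integral {0..max 0 t} (h y)))"
      by (rule continuous_on_compose2[of "{0..}" _ UNIV "\<lambda>t. max 0 t"]) (auto intro!: continuous_intros)
    thus ?thesis by (simp add: G_def[abs_def])
  qed
  have bound: "norm (integral {0..t} (h y)) \<le> (1 + norm y) * ((E t - 1) / 2)" if t: "0 \<le> t" for y t
  proof -
    have "norm (h y s) \<le> (1 + norm y) * (L s * E s)" if "s \<in> {0..t}" for s
    proof -
      have s: "0 \<le> s" using that by simp
      have "norm (h y s) \<le> norm (h y s - f s 0) + norm (f s 0)" by norm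
      also have "\<dots> \<le> L s * norm (E s *\<^sub>R apply_bcontfun y s - 0) + L s"
        unfolding h_def by (intro add_mono lip f0 s)
      also have "\<dots> \<le> L s * (E s * norm y) + L s * E s"
        using L0[OF s] E1[of s] norm_bounded[of y s] Epos[of s]
        by (intro add_mono mult_left_mono) (auto simp: mult_left_mono mult_le_cancel_left1)
      finally show ?thesis by (simp add: algebra_simps)
    qed
    thus ?thesis
      by (intro norm_integral_le[OF ih has_integral_mult_right[OF intLE[OF t]]])
  qed
  have bG: "G y \<in> bcontfun" for y
  proof (rule bcontfun_normI[OF cG])
    fix t :: real
    let ?t = "max 0 t"
    have "norm (G y t) \<le> (1 / E ?t) * (norm x0 + norm (integral {0..?t} (h y)))"
      unfolding G_def using Epos[of ?t] by (auto intro!: divide_right_mono norm_triangle_ineq simp: norm_scaleR)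
    also have "\<dots> \<le> (1 / E ?t) * (norm x0 * E ?t + (1 + norm y) * E ?t)"
    proof (intro mult_left_mono add_mono)
      show "norm x0 \<le> norm x0 * E ?t" using E1[of ?t] by (simp add: mult_le_cancel_left1)
      have "(1 + norm y) * ((E ?t - 1) / 2) \<le> (1 + norm y) * E ?t"
        using E1[of ?t] by (intro mult_left_mono) auto
      thus "norm (integral {0..?t} (h y)) \<le> (1 + norm y) * E ?t" using bound[of ?t y] by simp
    qed (use Epos[of ?t] in simp)
    also have "\<dots> = norm x0 + (1 + norm y)" using Epos[of ?t] by (simp add: field_simps)
    finally show "norm (G y t) \<le> norm x0 + (1 + norm y)" .
  qed
  define \<Psi> where "\<Psi> y = Bcontfun (G y)" for y
  have \<Psi>: "apply_bcontfun (\<Psi> y) = G y" for y unfolding \<Psi>_def by (rule Bcontfun_inverse[OF bG])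
  have "\<exists>!y. \<Psi> y = y"
  proof (rule banach_fix_type[of "1/2"])
    show "\<forall>y z. dist (\<Psi> y) (\<Psi> z) \<le> 1/2 * dist y z"
    proof (intro allI dist_bound)
      fix y z and t :: real
      let ?t = "max 0 t"
      have "norm (integral {0..?t} (h y) - integral {0..?t} (h z)) \<le> norm (y - z) * ((E ?t - 1) / 2)"
      proof -
        have "norm (h y s - h z s) \<le> norm (y - z) * (L s * E s)" if "s \<in> {0..?t}" for s
        proof -
          have s: "0 \<le> s" using that by simp
          have "norm (h y s - h z s) \<le> L s * norm (E s *\<^sub>R apply_bcontfun y s - E s *\<^sub>R apply_bcontfun z s)"
            unfolding h_def by (rule lip[OF s])
          also have "\<dots> = L s * (E s * norm (apply_bcontfun (y - z) s))"
            using Epos[of s] by (simp add: scaleR_diff_right[symmetric])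
          also have "\<dots> \<le> L s * (E s * norm (y - z))"
            using L0[OF s] Epos[of s] by (intro mult_left_mono norm_bounded) auto
          finally show ?thesis by (simp add: algebra_simps)
        qed
        hence "norm (integral {0..?t} (\<lambda>s. h y s - h z s)) \<le> norm (y - z) * ((E ?t - 1) / 2)"
          by (intro norm_integral_le[OF integrable_diff[OF ih ih] has_integral_mult_right[OF intLE]]) auto
        thus ?thesis by (simp add: Henstock_Kurzweil_Integration.integral_diff ih)
      qed
      also have "\<dots> \<le> norm (y - z) * (E ?t / 2)" by (intro mult_left_mono) auto
      finally have "norm (integral {0..?t} (h y) - integral {0..?t} (h z)) / E ?t \<le> norm (y - z) * (E ?t / 2) / E ?t"
        using Epos[of ?t] by (intro divide_right_mono) auto
      hence le: "norm (integral {0..?t} (h y) - integral {0..?t} (h z)) / E ?t \<le> norm (y - z) / 2"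
        using Epos[of ?t] by simp
      have "G y t - G z t = (1 / E ?t) *\<^sub>R (integral {0..?t} (h y) - integral {0..?t} (h z))"
        by (simp add: G_def algebra_simps)
      hence "norm (G y t - G z t) \<le> norm (y - z) / 2"
        using le Epos[of ?t] by simp
      thus "dist (apply_bcontfun (\<Psi> y) t) (apply_bcontfun (\<Psi> z) t) \<le> 1/2 * dist y z"
        by (simp add: \<Psi> dist_norm)
    qed
  qed auto
  then obtain y where y: "\<Psi> y = y" by blast
  define x where "x t = E t *\<^sub>R apply_bcontfun y t" for t
  have hx: "h y = (\<lambda>s. f s (x s))" by (rule ext) (simp add: h_def x_def)
  have int: "x t = x0 + integral {0..t} (h y)" if "0 \<le> t" for t
    using fun_cong[OF \<Psi>[of y], of t] that less_imp_neq[OF Epos[of t]] by (simp add: y x_def G_def)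
  show ?thesis
  proof
    show "x 0 = x0" using int[of 0] by simp
    fix t :: real assume t: "0 \<le> t"
    have "((\<lambda>t. x0 + integral {0..t} (h y)) has_vector_derivative (0 + h y t)) (at t within {0..})"
      by (intro has_vector_derivative_add has_vector_derivative_const integral_derivative_atLeast_0[OF ch t])
    thus "(x has_vector_derivative f t (x t)) (at t within {0..})"
      using t by (intro has_vector_derivative_transform[of t "{0..}" x]) (auto simp: int hx)
  qed
qed

text \<open>The flow of the time-dependent affine field \<open>x \<mapsto> W t x + m t\<close> is
  \<open>x \<mapsto> P t x + p t\<close>.\<close>

lemma affine_flow:
  fixes W :: "real \<Rightarrow> real^'n^'n" and m :: "real \<Rightarrow> real^'n"
  assumes W: "continuous_on {0..} W" and m: "continuous_on {0..} m"
  obtains P p where "P 0 = mat 1" "p 0 = 0"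
    "\<And>t. 0 \<le> t \<Longrightarrow> (P has_vector_derivative W t ** P t) (at t within {0..})"
    "\<And>t. 0 \<le> t \<Longrightarrow> (p has_vector_derivative W t *v p t + m t) (at t within {0..})"
proof -
  define f where "f t x = (W t ** fst x, W t *v snd x + m t)" for t and x :: "(real^'n^'n) \<times> (real^'n)"
  have cont: "continuous_on ({0..} \<times> UNIV) (\<lambda>(t, x). f t x)"
    unfolding f_def case_prod_beta
    by (intro continuous_intros bounded_bilinear.continuous_on[OF bounded_bilinear_matrix_mult]
        bounded_bilinear.continuous_on[OF bounded_bilinear_matrix_vector_mult]
        continuous_on_compose2[OF W] continuous_on_compose2[OF m]) auto
  have lip: "norm (f t x - f t y) \<le> (2 * norm (W t) + norm (m t)) * norm (x - y)" for t x y
  proof -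
    have "f t x - f t y = (W t ** fst (x - y), W t *v snd (x - y))"
      by (simp add: f_def matrix_algebra)
    also have "norm \<dots> \<le> norm (W t ** fst (x - y)) + norm (W t *v snd (x - y))"
      by (rule norm_Pair_le)
    also have "\<dots> \<le> norm (W t) * norm (x - y) + norm (W t) * norm (x - y)"
    proof (intro add_mono)
      show "norm (W t ** fst (x - y)) \<le> norm (W t) * norm (x - y)"
        using norm_fst_le[of "fst (x - y)" "snd (x - y)", unfolded prod.collapse]
        by (intro order_trans[OF norm_matrix_mult_le] mult_left_mono) auto
      show "norm (W t *v snd (x - y)) \<le> norm (W t) * norm (x - y)"
        using norm_snd_le[of "snd (x - y)" "fst (x - y)", unfolded prod.collapse]
        by (intro order_trans[OF norm_matrix_vector_le] mult_left_mono) auto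
    qed
    also have "\<dots> \<le> (2 * norm (W t) + norm (m t)) * norm (x - y)" by (simp add: algebra_simps)
    finally show ?thesis .
  qed
  have f0: "norm (f t 0) \<le> 2 * norm (W t) + norm (m t)" for t
    using norm_Pair_le[of 0 "m t"] by (simp add: f_def matrix_algebra)
  obtain x where x: "x 0 = (mat 1, 0)" "\<And>t. 0 \<le> t \<Longrightarrow> (x has_vector_derivative f t (x t)) (at t within {0..})"
    by (rule global_ode_solution[OF cont _ lip f0]) (auto intro!: continuous_intros W m)
  show ?thesis
  proof
    show "(fst \<circ> x) 0 = mat 1" "(snd \<circ> x) 0 = 0" by (simp_all add: x(1))
    fix t :: real assume t: "0 \<le> t"
    show "((fst \<circ> x) has_vector_derivative W t ** (fst \<circ> x) t) (at t within {0..})"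
      using bounded_linear.has_vector_derivative[OF bounded_linear_fst x(2)[OF t]] by (simp add: f_def o_def)
    show "((snd \<circ> x) has_vector_derivative W t *v (snd \<circ> x) t + m t) (at t within {0..})"
      using bounded_linear.has_vector_derivative[OF bounded_linear_snd x(2)[OF t]] by (simp add: f_def o_def)
  qed
qed

text \<open>Jacobi's formula. The product rule replaces one row \<open>i\<close> of
  \<open>P\<close> at a time by row \<open>i\<close> of \<open>W P\<close>, a linear combination
  of the rows of \<open>P\<close>; in the determinant only the multiple of row \<open>i\<close>
  itself survives.\<close>

lemma det_has_derivative:
  fixes P :: "real \<Rightarrow> real^'n^'n"
  assumes P: "(P has_vector_derivative W ** P t) (at t within S)"
  shows "((\<lambda>t. det (P t)) has_real_derivative trace W * det (P t)) (at t within S)"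
proof -
  have entry: "((\<lambda>t. P t $ i $ j) has_derivative (\<lambda>h. h * (W ** P t) $ i $ j)) (at t within S)" for i j
    using bounded_linear.has_vector_derivative[OF bounded_linear_vec_nth[of j]
      bounded_linear.has_vector_derivative[OF bounded_linear_vec_nth[of i] P]]
    by (simp add: has_vector_derivative_def)
  have row: "(\<Sum>p | p permutes (UNIV :: 'n set). of_int (sign p) * ((W ** P t) $ i $ p i * (\<Prod>j\<in>UNIV - {i}. P t $ j $ p j)))
    = W $ i $ i * det (P t)" for i
  proof -
    have "(\<Sum>p | p permutes (UNIV :: 'n set). of_int (sign p) * ((W ** P t) $ i $ p i * (\<Prod>j\<in>UNIV - {i}. P t $ j $ p j)))
      = det (\<chi> r. if r = i then (\<Sum>k\<in>UNIV. W $ i $ k *s P t $ k) else P t $ r)"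
      unfolding det_def
    proof (intro sum.cong refl arg_cong2[where f="(*)"])
      fix p
      have "(\<Prod>r\<in>UNIV. (\<chi> r. if r = i then (\<Sum>k\<in>UNIV. W $ i $ k *s P t $ k) else P t $ r) $ r $ p r)
        = (\<Sum>k\<in>UNIV. W $ i $ k *s P t $ k) $ p i * (\<Prod>r\<in>UNIV - {i}. P t $ r $ p r)"
        by (subst prod.remove[of UNIV i]) auto
      thus "(W ** P t) $ i $ p i * (\<Prod>j\<in>UNIV - {i}. P t $ j $ p j) =
        (\<Prod>r\<in>UNIV. (\<chi> r. if r = i then (\<Sum>k\<in>UNIV. W $ i $ k *s P t $ k) else P t $ r) $ r $ p r)"
        by (simp add: matrix_matrix_mult_def)
    qed
    also have "\<dots> = (\<Sum>k\<in>UNIV. det (\<chi> r. if r = i then W $ i $ k *s P t $ k else P t $ r))"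
      by (rule det_linear_row_sum) simp
    also have "\<dots> = (\<Sum>k\<in>UNIV. if k = i then W $ i $ i * det (P t) else 0)"
    proof (intro sum.cong refl)
      fix k
      have "det (\<chi> r. if r = i then W $ i $ k *s P t $ k else P t $ r) = W $ i $ k * det (\<chi> r. if r = i then P t $ k else P t $ r)"
        by (rule det_row_mul)
      moreover have "det (\<chi> r. if r = i then P t $ k else P t $ r) = (if k = i then det (P t) else 0)"
      proof (cases "k = i")
        case True
        hence "(\<chi> r. if r = i then P t $ k else P t $ r) = P t" by (auto simp: vec_eq_iff)
        thus ?thesis using True by simp
      next
        case False
        have "det (\<chi> r. if r = i then P t $ k else P t $ r) = 0"
          by (rule det_identical_rows[of k i]) (use False in \<open>auto simp: row_def\<close>)
        thus ?thesis using False by simp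
      qed
      ultimately show "det (\<chi> r. if r = i then W $ i $ k *s P t $ k else P t $ r) = (if k = i then W $ i $ i * det (P t) else 0)"
        by simp
    qed
    finally show ?thesis by simp
  qed
  have "((\<lambda>t. det (P t)) has_derivative
     (\<lambda>h. \<Sum>p | p permutes (UNIV :: 'n set). of_int (sign p) * (\<Sum>i\<in>UNIV. h * (W ** P t) $ i $ p i * (\<Prod>j\<in>UNIV - {i}. P t $ j $ p j)))) (at t within S)"
    unfolding det_def by (intro has_derivative_sum has_derivative_mult_right has_derivative_prod entry)
  also have "(\<lambda>h. \<Sum>p | p permutes (UNIV :: 'n set). of_int (sign p) * (\<Sum>i\<in>UNIV. h * (W ** P t) $ i $ p i * (\<Prod>j\<in>UNIV - {i}. P t $ j $ p j)))
    = (\<lambda>h. (trace W * det (P t)) * h)"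
  proof
    fix h
    have "(\<Sum>p | p permutes (UNIV :: 'n set). of_int (sign p) * (\<Sum>i\<in>UNIV. h * (W ** P t) $ i $ p i * (\<Prod>j\<in>UNIV - {i}. P t $ j $ p j)))
      = (\<Sum>i\<in>UNIV. h * (\<Sum>p | p permutes (UNIV :: 'n set). of_int (sign p) * ((W ** P t) $ i $ p i * (\<Prod>j\<in>UNIV - {i}. P t $ j $ p j))))"
      unfolding sum_distrib_left by (subst sum.swap) (simp add: ac_simps)
    also have "\<dots> = (trace W * det (P t)) * h" unfolding row by (simp add: trace_def sum_distrib_left sum_distrib_right ac_simps)
    finally show "(\<Sum>p | p permutes (UNIV :: 'n set). of_int (sign p) * (\<Sum>i\<in>UNIV. h * (W ** P t) $ i $ p i * (\<Prod>j\<in>UNIV - {i}. P t $ j $ p j)))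
      = (trace W * det (P t)) * h" .
  qed
  finally show ?thesis by (simp add: has_field_derivative_def)
qed

section \<open>Local Lipschitz continuity\<close>

text \<open>Polynomial vector fields have this property, and the closure lemmas that follow derive
  it from their syntactic structure.\<close>

definition lipschitz_on_balls :: "('a::real_normed_vector \<Rightarrow> 'b::real_normed_vector) \<Rightarrow> bool" where
  "lipschitz_on_balls f \<longleftrightarrow> (\<forall>R. \<exists>L\<ge>0. \<forall>x y. norm x \<le> R \<longrightarrow> norm y \<le> R \<longrightarrow> norm (f x - f y) \<le> L * norm (x - y))"

lemma lipschitz_on_ballsE:
  assumes "lipschitz_on_balls f"
  obtains L where "L \<ge> 0" "\<And>x y. norm x \<le> R \<Longrightarrow> norm y \<le> R \<Longrightarrow> norm (f x - f y) \<le> L * norm (x - y)"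
  using assms unfolding lipschitz_on_balls_def by blast

lemma lipschitz_on_balls_const: "lipschitz_on_balls (\<lambda>x. c)"
  by (auto simp: lipschitz_on_balls_def intro!: exI[of _ 0])

lemma lipschitz_on_balls_linear:
  assumes "bounded_linear T" "lipschitz_on_balls f"
  shows "lipschitz_on_balls (\<lambda>x. T (f x))"
  unfolding lipschitz_on_balls_def
proof
  fix R
  obtain L where L: "L \<ge> 0" "\<And>x y. norm x \<le> R \<Longrightarrow> norm y \<le> R \<Longrightarrow> norm (f x - f y) \<le> L * norm (x - y)"
    using lipschitz_on_ballsE[OF assms(2)] by blast
  obtain B where B: "B \<ge> 0" "\<And>x. norm (T x) \<le> norm x * B" using bounded_linear.nonneg_bounded[OF assms(1)] by blast
  have "norm (T (f x) - T (f y)) \<le> B * L * norm (x - y)" if "norm x \<le> R" "norm y \<le> R" for x y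
  proof -
    have "norm (T (f x) - T (f y)) \<le> norm (f x - f y) * B"
      using B(2)[of "f x - f y"] by (simp add: linear_diff[OF bounded_linear.linear[OF assms(1)]])
    also have "\<dots> \<le> (L * norm (x - y)) * B" using L(2)[OF that] B(1) by (intro mult_right_mono)
    finally show ?thesis by (simp add: ac_simps)
  qed
  thus "\<exists>L\<ge>0. \<forall>x y. norm x \<le> R \<longrightarrow> norm y \<le> R \<longrightarrow> norm (T (f x) - T (f y)) \<le> L * norm (x - y)"
    using L(1) B(1) by (intro exI[of _ "B * L"]) auto
qed

lemma lipschitz_on_balls_id: "lipschitz_on_balls (\<lambda>x. x)"
  by (auto simp: lipschitz_on_balls_def intro!: exI[of _ 1])

lemma lipschitz_on_balls_add:
  assumes "lipschitz_on_balls f" "lipschitz_on_balls g"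
  shows "lipschitz_on_balls (\<lambda>x. f x + g x)"
  unfolding lipschitz_on_balls_def
proof
  fix R
  obtain L where L: "L \<ge> 0" "\<And>x y. norm x \<le> R \<Longrightarrow> norm y \<le> R \<Longrightarrow> norm (f x - f y) \<le> L * norm (x - y)"
    using lipschitz_on_ballsE[OF assms(1)] by blast
  obtain M where M: "M \<ge> 0" "\<And>x y. norm x \<le> R \<Longrightarrow> norm y \<le> R \<Longrightarrow> norm (g x - g y) \<le> M * norm (x - y)"
    using lipschitz_on_ballsE[OF assms(2)] by blast
  have "norm (f x + g x - (f y + g y)) \<le> (L + M) * norm (x - y)" if "norm x \<le> R" "norm y \<le> R" for x y
    using norm_triangle_ineq[of "f x - f y" "g x - g y"] L(2)[OF that] M(2)[OF that] by (simp add: algebra_simps)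
  thus "\<exists>L\<ge>0. \<forall>x y. norm x \<le> R \<longrightarrow> norm y \<le> R \<longrightarrow> norm (f x + g x - (f y + g y)) \<le> L * norm (x - y)"
    using L(1) M(1) by (intro exI[of _ "L + M"]) auto
qed

lemma lipschitz_on_balls_diff:
  assumes "lipschitz_on_balls f" "lipschitz_on_balls g"
  shows "lipschitz_on_balls (\<lambda>x. f x - g x)"
  using lipschitz_on_balls_add[OF assms(1) lipschitz_on_balls_linear[OF bounded_linear_minus[OF bounded_linear_ident] assms(2)]]
  by simp

lemma lipschitz_on_balls_bilinear:
  assumes B: "bounded_bilinear B" and "lipschitz_on_balls f" "lipschitz_on_balls g"
  shows "lipschitz_on_balls (\<lambda>x. B (f x) (g x))"
  unfolding lipschitz_on_balls_def
proof
  fix R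
  obtain L where L: "L \<ge> 0" "\<And>x y. norm x \<le> R \<Longrightarrow> norm y \<le> R \<Longrightarrow> norm (f x - f y) \<le> L * norm (x - y)"
    using lipschitz_on_ballsE[OF assms(2)] by blast
  obtain M where M: "M \<ge> 0" "\<And>x y. norm x \<le> R \<Longrightarrow> norm y \<le> R \<Longrightarrow> norm (g x - g y) \<le> M * norm (x - y)"
    using lipschitz_on_ballsE[OF assms(3)] by blast
  obtain K where K: "K \<ge> 0" "\<And>a b. norm (B a b) \<le> norm a * norm b * K" using bounded_bilinear.nonneg_bounded[OF B] by blast
  let ?F = "norm (f 0) + L * \<bar>R\<bar>" and ?G = "norm (g 0) + M * \<bar>R\<bar>"
  let ?C = "(L * ?G + ?F * M) * K"
  have "norm (B (f x) (g x) - B (f y) (g y)) \<le> ?C * norm (x - y)" if xy: "norm x \<le> R" "norm y \<le> R" for x y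
  proof -
    have R: "0 \<le> R" using xy norm_ge_zero order_trans by blast
    have "norm (g x) \<le> norm (g x - g 0) + norm (g 0)" by norm
    also have "\<dots> \<le> M * norm (x - 0) + norm (g 0)" using M(2)[of x 0] xy R by simp
    also have "\<dots> \<le> ?G" using mult_left_mono[OF xy(1) M(1)] R by simp
    finally have gx: "norm (g x) \<le> ?G" .
    have "norm (f y) \<le> norm (f y - f 0) + norm (f 0)" by norm
    also have "\<dots> \<le> L * norm (y - 0) + norm (f 0)" using L(2)[of y 0] xy R by simp
    also have "\<dots> \<le> ?F" using mult_left_mono[OF xy(2) L(1)] R by simp
    finally have fy: "norm (f y) \<le> ?F" .
    have "B (f x) (g x) - B (f y) (g y) = B (f x - f y) (g x) + B (f y) (g x - g y)"
      by (simp add: bounded_bilinear.diff_left[OF B] bounded_bilinear.diff_right[OF B])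
    also have "norm \<dots> \<le> norm (B (f x - f y) (g x)) + norm (B (f y) (g x - g y))" by (rule norm_triangle_ineq)
    also have "\<dots> \<le> norm (f x - f y) * norm (g x) * K + norm (f y) * norm (g x - g y) * K" by (intro add_mono K(2))
    also have "\<dots> \<le> (L * norm (x - y)) * ?G * K + ?F * (M * norm (x - y)) * K"
      using L M K gx fy xy by (intro add_mono mult_right_mono mult_mono) auto
    finally show ?thesis by (simp add: algebra_simps)
  qed
  moreover have "?C \<ge> 0" using L M K by auto
  ultimately show "\<exists>L\<ge>0. \<forall>x y. norm x \<le> R \<longrightarrow> norm y \<le> R \<longrightarrow> norm (B (f x) (g x) - B (f y) (g y)) \<le> L * norm (x - y)"
    by blast
qed

lemma lipschitz_on_balls_Pair:
  assumes "lipschitz_on_balls f" "lipschitz_on_balls g"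
  shows "lipschitz_on_balls (\<lambda>x. (f x, g x))"
proof -
  have "bounded_linear (\<lambda>x. (x, 0) :: 'b \<times> 'c)" "bounded_linear (\<lambda>y. (0, y) :: 'b \<times> 'c)"
    by (auto intro!: bounded_linear_Pair bounded_linear_ident bounded_linear_zero)
  from lipschitz_on_balls_add[OF lipschitz_on_balls_linear[OF this(1) assms(1)] lipschitz_on_balls_linear[OF this(2) assms(2)]]
  show ?thesis by simp
qed

section \<open>Gaussian integrals\<close>

lemma lborel_distr_translation_nn_integral:
  fixes c :: "'a::euclidean_space"
  assumes [measurable]: "f \<in> borel_measurable borel"
  shows "(\<integral>\<^sup>+x. f (x + c) \<partial>lborel) = (\<integral>\<^sup>+x. f x \<partial>lborel)"
proof -
  have "(\<integral>\<^sup>+x. f x \<partial>lborel) = (\<integral>\<^sup>+x. f x \<partial>distr lborel borel ((+) c))" by (simp add: lborel_distr_plus)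
  also have "\<dots> = (\<integral>\<^sup>+x. f (x + c) \<partial>lborel)" by (subst nn_integral_distr) (auto simp: add.commute)
  finally show ?thesis ..
qed

lemma borel_measurable_matrix_mult [measurable]:
  fixes U :: "real^'n^'m" shows "(\<lambda>x. U *v x) \<in> borel_measurable borel"
  by (intro borel_measurable_continuous_onI linear_continuous_on bounded_bilinear.bounded_linear_right[OF bounded_bilinear_matrix_vector_mult])

text \<open>This is the uniqueness of translation-invariant measures. In the double integral of
  \<open>f (U x) g y\<close>, first translating \<open>y\<close> by \<open>- U x\<close> and then
  \<open>x\<close> by \<open>U\<^sup>T y\<close> shows that the integral of \<open>f \<circ>
  U\<close> times that of \<open>g\<close> equals the integral of \<open>f\<close> times that of
  \<open>g (- U x)\<close>. For \<open>g\<close> the indicator of the unit ball, the factors with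
  \<open>g\<close> coincide and cancel.\<close>

lemma nn_integral_orthogonal:
  fixes U :: "real^'n^'n"
  assumes U: "orthogonal_matrix U" and [measurable]: "f \<in> borel_measurable borel"
  shows "(\<integral>\<^sup>+x. f (U *v x) \<partial>lborel) = (\<integral>\<^sup>+x. f x \<partial>lborel)"
proof -
  define g :: "real^'n \<Rightarrow> ennreal" where "g = indicator (ball 0 1)"
  have [measurable]: "g \<in> borel_measurable borel" unfolding g_def by (rule borel_measurable_indicator) simp
  define V where "V = (\<integral>\<^sup>+y. g y \<partial>(lborel :: (real^'n) measure))"
  have V: "V \<noteq> 0" "V \<noteq> \<infinity>"
  proof -
    have V: "V = emeasure lborel (ball (0 :: real^'n) 1)" by (simp add: V_def g_def)
    show "V \<noteq> 0" using content_ball_pos[of 1 "0 :: real^'n"] unfolding V by (auto simp: measure_def)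
    show "V \<noteq> \<infinity>" using emeasure_lborel_ball_finite[of "0 :: real^'n" 1] unfolding V by simp
  qed
  have gU: "g (- (U *v x)) = g x" for x by (simp add: g_def indicator_def norm_orthogonal[OF U])
  have "(\<integral>\<^sup>+x. f (U *v x) \<partial>lborel) * V = (\<integral>\<^sup>+x. f (U *v x) * (\<integral>\<^sup>+y. g (y + - (U *v x)) \<partial>lborel) \<partial>lborel)"
    unfolding V_def lborel_distr_translation_nn_integral[OF \<open>g \<in> _\<close>] by (simp add: nn_integral_multc)
  also have "\<dots> = (\<integral>\<^sup>+x. (\<integral>\<^sup>+y. f (U *v x) * g (y + - (U *v x)) \<partial>lborel) \<partial>lborel)"
    by (simp add: nn_integral_cmult)
  also have "\<dots> = (\<integral>\<^sup>+y. (\<integral>\<^sup>+x. f (U *v x) * g (y + - (U *v x)) \<partial>lborel) \<partial>lborel)"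
    by (rule lborel_pair.Fubini') measurable
  also have "\<dots> = (\<integral>\<^sup>+y. (\<integral>\<^sup>+x. f (U *v x + y) * g (- (U *v x)) \<partial>lborel) \<partial>lborel)"
  proof (rule nn_integral_cong)
    fix y :: "real^'n"
    have "(\<integral>\<^sup>+x. f (U *v x) * g (y + - (U *v x)) \<partial>lborel) =
      (\<integral>\<^sup>+x. f (U *v (x + transpose U *v y)) * g (y + - (U *v (x + transpose U *v y))) \<partial>lborel)"
      by (rule lborel_distr_translation_nn_integral[symmetric]) measurable
    also have "\<dots> = (\<integral>\<^sup>+x. f (U *v x + y) * g (- (U *v x)) \<partial>lborel)"
      by (simp only: matrix_vector_right_distrib cancel_orthogonal[OF U]) simp
    finally show "(\<integral>\<^sup>+x. f (U *v x) * g (y + - (U *v x)) \<partial>lborel) = (\<integral>\<^sup>+x. f (U *v x + y) * g (- (U *v x)) \<partial>lborel)" .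
  qed
  also have "\<dots> = (\<integral>\<^sup>+x. (\<integral>\<^sup>+y. f (U *v x + y) * g (- (U *v x)) \<partial>lborel) \<partial>lborel)"
    by (rule lborel_pair.Fubini'[symmetric]) measurable
  also have "\<dots> = (\<integral>\<^sup>+x. (\<integral>\<^sup>+y. f (y + U *v x) \<partial>lborel) * g x \<partial>lborel)"
    by (simp add: nn_integral_multc gU add.commute)
  also have "\<dots> = (\<integral>\<^sup>+x. f x \<partial>lborel) * V"
    unfolding V_def lborel_distr_translation_nn_integral[OF \<open>f \<in> _\<close>] by (simp add: nn_integral_cmult)
  finally show ?thesis using V by (simp add: ennreal_mult_cancel_left mult.commute[of _ V])
qed

lemma lborel_distr_orthogonal:
  fixes U :: "real^'n^'n"
  assumes U: "orthogonal_matrix U"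
  shows "distr lborel borel (\<lambda>x. m + U *v x) = lborel"
proof (rule measure_eqI)
  fix X assume "X \<in> sets (distr lborel borel (\<lambda>x. m + U *v x))"
  hence [measurable]: "X \<in> sets borel" by simp
  have "emeasure (distr lborel borel (\<lambda>x. m + U *v x)) X = (\<integral>\<^sup>+x. indicator X (m + U *v x) \<partial>lborel)"
    by (subst nn_integral_indicator[symmetric], simp, subst nn_integral_distr) auto
  also have "\<dots> = (\<integral>\<^sup>+x. indicator X (x + m) \<partial>lborel)"
    by (subst nn_integral_orthogonal[OF U, of "\<lambda>x. indicator X (m + x)"]) (auto simp: add.commute)
  also have "\<dots> = emeasure lborel X" by (subst lborel_distr_translation_nn_integral) auto
  finally show "emeasure (distr lborel borel (\<lambda>x. m + U *v x)) X = emeasure lborel X" .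
qed simp

lemma has_bochner_integral_lborel_prod:
  fixes F :: "'a::euclidean_space \<Rightarrow> real \<Rightarrow> real"
  assumes F: "\<And>b. b \<in> Basis \<Longrightarrow> has_bochner_integral lborel (F b) (I b)"
  shows "has_bochner_integral lborel (\<lambda>x :: 'a. \<Prod>b\<in>Basis. F b (x \<bullet> b)) (\<Prod>b\<in>Basis. I b)"
proof -
  interpret product_sigma_finite "\<lambda>_ :: 'a. lborel :: real measure" ..
  have [measurable]: "F b \<in> borel_measurable borel" if "b \<in> Basis" for b
    using F[OF that] by (auto simp: has_bochner_integral_iff)
  have int: "integrable lborel (F b)" and val: "integral\<^sup>L lborel (F b) = I b" if "b \<in> Basis" for b
    using F[OF that] by (auto simp: has_bochner_integral_iff)
  have prod: "has_bochner_integral (\<Pi>\<^sub>M b\<in>Basis. lborel) (\<lambda>f. \<Prod>b\<in>Basis. F b (f b)) (\<Prod>b\<in>(Basis :: 'a set). I b)"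
    unfolding has_bochner_integral_iff
    using product_integrable_prod[of Basis F] product_integral_prod[of Basis F] int val by simp
  define G where "G x = (\<Prod>b\<in>Basis. F b (x \<bullet> b))" for x :: 'a
  define T where "T f = (\<Sum>b\<in>Basis. f b *\<^sub>R b)" for f :: "'a \<Rightarrow> real"
  have "has_bochner_integral (\<Pi>\<^sub>M b\<in>Basis. lborel) (\<lambda>f. G (T f)) (\<Prod>b\<in>Basis. I b)"
    using prod by (simp add: G_def T_def inner_sum_left_Basis)
  moreover have "G \<in> borel_measurable borel" unfolding G_def[abs_def] by measurable
  moreover have "T \<in> borel_measurable (\<Pi>\<^sub>M b\<in>Basis. lborel)" unfolding T_def[abs_def] by measurable
  ultimately have "has_bochner_integral (distr (\<Pi>\<^sub>M b\<in>Basis. lborel) borel T) G (\<Prod>b\<in>Basis. I b)"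
    by (intro has_bochner_integral_distr[of G borel T])
  thus ?thesis unfolding lborel_eq[where 'a='a] G_def[abs_def] T_def[abs_def] .
qed

lemma prod_Basis_vec: "(\<Prod>b\<in>(Basis :: (real^'n) set). f b) = (\<Prod>i\<in>UNIV. f (axis i 1))"
proof -
  have "(Basis :: (real^'n) set) = range (\<lambda>i. axis i 1)" by (auto simp: Basis_vec_def)
  moreover have "inj (\<lambda>i. axis i (1 :: real) :: real^'n)" by (auto simp: inj_on_def axis_eq_axis)
  ultimately show ?thesis using prod.reindex[of "\<lambda>i. axis i (1 :: real) :: real^'n" UNIV f] by (simp only: o_def)
qed

lemma has_bochner_integral_vec_prod:
  fixes F :: "'n::finite \<Rightarrow> real \<Rightarrow> real"
  assumes F: "\<And>i. has_bochner_integral lborel (F i) (I i)"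
  shows "has_bochner_integral lborel (\<lambda>x :: real^'n. \<Prod>i\<in>UNIV. F i (x $ i)) (\<Prod>i\<in>UNIV. I i)"
proof -
  define ix where "ix b = (THE i. b = axis i (1::real))" for b :: "real^'n"
  have ix: "ix (axis i 1) = i" for i by (simp add: ix_def axis_eq_axis)
  have "has_bochner_integral lborel (\<lambda>x :: real^'n. \<Prod>b\<in>Basis. F (ix b) (x \<bullet> b)) (\<Prod>b\<in>(Basis :: (real^'n) set). I (ix b))"
    by (rule has_bochner_integral_lborel_prod) (rule F)
  thus ?thesis by (simp add: prod_Basis_vec ix inner_axis)
qed

lemma normal_low_moments:
  assumes "0 < \<sigma>"
  shows "has_bochner_integral lborel (\<lambda>x. normal_density 0 \<sigma> x * x ^ 0) 1"
    "has_bochner_integral lborel (\<lambda>x. normal_density 0 \<sigma> x * x ^ 1) 0"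
    "has_bochner_integral lborel (\<lambda>x. normal_density 0 \<sigma> x * x ^ 2) (\<sigma>\<^sup>2)"
  using normal_moment_even[OF assms, of 0 0] normal_moment_odd[OF assms, of 0 0] normal_moment_even[OF assms, of 0 1]
  by (simp_all add: eval_nat_numeral)

context
  fixes \<sigma> :: "'n::finite \<Rightarrow> real"
  assumes \<sigma>: "\<And>i. 0 < \<sigma> i"
begin

definition prod_normal :: "real^'n \<Rightarrow> real" where
  "prod_normal y = (\<Prod>i\<in>UNIV. normal_density 0 (\<sigma> i) (y $ i))"

lemma prod_normal_moment_0: "has_bochner_integral lborel prod_normal 1"
  using has_bochner_integral_vec_prod[OF normal_low_moments(1)[OF \<sigma>]] by (simp add: prod_normal_def[abs_def])

lemma prod_normal_moment:
  assumes k: "\<And>i. k i \<in> {0, 1, 2 :: nat}"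
  shows "has_bochner_integral lborel (\<lambda>y. prod_normal y * (\<Prod>i\<in>UNIV. y $ i ^ k i))
    (\<Prod>i\<in>UNIV. if k i = 0 then 1 else if k i = 1 then 0 else (\<sigma> i)\<^sup>2)"
proof -
  have "has_bochner_integral lborel (\<lambda>x. normal_density 0 (\<sigma> i) x * x ^ k i) (if k i = 0 then 1 else if k i = 1 then 0 else (\<sigma> i)\<^sup>2)" for i
    using k[of i] normal_low_moments[OF \<sigma>[of i]] by auto
  from has_bochner_integral_vec_prod[OF this] show ?thesis
    by (simp add: prod_normal_def prod.distrib)
qed

lemma prod_normal_moment_1: "has_bochner_integral lborel (\<lambda>y. prod_normal y * y $ j) 0"
proof -
  let ?k = "\<lambda>i. if i = j then 1 else 0 :: nat"
  have "has_bochner_integral lborel (\<lambda>y. prod_normal y * (\<Prod>i\<in>UNIV. y $ i ^ ?k i))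
    (\<Prod>i\<in>UNIV. if ?k i = 0 then 1 else if ?k i = 1 then 0 else (\<sigma> i)\<^sup>2)"
    by (rule prod_normal_moment) auto
  moreover have "(\<Prod>i\<in>UNIV. y $ i ^ ?k i) = y $ j" for y :: "real^'n"
    by (subst prod.remove[of _ j]) auto
  moreover have "(\<Prod>i\<in>UNIV. if ?k i = 0 then 1 else if ?k i = 1 then 0 else (\<sigma> i)\<^sup>2) = 0"
    by (rule prod_zero) auto
  ultimately show ?thesis by (simp only:)
qed

lemma prod_normal_moment_2:
  "has_bochner_integral lborel (\<lambda>y. prod_normal y * (y $ j * y $ l)) (if j = l then (\<sigma> j)\<^sup>2 else 0)"
proof -
  let ?k = "\<lambda>i. (if i = j then 1 else 0) + (if i = l then 1 else 0) :: nat"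
  have "has_bochner_integral lborel (\<lambda>y. prod_normal y * (\<Prod>i\<in>UNIV. y $ i ^ ?k i))
    (\<Prod>i\<in>UNIV. if ?k i = 0 then 1 else if ?k i = 1 then 0 else (\<sigma> i)\<^sup>2)"
    by (rule prod_normal_moment) auto
  moreover have "(\<Prod>i\<in>UNIV. y $ i ^ ?k i) = y $ j * y $ l" for y :: "real^'n"
  proof -
    have e: "(\<Prod>i\<in>UNIV. y $ i ^ (if i = a then 1 else 0 :: nat)) = y $ a" for a
      by (subst prod.remove[of _ a]) auto
    show ?thesis by (simp only: power_add prod.distrib e)
  qed
  moreover have "(\<Prod>i\<in>UNIV. if ?k i = 0 then 1 else if ?k i = 1 then 0 else (\<sigma> i)\<^sup>2) = (if j = l then (\<sigma> j)\<^sup>2 else 0)"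
  proof (cases "j = l")
    case True
    thus ?thesis by (subst prod.remove[of _ j]) auto
  next
    case False
    hence "(\<Prod>i\<in>UNIV. if ?k i = 0 then 1 else if ?k i = 1 then 0 else (\<sigma> i)\<^sup>2) = 0"
      by (intro prod_zero bexI[of _ j]) auto
    thus ?thesis using False by simp
  qed
  ultimately show ?thesis by (simp only:)
qed

lemma prod_normal_moment_1_inner: "has_bochner_integral lborel (\<lambda>y. prod_normal y * (p \<bullet> y)) 0"
proof -
  have "has_bochner_integral lborel (\<lambda>y. \<Sum>i\<in>UNIV. p $ i * (prod_normal y * y $ i)) (\<Sum>i\<in>UNIV. p $ i * 0)"
    by (intro has_bochner_integral_sum has_bochner_integral_mult_right prod_normal_moment_1)
  thus ?thesis by (simp add: inner_vec_def sum_distrib_left mult.left_commute)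
qed

lemma prod_normal_moment_2_inner:
  "has_bochner_integral lborel (\<lambda>y. prod_normal y * ((p \<bullet> y) * (q \<bullet> y))) (\<Sum>i\<in>UNIV. (\<sigma> i)\<^sup>2 * p $ i * q $ i)"
proof -
  have "has_bochner_integral lborel (\<lambda>y. \<Sum>i\<in>UNIV. \<Sum>j\<in>UNIV. (p $ i * q $ j) * (prod_normal y * (y $ i * y $ j)))
     (\<Sum>i\<in>UNIV. \<Sum>j\<in>UNIV. (p $ i * q $ j) * (if i = j then (\<sigma> i)\<^sup>2 else 0))"
    by (intro has_bochner_integral_sum has_bochner_integral_mult_right prod_normal_moment_2)
  moreover have "(\<Sum>i\<in>UNIV. \<Sum>j\<in>UNIV. (p $ i * q $ j) * (if i = j then (\<sigma> i)\<^sup>2 else 0)) = (\<Sum>i\<in>UNIV. (\<sigma> i)\<^sup>2 * p $ i * q $ i)"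
    by (intro sum.cong refl) (simp add: if_distrib cong: if_cong)
  moreover have "(\<Sum>i\<in>UNIV. \<Sum>j\<in>UNIV. (p $ i * q $ j) * (prod_normal y * (y $ i * y $ j))) = prod_normal y * ((p \<bullet> y) * (q \<bullet> y))" for y
  proof -
    have "(p \<bullet> y) * (q \<bullet> y) = (\<Sum>i\<in>UNIV. \<Sum>j\<in>UNIV. (p $ i * y $ i) * (q $ j * y $ j))"
      by (simp add: inner_vec_def sum_product)
    thus ?thesis by (simp add: sum_distrib_left ac_simps)
  qed
  ultimately show ?thesis by (simp only:)
qed

end

lemma matrix_inv_spectral:
  fixes U :: "real^'n^'n"
  assumes U: "orthogonal_matrix U" and d: "\<And>i. d i \<noteq> 0"
  shows "matrix_inv (U ** diag d ** transpose U) = U ** diag (\<lambda>i. 1 / d i) ** transpose U"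
proof (rule matrix_inv_unique(2))
  have "U ** diag d ** transpose U ** (U ** diag (\<lambda>i. 1 / d i) ** transpose U)
    = U ** (diag d ** (transpose U ** (U ** (diag (\<lambda>i. 1 / d i) ** transpose U))))"
    by (simp only: matrix_mul_assoc)
  also have "\<dots> = U ** (diag d ** diag (\<lambda>i. 1 / d i)) ** transpose U"
    unfolding cancel_orthogonal[OF U] by (simp only: matrix_mul_assoc)
  also have "\<dots> = mat 1" using d by (simp add: diag_mult_diag diag_1 orthogonal_matrixD[OF U])
  finally show "U ** diag d ** transpose U ** (U ** diag (\<lambda>i. 1 / d i) ** transpose U) = mat 1" .
qed

lemma det_spectral:
  fixes U :: "real^'n^'n"
  assumes U: "orthogonal_matrix U"
  shows "det (U ** diag d ** transpose U) = prod d UNIV"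
  using det_orthogonal_matrix[OF U] by (auto simp: det_mul det_diag)

lemma sqrt_prod: "sqrt (\<Prod>i\<in>I. f i) = (\<Prod>i\<in>I. sqrt (f i))"
  by (induction I rule: infinite_finite_induct) (auto simp: real_sqrt_mult)

text \<open>In an eigenbasis of the covariance the Gaussian is a product of one-dimensional normal
  densities, so that all its moments reduce to dimension one.\<close>

lemma gaussian_spectral:
  fixes U :: "real^'n^'n"
  assumes U: "orthogonal_matrix U" and C: "C = U ** diag d ** transpose U" and d: "\<And>i. 0 < d i"
  shows "gaussian m C (m + U *v y) = prod_normal (\<lambda>i. sqrt (d i)) y"
proof -
  have "(U *v y) \<bullet> (matrix_inv C *v (U *v y)) = (\<Sum>i\<in>UNIV. (1 / d i) * (transpose U *v (U *v y)) $ i * (transpose U *v (U *v y)) $ i)"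
    unfolding C matrix_inv_spectral[OF U less_imp_neq[OF d, symmetric]] by (rule quadratic_form_diag[OF refl])
  also have "\<dots> = (\<Sum>i\<in>UNIV. (y $ i)\<^sup>2 / d i)"
    unfolding cancel_orthogonal[OF U] by (simp add: power2_eq_square)
  finally have q: "(U *v y) \<bullet> (matrix_inv C *v (U *v y)) = (\<Sum>i\<in>UNIV. (y $ i)\<^sup>2 / d i)" .
  have det: "(2 * pi) ^ CARD('n) * det C = (\<Prod>i\<in>UNIV. 2 * pi * d i)"
    unfolding C det_spectral[OF U] by (simp add: prod.distrib)
  have "prod_normal (\<lambda>i. sqrt (d i)) y = (\<Prod>i\<in>UNIV. exp (- (y $ i)\<^sup>2 / (2 * d i)) / sqrt (2 * pi * d i))"
    unfolding prod_normal_def[OF real_sqrt_gt_zero[OF d]] normal_density_def using d by (simp add: less_imp_le)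
  also have "\<dots> = exp (\<Sum>i\<in>UNIV. - (y $ i)\<^sup>2 / (2 * d i)) / sqrt (\<Prod>i\<in>UNIV. 2 * pi * d i)"
    by (simp add: prod_dividef exp_sum sqrt_prod)
  also have "(\<Sum>i\<in>UNIV. - (y $ i)\<^sup>2 / (2 * d i)) = - (1/2) * (\<Sum>i\<in>UNIV. (y $ i)\<^sup>2 / d i)"
    by (simp add: sum_distrib_left sum_negf)
  finally show ?thesis unfolding gaussian_def add_diff_cancel_left' q det ..
qed

lemma borel_measurable_gaussian [measurable]: "gaussian m C \<in> borel_measurable borel"
  unfolding gaussian_def[abs_def] by measurable

lemma gaussian_moments:
  fixes C :: "real^'n^'n"
  assumes C: "C \<in> Sym_plus"
  shows "has_bochner_integral lborel (gaussian m C) 1"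
    and "has_bochner_integral lborel (\<lambda>x. gaussian m C x * (p \<bullet> (x - m))) 0"
    and "has_bochner_integral lborel (\<lambda>x. gaussian m C x * ((p \<bullet> (x - m)) * (q \<bullet> (x - m)))) (p \<bullet> (C *v q))"
proof -
  obtain U d where U: "orthogonal_matrix U" and Cd: "C = U ** diag d ** transpose U" and d: "\<And>i. 0 < d i"
    using Sym_plus_spectral[OF C] by blast
  have transfer: "has_bochner_integral lborel f I"
    if "f \<in> borel_measurable borel" "has_bochner_integral lborel (\<lambda>y. f (m + U *v y)) I" for f :: "real^'n \<Rightarrow> real" and I
    using has_bochner_integral_distr[of f borel "\<lambda>y. m + U *v y" lborel I] that lborel_distr_orthogonal[OF U, of m] by simp
  note sd = real_sqrt_gt_zero[OF d]
  note gauss = gaussian_spectral[OF U Cd d]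
  have inner: "p \<bullet> (U *v y) = (transpose U *v p) \<bullet> y" for p y by (rule inner_matrix_vector)
  show "has_bochner_integral lborel (gaussian m C) 1"
    by (rule transfer) (use prod_normal_moment_0[OF sd] in \<open>auto simp: gauss\<close>)
  show "has_bochner_integral lborel (\<lambda>x. gaussian m C x * (p \<bullet> (x - m))) 0"
    by (rule transfer, measurable)
      (use prod_normal_moment_1_inner[where \<sigma> = "\<lambda>i. sqrt (d i)", OF sd, where p = "transpose U *v p"] in \<open>simp only: gauss inner add_diff_cancel_left'\<close>)
  have "(\<Sum>i\<in>UNIV. (sqrt (d i))\<^sup>2 * (transpose U *v p) $ i * (transpose U *v q) $ i) = p \<bullet> (C *v q)"
    unfolding quadratic_form_diag[OF Cd] using d by (simp add: less_imp_le)
  with prod_normal_moment_2_inner[where \<sigma> = "\<lambda>i. sqrt (d i)", OF sd, where p = "transpose U *v p" and q = "transpose U *v q"]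
  have "has_bochner_integral lborel (\<lambda>y. gaussian m C (m + U *v y) * ((p \<bullet> (m + U *v y - m)) * (q \<bullet> (m + U *v y - m)))) (p \<bullet> (C *v q))"
    by (simp only: gauss inner add_diff_cancel_left')
  thus "has_bochner_integral lborel (\<lambda>x. gaussian m C x * ((p \<bullet> (x - m)) * (q \<bullet> (x - m)))) (p \<bullet> (C *v q))"
    by (rule transfer[rotated]) measurable
qed

lemma gaussian_pos:
  assumes "C \<in> Sym_plus"
  shows "0 < gaussian m C x"
proof -
  obtain U d where U: "orthogonal_matrix U" and Cd: "C = U ** diag d ** transpose U" and d: "\<And>i. 0 < d i"
    using Sym_plus_spectral[OF assms] by blast
  have "det C > 0" unfolding Cd det_spectral[OF U] by (intro prod_pos ballI d)
  thus ?thesis by (simp add: gaussian_def)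
qed

text \<open>The kernel is affine in \<open>y\<close>, so for an affine gradient the integrand is a
  polynomial of degree 2 in \<open>y - m\<close> against the Gaussian, and only its moments up to
  order two enter.\<close>

lemma kernel_field_gaussian:
  fixes A C T :: "real^'n^'n"
  assumes A: "transpose A = A" and C: "C \<in> Sym_plus"
    and grad: "\<And>y. grad \<Phi> y = T *v (y - m) + w"
    and int: "integrable lborel (\<lambda>y. (bilinear_kernel A x y * gaussian m C y) *\<^sub>R grad \<Phi> y)"
  shows "kernel_field (bilinear_kernel A) (gaussian m C) \<Phi> x = bilinear_kernel A x m *\<^sub>R w + T *v (C *v (A *v x))"
proof -
  have K: "bilinear_kernel A x y = bilinear_kernel A x m + (A *v x) \<bullet> (y - m)" for y
    using inner_matrix_vector[of x A "y - m"] A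
    by (simp add: bilinear_kernel_def matrix_algebra inner_diff_right)
  have "kernel_field (bilinear_kernel A) (gaussian m C) \<Phi> x \<bullet> e = (bilinear_kernel A x m *\<^sub>R w + T *v (C *v (A *v x))) \<bullet> e" for e
  proof -
    define r where "r = transpose T *v e"
    define c where "c = bilinear_kernel A x m"
    define p where "p = A *v x"
    have "kernel_field (bilinear_kernel A) (gaussian m C) \<Phi> x \<bullet> e
      = (\<integral>y. ((bilinear_kernel A x y * gaussian m C y) *\<^sub>R grad \<Phi> y) \<bullet> e \<partial>lborel)"
      unfolding kernel_field_def by (rule integral_inner_left[OF int, symmetric])
    also have "(\<lambda>y. ((bilinear_kernel A x y * gaussian m C y) *\<^sub>R grad \<Phi> y) \<bullet> e) =
      (\<lambda>y. (c * (w \<bullet> e)) * gaussian m C y + c * (gaussian m C y * (r \<bullet> (y - m))) + (w \<bullet> e) * (gaussian m C y * (p \<bullet> (y - m)))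
         + gaussian m C y * ((r \<bullet> (y - m)) * (p \<bullet> (y - m))))"
    proof
      fix y
      have g: "grad \<Phi> y \<bullet> e = r \<bullet> (y - m) + w \<bullet> e"
        using inner_matrix_vector[of e T "y - m"] by (simp only: grad inner_add_right r_def inner_commute[of _ e])
      show "((bilinear_kernel A x y * gaussian m C y) *\<^sub>R grad \<Phi> y) \<bullet> e =
         (c * (w \<bullet> e)) * gaussian m C y + c * (gaussian m C y * (r \<bullet> (y - m))) + (w \<bullet> e) * (gaussian m C y * (p \<bullet> (y - m)))
         + gaussian m C y * ((r \<bullet> (y - m)) * (p \<bullet> (y - m)))"
        unfolding K[of y] c_def[symmetric] p_def[symmetric] inner_scaleR_left g by (simp add: algebra_simps)
    qed
    also have "integral\<^sup>L lborel \<dots> = (c * (w \<bullet> e)) * 1 + c * 0 + (w \<bullet> e) * 0 + r \<bullet> (C *v p)"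
      by (intro has_bochner_integral_integral_eq has_bochner_integral_add has_bochner_integral_mult_right gaussian_moments[OF C])
    also have "\<dots> = (c *\<^sub>R w + T *v (C *v p)) \<bullet> e"
      using inner_matrix_vector[of e T "C *v p"] by (simp only: r_def inner_add_right inner_scaleR_right inner_commute[of _ e] mult_1_right mult_zero_right add_0_right)
    finally show ?thesis by (simp add: c_def p_def)
  qed
  thus ?thesis by (meson vector_eq_rdot)
qed

section \<open>Transport by affine vector fields\<close>

lemma divergence_scaled_affine:
  fixes W :: "real^'n^'n"
  assumes f: "(f has_derivative f') (at x)"
  shows "divergence (\<lambda>z. f z *\<^sub>R (m + W *v z)) x = f' (m + W *v x) + f x * trace W"
proof -
  have lin: "((\<lambda>z. m + W *v z) has_derivative (\<lambda>h. W *v h)) (at x)"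
    using has_derivative_add[OF has_derivative_const bounded_linear.has_derivative[OF
      bounded_bilinear.bounded_linear_right[OF bounded_bilinear_matrix_vector_mult] has_derivative_ident]]
    by simp
  have "((\<lambda>z. f z *\<^sub>R (m + W *v z)) has_derivative (\<lambda>h. f x *\<^sub>R (W *v h) + f' h *\<^sub>R (m + W *v x))) (at x)"
    by (rule has_derivative_scaleR[OF f lin])
  hence "frechet_derivative (\<lambda>z. f z *\<^sub>R (m + W *v z)) (at x) = (\<lambda>h. f x *\<^sub>R (W *v h) + f' h *\<^sub>R (m + W *v x))"
    by (rule frechet_derivative_at[symmetric])
  hence "divergence (\<lambda>z. f z *\<^sub>R (m + W *v z)) x
      = (\<Sum>i\<in>UNIV. f x * (W *v axis i 1) $ i + f' (axis i 1) * (m + W *v x) $ i)"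
    by (simp add: divergence_def jacobian_def trace_def matrix_def)
  also have "\<dots> = f x * trace W + (\<Sum>i\<in>UNIV. f' (axis i 1) * (m + W *v x) $ i)"
    by (simp add: sum.distrib sum_distrib_left[symmetric] trace_def matrix_vector_mult_basis column_def)
  also have "(\<Sum>i\<in>UNIV. f' (axis i 1) * (m + W *v x) $ i) = f' (m + W *v x)"
  proof -
    have l: "linear f'" using has_derivative_linear[OF f] .
    have "f' (m + W *v x) = f' (\<Sum>i\<in>UNIV. (m + W *v x) $ i *\<^sub>R axis i 1)"
      by (subst basis_expansion[symmetric]) (simp add: scalar_mult_eq_scaleR)
    also have "\<dots> = (\<Sum>i\<in>UNIV. (m + W *v x) $ i * f' (axis i 1))"
      by (simp add: linear_sum[OF l] linear_scale[OF l])
    finally show ?thesis by (simp add: mult.commute)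
  qed
  finally show ?thesis by simp
qed

text \<open>By Jacobi's formula the determinant is the exponential of the integrated trace of
  \<open>W\<close>.\<close>

lemma det_flow_pos:
  fixes W :: "real \<Rightarrow> real^'n^'n"
  assumes W: "continuous_on {0..} W" and P0: "P 0 = mat 1"
    and P: "\<And>t. 0 \<le> t \<Longrightarrow> (P has_vector_derivative W t ** P t) (at t within {0..})" and t: "0 \<le> t"
  shows "0 < det (P t)"
proof -
  define \<tau> where "\<tau> t = integral {0..t} (\<lambda>s. trace (W s))" for t
  have cW: "continuous_on {0..} (\<lambda>s. trace (W s))"
    by (rule bounded_linear.continuous_on[OF bounded_linear_trace W])
  have \<tau>: "(\<tau> has_real_derivative trace (W s)) (at s within {0..})" if "0 \<le> s" for s
    unfolding \<tau>_def has_real_derivative_iff_has_vector_derivative by (rule integral_derivative_atLeast_0[OF cW that])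
  define g where "g t = det (P t) * exp (- \<tau> t)" for t
  have g: "(g has_vector_derivative 0) (at s within {0..})" if "0 \<le> s" for s
  proof -
    have "(g has_real_derivative trace (W s) * det (P s) * exp (- \<tau> s) + exp (- \<tau> s) * (- trace (W s)) * det (P s)) (at s within {0..})"
      unfolding g_def by (rule derivative_intros det_has_derivative[OF P[OF that]] \<tau>[OF that])+
    thus ?thesis by (simp add: has_real_derivative_iff_has_vector_derivative)
  qed
  have "g t = 1"
  proof (rule ode_unique[OF t, where x = g and x' = "\<lambda>_. 0" and y = "\<lambda>_. 1" and y' = "\<lambda>_. 0" and C = 0])
    show "continuous_on {0..t} g"
      by (rule continuous_on_subset[OF has_vector_derivative_continuous_on[OF g]]) auto
    show "(g has_vector_derivative 0) (at s)" if "0 < s" "s < t" for s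
      using has_vector_derivative_within_atLeast_0[OF g] that by simp
    show "g 0 = 1" by (simp add: g_def \<tau>_def P0)
  qed auto
  hence "0 < det (P t) * exp (- \<tau> t)" by (simp add: g_def)
  thus ?thesis by (simp add: zero_less_mult_iff)
qed

lemma gaussian_affine:
  fixes P C :: "real^'n^'n"
  assumes C: "C \<in> Sym_plus" and P: "0 < det P"
  shows "gaussian (P *v m + p) (P ** C ** transpose P) (P *v x + p) = gaussian m C x / det P"
proof -
  have iP: "invertible P" using P by (simp add: invertible_det_nz)
  have iC: "invertible C" by (rule Sym_plus_invertible[OF C])
  have inv: "matrix_inv (P ** C ** transpose P) = transpose (matrix_inv P) ** matrix_inv C ** matrix_inv P"
    using iP iC by (simp add: matrix_inv_mult invertible_mult transpose_invertible transpose_matrix_inv matrix_mul_assoc)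
  have diff: "P *v x + p - (P *v m + p) = P *v (x - m)" by (simp add: matrix_algebra)
  have cancel: "matrix_inv P *v (P *v v) = v" for v
    using matrix_inv_inverse[OF iP] by (simp add: matrix_vector_mul_assoc)
  have "(P *v v) \<bullet> ((transpose (matrix_inv P) ** matrix_inv C ** matrix_inv P) *v (P *v v)) = v \<bullet> (matrix_inv C *v v)" for v
  proof -
    have "(P *v v) \<bullet> ((transpose (matrix_inv P) ** matrix_inv C ** matrix_inv P) *v (P *v v))
      = (P *v v) \<bullet> (transpose (matrix_inv P) *v (matrix_inv C *v v))"
      by (simp only: matrix_vector_mul_assoc[symmetric] matrix_mul_assoc[symmetric] cancel)
    also have "\<dots> = (matrix_inv P *v (P *v v)) \<bullet> (matrix_inv C *v v)"
      by (subst inner_matrix_vector) (simp only: transpose_transpose)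
    finally show ?thesis by (simp only: cancel)
  qed
  moreover have "sqrt ((2 * pi) ^ CARD('n) * det (P ** C ** transpose P)) = det P * sqrt ((2 * pi) ^ CARD('n) * det C)"
  proof -
    have "(2 * pi) ^ CARD('n) * det (P ** C ** transpose P) = (det P)\<^sup>2 * ((2 * pi) ^ CARD('n) * det C)"
      by (simp add: det_mul power2_eq_square ac_simps)
    thus ?thesis using P by (simp only: real_sqrt_mult real_sqrt_abs abs_of_pos)
  qed
  ultimately show ?thesis unfolding gaussian_def diff inv by simp
qed

text \<open>The density along a characteristic, multiplied by the Jacobian determinant of the flow
  map, is conserved. Hence the density is the push-forward of the initial Gaussian under an affine
  map.\<close>

lemma affine_transport_gaussian:
  fixes \<rho> :: "real \<Rightarrow> real^'n \<Rightarrow> real" and W :: "real \<Rightarrow> real^'n^'n"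
  assumes cont: "continuous_on ({0..} \<times> UNIV) (\<lambda>(t, x). \<rho> t x)"
    and diff: "\<And>t x. 0 < t \<Longrightarrow> (\<lambda>(t, x). \<rho> t x) differentiable (at (t, x))"
    and pde: "\<And>t x. 0 < t \<Longrightarrow> ((\<lambda>s. \<rho> s x) has_real_derivative
        - divergence (\<lambda>z. \<rho> t z *\<^sub>R (m t + W t *v z)) x) (at t)"
    and W: "continuous_on {0..} W" and P0: "P 0 = mat 1" and p0: "p 0 = 0"
    and P: "\<And>t. 0 \<le> t \<Longrightarrow> (P has_vector_derivative W t ** P t) (at t within {0..})"
    and p: "\<And>t. 0 \<le> t \<Longrightarrow> (p has_vector_derivative W t *v p t + m t) (at t within {0..})"
    and init: "\<rho> 0 = gaussian \<mu>0 \<Sigma>0" and \<Sigma>0: "\<Sigma>0 \<in> Sym_plus" and t: "0 \<le> t"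
  shows "\<rho> t = gaussian (P t *v \<mu>0 + p t) (P t ** \<Sigma>0 ** transpose (P t))"
proof
  fix y
  have dP: "0 < det (P t)" by (rule det_flow_pos[OF W P0 P t])
  have iP: "invertible (P t)" using dP by (simp add: invertible_det_nz)
  define x where "x = matrix_inv (P t) *v (y - p t)"
  define X where "X s = P s *v x + p s" for s
  have Xt: "X t = y" using matrix_inv_inverse[OF iP] by (simp add: X_def x_def matrix_vector_mul_assoc)
  have X: "(X has_vector_derivative m s + W s *v X s) (at s within {0..})" if "0 \<le> s" for s
  proof -
    have "((\<lambda>s. P s *v x) has_vector_derivative (W s ** P s) *v x) (at s within {0..})"
      by (rule bounded_linear.has_vector_derivative[OF bounded_bilinear.bounded_linear_left[OF bounded_bilinear_matrix_vector_mult] P[OF that]])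
    from has_vector_derivative_add[OF this p[OF that]] show ?thesis
      by (simp add: X_def[abs_def] matrix_algebra matrix_vector_right_distrib matrix_vector_mul_assoc add.commute add.left_commute)
  qed
  have cX: "continuous_on {0..} X" by (rule has_vector_derivative_continuous_on[OF X]) simp
  have cP: "continuous_on {0..} (\<lambda>s. det (P s))"
    by (rule has_vector_derivative_continuous_on[OF det_has_derivative[OF P, unfolded has_real_derivative_iff_has_vector_derivative]]) simp
  define g where "g s = \<rho> s (X s) * det (P s)" for s
  have "g t = g 0"
  proof (rule ode_unique[OF t, where x = g and x' = "\<lambda>_. 0" and y = "\<lambda>_. g 0" and y' = "\<lambda>_. 0" and C = 0])
    have "continuous_on {0..} (\<lambda>s. (\<lambda>(t, x). \<rho> t x) (s, X s))"
      by (rule continuous_on_compose2[OF cont]) (auto intro!: continuous_intros cX)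
    hence "continuous_on {0..} g" unfolding g_def using cP by (auto intro!: continuous_intros)
    thus "continuous_on {0..t} g" by (rule continuous_on_subset) auto
    fix s assume s: "0 < s" "s < t"
    obtain D where D: "((\<lambda>(t, x). \<rho> t x) has_derivative D) (at (s, X s))"
      using diff[OF s(1)] unfolding differentiable_def by blast
    have lD: "linear D" by (rule has_derivative_linear[OF D])
    have Dx: "(\<rho> s has_derivative (\<lambda>h. D (0, h))) (at (X s))"
    proof -
      have "((\<lambda>z. (s, z)) has_derivative (\<lambda>h. (0, h))) (at (X s))" by (auto intro!: derivative_eq_intros)
      from has_derivative_compose[OF this, of "\<lambda>(t, x). \<rho> t x" D] D show ?thesis by simp
    qed
    have Dt: "((\<lambda>s. \<rho> s (X s')) has_derivative (\<lambda>h. D (h, 0))) (at s)" if "s' = s" for s'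
    proof -
      have "((\<lambda>r. (r, X s)) has_derivative (\<lambda>h. (h, 0))) (at s)" by (auto intro!: derivative_eq_intros)
      from has_derivative_compose[OF this, of "\<lambda>(t, x). \<rho> t x" D] D that show ?thesis by simp
    qed
    have "(\<lambda>h. D (h, 0)) = (*) (- divergence (\<lambda>z. \<rho> s z *\<^sub>R (m s + W s *v z)) (X s))"
      using has_derivative_unique[OF Dt[OF refl] pde[OF s(1), of "X s", unfolded has_field_derivative_def]] .
    from fun_cong[OF this, of 1]
    have Dt1: "D (1, 0) = - divergence (\<lambda>z. \<rho> s z *\<^sub>R (m s + W s *v z)) (X s)" by simp
    have DX: "((\<lambda>s. (s, X s)) has_derivative (\<lambda>h. h *\<^sub>R (1, m s + W s *v X s))) (at s)"
      using has_derivative_Pair[OF has_derivative_ident has_vector_derivative_within_atLeast_0[OF X s(1), unfolded has_vector_derivative_def]] s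
      by simp
    have "((\<lambda>s. \<rho> s (X s)) has_derivative (\<lambda>h. D (h *\<^sub>R (1, m s + W s *v X s)))) (at s)"
      using has_derivative_compose[OF DX, of "\<lambda>(t, x). \<rho> t x" D] D by simp
    moreover have "D (h *\<^sub>R (1, m s + W s *v X s)) = (D (1, 0) + D (0, m s + W s *v X s)) * h" for h
      using linear_add[OF lD, of "(1, 0)" "(0, m s + W s *v X s)"] linear_scale[OF lD, of h "(1, m s + W s *v X s)"] by simp
    ultimately have "((\<lambda>s. \<rho> s (X s)) has_real_derivative D (1, 0) + D (0, m s + W s *v X s)) (at s)"
      by (simp add: has_field_derivative_def)
    moreover have "D (1, 0) + D (0, m s + W s *v X s) = - (\<rho> s (X s) * trace (W s))"
      unfolding Dt1 divergence_scaled_affine[OF Dx] by simp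
    ultimately have d\<rho>: "((\<lambda>s. \<rho> s (X s)) has_real_derivative - (\<rho> s (X s) * trace (W s))) (at s)" by simp
    have ddet: "((\<lambda>s. det (P s)) has_real_derivative trace (W s) * det (P s)) (at s)"
      by (rule det_has_derivative) (use has_vector_derivative_within_atLeast_0[OF P s(1)] s in simp)
    have "(g has_real_derivative - (\<rho> s (X s) * trace (W s)) * det (P s) + (trace (W s) * det (P s)) * \<rho> s (X s)) (at s)"
      unfolding g_def by (rule DERIV_mult[OF d\<rho> ddet])
    thus "(g has_vector_derivative 0) (at s)"
      by (simp add: has_real_derivative_iff_has_vector_derivative)
  qed auto
  hence "\<rho> t y * det (P t) = gaussian \<mu>0 \<Sigma>0 x"
    by (simp add: g_def Xt init P0 X_def[of 0] p0)
  hence "\<rho> t y = gaussian \<mu>0 \<Sigma>0 x / det (P t)" using dP by (simp add: field_simps)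
  also have "\<dots> = gaussian (P t *v \<mu>0 + p t) (P t ** \<Sigma>0 ** transpose (P t)) y"
    using gaussian_affine[OF \<Sigma>0 dP, of \<mu>0 "p t" x] Xt by (simp add: X_def)
  finally show "\<rho> t y = gaussian (P t *v \<mu>0 + p t) (P t ** \<Sigma>0 ** transpose (P t)) y" .
qed

lemma congruence_flow_derivative:
  fixes P :: "real \<Rightarrow> real^'n^'n"
  assumes P: "(P has_vector_derivative W ** P t) (at t within S)"
  shows "((\<lambda>t. P t ** C ** transpose (P t)) has_vector_derivative
    W ** (P t ** C ** transpose (P t)) + (P t ** C ** transpose (P t)) ** transpose W) (at t within S)"
proof -
  note mult = bounded_bilinear.has_vector_derivative[OF bounded_bilinear_matrix_mult]
  have "((\<lambda>t. P t ** C) has_vector_derivative (W ** P t) ** C) (at t within S)"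
    by (rule bounded_linear.has_vector_derivative[OF bounded_bilinear.bounded_linear_left[OF bounded_bilinear_matrix_mult] P])
  from mult[OF this bounded_linear.has_vector_derivative[OF bounded_linear_transpose P]]
  show ?thesis by (simp add: matrix_algebra add.commute)
qed

text \<open>The kernel is affine in its first argument, and so is the velocity field, whatever the
  density.\<close>

lemma kernel_field_affine:
  fixes A :: "real^'n^'n"
  assumes int: "\<And>x. integrable lborel (\<lambda>y. (bilinear_kernel A x y * \<rho> y) *\<^sub>R grad \<Phi> y)"
  defines "F \<equiv> kernel_field (bilinear_kernel A) \<rho> \<Phi>"
  shows "F x = F 0 + (\<chi> i j. (F (axis j 1) - F 0) $ i) *v x"
proof -
  define L where "L x = F x - F 0" for x
  let ?h = "\<lambda>x y. ((x \<bullet> (A *v y)) * \<rho> y) *\<^sub>R grad \<Phi> y"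
  have h: "?h x = (\<lambda>y. (bilinear_kernel A x y * \<rho> y) *\<^sub>R grad \<Phi> y - (bilinear_kernel A 0 y * \<rho> y) *\<^sub>R grad \<Phi> y)" for x
    by (simp add: fun_eq_iff bilinear_kernel_def algebra_simps)
  have inth: "integrable lborel (?h x)" for x unfolding h by (intro Bochner_Integration.integrable_diff int)
  have L: "L x = (\<integral>y. ?h x y \<partial>lborel)" for x
    unfolding L_def F_def kernel_field_def h by (rule Bochner_Integration.integral_diff[OF int int, symmetric])
  have "linear L"
  proof (rule linearI)
    fix x z and c :: real
    have "?h (x + z) = (\<lambda>y. ?h x y + ?h z y)" by (simp add: fun_eq_iff algebra_simps)
    thus "L (x + z) = L x + L z" unfolding L by (simp add: Bochner_Integration.integral_add[OF inth inth])
    have hc: "?h (c *\<^sub>R x) = (\<lambda>y. c *\<^sub>R ?h x y)" by (simp add: fun_eq_iff algebra_simps)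
    show "L (c *\<^sub>R x) = c *\<^sub>R L x" unfolding L hc by (rule integral_scaleR_right)
  qed
  hence "matrix L *v x = L x" by (simp add: matrix_works linear_matrix_vector_mul_eq)
  thus ?thesis by (simp add: L_def matrix_def)
qed

lemma grad_eqI:
  assumes "(f has_derivative (\<lambda>h. v \<bullet> h)) (at x)"
  shows "grad f x = v"
  using frechet_derivative_at[OF assms, symmetric] by (simp add: grad_def vec_eq_iff inner_axis)

lemma quadratic_has_derivative:
  fixes M :: "real^'n^'n"
  assumes "transpose M = M"
  shows "((\<lambda>x. (x - m) \<bullet> (M *v (x - m))) has_derivative (\<lambda>h. (2 *\<^sub>R (M *v (x - m))) \<bullet> h)) (at x)"
proof -
  have d: "((\<lambda>x. x - m) has_derivative (\<lambda>h. h)) (at x)" by (auto intro!: derivative_eq_intros)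
  have "((\<lambda>x. M *v (x - m)) has_derivative (\<lambda>h. M *v h)) (at x)"
    by (rule bounded_linear.has_derivative[OF bounded_bilinear.bounded_linear_right[OF bounded_bilinear_matrix_vector_mult] d])
  from has_derivative_inner[OF d this]
  have "((\<lambda>x. (x - m) \<bullet> (M *v (x - m))) has_derivative (\<lambda>h. (x - m) \<bullet> (M *v h) + h \<bullet> (M *v (x - m)))) (at x)" .
  moreover have "(x - m) \<bullet> (M *v h) + h \<bullet> (M *v (x - m)) = (2 *\<^sub>R (M *v (x - m))) \<bullet> h" for h
    using inner_matrix_vector[of "x - m" M h] assms by (simp add: inner_commute)
  ultimately show ?thesis by simp
qed

lemma ln_gaussian:
  assumes "C \<in> Sym_plus"
  shows "ln (gaussian m C x) = - (1/2) * ((x - m) \<bullet> (matrix_inv C *v (x - m))) + ln (gaussian m C m)"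
proof -
  have "gaussian m C x = exp (- (1/2) * ((x - m) \<bullet> (matrix_inv C *v (x - m)))) * gaussian m C m"
    by (simp add: gaussian_def)
  thus ?thesis using gaussian_pos[OF assms, of m m] by (simp add: ln_mult)
qed

lemma KL_first_variation_gaussian:
  assumes S: "S \<in> Sym_plus" and Q: "Q \<in> Sym_plus"
  shows "\<exists>c. \<forall>x. KL_first_variation (gaussian b Q) (gaussian m S) x =
    c - (1/2) * ((x - m) \<bullet> (matrix_inv S *v (x - m))) + (1/2) * ((x - b) \<bullet> (matrix_inv Q *v (x - b)))"
proof (intro exI allI)
  fix x
  show "KL_first_variation (gaussian b Q) (gaussian m S) x = (ln (gaussian m S m) - ln (gaussian b Q b) + 1)
    - (1/2) * ((x - m) \<bullet> (matrix_inv S *v (x - m))) + (1/2) * ((x - b) \<bullet> (matrix_inv Q *v (x - b)))"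
    using ln_gaussian[OF S, of m x] ln_gaussian[OF Q, of b x] gaussian_pos[OF S, of m x] gaussian_pos[OF Q, of b x]
    by (simp add: KL_first_variation_def ln_div)
qed

lemma grad_KL_first_variation_gaussian:
  assumes S: "S \<in> Sym_plus" and Q: "Q \<in> Sym_plus"
  shows "grad (KL_first_variation (gaussian b Q) (gaussian m S)) x =
    (matrix_inv Q - matrix_inv S) *v (x - m) + matrix_inv Q *v (m - b)"
proof (rule grad_eqI)
  obtain c where c: "KL_first_variation (gaussian b Q) (gaussian m S) =
     (\<lambda>x. c - (1/2) * ((x - m) \<bullet> (matrix_inv S *v (x - m))) + (1/2) * ((x - b) \<bullet> (matrix_inv Q *v (x - b))))"
    using KL_first_variation_gaussian[OF S Q] by fastforce
  have "((\<lambda>x. c - (1/2) * ((x - m) \<bullet> (matrix_inv S *v (x - m))) + (1/2) * ((x - b) \<bullet> (matrix_inv Q *v (x - b))))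
    has_derivative (\<lambda>h. 0 - (1/2) * ((2 *\<^sub>R (matrix_inv S *v (x - m))) \<bullet> h) + (1/2) * ((2 *\<^sub>R (matrix_inv Q *v (x - b))) \<bullet> h))) (at x)"
    by (intro has_derivative_add has_derivative_diff has_derivative_const has_derivative_mult_right
        quadratic_has_derivative Sym_plusD(1)[OF Sym_plus_matrix_inv] S Q)
  moreover have "0 - (1/2) * ((2 *\<^sub>R (matrix_inv S *v (x - m))) \<bullet> h) + (1/2) * ((2 *\<^sub>R (matrix_inv Q *v (x - b))) \<bullet> h)
    = ((matrix_inv Q - matrix_inv S) *v (x - m) + matrix_inv Q *v (m - b)) \<bullet> h" for h
    by (simp add: matrix_algebra inner_add_left inner_diff_left field_simps)
  ultimately show "(KL_first_variation (gaussian b Q) (gaussian m S) has_derivative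
    (\<lambda>h. ((matrix_inv Q - matrix_inv S) *v (x - m) + matrix_inv Q *v (m - b)) \<bullet> h)) (at x)"
    unfolding c by (simp only:)
qed

section \<open>The moment system\<close>

text \<open>The velocity field of the flow at the Gaussian with mean \<open>m\<close> and
  covariance \<open>S\<close> is \<open>x \<mapsto> stein_drift A b Q m S x - Q\<^sup>-\<^sup>1 (m
  - b)\<close>.\<close>

definition stein_drift :: "real^'n^'n \<Rightarrow> real^'n \<Rightarrow> real^'n^'n \<Rightarrow> real^'n \<Rightarrow> real^'n^'n \<Rightarrow> real^'n^'n" where
  "stein_drift A b Q m S = (mat 1 - matrix_inv Q ** S) ** A - outer (matrix_inv Q *v (m - b)) (A *v m)"

lemma stein_mean_rhs:
  "((mat 1 - matrix_inv Q ** S) ** A) *v m - bilinear_kernel A m m *\<^sub>R (matrix_inv Q *v (m - b))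
    = stein_drift A b Q m S *v m - matrix_inv Q *v (m - b)"
  by (simp add: stein_drift_def bilinear_kernel_def matrix_vector_mult_diff_rdistrib outer_mult_vector inner_commute[of "A *v m"] scaleR_left_distrib)

lemma two_Sym: "2 *\<^sub>R Sym B = B + transpose B"
  by (simp add: Sym_def)

text \<open>Written as \<open>W S + S W\<^sup>T\<close>, the covariance equation is solved by
  congruences \<open>P S P\<^sup>T\<close>. This is why it preserves positive
  definiteness.\<close>

lemma stein_cov_rhs:
  fixes A Q S :: "real^'n^'n"
  assumes A: "transpose A = A" and S: "transpose S = S" and Q: "transpose (matrix_inv Q) = matrix_inv Q"
  shows "2 *\<^sub>R Sym (S ** A) - 2 *\<^sub>R Sym (S ** A ** (S + outer m (m - b)) ** matrix_inv Q)
    = stein_drift A b Q m S ** S + S ** transpose (stein_drift A b Q m S)"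
proof -
  define w where "w = matrix_inv Q *v (m - b)"
  have o: "outer m (m - b) ** matrix_inv Q = outer m w" by (simp only: outer_matrix_mult Q w_def)
  have o1: "S ** A ** outer m (m - b) ** matrix_inv Q = outer (S *v (A *v m)) w"
  proof -
    have "S ** A ** outer m (m - b) ** matrix_inv Q = (S ** A) ** (outer m (m - b) ** matrix_inv Q)"
      by (simp only: matrix_mul_assoc)
    thus ?thesis unfolding o by (simp only: matrix_mult_outer matrix_vector_mul_assoc)
  qed
  have o2: "outer w (A *v m) ** S = outer w (S *v (A *v m))" by (simp only: outer_matrix_mult S)
  have "S ** A ** (S + outer m (m - b)) ** matrix_inv Q = S ** A ** S ** matrix_inv Q + outer (S *v (A *v m)) w"
    unfolding o1[symmetric] by (simp only: matrix_algebra)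
  moreover have "stein_drift A b Q m S ** S = A ** S - matrix_inv Q ** S ** A ** S - outer w (S *v (A *v m))"
    unfolding stein_drift_def w_def[symmetric] o2[symmetric] by (simp only: matrix_algebra)
  moreover have "S ** transpose (stein_drift A b Q m S) = S ** A - S ** A ** S ** matrix_inv Q - outer (S *v (A *v m)) w"
    unfolding stein_drift_def w_def[symmetric]
    by (simp only: matrix_algebra transpose_mat transpose_outer A S Q matrix_mult_outer)
  ultimately show ?thesis
    unfolding two_Sym by (simp add: matrix_algebra transpose_outer A S Q matrix_mul_assoc)
qed

text \<open>Solutions on a compact interval, for the a priori bounds that precede global
  existence.\<close>

definition solves_until :: "real^'n^'n \<Rightarrow> real^'n \<Rightarrow> real^'n^'n \<Rightarrow> real \<Rightarrow> (real \<Rightarrow> real^'n) \<Rightarrow> (real \<Rightarrow> real^'n^'n) \<Rightarrow> bool" where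
  "solves_until A b Q T \<mu> \<Sigma> \<longleftrightarrow>
    (\<forall>t\<in>{0..T}. (\<mu> has_vector_derivative
        ((mat 1 - matrix_inv Q ** \<Sigma> t) ** A) *v \<mu> t
          - bilinear_kernel A (\<mu> t) (\<mu> t) *\<^sub>R (matrix_inv Q *v (\<mu> t - b))) (at t within {0..T}) \<and>
      (\<Sigma> has_vector_derivative
        2 *\<^sub>R Sym (\<Sigma> t ** A) - 2 *\<^sub>R Sym (\<Sigma> t ** A ** (\<Sigma> t + outer (\<mu> t) (\<mu> t - b)) ** matrix_inv Q))
        (at t within {0..T}))"

lemma stein_gaussian_system_solves_until:
  assumes "stein_gaussian_system A b Q \<mu>0 \<Sigma>0 \<mu> \<Sigma>"
  shows "solves_until A b Q T \<mu> \<Sigma>"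
  using assms unfolding solves_until_def stein_gaussian_system_def
  by (auto intro!: has_vector_derivative_within_subset[of _ _ _ "{0..}" "{0..T}"])

lemma solves_until_continuous:
  assumes "solves_until A b Q T \<mu> \<Sigma>"
  shows "continuous_on {0..T} \<mu>" "continuous_on {0..T} \<Sigma>"
  using assms unfolding solves_until_def continuous_on_eq_continuous_within
  by (blast intro: has_vector_derivative_continuous)+

lemma has_vector_derivative_within_Icc_0:
  assumes "(f has_vector_derivative D) (at t within {0..T})" "0 < t" "t < (T::real)"
  shows "(f has_vector_derivative D) (at t)"
  using assms by (simp add: at_within_Icc_at)

lemma continuous_on_stein_drift:
  assumes "continuous_on X \<mu>" "continuous_on X \<Sigma>"
  shows "continuous_on X (\<lambda>t. stein_drift A b Q (\<mu> t) (\<Sigma> t))"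
  unfolding stein_drift_def
  by (intro continuous_intros bounded_bilinear.continuous_on[OF bounded_bilinear_matrix_mult]
      bounded_bilinear.continuous_on[OF bounded_bilinear_outer]
      bounded_bilinear.continuous_on[OF bounded_bilinear_matrix_vector_mult] assms)

lemma continuous_bounded_Icc:
  fixes f :: "real \<Rightarrow> 'a::real_normed_vector"
  assumes "continuous_on {0..T} f"
  obtains C where "\<And>t. 0 \<le> t \<Longrightarrow> t \<le> T \<Longrightarrow> norm (f t) \<le> C"
proof -
  have "bounded (f ` {0..T})" by (intro compact_imp_bounded compact_continuous_image assms compact_Icc)
  then obtain C where "\<forall>x\<in>f ` {0..T}. norm x \<le> C" unfolding bounded_iff by blast
  thus ?thesis by (intro that[of C]) auto
qed

text \<open>The derivative of \<open>\<Sigma>\<close> is symmetric by construction, so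
  \<open>\<Sigma>\<close> stays symmetric. Therefore \<open>\<Sigma>\<close> solves the linear
  equation \<open>\<Sigma>' = W \<Sigma> + \<Sigma> W\<^sup>T\<close>, where \<open>W\<close> is
  the drift along the given solution, and it is the congruence of the initial value by the flow of
  \<open>W\<close>.\<close>

lemma solution_Sym_plus:
  fixes A Q :: "real^'n^'n"
  assumes A: "A \<in> Sym_plus" and Q: "Q \<in> Sym_plus" and init: "\<Sigma> 0 \<in> Sym_plus"
    and sol: "solves_until A b Q T \<mu> \<Sigma>" and T: "0 \<le> T"
  shows "\<Sigma> T \<in> Sym_plus"
proof -
  note As = Sym_plusD(1)[OF A] and Qs = Sym_plusD(1)[OF Sym_plus_matrix_inv[OF Q]]
  note cont = solves_until_continuous[OF sol]
  define S' where "S' t = 2 *\<^sub>R Sym (\<Sigma> t ** A) - 2 *\<^sub>R Sym (\<Sigma> t ** A ** (\<Sigma> t + outer (\<mu> t) (\<mu> t - b)) ** matrix_inv Q)" for t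
  have S': "(\<Sigma> has_vector_derivative S' t) (at t within {0..T})" if "t \<in> {0..T}" for t
    using sol that by (auto simp: solves_until_def S'_def)
  have S'sym: "transpose (S' t) = S' t" for t
    unfolding S'_def two_Sym by (simp add: linear_add[OF bounded_linear.linear[OF bounded_linear_transpose]]
      linear_diff[OF bounded_linear.linear[OF bounded_linear_transpose]] add.commute)
  have sym: "transpose (\<Sigma> t) = \<Sigma> t" if t: "t \<in> {0..T}" for t
  proof (rule ode_unique[of t _ _ "S'" S' 0])
    have ct: "continuous_on {0..T} (\<lambda>t. transpose (\<Sigma> t))"
      by (rule bounded_linear.continuous_on[OF bounded_linear_transpose cont(2)])
    show "continuous_on {0..t} (\<lambda>t. transpose (\<Sigma> t))" "continuous_on {0..t} \<Sigma>"
      using continuous_on_subset[OF ct, of "{0..t}"] continuous_on_subset[OF cont(2), of "{0..t}"] t by auto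
    fix s assume s: "0 < s" "s < t"
    hence s': "s \<in> {0..T}" "s < T" using t by auto
    show "(\<Sigma> has_vector_derivative S' s) (at s)" by (rule has_vector_derivative_within_Icc_0[OF S'[OF s'(1)] s(1) s'(2)])
    from bounded_linear.has_vector_derivative[OF bounded_linear_transpose this]
    show "((\<lambda>t. transpose (\<Sigma> t)) has_vector_derivative S' s) (at s)" by (simp only: S'sym)
  qed (use t Sym_plusD(1)[OF init] in auto)
  \<comment> \<open>The drift is continued constantly beyond \<open>T\<close>, since linear flows are constructed on \<open>[0,\<infinity>)\<close>.\<close>
  define W where "W t = stein_drift A b Q (\<mu> (min t T)) (\<Sigma> (min t T))" for t
  have cW: "continuous_on {0..} W"
  proof -
    have "continuous_on {0..} (\<lambda>t. (\<lambda>s. stein_drift A b Q (\<mu> s) (\<Sigma> s)) (min t T))"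
      by (rule continuous_on_compose2[OF continuous_on_stein_drift[OF cont]]) (auto intro!: continuous_intros simp: T)
    thus ?thesis by (simp add: W_def[abs_def])
  qed
  obtain P p where P: "P 0 = mat 1" "\<And>t. 0 \<le> t \<Longrightarrow> (P has_vector_derivative W t ** P t) (at t within {0..})"
    by (rule affine_flow[OF cW continuous_on_const]) blast
  obtain C where C: "\<And>t. 0 \<le> t \<Longrightarrow> t \<le> T \<Longrightarrow> norm (W t) \<le> C"
    by (rule continuous_bounded_Icc[OF continuous_on_subset[OF cW, of "{0..T}"]]) auto
  note flow = congruence_flow_derivative[OF P(2), where C = "\<Sigma> 0"]
  have "\<Sigma> T = P T ** \<Sigma> 0 ** transpose (P T)"
  proof (rule ode_unique[OF T cont(2)])
    show "continuous_on {0..T} (\<lambda>t. P t ** \<Sigma> 0 ** transpose (P t))"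
      by (rule continuous_on_subset[OF has_vector_derivative_continuous_on[OF flow]]) auto
    show "\<Sigma> 0 = P 0 ** \<Sigma> 0 ** transpose (P 0)" by (simp add: P(1))
    fix t assume t: "0 < t" "t < T"
    hence t': "t \<in> {0..T}" by simp
    show "((\<lambda>t. P t ** \<Sigma> 0 ** transpose (P t)) has_vector_derivative
        W t ** (P t ** \<Sigma> 0 ** transpose (P t)) + (P t ** \<Sigma> 0 ** transpose (P t)) ** transpose (W t)) (at t)"
      using has_vector_derivative_within_atLeast_0[OF flow t(1)] t(1) by simp
    have "S' t = W t ** \<Sigma> t + \<Sigma> t ** transpose (W t)"
      unfolding S'_def stein_cov_rhs[OF As sym[OF t'] Qs] using t by (simp add: W_def)
    thus "(\<Sigma> has_vector_derivative W t ** \<Sigma> t + \<Sigma> t ** transpose (W t)) (at t)"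
      using has_vector_derivative_within_Icc_0[OF S'[OF t'] t] by simp
    let ?D = "\<Sigma> t - P t ** \<Sigma> 0 ** transpose (P t)"
    have "norm (W t ** \<Sigma> t + \<Sigma> t ** transpose (W t) - (W t ** (P t ** \<Sigma> 0 ** transpose (P t)) + P t ** \<Sigma> 0 ** transpose (P t) ** transpose (W t)))
      = norm (W t ** ?D + ?D ** transpose (W t))"
      by (simp add: matrix_algebra algebra_simps)
    also have "\<dots> \<le> norm (W t) * norm ?D + norm ?D * norm (W t)"
      using norm_matrix_mult_le[of "W t" ?D] norm_matrix_mult_le[of ?D "transpose (W t)"]
      by (intro order_trans[OF norm_triangle_ineq] add_mono) (simp_all add: norm_transpose)
    also have "\<dots> \<le> 2 * C * norm ?D" using mult_right_mono[OF C[of t], of "norm ?D"] t by (simp add: algebra_simps)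
    finally show "norm (W t ** \<Sigma> t + \<Sigma> t ** transpose (W t) - (W t ** (P t ** \<Sigma> 0 ** transpose (P t)) + P t ** \<Sigma> 0 ** transpose (P t) ** transpose (W t)))
      \<le> 2 * C * norm (\<Sigma> t - P t ** \<Sigma> 0 ** transpose (P t))" .
  qed
  moreover have "invertible (P T)" using det_flow_pos[OF cW P T] by (simp add: invertible_det_nz)
  ultimately show ?thesis using Sym_plus_congruence[OF init] by simp
qed

section \<open>Entropy of the Gaussian relative to the target\<close>

text \<open>The Kullback-Leibler divergence of the Gaussian with mean \<open>m\<close> and
  covariance \<open>S\<close> from the target.\<close>

definition gaussian_KL :: "real^'n \<Rightarrow> real^'n^'n \<Rightarrow> real^'n \<Rightarrow> real^'n^'n \<Rightarrow> real" where
  "gaussian_KL b Q m S = 1/2 * (trace (matrix_inv Q ** S) - CARD('n) - ln (det S / det Q)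
     + (m - b) \<bullet> (matrix_inv Q *v (m - b)))"

lemma det_Sym_plus_pos: "M \<in> Sym_plus \<Longrightarrow> 0 < det M"
  by (rule Sym_plus_spectral[of M]) (auto simp: det_spectral intro!: prod_pos)

text \<open>The moment system is the gradient flow of the divergence. With \<open>W\<close> the
  drift, the trace and logarithm terms contribute \<open>W \<bullet> Z\<close> and the mean
  contributes \<open>w \<bullet> W \<mu> - \<bar>w\<bar>\<^sup>2\<close>. Since \<open>W = - (Z +
  w \<mu>\<^sup>T) A\<close>, the sum is the negative of a square.\<close>

lemma gaussian_KL_derivative:
  fixes A Q :: "real^'n^'n"
  assumes A: "A \<in> Sym_plus" and Q: "Q \<in> Sym_plus" and S: "\<Sigma> t \<in> Sym_plus"
    and d\<mu>: "(\<mu> has_vector_derivative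
        ((mat 1 - matrix_inv Q ** \<Sigma> t) ** A) *v \<mu> t
          - bilinear_kernel A (\<mu> t) (\<mu> t) *\<^sub>R (matrix_inv Q *v (\<mu> t - b))) (at t within X)"
    and d\<Sigma>: "(\<Sigma> has_vector_derivative
        2 *\<^sub>R Sym (\<Sigma> t ** A) - 2 *\<^sub>R Sym (\<Sigma> t ** A ** (\<Sigma> t + outer (\<mu> t) (\<mu> t - b)) ** matrix_inv Q))
        (at t within X)"
  shows "((\<lambda>t. gaussian_KL b Q (\<mu> t) (\<Sigma> t)) has_real_derivative
    - dissipation A (\<mu> t) (matrix_inv Q ** \<Sigma> t - mat 1) (matrix_inv Q *v (\<mu> t - b))) (at t within X)"
proof -
  note As = Sym_plusD(1)[OF A] and Qs = Sym_plusD(1)[OF Sym_plus_matrix_inv[OF Q]] and Ss = Sym_plusD(1)[OF S]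
  define W where "W = stein_drift A b Q (\<mu> t) (\<Sigma> t)"
  define w where "w = matrix_inv Q *v (\<mu> t - b)"
  define Z where "Z = matrix_inv Q ** \<Sigma> t - mat 1"
  have W: "W = - ((Z + outer w (\<mu> t)) ** A)"
    unfolding W_def stein_drift_def Z_def w_def using outer_matrix_mult[of "matrix_inv Q *v (\<mu> t - b)" "\<mu> t" A]
    by (simp add: matrix_algebra As)
  have d\<mu>': "(\<mu> has_vector_derivative W *v \<mu> t - w) (at t within X)"
    using d\<mu> unfolding stein_mean_rhs W_def w_def .
  have d\<Sigma>': "(\<Sigma> has_vector_derivative W ** \<Sigma> t + \<Sigma> t ** transpose W) (at t within X)"
    using d\<Sigma> unfolding stein_cov_rhs[OF As Ss Qs] W_def .
  have tr: "((\<lambda>t. trace (matrix_inv Q ** \<Sigma> t)) has_real_derivative trace (matrix_inv Q ** (W ** \<Sigma> t + \<Sigma> t ** transpose W))) (at t within X)"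
    unfolding has_real_derivative_iff_has_vector_derivative
    by (intro bounded_linear.has_vector_derivative[OF bounded_linear_trace]
        bounded_linear.has_vector_derivative[OF bounded_bilinear.bounded_linear_right[OF bounded_bilinear_matrix_mult]] d\<Sigma>')
  have "trace (matrix_inv Q ** (\<Sigma> t ** transpose W)) = trace (transpose (matrix_inv Q ** (\<Sigma> t ** transpose W)))"
    by (rule trace_transpose[symmetric])
  also have "\<dots> = trace ((W ** \<Sigma> t) ** matrix_inv Q)" by (simp only: matrix_transpose_mul transpose_transpose Ss Qs)
  finally have tr1: "trace (matrix_inv Q ** (\<Sigma> t ** transpose W)) = trace (W ** \<Sigma> t ** matrix_inv Q)" .
  have tr2: "trace (matrix_inv Q ** (W ** \<Sigma> t)) = trace (W ** \<Sigma> t ** matrix_inv Q)" by (rule trace_mul_sym)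
  have trv: "trace (matrix_inv Q ** (W ** \<Sigma> t + \<Sigma> t ** transpose W)) = 2 * trace (W ** \<Sigma> t ** matrix_inv Q)"
    using tr1 tr2 by (simp add: matrix_algebra)
  note Si = Sym_plus_inv[OF S]
  have "W ** \<Sigma> t + \<Sigma> t ** transpose W = (W + \<Sigma> t ** transpose W ** matrix_inv (\<Sigma> t)) ** \<Sigma> t"
    using Si(2) by (simp add: matrix_algebra matrix_mul_assoc[symmetric, of _ "matrix_inv (\<Sigma> t)"])
  with d\<Sigma>' have "(\<Sigma> has_vector_derivative (W + \<Sigma> t ** transpose W ** matrix_inv (\<Sigma> t)) ** \<Sigma> t) (at t within X)" by simp
  from det_has_derivative[OF this]
  have "((\<lambda>t. det (\<Sigma> t)) has_real_derivative trace (W + \<Sigma> t ** transpose W ** matrix_inv (\<Sigma> t)) * det (\<Sigma> t)) (at t within X)" .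
  moreover have "trace (\<Sigma> t ** transpose W ** matrix_inv (\<Sigma> t)) = trace W"
    using trace_mul_sym[of "\<Sigma> t ** transpose W" "matrix_inv (\<Sigma> t)"] Si(2) by (simp add: matrix_mul_assoc trace_transpose)
  ultimately have det: "((\<lambda>t. det (\<Sigma> t)) has_real_derivative 2 * trace W * det (\<Sigma> t)) (at t within X)"
    by (simp add: linear_add[OF bounded_linear.linear[OF bounded_linear_trace]])
  have dS: "0 < det (\<Sigma> t)" and dQ: "0 < det Q" by (rule det_Sym_plus_pos[OF S], rule det_Sym_plus_pos[OF Q])
  have ln: "((\<lambda>t. ln (det (\<Sigma> t) / det Q)) has_real_derivative 2 * trace W) (at t within X)"
    by (rule derivative_eq_intros det refl | use dS dQ in simp)+
  have "((\<lambda>t. (\<mu> t - b) \<bullet> (matrix_inv Q *v (\<mu> t - b))) has_derivative (\<lambda>h. (2 *\<^sub>R w) \<bullet> (h *\<^sub>R (W *v \<mu> t - w)))) (at t within X)"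
    unfolding w_def
    by (rule has_derivative_compose[OF d\<mu>'[unfolded has_vector_derivative_def w_def] quadratic_has_derivative[OF Qs, of b]])
  moreover have "(\<lambda>h. (2 *\<^sub>R w) \<bullet> (h *\<^sub>R (W *v \<mu> t - w))) = (*) ((2 *\<^sub>R w) \<bullet> (W *v \<mu> t - w))"
    by (simp add: fun_eq_iff)
  ultimately have quad: "((\<lambda>t. (\<mu> t - b) \<bullet> (matrix_inv Q *v (\<mu> t - b))) has_real_derivative (2 *\<^sub>R w) \<bullet> (W *v \<mu> t - w)) (at t within X)"
    unfolding has_field_derivative_def by simp
  have "((\<lambda>t. gaussian_KL b Q (\<mu> t) (\<Sigma> t)) has_real_derivative
    1/2 * (2 * trace (W ** \<Sigma> t ** matrix_inv Q) - 0 - 2 * trace W + (2 *\<^sub>R w) \<bullet> (W *v \<mu> t - w))) (at t within X)"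
    unfolding gaussian_KL_def
    by (intro DERIV_cmult DERIV_add DERIV_diff DERIV_const tr[unfolded trv] ln quad)
  moreover have "1/2 * (2 * trace (W ** \<Sigma> t ** matrix_inv Q) - 0 - 2 * trace W + (2 *\<^sub>R w) \<bullet> (W *v \<mu> t - w))
    = - dissipation A (\<mu> t) Z w"
  proof -
    have "Z \<bullet> W = trace (transpose Z ** W)" by (rule inner_matrix_eq_trace)
    also have "\<dots> = trace (W ** transpose Z)" by (rule trace_mul_sym)
    also have "\<dots> = trace (W ** \<Sigma> t ** matrix_inv Q) - trace W"
      unfolding Z_def by (simp add: matrix_algebra Ss Qs)
    finally have ZW: "trace (W ** \<Sigma> t ** matrix_inv Q) - trace W = W \<bullet> Z" by (simp add: inner_commute)
    have wW: "w \<bullet> (W *v \<mu> t) = W \<bullet> outer w (\<mu> t)" by (simp add: inner_outer)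
    have "1/2 * (2 * trace (W ** \<Sigma> t ** matrix_inv Q) - 0 - 2 * trace W + (2 *\<^sub>R w) \<bullet> (W *v \<mu> t - w))
      = (trace (W ** \<Sigma> t ** matrix_inv Q) - trace W) + w \<bullet> (W *v \<mu> t) - w \<bullet> w"
      by (simp add: inner_diff_right)
    also have "\<dots> = W \<bullet> (Z + outer w (\<mu> t)) - w \<bullet> w" unfolding ZW wW by (simp add: inner_add_right)
    also have "\<dots> = - dissipation A (\<mu> t) Z w" by (simp add: W dissipation_def)
    finally show ?thesis .
  qed
  ultimately show ?thesis unfolding Z_def w_def by simp
qed

section \<open>The Kullback-Leibler divergence by eigenvalues\<close>

text \<open>An eigenvalue \<open>x\<close> of \<open>Q\<^sup>-\<^sup>1 S\<close> contributes
  \<open>x - 1 - ln x\<close> to twice the divergence. The factor \<open>1/2\<close> at \<open>x =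
  1\<close> is what makes the sharp rate of convergence come out.\<close>

lemma log_gap_bounds:
  fixes x :: real
  assumes "0 < x"
  shows "1 \<le> x \<Longrightarrow> x - 1 - ln x \<le> (x - 1)\<^sup>2 / 2" "x \<le> 1 \<Longrightarrow> (x - 1)\<^sup>2 / 2 \<le> x - 1 - ln x"
    "1 \<le> x \<Longrightarrow> (x - 1)\<^sup>2 / (2 * x) \<le> x - 1 - ln x" "x \<le> 1 \<Longrightarrow> x - 1 - ln x \<le> (x - 1)\<^sup>2 / (2 * x)"
proof -
  have 1: "(y - 1)\<^sup>2 / 2 - (y - 1 - ln y) \<le> (z - 1)\<^sup>2 / 2 - (z - 1 - ln z)" if "0 < y" "y \<le> z" for y z :: real
  proof (rule DERIV_nonneg_imp_nondecreasing[OF that(2)])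
    fix s assume s: "y \<le> s" "s \<le> z"
    have "((\<lambda>s. (s - 1)\<^sup>2 / 2 - (s - 1 - ln s)) has_real_derivative (s - 1) - (1 - 1 / s)) (at s)"
      using s that by (auto intro!: derivative_eq_intros simp: field_simps)
    moreover have "(s - 1) - (1 - 1 / s) = (s - 1)\<^sup>2 / s" using s that by (simp add: power2_eq_square field_simps)
    ultimately show "\<exists>y. ((\<lambda>s. (s - 1)\<^sup>2 / 2 - (s - 1 - ln s)) has_real_derivative y) (at s) \<and> 0 \<le> y"
      using s that by (intro exI[of _ "(s - 1)\<^sup>2 / s"]) simp
  qed
  have 2: "(y - 1 - ln y) - (y - 1)\<^sup>2 / (2 * y) \<le> (z - 1 - ln z) - (z - 1)\<^sup>2 / (2 * z)" if "0 < y" "y \<le> z" for y z :: real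
  proof (rule DERIV_nonneg_imp_nondecreasing[OF that(2)])
    fix s assume s: "y \<le> s" "s \<le> z"
    hence s0: "s > 0" using that by simp
    have "((\<lambda>s. (s - 1 - ln s) - (s - 1)\<^sup>2 / (2 * s)) has_real_derivative
       (1 - 1 / s) - (2 * (s - 1) * (2 * s) - (s - 1)\<^sup>2 * 2) / ((2 * s) * (2 * s))) (at s)"
      using s0 by (auto intro!: derivative_eq_intros simp: field_simps)
    moreover have "(1 - 1 / s) - (2 * (s - 1) * (2 * s) - (s - 1)\<^sup>2 * 2) / ((2 * s) * (2 * s)) = (s - 1)\<^sup>2 / (2 * s\<^sup>2)"
      using s0 by (simp add: power2_eq_square divide_simps)
    ultimately show "\<exists>y. ((\<lambda>s. (s - 1 - ln s) - (s - 1)\<^sup>2 / (2 * s)) has_real_derivative y) (at s) \<and> 0 \<le> y"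
      by (intro exI[of _ "(s - 1)\<^sup>2 / (2 * s\<^sup>2)"]) simp
  qed
  show "1 \<le> x \<Longrightarrow> x - 1 - ln x \<le> (x - 1)\<^sup>2 / 2" using 1[of 1 x] by simp
  show "x \<le> 1 \<Longrightarrow> (x - 1)\<^sup>2 / 2 \<le> x - 1 - ln x" using 1[of x 1] assms by simp
  show "1 \<le> x \<Longrightarrow> (x - 1)\<^sup>2 / (2 * x) \<le> x - 1 - ln x" using 2[of 1 x] by simp
  show "x \<le> 1 \<Longrightarrow> x - 1 - ln x \<le> (x - 1)\<^sup>2 / (2 * x)" using 2[of x 1] assms by simp
qed

lemma log_gap_upper:
  fixes x :: real
  assumes "0 < \<delta>" "\<delta> \<le> 1" "\<delta> \<le> x"
  shows "x - 1 - ln x \<le> (x - 1)\<^sup>2 / (2 * \<delta>)"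
proof (cases "1 \<le> x")
  case True
  hence "x - 1 - ln x \<le> (x - 1)\<^sup>2 / 2" using log_gap_bounds(1)[of x] by simp
  also have "\<dots> \<le> (x - 1)\<^sup>2 / (2 * \<delta>)" using assms by (intro divide_left_mono) auto
  finally show ?thesis .
next
  case False
  hence "x - 1 - ln x \<le> (x - 1)\<^sup>2 / (2 * x)" using log_gap_bounds(4)[of x] assms by simp
  also have "\<dots> \<le> (x - 1)\<^sup>2 / (2 * \<delta>)" using assms by (intro divide_left_mono) auto
  finally show ?thesis .
qed

lemma log_gap_lower:
  fixes x :: real
  assumes "0 < x" "x \<le> D" "1 \<le> D"
  shows "(x - 1)\<^sup>2 / (2 * D) \<le> x - 1 - ln x"
proof (cases "1 \<le> x")
  case True
  have "(x - 1)\<^sup>2 / (2 * D) \<le> (x - 1)\<^sup>2 / (2 * x)" using assms by (intro divide_left_mono) auto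
  also have "\<dots> \<le> x - 1 - ln x" using log_gap_bounds(3)[of x] assms True by simp
  finally show ?thesis .
next
  case False
  have "(x - 1)\<^sup>2 / (2 * D) \<le> (x - 1)\<^sup>2 / 2" using assms by (intro divide_left_mono) auto
  also have "\<dots> \<le> x - 1 - ln x" using log_gap_bounds(2)[of x] assms False by simp
  finally show ?thesis .
qed

text \<open>The whitened covariance \<open>Q\<^sup>-\<^sup>1\<^sup>/\<^sup>2 S
  Q\<^sup>-\<^sup>1\<^sup>/\<^sup>2\<close> is similar to \<open>Q\<^sup>-\<^sup>1 S\<close>, and
  symmetric if \<open>S\<close> is.\<close>

definition cov_gap :: "real^'n^'n \<Rightarrow> real^'n^'n \<Rightarrow> real" where
  "cov_gap Q S = (norm (matrix_inv (mat_sqrt Q) ** S ** matrix_inv (mat_sqrt Q) - mat 1))\<^sup>2"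

definition mean_gap :: "real^'n^'n \<Rightarrow> real^'n \<Rightarrow> real" where
  "mean_gap Q v = v \<bullet> (matrix_inv Q *v v)"

lemma mean_gap_norm:
  fixes Q :: "real^'n^'n"
  assumes Q: "Q \<in> Sym_plus"
  shows "mean_gap Q v = (norm (matrix_inv (mat_sqrt Q) *v v))\<^sup>2"
proof -
  note H = inverse_sqrt[OF Q]
  have "matrix_inv Q *v v = matrix_inv (mat_sqrt Q) *v (matrix_inv (mat_sqrt Q) *v v)"
    using H(2) by (simp add: matrix_vector_mul_assoc)
  thus ?thesis
    using inner_matrix_vector[of v "matrix_inv (mat_sqrt Q)" "matrix_inv (mat_sqrt Q) *v v"] Sym_plusD(1)[OF H(1)]
    by (simp add: mean_gap_def power2_norm_eq_inner)
qed

lemma gaps_nonneg: "0 \<le> cov_gap Q S" "Q \<in> Sym_plus \<Longrightarrow> 0 \<le> mean_gap Q v"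
  by (simp_all add: cov_gap_def mean_gap_norm)

lemma norm_le_mean_gap:
  fixes Q :: "real^'n^'n"
  assumes Q: "Q \<in> Sym_plus"
  shows "norm v \<le> norm (mat_sqrt Q) * sqrt (mean_gap Q v)"
proof -
  have "v = mat_sqrt Q *v (matrix_inv (mat_sqrt Q) *v v)"
    using inverse_sqrt(3)[OF Q] by (simp add: matrix_vector_mul_assoc)
  thus ?thesis unfolding mean_gap_norm[OF Q] using norm_matrix_vector_le[of "mat_sqrt Q" "matrix_inv (mat_sqrt Q) *v v"] by simp
qed

lemma norm_le_cov_gap:
  fixes Q :: "real^'n^'n"
  assumes Q: "Q \<in> Sym_plus"
  shows "norm (S - Q) \<le> (norm (mat_sqrt Q))\<^sup>2 * sqrt (cov_gap Q S)"
proof -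
  define G where "G = mat_sqrt Q"
  define H where "H = matrix_inv G"
  note H = inverse_sqrt[OF Q, folded G_def, folded H_def]
  have c: "G ** (H ** X) = X" "X ** H ** G = X" for X :: "real^'n^'n"
    using H(3) H(4) by (simp_all add: matrix_mul_assoc[symmetric]) (simp add: matrix_mul_assoc)
  have "G ** (H ** S ** H - mat 1) ** G = S - Q"
    using mat_sqrt_square(2)[OF Q] c(1)[of "S ** H"] c(2)[of S] by (simp add: matrix_algebra G_def)
  hence "norm (S - Q) \<le> norm (G ** (H ** S ** H - mat 1)) * norm G"
    using norm_matrix_mult_le[of "G ** (H ** S ** H - mat 1)" G] by simp
  also have "\<dots> \<le> (norm G * norm (H ** S ** H - mat 1)) * norm G"
    by (intro mult_right_mono norm_matrix_mult_le) simp
  finally show ?thesis by (simp add: cov_gap_def G_def[symmetric] H_def[symmetric] power2_eq_square ac_simps)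
qed

text \<open>The matrix \<open>Z = Q\<^sup>-\<^sup>1 S - id\<close> is similar to the symmetric
  matrix \<open>X\<close> whose squared norm is the gap. Hence \<open>\<bar>X\<bar>\<^sup>2 = tr
  X\<^sup>2 = tr Z\<^sup>2 \<le> \<bar>Z\<bar>\<^sup>2\<close>, the last step being the
  Cauchy-Schwarz inequality.\<close>

lemma cov_gap_le:
  fixes Q S :: "real^'n^'n"
  assumes Q: "Q \<in> Sym_plus" and S: "transpose S = S"
  shows "cov_gap Q S \<le> (norm (matrix_inv Q ** S - mat 1))\<^sup>2"
proof -
  define G where "G = mat_sqrt Q"
  define H where "H = matrix_inv G"
  note H = inverse_sqrt[OF Q, folded G_def, folded H_def]
  define X where "X = H ** S ** H - mat 1"
  define Z where "Z = matrix_inv Q ** S - mat 1"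
  have Xs: "transpose X = X"
    using Sym_plusD(1)[OF H(1)] S by (simp add: X_def matrix_algebra)
  have HG: "Y ** H ** G = Y" "Y ** G ** H = Y" for Y :: "real^'n^'n" using H(3,4) by (simp_all add: matrix_mul_assoc[symmetric])
  have Z: "Z = H ** X ** G"
    unfolding Z_def X_def by (simp add: matrix_algebra HG H(2)[symmetric] H(4))
  have "cov_gap Q S = trace (X ** X)"
    by (simp add: cov_gap_def X_def[symmetric] G_def[symmetric] H_def[symmetric] power2_norm_eq_inner inner_matrix_eq_trace Xs)
  also have "\<dots> = trace (H ** (X ** X ** G))"
    using trace_mul_sym[of H "X ** X ** G"] HG(2)[of "X ** X"] by simp
  also have "H ** (X ** X ** G) = Z ** Z" unfolding Z by (simp add: matrix_mul_assoc HG(2))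
  also have "trace (Z ** Z) = transpose Z \<bullet> Z" by (simp add: inner_matrix_eq_trace)
  also have "\<dots> \<le> norm (transpose Z) * norm Z" by (rule norm_cauchy_schwarz)
  finally show ?thesis by (simp add: Z_def norm_transpose power2_eq_square)
qed

lemma gaussian_KL_spectral:
  fixes Q S :: "real^'n^'n"
  assumes Q: "Q \<in> Sym_plus" and S: "S \<in> Sym_plus"
  obtains d :: "'n \<Rightarrow> real" where "\<And>i. 0 < d i" "cov_gap Q S = (\<Sum>i\<in>UNIV. (d i - 1)\<^sup>2)"
    "\<And>b m. 2 * gaussian_KL b Q m S = (\<Sum>i\<in>UNIV. d i - 1 - ln (d i)) + mean_gap Q (m - b)"
proof -
  define G where "G = mat_sqrt Q"
  define H where "H = matrix_inv G"
  note H = inverse_sqrt[OF Q, folded G_def, folded H_def]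
  have Ht: "transpose H = H" by (rule Sym_plusD(1)[OF H(1)])
  have R: "H ** S ** H \<in> Sym_plus"
    using Sym_plus_congruence[OF S Sym_plus_invertible[OF H(1)]] by (simp add: Ht)
  obtain U d where U: "orthogonal_matrix U" "H ** S ** H = U ** diag d ** transpose U" and d: "\<And>i. 0 < d i"
    using Sym_plus_spectral[OF R] by blast
  have tr: "trace (U ** diag e ** transpose U) = sum e UNIV" for e
    using trace_mul_sym[of "U ** diag e" "transpose U"] by (simp add: matrix_mul_assoc orthogonal_matrixD[OF U(1)] trace_diag)
  have "trace (matrix_inv Q ** S) = trace (H ** (H ** S))" using H(2) by (simp add: matrix_mul_assoc)
  also have "\<dots> = trace (H ** S ** H)" by (rule trace_mul_sym)
  finally have 1: "trace (matrix_inv Q ** S) = sum d UNIV" by (simp add: U(2) tr)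
  have dH: "det H * det H = 1 / det Q"
  proof -
    have "det Q * (det H * det H) = det (Q ** matrix_inv Q)" by (simp add: H(2)[symmetric] det_mul)
    thus ?thesis using Sym_plus_inv(1)[OF Q] det_Sym_plus_pos[OF Q] by (simp add: field_simps)
  qed
  have "det (H ** S ** H) = det S * (det H * det H)" by (simp add: det_mul)
  hence "det S / det Q = det (H ** S ** H)" unfolding dH by simp
  hence 2: "ln (det S / det Q) = (\<Sum>i\<in>UNIV. ln (d i))"
    using ln_prod[of UNIV d] d by (simp add: U(2) det_spectral[OF U(1)] less_imp_neq[symmetric])
  have "H ** S ** H - mat 1 = U ** diag (\<lambda>i. d i - 1) ** transpose U"
  proof -
    have "diag (\<lambda>i. d i - 1) = diag d - mat 1" by (simp add: diag_def mat_def vec_eq_iff)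
    thus ?thesis by (simp add: U(2) matrix_algebra orthogonal_matrixD[OF U(1)])
  qed
  hence "cov_gap Q S = trace (transpose (U ** diag (\<lambda>i. d i - 1) ** transpose U) ** (U ** diag (\<lambda>i. d i - 1) ** transpose U))"
    by (simp add: cov_gap_def G_def[symmetric] H_def[symmetric] power2_norm_eq_inner inner_matrix_eq_trace)
  also have "transpose (U ** diag (\<lambda>i. d i - 1) ** transpose U) ** (U ** diag (\<lambda>i. d i - 1) ** transpose U)
    = U ** (diag (\<lambda>i. d i - 1) ** (transpose U ** (U ** (diag (\<lambda>i. d i - 1) ** transpose U))))"
    by (simp only: matrix_transpose_mul transpose_transpose transpose_diag matrix_mul_assoc)
  also have "\<dots> = U ** diag (\<lambda>i. (d i - 1) * (d i - 1)) ** transpose U"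
    unfolding cancel_orthogonal[OF U(1)] by (simp only: matrix_mul_assoc[of _ _ "transpose U", symmetric] matrix_mul_assoc[of "diag _"] diag_mult_diag)
  finally have 3: "cov_gap Q S = (\<Sum>i\<in>UNIV. (d i - 1)\<^sup>2)" by (simp add: tr power2_eq_square)
  have 4: "2 * gaussian_KL b Q m S = (\<Sum>i\<in>UNIV. d i - 1 - ln (d i)) + mean_gap Q (m - b)" for b m
    by (simp add: gaussian_KL_def 1 2 mean_gap_def sum_subtractf)
  show ?thesis using that d 3 4 by blast
qed

text \<open>The divergence and the gaps control each other. A bound on the divergence confines
  every eigenvalue \<open>d\<close> of \<open>Q\<^sup>-\<^sup>1 S\<close>, by \<open>d \<le> 4 e +
  2\<close> and \<open>d \<ge> exp (- 2 e - 1)\<close>, and on such a range \<open>d - 1 - ln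
  d\<close> is comparable to \<open>(d - 1)\<^sup>2\<close>. The last inequality becomes sharp as
  the covariance gap tends to 0.\<close>

lemma gaussian_KL_bounds:
  fixes Q S :: "real^'n^'n" and b m :: "real^'n"
  assumes Q: "Q \<in> Sym_plus" and S: "S \<in> Sym_plus"
  defines "e \<equiv> gaussian_KL b Q m S" and "r \<equiv> cov_gap Q S" and "u \<equiv> mean_gap Q (m - b)"
  shows "0 \<le> e" "u \<le> 2 * e" "r \<le> 4 * (4 * e + 2) * e" "4 * e \<le> r / exp (- 2 * e - 1) + 2 * u"
    "r < 1 \<Longrightarrow> 4 * e \<le> r / (1 - sqrt r) + 2 * u"
proof -
  obtain d :: "'n \<Rightarrow> real" where d: "\<And>i. 0 < d i" and r': "cov_gap Q S = (\<Sum>i\<in>UNIV. (d i - 1)\<^sup>2)"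
    and e': "\<And>b m. 2 * gaussian_KL b Q m S = (\<Sum>i\<in>UNIV. d i - 1 - ln (d i)) + mean_gap Q (m - b)"
    by (rule gaussian_KL_spectral[OF Q S]) (rule that, blast+)
  have r: "r = (\<Sum>i\<in>UNIV. (d i - 1)\<^sup>2)" unfolding r_def by (rule r')
  have e: "2 * e = (\<Sum>i\<in>UNIV. d i - 1 - ln (d i)) + u" unfolding e_def u_def by (rule e')
  have g0: "0 \<le> d i - 1 - ln (d i)" for i using ln_le_minus_one[OF d[of i]] by simp
  have u0: "0 \<le> u" unfolding u_def by (rule gaps_nonneg(2)[OF Q])
  have s0: "0 \<le> (\<Sum>i\<in>UNIV. d i - 1 - ln (d i))" by (intro sum_nonneg g0)
  show e0: "0 \<le> e" and "u \<le> 2 * e" using e s0 u0 by auto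
  have gi: "d i - 1 - ln (d i) \<le> 2 * e" for i
    using member_le_sum[of i UNIV "\<lambda>i. d i - 1 - ln (d i)"] g0 e u0 by simp
  have upper: "d i \<le> 4 * e + 2" for i
  proof -
    have "ln (d i / 2) \<le> d i / 2 - 1" using d[of i] by (intro ln_le_minus_one) simp
    hence "ln (d i) \<le> d i / 2 - 1 + ln 2" using d[of i] by (simp add: ln_div)
    moreover have "ln 2 \<le> (1::real)" using ln_le_minus_one[of 2] by simp
    ultimately show ?thesis using gi[of i] by simp
  qed
  let ?D = "4 * e + 2"
  have "r \<le> (\<Sum>i\<in>UNIV. 2 * ?D * (d i - 1 - ln (d i)))" unfolding r
  proof (rule sum_mono)
    fix i
    show "(d i - 1)\<^sup>2 \<le> 2 * ?D * (d i - 1 - ln (d i))"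
      using log_gap_lower[OF d[of i] upper[of i]] e0 by (simp add: field_simps)
  qed
  also have "\<dots> = 2 * ?D * (\<Sum>i\<in>UNIV. d i - 1 - ln (d i))" by (simp add: sum_distrib_left)
  also have "\<dots> \<le> 2 * ?D * (2 * e)" using e u0 e0 by (intro mult_left_mono) auto
  finally show "r \<le> 4 * (4 * e + 2) * e" by (simp add: algebra_simps)
  have key: "4 * e \<le> r / \<delta> + 2 * u" if "0 < \<delta>" "\<delta> \<le> 1" "\<And>i. \<delta> \<le> d i" for \<delta>
  proof -
    have "(\<Sum>i\<in>UNIV. d i - 1 - ln (d i)) \<le> (\<Sum>i\<in>UNIV. (d i - 1)\<^sup>2 / (2 * \<delta>))"
      by (intro sum_mono log_gap_upper that)
    also have "\<dots> = (r / \<delta>) / 2" unfolding r by (simp add: sum_divide_distrib mult.commute)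
    finally show ?thesis using e by simp
  qed
  show "4 * e \<le> r / exp (- 2 * e - 1) + 2 * u"
  proof (rule key)
    fix i
    have "ln (d i) \<ge> - 2 * e - 1" using gi[of i] d[of i] by simp
    thus "exp (- 2 * e - 1) \<le> d i" using d[of i] by (simp add: ln_ge_iff)
  qed (use e0 in auto)
  show "4 * e \<le> r / (1 - sqrt r) + 2 * u" if "r < 1"
  proof (rule key)
    have r0: "0 \<le> r" unfolding r by (intro sum_nonneg) simp
    show "0 < 1 - sqrt r" "1 - sqrt r \<le> 1" using that r0 by auto
    fix i
    have "(d i - 1)\<^sup>2 \<le> r" unfolding r by (rule member_le_sum) auto
    hence "\<bar>d i - 1\<bar> \<le> sqrt r" by (metis real_sqrt_abs real_sqrt_le_mono)
    thus "1 - sqrt r \<le> d i" by linarith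
  qed
qed

section \<open>Dissipation of entropy\<close>

text \<open>A Polyak-Lojasiewicz inequality: the dissipation dominates the gaps, and these
  dominate the divergence.\<close>

lemma dissipation_gaps:
  fixes A Q S :: "real^'n^'n"
  assumes A: "A \<in> Sym_plus" and Q: "Q \<in> Sym_plus" and S: "transpose S = S"
    and g: "0 \<le> g" "g \<le> lambda_min (stein_rate_matrix A x Q)"
  shows "g * (cov_gap Q S + 2 * mean_gap Q (m - b)) \<le> dissipation A x (matrix_inv Q ** S - mat 1) (matrix_inv Q *v (m - b))"
proof -
  define w where "w = matrix_inv Q *v (m - b)"
  have "Q *v w = m - b" using Sym_plus_inv(1)[OF Q] by (simp add: w_def matrix_vector_mul_assoc)
  hence u: "w \<bullet> (Q *v w) = mean_gap Q (m - b)" by (simp add: mean_gap_def w_def inner_commute)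
  have u0: "0 \<le> mean_gap Q (m - b)" by (rule gaps_nonneg(2)[OF Q])
  have "g * (cov_gap Q S + 2 * mean_gap Q (m - b)) \<le> g * ((norm (matrix_inv Q ** S - mat 1))\<^sup>2 + 2 * mean_gap Q (m - b))"
    using cov_gap_le[OF Q S] g(1) by (intro mult_left_mono) auto
  also have "\<dots> \<le> lambda_min (stein_rate_matrix A x Q) * ((norm (matrix_inv Q ** S - mat 1))\<^sup>2 + 2 * mean_gap Q (m - b))"
    using g(2) u0 by (intro mult_right_mono) auto
  also have "\<dots> \<le> dissipation A x (matrix_inv Q ** S - mat 1) w"
    using dissipation_lower_bound[OF A Q, of x "matrix_inv Q ** S - mat 1" w] by (simp add: u)
  finally show ?thesis by (simp add: w_def)
qed

text \<open>The square root of the dissipation is the norm of the pair \<open>((Z + w m\<^sup>T)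
  A\<^sup>1\<^sup>/\<^sup>2, w)\<close>. Replacing \<open>m\<close> by \<open>b\<close> changes
  this pair by at most \<open>\<bar>A\<^sup>1\<^sup>/\<^sup>2\<bar> \<bar>m - b\<bar>
  \<bar>w\<bar>\<close>, a small multiple of the norm itself.\<close>

lemma dissipation_change_base:
  fixes A Z :: "real^'n^'n"
  assumes A: "A \<in> Sym_plus" and s: "norm (mat_sqrt A) * norm (m - b) \<le> 1"
  shows "(1 - norm (mat_sqrt A) * norm (m - b))\<^sup>2 * dissipation A b Z w \<le> dissipation A m Z w"
proof -
  define B where "B = mat_sqrt A"
  define s where "s = norm B * norm (m - b)"
  define X where "X = (Z + outer w b) ** B"
  define V where "V = outer w (m - b) ** B"
  have eq: "dissipation A x Z w = (norm ((Z + outer w x) ** B, w))\<^sup>2" for x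
    by (simp add: dissipation_def norm_mult_sqrt[OF A] norm_Pair B_def power2_norm_eq_inner[of w])
  have XV: "(Z + outer w m) ** B = X + V"
    unfolding X_def V_def by (simp add: matrix_algebra)
  have "norm V \<le> norm (outer w (m - b)) * norm B" unfolding V_def by (rule norm_matrix_mult_le)
  hence V: "norm V \<le> s * norm w" by (simp add: norm_outer s_def ac_simps)
  have s0: "0 \<le> s" by (simp add: s_def)
  have wn: "norm w \<le> norm (X, w)" using norm_snd_le[of w X] by simp
  have "norm (X, w) \<le> norm (X + V, w) + norm V"
    using norm_triangle_ineq4[of "(X + V, w)" "(V, 0)"] by (simp add: norm_Pair)
  also have "norm V \<le> s * norm (X, w)" using V mult_left_mono[OF wn s0] by simp
  finally have "(1 - s) * norm (X, w) \<le> norm (X + V, w)" by (simp add: algebra_simps)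
  moreover have "0 \<le> (1 - s) * norm (X, w)" using s by (simp add: s_def B_def)
  ultimately have "((1 - s) * norm (X, w))\<^sup>2 \<le> (norm (X + V, w))\<^sup>2" by (rule power_mono)
  thus ?thesis unfolding eq XV by (simp add: power_mult_distrib X_def s_def B_def)
qed

lemma dissipation_nonneg: "A \<in> Sym_plus \<Longrightarrow> 0 \<le> dissipation A m Z w"
  by (simp add: dissipation_def Sym_plus_form_nonneg)

lemma gaussian_KL_along_solution:
  fixes A Q :: "real^'n^'n"
  assumes A: "A \<in> Sym_plus" and Q: "Q \<in> Sym_plus" and init: "\<Sigma> 0 \<in> Sym_plus"
    and sol: "solves_until A b Q T \<mu> \<Sigma>"
  defines "e \<equiv> \<lambda>t. gaussian_KL b Q (\<mu> t) (\<Sigma> t)"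
  shows "continuous_on {0..T} e"
    "\<And>t. 0 < t \<Longrightarrow> t < T \<Longrightarrow> (e has_real_derivative
       - dissipation A (\<mu> t) (matrix_inv Q ** \<Sigma> t - mat 1) (matrix_inv Q *v (\<mu> t - b))) (at t)"
    "\<And>t. 0 \<le> t \<Longrightarrow> t \<le> T \<Longrightarrow> e t \<le> e 0"
proof -
  have S: "\<Sigma> t \<in> Sym_plus" if "t \<in> {0..T}" for t
  proof (rule solution_Sym_plus[OF A Q])
    show "solves_until A b Q t \<mu> \<Sigma>" using sol that unfolding solves_until_def
      by (auto intro!: has_vector_derivative_within_subset[of _ _ _ "{0..T}" "{0..t}"])
  qed (use that init in auto)
  have der: "(e has_real_derivative
       - dissipation A (\<mu> t) (matrix_inv Q ** \<Sigma> t - mat 1) (matrix_inv Q *v (\<mu> t - b))) (at t within {0..T})" if "t \<in> {0..T}" for t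
    unfolding e_def using sol that by (intro gaussian_KL_derivative A Q S) (auto simp: solves_until_def)
  show cont: "continuous_on {0..T} e"
    by (rule has_vector_derivative_continuous_on[OF der[unfolded has_real_derivative_iff_has_vector_derivative]])
  show der': "(e has_real_derivative
       - dissipation A (\<mu> t) (matrix_inv Q ** \<Sigma> t - mat 1) (matrix_inv Q *v (\<mu> t - b))) (at t)" if "0 < t" "t < T" for t
    using der[of t] that by (simp add: at_within_Icc_at)
  show "e t \<le> e 0" if t: "0 \<le> t" "t \<le> T" for t
  proof -
    have "e t \<le> e 0 * exp (0 * (t - 0))"
    proof (rule gronwall[OF t(1)])
      show "continuous_on {0..t} e" using t by (intro continuous_on_subset[OF cont]) auto
      fix s assume "0 < s" "s < t"
      thus "(e has_real_derivative - dissipation A (\<mu> s) (matrix_inv Q ** \<Sigma> s - mat 1) (matrix_inv Q *v (\<mu> s - b))) (at s)"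
        using t by (intro der') auto
      show "- dissipation A (\<mu> s) (matrix_inv Q ** \<Sigma> s - mat 1) (matrix_inv Q *v (\<mu> s - b)) \<le> 0 * e s"
        using dissipation_nonneg[OF A] by simp
    qed
    thus ?thesis by simp
  qed
qed

section \<open>Well-posedness of the moment system\<close>

definition stein_field :: "real^'n^'n \<Rightarrow> real^'n \<Rightarrow> real^'n^'n \<Rightarrow> (real^'n) \<times> (real^'n^'n) \<Rightarrow> (real^'n) \<times> (real^'n^'n)" where
  "stein_field A b Q x =
     (((mat 1 - matrix_inv Q ** snd x) ** A) *v fst x
        - bilinear_kernel A (fst x) (fst x) *\<^sub>R (matrix_inv Q *v (fst x - b)),
      2 *\<^sub>R Sym (snd x ** A)
        - 2 *\<^sub>R Sym (snd x ** A ** (snd x + outer (fst x) (fst x - b)) ** matrix_inv Q))"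

lemma lipschitz_on_balls_stein_field:
  fixes A Q :: "real^'n^'n"
  shows "lipschitz_on_balls (stein_field A b Q)"
proof -
  note lin = lipschitz_on_balls_linear
  note mm = lipschitz_on_balls_bilinear[OF bounded_bilinear_matrix_mult]
  note mv = lipschitz_on_balls_bilinear[OF bounded_bilinear_matrix_vector_mult]
  note oo = lipschitz_on_balls_bilinear[OF bounded_bilinear_outer]
  note ii = lipschitz_on_balls_bilinear[OF bounded_bilinear_inner]
  note ss = lipschitz_on_balls_bilinear[OF bounded_bilinear_scaleR]
  note f = lin[OF bounded_linear_fst lipschitz_on_balls_id] and s = lin[OF bounded_linear_snd lipschitz_on_balls_id]
  note t = lin[OF bounded_linear_transpose]
  note c = lipschitz_on_balls_const
  note rules = lipschitz_on_balls_Pair lipschitz_on_balls_add lipschitz_on_balls_diff mm mv oo ii ss t f s c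
  have "lipschitz_on_balls (\<lambda>x :: (real^'n) \<times> (real^'n^'n).
     (((mat 1 - matrix_inv Q ** snd x) ** A) *v fst x
        - (fst x \<bullet> (A *v fst x) + 1) *\<^sub>R (matrix_inv Q *v (fst x - b)),
      (snd x ** A + transpose (snd x ** A))
        - (snd x ** A ** (snd x + outer (fst x) (fst x - b)) ** matrix_inv Q
          + transpose (snd x ** A ** (snd x + outer (fst x) (fst x - b)) ** matrix_inv Q))))"
    by (rule rules)+
  thus ?thesis by (simp only: stein_field_def[abs_def] two_Sym bilinear_kernel_def)
qed

lemma stein_system_norm_bound:
  fixes A Q :: "real^'n^'n"
  assumes Q: "Q \<in> Sym_plus" and S: "S \<in> Sym_plus" and le: "gaussian_KL b Q m S \<le> e"
  shows "norm (m - b) \<le> norm (mat_sqrt Q) * sqrt (2 * e)"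
    "norm (S - Q) \<le> (norm (mat_sqrt Q))\<^sup>2 * sqrt (4 * (4 * e + 2) * e)"
proof -
  note B = gaussian_KL_bounds[OF Q S, where b = b and m = m]
  have "sqrt (mean_gap Q (m - b)) \<le> sqrt (2 * e)" using B(2) le by (intro real_sqrt_le_mono) simp
  thus "norm (m - b) \<le> norm (mat_sqrt Q) * sqrt (2 * e)"
    by (intro order_trans[OF norm_le_mean_gap[OF Q]] mult_left_mono) auto
  have "4 * (4 * gaussian_KL b Q m S + 2) * gaussian_KL b Q m S \<le> 4 * (4 * e + 2) * e"
    using le B(1) by (intro mult_mono) auto
  hence "sqrt (cov_gap Q S) \<le> sqrt (4 * (4 * e + 2) * e)" using B(3) by (intro real_sqrt_le_mono) simp
  thus "norm (S - Q) \<le> (norm (mat_sqrt Q))\<^sup>2 * sqrt (4 * (4 * e + 2) * e)"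
    by (intro order_trans[OF norm_le_cov_gap[OF Q]] mult_left_mono) auto
qed

lemma stein_gaussian_system_iff_field:
  "stein_gaussian_system A b Q \<mu>0 \<Sigma>0 \<mu> \<Sigma> \<longleftrightarrow> \<mu> 0 = \<mu>0 \<and> \<Sigma> 0 = \<Sigma>0 \<and>
    (\<forall>t\<ge>0. ((\<lambda>t. (\<mu> t, \<Sigma> t)) has_vector_derivative stein_field A b Q (\<mu> t, \<Sigma> t)) (at t within {0..}))"
  (is "_ \<longleftrightarrow> _ \<and> _ \<and> (\<forall>t\<ge>0. ?D t)")
proof -
  have "?D t \<longleftrightarrow> (\<mu> has_vector_derivative fst (stein_field A b Q (\<mu> t, \<Sigma> t))) (at t within {0..}) \<and>
      (\<Sigma> has_vector_derivative snd (stein_field A b Q (\<mu> t, \<Sigma> t))) (at t within {0..})" for t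
  proof
    assume "?D t"
    from bounded_linear.has_vector_derivative[OF bounded_linear_fst this] bounded_linear.has_vector_derivative[OF bounded_linear_snd this]
    show "(\<mu> has_vector_derivative fst (stein_field A b Q (\<mu> t, \<Sigma> t))) (at t within {0..}) \<and>
      (\<Sigma> has_vector_derivative snd (stein_field A b Q (\<mu> t, \<Sigma> t))) (at t within {0..})" by simp
  next
    assume "(\<mu> has_vector_derivative fst (stein_field A b Q (\<mu> t, \<Sigma> t))) (at t within {0..}) \<and>
      (\<Sigma> has_vector_derivative snd (stein_field A b Q (\<mu> t, \<Sigma> t))) (at t within {0..})"
    from has_vector_derivative_Pair[OF conjunct1[OF this] conjunct2[OF this]] show "?D t" by simp
  qed
  thus ?thesis unfolding stein_gaussian_system_def by (auto simp: stein_field_def)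
qed

lemma stein_system_unique:
  assumes sol: "stein_gaussian_system A b Q \<mu>0 \<Sigma>0 \<mu> \<Sigma>" "stein_gaussian_system A b Q \<mu>0 \<Sigma>0 \<mu>' \<Sigma>'" and t: "0 \<le> t"
  shows "\<mu>' t = \<mu> t \<and> \<Sigma>' t = \<Sigma> t"
proof -
  define x where "x t = (\<mu> t, \<Sigma> t)" for t
  define y where "y t = (\<mu>' t, \<Sigma>' t)" for t
  have x: "(x has_vector_derivative stein_field A b Q (x s)) (at s within {0..})" if "0 \<le> s" for s
    using sol(1) that unfolding stein_gaussian_system_iff_field x_def[abs_def] by auto
  have y: "(y has_vector_derivative stein_field A b Q (y s)) (at s within {0..})" if "0 \<le> s" for s
    using sol(2) that unfolding stein_gaussian_system_iff_field y_def[abs_def] by auto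
  have cx: "continuous_on {0..t} x" by (rule continuous_on_subset[OF has_vector_derivative_continuous_on[OF x]]) auto
  have cy: "continuous_on {0..t} y" by (rule continuous_on_subset[OF has_vector_derivative_continuous_on[OF y]]) auto
  obtain C D where CD: "\<And>s. 0 \<le> s \<Longrightarrow> s \<le> t \<Longrightarrow> norm (x s) \<le> C" "\<And>s. 0 \<le> s \<Longrightarrow> s \<le> t \<Longrightarrow> norm (y s) \<le> D"
    using continuous_bounded_Icc[OF cx] continuous_bounded_Icc[OF cy] by metis
  obtain L where L: "\<And>x y. norm x \<le> max C D \<Longrightarrow> norm y \<le> max C D \<Longrightarrow> norm (stein_field A b Q x - stein_field A b Q y) \<le> L * norm (x - y)"
    using lipschitz_on_ballsE[OF lipschitz_on_balls_stein_field] by metis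
  have "x t = y t"
  proof (rule ode_unique[OF t cx cy])
    show "x 0 = y 0" using sol by (simp add: x_def y_def stein_gaussian_system_def)
    fix s assume s: "0 < s" "s < t"
    show "(x has_vector_derivative stein_field A b Q (x s)) (at s)" "(y has_vector_derivative stein_field A b Q (y s)) (at s)"
      using has_vector_derivative_within_atLeast_0[OF x s(1)] has_vector_derivative_within_atLeast_0[OF y s(1)] s by auto
    show "norm (stein_field A b Q (x s) - stein_field A b Q (y s)) \<le> L * norm (x s - y s)"
      using CD[of s] s by (intro L) auto
  qed
  thus ?thesis by (simp add: x_def y_def)
qed

text \<open>The field is truncated outside a ball, which makes it globally Lipschitz. As long as a
  solution stays in the ball, it solves the original system, its divergence from the target does
  not increase, and the bounds that follow from the divergence keep it strictly inside the
  ball.\<close>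

lemma stein_system_exists:
  fixes A Q \<Sigma>0 :: "real^'n^'n"
  assumes A: "A \<in> Sym_plus" and \<Sigma>0: "\<Sigma>0 \<in> Sym_plus" and Q: "Q \<in> Sym_plus"
  obtains \<mu> \<Sigma> where "stein_gaussian_system A b Q \<mu>0 \<Sigma>0 \<mu> \<Sigma>"
proof -
  define e0 where "e0 = gaussian_KL b Q \<mu>0 \<Sigma>0"
  define R0 where "R0 = norm b + norm (mat_sqrt Q) * sqrt (2 * e0) + (norm Q + (norm (mat_sqrt Q))\<^sup>2 * sqrt (4 * (4 * e0 + 2) * e0))"
  define R where "R = R0 + 1"
  have bound: "norm (m, S) < R" if S: "S \<in> Sym_plus" and e: "gaussian_KL b Q m S \<le> e0" for m S
  proof -
    note N = stein_system_norm_bound[OF Q S e]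
    have "norm m \<le> norm (m - b) + norm b" by norm
    moreover have "norm S \<le> norm (S - Q) + norm Q" by norm
    ultimately show ?thesis using N norm_Pair_le[of m S] by (simp add: R_def R0_def)
  qed
  have R: "0 \<le> R" using bound[OF \<Sigma>0, of \<mu>0] e0_def norm_ge_zero[of "(\<mu>0, \<Sigma>0)"] by linarith
  let ?pr = "closest_point (cball (0 :: (real^'n) \<times> (real^'n^'n)) R)"
  have pr: "norm (?pr x) \<le> R" for x
    using closest_point_in_set[of "cball (0 :: (real^'n) \<times> (real^'n^'n)) R" x] R by (auto simp: cball_eq_empty)
  have pr_lip: "norm (?pr x - ?pr y) \<le> norm (x - y)" for x y
    using closest_point_lipschitz[of "cball (0 :: (real^'n) \<times> (real^'n^'n)) R" x y] R by (auto simp: dist_norm cball_eq_empty)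
  have pr_id: "?pr x = x" if "norm x \<le> R" for x
    by (rule closest_point_self) (use that in simp)
  define f where "f x = stein_field A b Q (?pr x)" for x
  obtain L where L0: "L \<ge> 0" and L: "\<And>x y. norm x \<le> R \<Longrightarrow> norm y \<le> R \<Longrightarrow> norm (stein_field A b Q x - stein_field A b Q y) \<le> L * norm (x - y)"
    using lipschitz_on_ballsE[OF lipschitz_on_balls_stein_field] by metis
  have lip: "norm (f x - f y) \<le> (L + norm (f 0)) * norm (x - y)" for x y
  proof -
    have "norm (f x - f y) \<le> L * norm (?pr x - ?pr y)" unfolding f_def by (intro L pr)
    also have "\<dots> \<le> L * norm (x - y)" by (intro mult_left_mono pr_lip L0)
    finally show ?thesis by (simp add: algebra_simps add_increasing2)
  qed
  have cf: "continuous_on UNIV f"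
  proof (rule lipschitz_on_continuous_on[OF lipschitz_onI])
    show "dist (f x) (f y) \<le> (L + norm (f 0)) * dist x y" for x y using lip by (simp add: dist_norm)
  qed (use L0 in simp)
  have cf2: "continuous_on ({0..} \<times> UNIV) (\<lambda>(t :: real, x). f x)"
    unfolding case_prod_beta by (rule continuous_on_compose2[OF cf]) (auto intro!: continuous_intros)
  obtain x where x0: "x 0 = (\<mu>0, \<Sigma>0)" and x: "\<And>t. 0 \<le> t \<Longrightarrow> (x has_vector_derivative f (x t)) (at t within {0..})"
    by (rule global_ode_solution[of "\<lambda>_. f" "\<lambda>_. L + norm (f 0)" "(\<mu>0, \<Sigma>0)", OF cf2])
      (auto intro!: lip L0 continuous_intros)
  have cx: "continuous_on {0..} x" by (rule has_vector_derivative_continuous_on[OF x]) auto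
  have small: "norm (x t) < R" if t: "0 \<le> t" for t
  proof (rule ccontr)
    assume "\<not> norm (x t) < R"
    hence ge: "R \<le> norm (x t)" by simp
    have start: "norm (x 0) < R" unfolding x0 by (rule bound[OF \<Sigma>0]) (simp add: e0_def)
    have cn: "continuous_on {0..s} (\<lambda>t. norm (x t))" for s
      by (intro continuous_on_norm continuous_on_subset[OF cx]) auto
    let ?H = "{s \<in> {0..t}. norm (x s) = R}"
    \<comment> \<open>The first time at which the boundary is hit exists by compactness and the intermediate value theorem.\<close>
    have hit: "\<exists>r\<ge>0. r \<le> s \<and> norm (x r) = R" if "0 \<le> s" "R \<le> norm (x s)" for s
      using IVT'[of "\<lambda>t. norm (x t)" 0 R s] start that cn[of s] by auto
    have "compact ?H"
    proof -
      have "closed ?H" by (rule continuous_closed_preimage_constant[OF cn]) simp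
      moreover have "bounded ?H" by (rule bounded_subset[of "{0..t}"]) auto
      ultimately show ?thesis by (simp only: compact_eq_bounded_closed)
    qed
    moreover have "?H \<noteq> {}" using hit[OF t ge] by auto
    ultimately obtain \<tau> where \<tau>: "\<tau> \<in> ?H" and min: "\<And>s. s \<in> ?H \<Longrightarrow> \<tau> \<le> s"
      using compact_attains_inf[of ?H] by blast
    have le: "norm (x s) \<le> R" if s: "s \<in> {0..\<tau>}" for s
    proof (rule ccontr)
      assume "\<not> norm (x s) \<le> R"
      then obtain r where "0 \<le> r" "r \<le> s" "norm (x r) = R" using hit[of s] s by auto
      moreover from this have "\<tau> \<le> r" using min[of r] s \<tau> by auto
      ultimately show False using s \<open>\<not> norm (x s) \<le> R\<close> by (metis atLeastAtMost_iff order_antisym order_refl order_trans)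
    qed
    have sol: "solves_until A b Q \<tau> (fst \<circ> x) (snd \<circ> x)"
      unfolding solves_until_def
    proof (intro ballI)
      fix s assume s: "s \<in> {0..\<tau>}"
      have D: "(x has_vector_derivative stein_field A b Q (x s)) (at s within {0..\<tau>})"
        using x[of s] s unfolding f_def pr_id[OF le[OF s]]
        by (auto intro!: has_vector_derivative_within_subset[of _ _ _ "{0..}" "{0..\<tau>}"])
      show "((fst \<circ> x) has_vector_derivative
        ((mat 1 - matrix_inv Q ** (snd \<circ> x) s) ** A) *v (fst \<circ> x) s
          - bilinear_kernel A ((fst \<circ> x) s) ((fst \<circ> x) s) *\<^sub>R (matrix_inv Q *v ((fst \<circ> x) s - b))) (at s within {0..\<tau>}) \<and>
        ((snd \<circ> x) has_vector_derivative
        2 *\<^sub>R Sym ((snd \<circ> x) s ** A) - 2 *\<^sub>R Sym ((snd \<circ> x) s ** A ** ((snd \<circ> x) s + outer ((fst \<circ> x) s) ((fst \<circ> x) s - b)) ** matrix_inv Q))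
        (at s within {0..\<tau>})"
        using bounded_linear.has_vector_derivative[OF bounded_linear_fst D] bounded_linear.has_vector_derivative[OF bounded_linear_snd D]
        by (simp add: stein_field_def o_def)
    qed
    have init: "(snd \<circ> x) 0 \<in> Sym_plus" using \<Sigma>0 by (simp add: x0)
    have \<tau>0: "0 \<le> \<tau>" using \<tau> by simp
    have "gaussian_KL b Q ((fst \<circ> x) \<tau>) ((snd \<circ> x) \<tau>) \<le> e0"
      using gaussian_KL_along_solution(3)[where \<Sigma> = "snd \<circ> x" and \<mu> = "fst \<circ> x", OF A Q init sol \<tau>0] by (simp add: x0 e0_def)
    moreover have "(snd \<circ> x) \<tau> \<in> Sym_plus" by (rule solution_Sym_plus[where \<Sigma> = "snd \<circ> x", OF A Q init sol \<tau>0])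
    ultimately have "norm (x \<tau>) < R" using bound[of "snd (x \<tau>)" "fst (x \<tau>)"] by simp
    thus False using \<tau> by simp
  qed
  have "stein_gaussian_system A b Q \<mu>0 \<Sigma>0 (fst \<circ> x) (snd \<circ> x)"
    unfolding stein_gaussian_system_iff_field
    using x0 x small by (auto simp: f_def pr_id less_imp_le)
  thus ?thesis using that by blast
qed

section \<open>Exponential convergence\<close>

lemma stein_system_Sym_plus:
  assumes "A \<in> Sym_plus" "\<Sigma>0 \<in> Sym_plus" "Q \<in> Sym_plus" and sol: "stein_gaussian_system A b Q \<mu>0 \<Sigma>0 \<mu> \<Sigma>" and "0 \<le> t"
  shows "\<Sigma> t \<in> Sym_plus"
  using solution_Sym_plus[OF assms(1,3) _ stein_gaussian_system_solves_until[OF sol] assms(5)] sol assms(2)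
  by (simp add: stein_gaussian_system_def)

lemma tendsto_0_at_top_le:
  fixes f g :: "real \<Rightarrow> real"
  assumes "(g \<longlongrightarrow> 0) at_top" "\<And>t. 0 \<le> t \<Longrightarrow> 0 \<le> f t" "\<And>t. 0 \<le> t \<Longrightarrow> f t \<le> g t"
  shows "(f \<longlongrightarrow> 0) at_top"
proof (rule tendsto_sandwich[OF _ _ tendsto_const assms(1)])
  show "eventually (\<lambda>t. 0 \<le> f t) at_top" "eventually (\<lambda>t. f t \<le> g t) at_top"
    using eventually_ge_at_top[of 0] by (eventually_elim, simp add: assms)+
qed

text \<open>The divergence \<open>e\<close> satisfies \<open>e' = - D\<close>. Since
  \<open>e\<close> is nonincreasing, the means and the eigenvalues of the whitened covariances
  stay in compact sets, so that \<open>D\<close> is at least a fixed positive multiple of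
  \<open>e\<close>; hence \<open>e\<close> and both gaps tend to 0. Once they are small, the
  inequalities between \<open>D\<close>, the gaps and \<open>e\<close> hold with nearly sharp
  constants at the base point \<open>b\<close>, which gives \<open>e' \<le> - 4 (g - \<epsilon>)
  e\<close> for \<open>g\<close> the smallest eigenvalue of the rate matrix. The distances are
  bounded by the square root of \<open>e\<close>, which halves the exponent.\<close>

theorem stein_system_convergence:
  fixes A Q \<Sigma>0 :: "real^'n^'n"
  assumes A: "A \<in> Sym_plus" and \<Sigma>0: "\<Sigma>0 \<in> Sym_plus" and Q: "Q \<in> Sym_plus"
    and sol: "stein_gaussian_system A b Q \<mu>0 \<Sigma>0 \<mu> \<Sigma>"
  shows "(\<mu> \<longlongrightarrow> b) at_top" "(\<Sigma> \<longlongrightarrow> Q) at_top"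
    "\<And>\<epsilon>. 0 < \<epsilon> \<Longrightarrow> (\<lambda>t. norm (\<mu> t - b)) \<in> O[at_top](\<lambda>t. exp (- 2 * (lambda_min (stein_rate_matrix A b Q) - \<epsilon>) * t))"
    "\<And>\<epsilon>. 0 < \<epsilon> \<Longrightarrow> (\<lambda>t. norm (\<Sigma> t - Q)) \<in> O[at_top](\<lambda>t. exp (- 2 * (lambda_min (stein_rate_matrix A b Q) - \<epsilon>) * t))"
proof -
  define e where "e t = gaussian_KL b Q (\<mu> t) (\<Sigma> t)" for t
  define D where "D t = dissipation A (\<mu> t) (matrix_inv Q ** \<Sigma> t - mat 1) (matrix_inv Q *v (\<mu> t - b))" for t
  define r where "r t = cov_gap Q (\<Sigma> t)" for t
  define u where "u t = mean_gap Q (\<mu> t - b)" for t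
  define c where "c = norm (mat_sqrt Q)"
  define e0 where "e0 = e 0"
  have S: "\<Sigma> t \<in> Sym_plus" if "0 \<le> t" for t by (rule stein_system_Sym_plus[OF A \<Sigma>0 Q sol that])
  have init: "\<Sigma> 0 \<in> Sym_plus" by (rule S) simp
  note along = gaussian_KL_along_solution[OF A Q init stein_gaussian_system_solves_until[OF sol], folded e_def]
  have cont: "continuous_on {a..t} e" if "0 \<le> a" for a t
    by (rule continuous_on_subset[OF along(1)[of t]]) (use that in auto)
  have der: "(e has_real_derivative - D t) (at t)" if "0 < t" for t
    unfolding D_def by (rule along(2)[of t "t + 1"]) (use that in auto)
  have mono: "e t \<le> e0" if "0 \<le> t" for t unfolding e0_def by (rule along(3)[of t t]) (use that in auto)
  have B: "0 \<le> e t" "u t \<le> 2 * e t" "r t \<le> 4 * (4 * e t + 2) * e t" "4 * e t \<le> r t / exp (- 2 * e t - 1) + 2 * u t"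
    "r t < 1 \<Longrightarrow> 4 * e t \<le> r t / (1 - sqrt (r t)) + 2 * u t" if "0 \<le> t" for t
    unfolding e_def r_def u_def using gaussian_KL_bounds[OF Q S[OF that], where b = b and m = "\<mu> t"] by auto
  have r0: "0 \<le> r t" and u0: "0 \<le> u t" for t unfolding r_def u_def using gaps_nonneg Q by auto
  have D0: "0 \<le> D t" for t unfolding D_def by (rule dissipation_nonneg[OF A])
  have e0: "0 \<le> e0" using B(1)[of 0] by (simp add: e0_def)
  note N = stein_system_norm_bound[OF Q S, of _ b, folded c_def]
  \<comment> \<open>The means stay bounded, so the rate matrices taken at these means have a common lower bound.\<close>
  define k where "k = norm A * (norm b + c * sqrt (2 * e0))\<^sup>2 + 1"
  define a where "a = lambda_min A"
  define q where "q = lambda_max Q"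
  define \<kappa> where "\<kappa> = a / (k + 2 * a * q)"
  have aq: "0 < a" "0 < q" unfolding a_def q_def using lambda_min_pos[OF A] lambda_max_pos[OF Q] by auto
  have k1: "1 \<le> k" by (simp add: k_def)
  have \<kappa>: "0 < \<kappa>" unfolding \<kappa>_def using aq k1 by (intro divide_pos_pos add_pos_pos) auto
  have rate: "\<kappa> \<le> lambda_min (stein_rate_matrix A (\<mu> t) Q)" if t: "0 \<le> t" for t
  proof -
    have "norm (\<mu> t) \<le> norm (\<mu> t - b) + norm b" by norm
    also have "\<dots> \<le> norm b + c * sqrt (2 * e0)" using N(1)[OF t mono[OF t, unfolded e_def]] by simp
    finally have m: "norm (\<mu> t) \<le> norm b + c * sqrt (2 * e0)" .
    have "\<mu> t \<bullet> (A *v \<mu> t) \<le> norm (\<mu> t) * (norm A * norm (\<mu> t))"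
      by (rule order_trans[OF norm_cauchy_schwarz mult_left_mono[OF norm_matrix_vector_le]]) simp
    also have "\<dots> = norm A * (norm (\<mu> t))\<^sup>2" by (simp add: power2_eq_square)
    also have "\<dots> \<le> norm A * (norm b + c * sqrt (2 * e0))\<^sup>2"
      using m by (intro mult_left_mono power_mono) auto
    finally have K: "bilinear_kernel A (\<mu> t) (\<mu> t) \<le> k" by (simp add: bilinear_kernel_def k_def)
    have K1: "1 \<le> bilinear_kernel A (\<mu> t) (\<mu> t)" using Sym_plusD(3)[OF A, of "\<mu> t"] by (simp add: bilinear_kernel_def)
    have "\<kappa> \<le> a / (bilinear_kernel A (\<mu> t) (\<mu> t) + 2 * a * q)"
      unfolding \<kappa>_def using K K1 aq by (intro divide_left_mono mult_pos_pos add_pos_pos) auto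
    also have "\<dots> < lambda_min (stein_rate_matrix A (\<mu> t) Q)" unfolding a_def q_def by (rule rate_lower_bound[OF A Q])
    finally show ?thesis by simp
  qed
  define \<delta> where "\<delta> = exp (- 2 * e0 - 1)"
  have \<delta>: "0 < \<delta>" "\<delta> \<le> 1" using e0 by (auto simp: \<delta>_def)
  have crude: "- D t \<le> (- (4 * \<kappa> * \<delta>)) * e t" if t: "0 \<le> t" for t
  proof -
    have "r t / exp (- 2 * e t - 1) \<le> r t / \<delta>"
      using mono[OF t] r0 by (intro divide_left_mono) (auto simp: \<delta>_def)
    hence "4 * e t \<le> r t / \<delta> + 2 * u t" using B(4)[OF t] by simp
    hence "\<delta> * (4 * e t) \<le> \<delta> * (r t / \<delta> + 2 * u t)" using \<delta> by (intro mult_left_mono) auto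
    also have "\<dots> = r t + \<delta> * (2 * u t)" using \<delta> by (simp add: algebra_simps)
    also have "\<dots> \<le> r t + 2 * u t" using \<delta> u0[of t] by (simp add: mult_left_le_one_le)
    finally have "\<kappa> * (\<delta> * (4 * e t)) \<le> \<kappa> * (r t + 2 * u t)" using \<kappa> by (intro mult_left_mono) auto
    also have "\<dots> \<le> D t" unfolding r_def u_def D_def
      by (rule dissipation_gaps[OF A Q Sym_plusD(1)[OF S[OF t]] _ rate[OF t]]) (use \<kappa> in simp)
    finally show ?thesis by simp
  qed
  have exp_decay: "e t \<le> e0 * exp (- (4 * \<kappa> * \<delta>) * (t - 0))" if t: "0 \<le> t" for t
    unfolding e0_def by (rule gronwall[OF t cont _ crude]) (auto intro: der)
  have elim: "(e \<longlongrightarrow> 0) at_top"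
  proof (rule tendsto_0_at_top_le)
    have "filterlim (\<lambda>t. (4 * \<kappa> * \<delta>) * t) at_top at_top"
      by (rule filterlim_tendsto_pos_mult_at_top[OF tendsto_const _ filterlim_ident]) (use \<kappa> \<delta> in simp)
    hence "((\<lambda>t. exp (- ((4 * \<kappa> * \<delta>) * t))) \<longlongrightarrow> 0) at_top"
      by (intro filterlim_compose[OF exp_at_bot] filterlim_compose[OF filterlim_uminus_at_bot_at_top])
    from tendsto_mult_left[OF this, of e0] show "((\<lambda>t. e0 * exp (- (4 * \<kappa> * \<delta>) * t)) \<longlongrightarrow> 0) at_top" by simp
    show "0 \<le> e t" "e t \<le> e0 * exp (- (4 * \<kappa> * \<delta>) * t)" if "0 \<le> t" for t
      using B(1)[OF that] exp_decay[OF that] by simp_all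
  qed
  have bm: "norm (\<mu> t - b) \<le> c * sqrt (2 * e t)" and bs: "norm (\<Sigma> t - Q) \<le> c\<^sup>2 * sqrt (4 * (4 * e t + 2) * e t)" if "0 \<le> t" for t
    using N[OF that, of "\<mu> t" "e t"] by (auto simp: e_def)
  have "((\<lambda>t. c * sqrt (2 * e t)) \<longlongrightarrow> c * sqrt (2 * 0)) at_top" by (intro tendsto_intros elim)
  hence "((\<lambda>t. c * sqrt (2 * e t)) \<longlongrightarrow> 0) at_top" by simp
  hence "((\<lambda>t. norm (\<mu> t - b)) \<longlongrightarrow> 0) at_top"
    by (rule tendsto_0_at_top_le[of "\<lambda>t. c * sqrt (2 * e t)"]) (auto simp: bm)
  thus m_lim: "(\<mu> \<longlongrightarrow> b) at_top" by (simp add: LIM_zero_iff tendsto_norm_zero_iff)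
  have "((\<lambda>t. c\<^sup>2 * sqrt (4 * (4 * e t + 2) * e t)) \<longlongrightarrow> c\<^sup>2 * sqrt (4 * (4 * 0 + 2) * 0)) at_top" by (intro tendsto_intros elim)
  hence "((\<lambda>t. c\<^sup>2 * sqrt (4 * (4 * e t + 2) * e t)) \<longlongrightarrow> 0) at_top" by simp
  hence "((\<lambda>t. norm (\<Sigma> t - Q)) \<longlongrightarrow> 0) at_top"
    by (rule tendsto_0_at_top_le[of "\<lambda>t. c\<^sup>2 * sqrt (4 * (4 * e t + 2) * e t)"]) (use bs in auto)
  thus "(\<Sigma> \<longlongrightarrow> Q) at_top" by (simp add: LIM_zero_iff tendsto_norm_zero_iff)
  have r_lim: "(r \<longlongrightarrow> 0) at_top"
  proof -
    have "((\<lambda>t. 4 * (4 * e t + 2) * e t) \<longlongrightarrow> 4 * (4 * 0 + 2) * 0) at_top" by (intro tendsto_intros elim)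
  hence "((\<lambda>t. 4 * (4 * e t + 2) * e t) \<longlongrightarrow> 0) at_top" by simp
    thus ?thesis
      by (rule tendsto_0_at_top_le[of "\<lambda>t. 4 * (4 * e t + 2) * e t"]) (use B(3) r0 in auto)
  qed
  \<comment> \<open>From here on the rate matrix is taken at the limit \<open>b\<close> of the means.\<close>
  define g where "g = lambda_min (stein_rate_matrix A b Q)"
  have "bilinear_kernel A b b \<ge> 1" using Sym_plusD(3)[OF A, of b] by (simp add: bilinear_kernel_def)
  hence "0 < a / (bilinear_kernel A b b + 2 * a * q)" using aq by (intro divide_pos_pos add_pos_pos) auto
  also have "\<dots> < g" unfolding g_def a_def q_def by (rule rate_lower_bound[OF A Q])
  finally have g: "0 < g" .
  define s where "s t = norm (mat_sqrt A) * norm (\<mu> t - b)" for t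
  have s_lim: "(s \<longlongrightarrow> 0) at_top"
    unfolding s_def using tendsto_mult_left[OF \<open>((\<lambda>t. norm (\<mu> t - b)) \<longlongrightarrow> 0) at_top\<close>] by simp
  have sharp: "\<exists>C. eventually (\<lambda>t. e t \<le> C * exp (- (4 * (g - \<epsilon>)) * t)) at_top" if \<epsilon>: "0 < \<epsilon>" for \<epsilon>
  proof -
    have "((\<lambda>t. (1 - s t)\<^sup>2 * (1 - sqrt (r t)) * g) \<longlongrightarrow> (1 - 0)\<^sup>2 * (1 - sqrt 0) * g) at_top"
      by (intro tendsto_intros s_lim r_lim)
    hence "eventually (\<lambda>t. g - \<epsilon> < (1 - s t)\<^sup>2 * (1 - sqrt (r t)) * g) at_top"
      using \<epsilon> by (intro order_tendstoD(1)) auto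
    moreover have "eventually (\<lambda>t. s t < 1) at_top" "eventually (\<lambda>t. r t < 1) at_top"
      using order_tendstoD(2)[OF s_lim] order_tendstoD(2)[OF r_lim] by auto
    ultimately have "eventually (\<lambda>t. - D t \<le> (- (4 * (g - \<epsilon>))) * e t) at_top"
      using eventually_ge_at_top[of 0]
    proof eventually_elim
      case (elim t)
      note t = elim(4)
      have sr: "0 < 1 - sqrt (r t)" "sqrt (r t) \<ge> 0" using elim(3) r0[of t] by auto
      have "(1 - sqrt (r t)) * (4 * e t) \<le> (1 - sqrt (r t)) * (r t / (1 - sqrt (r t)) + 2 * u t)"
        using sr B(5)[OF t elim(3)] by (intro mult_left_mono) auto
      also have "\<dots> = r t + (1 - sqrt (r t)) * (2 * u t)" using sr by (simp add: distrib_left)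
      also have "\<dots> \<le> r t + 2 * u t" using sr u0[of t] by (simp add: mult_left_le_one_le)
      finally have "g * ((1 - sqrt (r t)) * (4 * e t)) \<le> g * (r t + 2 * u t)" using g by (intro mult_left_mono) auto
      also have "\<dots> \<le> dissipation A b (matrix_inv Q ** \<Sigma> t - mat 1) (matrix_inv Q *v (\<mu> t - b))"
        unfolding r_def u_def by (rule dissipation_gaps[OF A Q Sym_plusD(1)[OF S[OF t]]]) (use g in \<open>auto simp: g_def\<close>)
      finally have "(1 - s t)\<^sup>2 * (g * ((1 - sqrt (r t)) * (4 * e t))) \<le> (1 - s t)\<^sup>2 * dissipation A b (matrix_inv Q ** \<Sigma> t - mat 1) (matrix_inv Q *v (\<mu> t - b))"
        by (intro mult_left_mono) auto
      also have "\<dots> \<le> D t" unfolding D_def s_def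
        by (rule dissipation_change_base[OF A]) (use elim(2) in \<open>simp add: s_def\<close>)
      finally have 1: "((1 - s t)\<^sup>2 * (1 - sqrt (r t)) * g) * (4 * e t) \<le> D t" by (simp only: ac_simps)
      have "(g - \<epsilon>) * (4 * e t) \<le> ((1 - s t)\<^sup>2 * (1 - sqrt (r t)) * g) * (4 * e t)"
        using elim(1) B(1)[OF t] by (intro mult_right_mono) auto
      moreover have "(- (4 * (g - \<epsilon>))) * e t = - ((g - \<epsilon>) * (4 * e t))" by algebra
      ultimately show ?case using 1 by linarith
    qed
    then obtain T where T: "\<And>t. T \<le> t \<Longrightarrow> - D t \<le> (- (4 * (g - \<epsilon>))) * e t" by (auto simp: eventually_at_top_linorder)
    define T0 where "T0 = max T 0"
    have "e t \<le> e T0 * exp (4 * (g - \<epsilon>) * T0) * exp (- (4 * (g - \<epsilon>)) * t)" if t: "T0 \<le> t" for t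
    proof -
      have "e t \<le> e T0 * exp (- (4 * (g - \<epsilon>)) * (t - T0))"
      proof (rule gronwall[OF t cont])
        fix s assume s: "T0 < s" "s < t"
        show "(e has_real_derivative - D s) (at s)" by (rule der) (use s in \<open>simp add: T0_def\<close>)
        show "- D s \<le> (- (4 * (g - \<epsilon>))) * e s" by (rule T) (use s in \<open>simp add: T0_def\<close>)
      qed (simp add: T0_def)
      also have "exp (- (4 * (g - \<epsilon>)) * (t - T0)) = exp (4 * (g - \<epsilon>) * T0) * exp (- (4 * (g - \<epsilon>)) * t)"
        by (simp add: exp_add[symmetric] algebra_simps)
      finally show ?thesis by (simp add: mult.assoc)
    qed
    thus ?thesis by (auto simp: eventually_at_top_linorder)
  qed
  have rate_bound: "f \<in> O[at_top](\<lambda>t. exp (- 2 * (g - \<epsilon>) * t))"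
    if \<epsilon>: "0 < \<epsilon>" and f: "\<And>t. 0 \<le> t \<Longrightarrow> norm (f t) \<le> C1 * sqrt (C2 * e t)" and C: "0 \<le> C1" "0 \<le> C2" for \<epsilon> C1 C2 and f :: "real \<Rightarrow> real"
  proof -
    obtain C where "eventually (\<lambda>t. e t \<le> C * exp (- (4 * (g - \<epsilon>)) * t)) at_top" using sharp[OF \<epsilon>] by blast
    hence "eventually (\<lambda>t. norm (f t) \<le> (C1 * sqrt (C2 * C)) * norm (exp (- 2 * (g - \<epsilon>) * t))) at_top"
      using eventually_ge_at_top[of 0]
    proof eventually_elim
      case (elim t)
      have sq: "exp (- (4 * (g - \<epsilon>)) * t) = (exp (- 2 * (g - \<epsilon>) * t))\<^sup>2"
        by (simp add: power2_eq_square exp_add[symmetric] algebra_simps)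
      have "C2 * e t \<le> C2 * (C * exp (- (4 * (g - \<epsilon>)) * t))" using elim(1) C by (intro mult_left_mono)
      hence "sqrt (C2 * e t) \<le> sqrt ((C2 * C) * (exp (- 2 * (g - \<epsilon>) * t))\<^sup>2)" unfolding sq by (simp add: mult.assoc)
      also have "\<dots> = sqrt (C2 * C) * exp (- 2 * (g - \<epsilon>) * t)" by (simp only: real_sqrt_mult real_sqrt_abs abs_exp_cancel)
      finally have "C1 * sqrt (C2 * e t) \<le> C1 * (sqrt (C2 * C) * exp (- 2 * (g - \<epsilon>) * t))" using C by (intro mult_left_mono)
      thus ?case using f[OF elim(2)] by simp
    qed
    thus ?thesis by (rule bigoI)
  qed
  have c0: "0 \<le> c" by (simp add: c_def)
  fix \<epsilon> :: real assume \<epsilon>: "0 < \<epsilon>"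
  show "(\<lambda>t. norm (\<mu> t - b)) \<in> O[at_top](\<lambda>t. exp (- 2 * (lambda_min (stein_rate_matrix A b Q) - \<epsilon>) * t))"
    unfolding g_def[symmetric] by (rule rate_bound[OF \<epsilon>, of _ c 2]) (auto simp: bm c0)
  show "(\<lambda>t. norm (\<Sigma> t - Q)) \<in> O[at_top](\<lambda>t. exp (- 2 * (lambda_min (stein_rate_matrix A b Q) - \<epsilon>) * t))"
    unfolding g_def[symmetric]
  proof (rule rate_bound[OF \<epsilon>, of _ "c\<^sup>2" "4 * (4 * e0 + 2)"])
    fix t :: real assume t: "0 \<le> t"
    have "sqrt (4 * (4 * e t + 2) * e t) \<le> sqrt (4 * (4 * e0 + 2) * e t)"
      using mono[OF t] B(1)[OF t] by (intro real_sqrt_le_mono mult_right_mono) auto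
    thus "norm (norm (\<Sigma> t - Q)) \<le> c\<^sup>2 * sqrt (4 * (4 * e0 + 2) * e t)"
      using bs[OF t] by (simp add: order_trans[OF _ mult_left_mono])
  qed (use e0 c0 in auto)
qed

section \<open>The flow of a Gaussian\<close>

text \<open>Values at finitely many points determine an affine map, so its matrix inherits
  continuity in time from the pointwise continuity of the field.\<close>

definition linear_part :: "(real^'n \<Rightarrow> real^'n) \<Rightarrow> real^'n^'n" where
  "linear_part F = (\<chi> i j. (F (axis j 1) - F 0) $ i)"

lemma linear_part_affine:
  assumes "\<And>x. F x = c + M *v x"
  shows "linear_part F = M" "F 0 = c"
  by (simp_all add: assms linear_part_def matrix_algebra matrix_vector_mult_basis column_def vec_eq_iff)

lemma continuous_on_linear_part:
  assumes F: "continuous_on (T \<times> UNIV) (\<lambda>(t, x). F t x)"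
  shows "continuous_on T (\<lambda>t. F t x)" "continuous_on T (\<lambda>t. linear_part (F t))"
proof -
  show c: "continuous_on T (\<lambda>t. F t x)" for x
  proof -
    have "continuous_on T (\<lambda>t. (\<lambda>(t, x). F t x) (t, x))"
      by (rule continuous_on_compose2[OF F]) (auto intro!: continuous_intros)
    thus ?thesis by simp
  qed
  show "continuous_on T (\<lambda>t. linear_part (F t))"
    unfolding linear_part_def by (intro continuous_on_vec_lambda continuous_on_component continuous_on_diff c)
qed

lemma gaussian_transport:
  fixes \<rho> :: "real \<Rightarrow> real^'n \<Rightarrow> real" and F :: "real \<Rightarrow> real^'n \<Rightarrow> real^'n"
  assumes cont: "continuous_on ({0..} \<times> UNIV) (\<lambda>(t, x). \<rho> t x)"
    and diff: "\<And>t x. 0 < t \<Longrightarrow> (\<lambda>(t, x). \<rho> t x) differentiable (at (t, x))"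
    and pde: "\<And>t x. 0 < t \<Longrightarrow> ((\<lambda>s. \<rho> s x) has_real_derivative
        - divergence (\<lambda>z. \<rho> t z *\<^sub>R F t z) x) (at t)"
    and F: "continuous_on ({0..} \<times> UNIV) (\<lambda>(t, x). F t x)"
    and affine: "\<And>t x. 0 \<le> t \<Longrightarrow> F t x = F t 0 + linear_part (F t) *v x"
    and init: "\<rho> 0 = gaussian \<mu>0 \<Sigma>0" and \<Sigma>0: "\<Sigma>0 \<in> Sym_plus"
  obtains P p \<mu> \<Sigma> where "P 0 = mat 1" "p 0 = 0"
    "\<And>t. 0 \<le> t \<Longrightarrow> (P has_vector_derivative linear_part (F t) ** P t) (at t within {0..})"
    "\<And>t. 0 \<le> t \<Longrightarrow> (p has_vector_derivative linear_part (F t) *v p t + F t 0) (at t within {0..})"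
    "\<And>t. 0 \<le> t \<Longrightarrow> invertible (P t)"
    "\<mu> 0 = \<mu>0" "\<Sigma> 0 = \<Sigma>0"
    "\<And>t. 0 \<le> t \<Longrightarrow> (\<mu> has_vector_derivative F t (\<mu> t)) (at t within {0..})"
    "\<And>t. 0 \<le> t \<Longrightarrow> (\<Sigma> has_vector_derivative linear_part (F t) ** \<Sigma> t + \<Sigma> t ** transpose (linear_part (F t))) (at t within {0..})"
    "\<And>t. 0 \<le> t \<Longrightarrow> \<Sigma> t \<in> Sym_plus" "\<And>t. 0 \<le> t \<Longrightarrow> \<rho> t = gaussian (\<mu> t) (\<Sigma> t)"
proof -
  note cW = continuous_on_linear_part(2)[OF F] and cm = continuous_on_linear_part(1)[OF F, of 0]
  obtain P p where P0: "P 0 = mat 1" and p0: "p 0 = 0"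
    and P: "\<And>t. 0 \<le> t \<Longrightarrow> (P has_vector_derivative linear_part (F t) ** P t) (at t within {0..})"
    and p: "\<And>t. 0 \<le> t \<Longrightarrow> (p has_vector_derivative linear_part (F t) *v p t + F t 0) (at t within {0..})"
    using affine_flow[OF cW cm] by blast
  have iP: "invertible (P t)" if "0 \<le> t" for t
    using det_flow_pos[OF cW P0 P that] by (simp add: invertible_det_nz)
  define \<mu> where "\<mu> t = P t *v \<mu>0 + p t" for t
  define \<Sigma> where "\<Sigma> t = P t ** \<Sigma>0 ** transpose (P t)" for t
  have d\<mu>: "(\<mu> has_vector_derivative F t (\<mu> t)) (at t within {0..})" if t: "0 \<le> t" for t
  proof -
    have "((\<lambda>s. P s *v \<mu>0) has_vector_derivative (linear_part (F t) ** P t) *v \<mu>0) (at t within {0..})"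
      by (rule bounded_linear.has_vector_derivative[OF bounded_bilinear.bounded_linear_left[OF bounded_bilinear_matrix_vector_mult] P[OF t]])
    from has_vector_derivative_add[OF this p[OF t]]
    show ?thesis unfolding affine[OF t, of "\<mu> t"]
      by (simp add: \<mu>_def[abs_def] matrix_vector_right_distrib matrix_vector_mul_assoc ac_simps)
  qed
  have d\<Sigma>: "(\<Sigma> has_vector_derivative linear_part (F t) ** \<Sigma> t + \<Sigma> t ** transpose (linear_part (F t))) (at t within {0..})"
    if t: "0 \<le> t" for t
    unfolding \<Sigma>_def[abs_def] by (rule congruence_flow_derivative[OF P[OF t]])
  have \<rho>: "\<rho> t = gaussian (\<mu> t) (\<Sigma> t)" if t: "0 \<le> t" for t
    unfolding \<mu>_def \<Sigma>_def
  proof (rule affine_transport_gaussian[OF cont diff _ cW P0 p0 P p init \<Sigma>0 t])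
    fix s x assume s: "0 < (s::real)"
    have "(\<lambda>z. \<rho> s z *\<^sub>R F s z) = (\<lambda>z. \<rho> s z *\<^sub>R (F s 0 + linear_part (F s) *v z))"
      using affine[of s] s by (intro ext) (metis less_imp_le)
    thus "((\<lambda>s. \<rho> s x) has_real_derivative - divergence (\<lambda>z. \<rho> s z *\<^sub>R (F s 0 + linear_part (F s) *v z)) x) (at s)"
      using pde[OF s, of x] by (simp only:)
  qed
  have S: "\<Sigma> t \<in> Sym_plus" if "0 \<le> t" for t
    unfolding \<Sigma>_def by (rule Sym_plus_congruence[OF \<Sigma>0 iP[OF that]])
  show ?thesis
    by (rule that[OF P0 p0 P p iP _ _ d\<mu> d\<Sigma> S \<rho>]) (auto simp: \<mu>_def \<Sigma>_def P0 p0)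
qed

lemma kernel_field_linear_part:
  assumes "\<And>x. integrable lborel (\<lambda>y. (bilinear_kernel A x y * \<rho> y) *\<^sub>R grad \<Phi> y)"
  shows "kernel_field (bilinear_kernel A) \<rho> \<Phi> x =
    kernel_field (bilinear_kernel A) \<rho> \<Phi> 0 + linear_part (kernel_field (bilinear_kernel A) \<rho> \<Phi>) *v x"
  unfolding linear_part_def by (rule kernel_field_affine[OF assms])

text \<open>The velocity field is affine before anything else is known about the density, so the
  flow transports the initial Gaussian to Gaussians. Only then is the field computed explicitly,
  which identifies the equations for the moments.\<close>

theorem stein_flow_gaussian:
  fixes A Q \<Sigma>0 :: "real^'n^'n"
  assumes A: "A \<in> Sym_plus" and \<Sigma>0: "\<Sigma>0 \<in> Sym_plus" and Q: "Q \<in> Sym_plus"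
    and flow: "stein_gradient_flow (bilinear_kernel A) (KL_first_variation (gaussian b Q)) (gaussian \<mu>0 \<Sigma>0) \<rho>"
  obtains \<mu> \<Sigma> where "stein_gaussian_system A b Q \<mu>0 \<Sigma>0 \<mu> \<Sigma>"
    "\<And>t. 0 \<le> t \<Longrightarrow> \<Sigma> t \<in> Sym_plus" "\<And>t. 0 \<le> t \<Longrightarrow> \<rho> t = gaussian (\<mu> t) (\<Sigma> t)"
proof -
  note As = Sym_plusD(1)[OF A] and Qs = Sym_plusD(1)[OF Sym_plus_matrix_inv[OF Q]]
  let ?\<delta> = "KL_first_variation (gaussian b Q)"
  define k where "k t = kernel_field (bilinear_kernel A) (\<rho> t) (?\<delta> (\<rho> t))" for t
  have init: "\<rho> 0 = gaussian \<mu>0 \<Sigma>0" and smooth: "smooth_on ({0..} \<times> UNIV) (\<lambda>(t, x). \<rho> t x)"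
    and int: "\<And>t x. 0 \<le> t \<Longrightarrow> integrable lborel (\<lambda>y. (bilinear_kernel A x y * \<rho> t y) *\<^sub>R grad (?\<delta> (\<rho> t)) y)"
    and ck: "continuous_on ({0..} \<times> UNIV) (\<lambda>(t, x). k t x)"
    and pde: "\<And>t x. 0 \<le> t \<Longrightarrow> ((\<lambda>s. \<rho> s x) has_real_derivative
        - stein_inverse_metric (bilinear_kernel A) (\<rho> t) (?\<delta> (\<rho> t)) x) (at t within {0..})"
    using flow unfolding stein_gradient_flow_def k_def by auto
  have aff: "k t x = k t 0 + linear_part (k t) *v x" if "0 \<le> t" for t x
    unfolding k_def by (rule kernel_field_linear_part[OF int[OF that]])
  have C0: "C_k_on 0 ({0..} \<times> UNIV) (\<lambda>(t, x). \<rho> t x)" and C1: "C_k_on 1 ({0..} \<times> UNIV) (\<lambda>(t, x). \<rho> t x)"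
    using smooth by (auto simp only: smooth_on_def)
  have diff: "(\<lambda>(t, x). \<rho> t x) differentiable (at (t, x))" if t: "0 < t" for t x
  proof -
    have "(\<lambda>(t, x). \<rho> t x) differentiable (at (t, x) within {0..} \<times> UNIV)"
      using C1 t by (force simp: differentiable_def)
    hence "(\<lambda>(t, x). \<rho> t x) differentiable (at (t, x) within {0<..} \<times> UNIV)"
      by (rule differentiable_within_subset) auto
    thus ?thesis using t by (simp add: at_within_open[OF _ open_Times])
  qed
  define F where "F t x = - k t x" for t x
  have lin: "linear_part (F t) = - linear_part (k t)" for t
    by (simp add: linear_part_def F_def vec_eq_iff)
  have affF: "F t x = F t 0 + linear_part (F t) *v x" if "0 \<le> t" for t x
    using aff[OF that, of x] unfolding lin by (simp add: F_def matrix_algebra)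
  have cF: "continuous_on ({0..} \<times> UNIV) (\<lambda>(t, x). F t x)"
    using continuous_on_minus[OF ck] by (simp add: F_def case_prod_beta)
  have pdeF: "((\<lambda>s. \<rho> s x) has_real_derivative - divergence (\<lambda>z. \<rho> t z *\<^sub>R F t z) x) (at t)" if t: "0 < t" for t x
  proof -
    obtain D where D: "((\<lambda>(t, x). \<rho> t x) has_derivative D) (at (t, x))" using diff[OF t] by (auto simp: differentiable_def)
    have "((\<lambda>z. (t, z)) has_derivative (\<lambda>h. (0, h))) (at x)" by (auto intro!: derivative_eq_intros)
    from has_derivative_compose[OF this, of "\<lambda>(t, x). \<rho> t x" D] D
    have Dx: "(\<rho> t has_derivative (\<lambda>h. D (0, h))) (at x)" by simp
    have e1: "(\<lambda>z. \<rho> t z *\<^sub>R F t z) = (\<lambda>z. \<rho> t z *\<^sub>R (F t 0 + linear_part (F t) *v z))"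
      using affF t by (intro ext) (metis less_imp_le)
    have e2: "(\<lambda>z. \<rho> t z *\<^sub>R k t z) = (\<lambda>z. \<rho> t z *\<^sub>R (k t 0 + linear_part (k t) *v z))"
      using aff t by (intro ext) (metis less_imp_le)
    have v: "F t 0 + linear_part (F t) *v x = - (k t 0 + linear_part (k t) *v x)"
      unfolding lin by (simp add: F_def matrix_algebra)
    have l: "linear (\<lambda>h. D (0, h))" by (rule has_derivative_linear[OF Dx])
    have "- divergence (\<lambda>z. \<rho> t z *\<^sub>R F t z) x = divergence (\<lambda>z. \<rho> t z *\<^sub>R k t z) x"
      unfolding e1 e2 divergence_scaled_affine[OF Dx] v unfolding lin
      using linear_neg[OF l, of "k t 0 + linear_part (k t) *v x"]
      by (simp add: linear_neg[OF bounded_linear.linear[OF bounded_linear_trace]] del: minus_add_distrib)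
    also have "\<dots> = - stein_inverse_metric (bilinear_kernel A) (\<rho> t) (?\<delta> (\<rho> t)) x"
      by (simp add: stein_inverse_metric_def k_def)
    finally have "((\<lambda>s. \<rho> s x) has_real_derivative - divergence (\<lambda>z. \<rho> t z *\<^sub>R F t z) x) (at t within {0..})"
      using pde[of t x] t by simp
    thus ?thesis
      using has_vector_derivative_within_atLeast_0 t by (simp add: has_real_derivative_iff_has_vector_derivative)
  qed
  obtain \<mu> \<Sigma> where m0: "\<mu> 0 = \<mu>0" and S0: "\<Sigma> 0 = \<Sigma>0"
    and d\<mu>: "\<And>t. 0 \<le> t \<Longrightarrow> (\<mu> has_vector_derivative F t (\<mu> t)) (at t within {0..})"
    and d\<Sigma>: "\<And>t. 0 \<le> t \<Longrightarrow> (\<Sigma> has_vector_derivative linear_part (F t) ** \<Sigma> t + \<Sigma> t ** transpose (linear_part (F t))) (at t within {0..})"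
    and S: "\<And>t. 0 \<le> t \<Longrightarrow> \<Sigma> t \<in> Sym_plus" and \<rho>: "\<And>t. 0 \<le> t \<Longrightarrow> \<rho> t = gaussian (\<mu> t) (\<Sigma> t)"
  proof (rule gaussian_transport[OF C0[simplified] diff pdeF cF affF init \<Sigma>0], assumption+)
    fix P p \<mu> \<Sigma>
    assume "\<mu> 0 = \<mu>0" "\<Sigma> 0 = \<Sigma>0"
      "\<And>t. 0 \<le> t \<Longrightarrow> (\<mu> has_vector_derivative F t (\<mu> t)) (at t within {0..})"
      "\<And>t. 0 \<le> t \<Longrightarrow> (\<Sigma> has_vector_derivative linear_part (F t) ** \<Sigma> t + \<Sigma> t ** transpose (linear_part (F t))) (at t within {0..})"
      "\<And>t. 0 \<le> t \<Longrightarrow> \<Sigma> t \<in> Sym_plus" "\<And>t. 0 \<le> t \<Longrightarrow> \<rho> t = gaussian (\<mu> t) (\<Sigma> t)"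
    thus thesis by (rule that)
  qed
  have Fx: "F t x = - (matrix_inv Q *v (\<mu> t - b)) + stein_drift A b Q (\<mu> t) (\<Sigma> t) *v x" if t: "0 \<le> t" for t x
  proof -
    define w where "w = matrix_inv Q *v (\<mu> t - b)"
    have k1: "k t x = bilinear_kernel A x (\<mu> t) *\<^sub>R w + (matrix_inv Q - matrix_inv (\<Sigma> t)) *v (\<Sigma> t *v (A *v x))"
      unfolding k_def \<rho>[OF t] w_def
      by (rule kernel_field_gaussian[OF As S[OF t] grad_KL_first_variation_gaussian[OF S[OF t] Q] int[OF t, unfolded \<rho>[OF t]]])
    have k2: "bilinear_kernel A x (\<mu> t) = (A *v \<mu> t) \<bullet> x + 1"
      by (simp add: bilinear_kernel_def inner_commute)
    have k3: "(matrix_inv Q - matrix_inv (\<Sigma> t)) *v (\<Sigma> t *v (A *v x)) = (matrix_inv Q ** \<Sigma> t) *v (A *v x) - A *v x"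
      using Sym_plus_inv(2)[OF S[OF t]] by (simp add: matrix_algebra)
    have k4: "stein_drift A b Q (\<mu> t) (\<Sigma> t) *v x = A *v x - (matrix_inv Q ** \<Sigma> t) *v (A *v x) - ((A *v \<mu> t) \<bullet> x) *\<^sub>R w"
      unfolding stein_drift_def w_def[symmetric] by (simp add: matrix_algebra outer_mult_vector)
    show ?thesis unfolding F_def k1 k2 k3 k4 w_def[symmetric] by (simp add: scaleR_left_distrib)
  qed
  have "stein_gaussian_system A b Q \<mu>0 \<Sigma>0 \<mu> \<Sigma>"
    unfolding stein_gaussian_system_def stein_mean_rhs
  proof (intro conjI allI impI m0 S0)
    fix t :: real assume t: "0 \<le> t"
    show "(\<mu> has_vector_derivative stein_drift A b Q (\<mu> t) (\<Sigma> t) *v \<mu> t - matrix_inv Q *v (\<mu> t - b)) (at t within {0..})"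
      using d\<mu>[OF t] unfolding Fx[OF t] by simp
    show "(\<Sigma> has_vector_derivative 2 *\<^sub>R Sym (\<Sigma> t ** A) - 2 *\<^sub>R Sym (\<Sigma> t ** A ** (\<Sigma> t + outer (\<mu> t) (\<mu> t - b)) ** matrix_inv Q)) (at t within {0..})"
      unfolding stein_cov_rhs[OF As Sym_plusD(1)[OF S[OF t]] Qs]
      using d\<Sigma>[OF t] unfolding linear_part_affine(1)[OF Fx[OF t]] .
  qed
  thus ?thesis using that S \<rho> by blast
qed

section \<open>Weak convergence\<close>

text \<open>From \<open>S\<^sup>-\<^sup>1 - Q\<^sup>-\<^sup>1 = S\<^sup>-\<^sup>1 (Q - S)
  Q\<^sup>-\<^sup>1\<close> it follows first that \<open>\<bar>S\<^sup>-\<^sup>1\<bar> \<le> 2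
  \<bar>Q\<^sup>-\<^sup>1\<bar>\<close> for \<open>S\<close> close to \<open>Q\<close>, and then
  that the difference tends to 0.\<close>

lemma matrix_inv_tendsto:
  fixes S :: "real \<Rightarrow> real^'n^'n"
  assumes Q: "invertible Q" and S: "\<And>t. 0 \<le> t \<Longrightarrow> invertible (S t)" and lim: "(S \<longlongrightarrow> Q) at_top"
  shows "((\<lambda>t. matrix_inv (S t)) \<longlongrightarrow> matrix_inv Q) at_top"
proof -
  define q where "q = norm (matrix_inv Q)"
  have dl: "((\<lambda>t. norm (Q - S t)) \<longlongrightarrow> 0) at_top"
    using tendsto_norm[OF tendsto_diff[OF tendsto_const lim, of Q]] by simp
  have "((\<lambda>t. q * norm (Q - S t)) \<longlongrightarrow> 0) at_top" using tendsto_mult_left[OF dl, of q] by simp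
  hence "eventually (\<lambda>t. q * norm (Q - S t) < 1/2) at_top" by (rule order_tendstoD) simp
  hence bound: "eventually (\<lambda>t. norm (matrix_inv (S t) - matrix_inv Q) \<le> 2 * q * q * norm (Q - S t)) at_top"
    using eventually_ge_at_top[of 0]
  proof eventually_elim
    case (elim t)
    note inv = matrix_inv_inverse[OF S[OF elim(2)]]
    have "matrix_inv (S t) - matrix_inv Q = matrix_inv (S t) ** (Q - S t) ** matrix_inv Q"
      using inv(2) matrix_inv_inverse(1)[OF Q] by (simp add: matrix_algebra matrix_mul_assoc[symmetric, of _ Q])
    also have "norm \<dots> \<le> norm (matrix_inv (S t) ** (Q - S t)) * q" unfolding q_def by (rule norm_matrix_mult_le)
    also have "\<dots> \<le> norm (matrix_inv (S t)) * norm (Q - S t) * q"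
      unfolding q_def by (intro mult_right_mono norm_matrix_mult_le) simp
    finally have 1: "norm (matrix_inv (S t) - matrix_inv Q) \<le> norm (matrix_inv (S t)) * (q * norm (Q - S t))" by (simp add: ac_simps)
    also have "\<dots> \<le> norm (matrix_inv (S t)) * (1/2)" using elim(1) by (intro mult_left_mono) auto
    finally have "norm (matrix_inv (S t)) \<le> 2 * q"
      using norm_triangle_ineq2[of "matrix_inv (S t)" "matrix_inv Q"] unfolding q_def by linarith
    hence "norm (matrix_inv (S t)) * (q * norm (Q - S t)) \<le> 2 * q * (q * norm (Q - S t))"
      by (intro mult_right_mono) (auto simp: q_def)
    with 1 show ?case by (simp add: ac_simps)
  qed
  have "((\<lambda>t. 2 * q * q * norm (Q - S t)) \<longlongrightarrow> 0) at_top" using tendsto_mult_left[OF dl, of "2 * q * q"] by simp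
  from Lim_null_comparison[OF bound this] show ?thesis by (simp add: LIM_zero_iff)
qed

lemma det_tendsto:
  fixes S :: "'a \<Rightarrow> real^'n^'n"
  assumes "(S \<longlongrightarrow> Q) F"
  shows "((\<lambda>t. det (S t)) \<longlongrightarrow> det Q) F"
  unfolding det_def by (intro tendsto_intros tendsto_vec_nth assms)

lemma gaussian_tendsto:
  fixes S :: "real \<Rightarrow> real^'n^'n"
  assumes Q: "Q \<in> Sym_plus" and S: "\<And>t. 0 \<le> t \<Longrightarrow> S t \<in> Sym_plus"
    and lim: "(m \<longlongrightarrow> b) at_top" "(S \<longlongrightarrow> Q) at_top"
  shows "((\<lambda>t. gaussian (m t) (S t) x) \<longlongrightarrow> gaussian b Q x) at_top"
proof -
  have inv: "((\<lambda>t. matrix_inv (S t)) \<longlongrightarrow> matrix_inv Q) at_top"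
    by (rule matrix_inv_tendsto[OF Sym_plus_invertible[OF Q] Sym_plus_invertible[OF S] lim(2)])
  have "sqrt ((2 * pi) ^ CARD('n) * det Q) \<noteq> 0" using det_Sym_plus_pos[OF Q] by simp
  thus ?thesis unfolding gaussian_def
    by (intro tendsto_intros det_tendsto lim inv bounded_bilinear.tendsto[OF bounded_bilinear_matrix_vector_mult])
qed

text \<open>Pointwise convergence of probability densities implies convergence in
  \<open>L\<^sup>1\<close>, by Scheffe's lemma.\<close>

lemma gaussian_converges_weakly:
  fixes \<Sigma> :: "real \<Rightarrow> real^'n^'n"
  assumes Q: "Q \<in> Sym_plus" and S: "\<And>t. 0 \<le> t \<Longrightarrow> \<Sigma> t \<in> Sym_plus"
    and lim: "(\<mu> \<longlongrightarrow> b) at_top" "(\<Sigma> \<longlongrightarrow> Q) at_top"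
    and \<rho>: "\<And>t. 0 \<le> t \<Longrightarrow> \<rho> t = gaussian (\<mu> t) (\<Sigma> t)"
  shows "converges_weakly \<rho> (gaussian b Q) at_top"
  unfolding converges_weakly_def
proof (intro allI impI tendsto_at_topI_sequentially)
  fix f :: "real^'n \<Rightarrow> real" and X :: "nat \<Rightarrow> real"
  assume f: "continuous_on UNIV f \<and> bounded (range f)" and X: "filterlim X at_top sequentially"
  have [measurable]: "f \<in> borel_measurable borel" using f by (intro borel_measurable_continuous_onI) simp
  obtain B where B: "\<And>x. norm (f x) \<le> B" using f by (auto simp: bounded_iff)
  have B0: "0 \<le> B" using B[of 0] norm_ge_zero order_trans by blast
  define G where "G n = gaussian (\<mu> (max 0 (X n))) (\<Sigma> (max 0 (X n)))" for n
  let ?G = "gaussian b Q"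
  have mom: "has_bochner_integral lborel (G n) 1" for n unfolding G_def by (rule gaussian_moments(1)[OF S]) simp
  have mom': "has_bochner_integral lborel ?G 1" by (rule gaussian_moments(1)[OF Q])
  have int: "integrable lborel (G n)" "integrable lborel ?G" for n using mom mom' by (auto simp: has_bochner_integral_iff)
  have pos: "0 \<le> G n x" "0 \<le> ?G x" for n x
    unfolding G_def using gaussian_pos[OF S[of "max 0 (X n)"]] gaussian_pos[OF Q] by (auto simp: less_imp_le)
  have nn: "(\<integral>\<^sup>+x. norm (G n x) \<partial>lborel) = 1" "(\<integral>\<^sup>+x. norm (?G x) \<partial>lborel) = 1" for n
    using nn_integral_eq_integral[OF int(1)[of n]] nn_integral_eq_integral[OF int(2)] pos mom[of n] mom'
    by (auto simp: has_bochner_integral_iff)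
  have Y: "filterlim (\<lambda>n. max 0 (X n)) at_top sequentially"
    by (rule filterlim_at_top_mono[OF X]) simp
  have ptw: "(\<lambda>n. G n x) \<longlonglongrightarrow> ?G x" for x
    unfolding G_def by (rule filterlim_compose[OF gaussian_tendsto[OF Q S lim] Y])
  have "(\<lambda>n. \<integral>\<^sup>+x. norm (G n x - ?G x) \<partial>lborel) \<longlonglongrightarrow> 0"
    by (rule Scheffe_lemma2) (use int ptw nn in \<open>auto simp: borel_measurable_integrable\<close>)
  moreover have "(\<integral>\<^sup>+x. norm (G n x - ?G x) \<partial>lborel) = ennreal (\<integral>x. norm (G n x - ?G x) \<partial>lborel)" for n
    by (rule nn_integral_eq_integral) (use int in auto)
  ultimately have "(\<lambda>n. ennreal (\<integral>x. norm (G n x - ?G x) \<partial>lborel)) \<longlonglongrightarrow> ennreal 0" by simp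
  hence L1: "(\<lambda>n. \<integral>x. norm (G n x - ?G x) \<partial>lborel) \<longlonglongrightarrow> 0"
    by (rule tendsto_ennrealD) (auto intro!: always_eventually)
  have intf: "integrable lborel (\<lambda>x. f x * g x)" if g: "integrable lborel g" for g :: "real^'n \<Rightarrow> real"
  proof (rule Bochner_Integration.integrable_bound[OF integrable_mult_right[OF integrable_norm[OF g], of B]])
    show "(\<lambda>x. f x * g x) \<in> borel_measurable lborel" using g by simp
    show "AE x in lborel. norm (f x * g x) \<le> norm (B * norm (g x))"
      using B B0 by (intro AE_I2) (simp add: abs_mult mult_right_mono)
  qed
  have diff: "norm ((\<integral>x. f x * G n x \<partial>lborel) - (\<integral>x. f x * ?G x \<partial>lborel)) \<le> B * (\<integral>x. norm (G n x - ?G x) \<partial>lborel)" for n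
  proof -
    have "(\<integral>x. f x * G n x \<partial>lborel) - (\<integral>x. f x * ?G x \<partial>lborel) = (\<integral>x. f x * (G n x - ?G x) \<partial>lborel)"
      using Bochner_Integration.integral_diff[OF intf[OF int(1)] intf[OF int(2)], of n] by (simp add: right_diff_distrib)
    also have "norm \<dots> \<le> (\<integral>x. B * norm (G n x - ?G x) \<partial>lborel)"
    proof (rule Bochner_Integration.integral_norm_bound_integral)
      show "integrable lborel (\<lambda>x. f x * (G n x - ?G x))" by (intro intf Bochner_Integration.integrable_diff int)
      show "integrable lborel (\<lambda>x. B * norm (G n x - ?G x))" by (intro integrable_mult_right integrable_norm Bochner_Integration.integrable_diff int)
      show "norm (f x * (G n x - ?G x)) \<le> B * norm (G n x - ?G x)" for x
        unfolding norm_mult using B[of x] by (intro mult_right_mono) auto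
    qed
    finally show ?thesis by simp
  qed
  have "(\<lambda>n. (\<integral>x. f x * G n x \<partial>lborel) - (\<integral>x. f x * ?G x \<partial>lborel)) \<longlonglongrightarrow> 0"
    by (rule Lim_null_comparison[OF always_eventually[OF allI[OF diff]]]) (use tendsto_mult_left[OF L1, of B] in simp)
  hence "(\<lambda>n. \<integral>x. f x * G n x \<partial>lborel) \<longlonglongrightarrow> (\<integral>x. f x * ?G x \<partial>lborel)" by (simp add: LIM_zero_iff)
  moreover have "eventually (\<lambda>n. (\<integral>x. f x * \<rho> (X n) x \<partial>lborel) = (\<integral>x. f x * G n x \<partial>lborel)) sequentially"
  proof -
    have "eventually (\<lambda>n. 0 \<le> X n) sequentially" using X by (simp add: filterlim_at_top)
    thus ?thesis by eventually_elim (simp add: G_def \<rho>)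
  qed
  ultimately show "(\<lambda>n. \<integral>x. f x * \<rho> (X n) x \<partial>lborel) \<longlonglongrightarrow> (\<integral>x. f x * ?G x \<partial>lborel)"
    by (simp add: tendsto_cong)
qed

section \<open>The centered case\<close>

lemma stein_cov_rhs_centered:
  "2 *\<^sub>R Sym (S ** A) - 2 *\<^sub>R Sym (S ** A ** (S + outer 0 (0 - 0)) ** matrix_inv Q)
    = 2 *\<^sub>R Sym (S ** A ** (mat 1 - S ** matrix_inv Q))"
  unfolding two_Sym by (simp add: matrix_algebra)

text \<open>For \<open>b = 0\<close> the mean equation is \<open>\<mu>' = G \<mu>\<close> with a
  matrix \<open>G\<close> that is continuous in time, so a mean starting at 0 stays there.\<close>

lemma stein_system_centered_iff:
  fixes A Q \<Sigma>0 :: "real^'n^'n"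
  shows "stein_gaussian_system A 0 Q 0 \<Sigma>0 \<mu> \<Sigma> \<longleftrightarrow> (\<forall>t\<ge>0. \<mu> t = 0) \<and> stein_lyapunov_equation A Q \<Sigma>0 \<Sigma>"
proof
  assume sol: "stein_gaussian_system A 0 Q 0 \<Sigma>0 \<mu> \<Sigma>"
  have d: "(\<mu> has_vector_derivative
        ((mat 1 - matrix_inv Q ** \<Sigma> t) ** A) *v \<mu> t
          - bilinear_kernel A (\<mu> t) (\<mu> t) *\<^sub>R (matrix_inv Q *v (\<mu> t - 0))) (at t within {0..})"
    "(\<Sigma> has_vector_derivative 2 *\<^sub>R Sym (\<Sigma> t ** A) - 2 *\<^sub>R Sym (\<Sigma> t ** A ** (\<Sigma> t + outer (\<mu> t) (\<mu> t - 0)) ** matrix_inv Q)) (at t within {0..})"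
    if "0 \<le> t" for t
    using sol that by (auto simp: stein_gaussian_system_def)
  have c: "continuous_on {0..} \<mu>" "continuous_on {0..} \<Sigma>"
    by (rule has_vector_derivative_continuous_on[OF d(1)], simp) (rule has_vector_derivative_continuous_on[OF d(2)], simp)
  define G where "G t = (mat 1 - matrix_inv Q ** \<Sigma> t) ** A - bilinear_kernel A (\<mu> t) (\<mu> t) *\<^sub>R matrix_inv Q" for t
  have cG: "continuous_on {0..T} G" for T
    unfolding G_def bilinear_kernel_def
    by (intro continuous_intros bounded_bilinear.continuous_on[OF bounded_bilinear_matrix_mult]
      bounded_bilinear.continuous_on[OF bounded_bilinear_matrix_vector_mult] continuous_on_subset[OF c(1)] continuous_on_subset[OF c(2)]) auto
  have zero: "\<mu> t = 0" if t: "0 \<le> t" for t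
  proof -
    obtain C where C: "\<And>s. 0 \<le> s \<Longrightarrow> s \<le> t \<Longrightarrow> norm (G s) \<le> C" using continuous_bounded_Icc[OF cG] by blast
    show ?thesis
    proof (rule ode_unique[OF t, where x = \<mu> and x' = "\<lambda>s. G s *v \<mu> s" and y = "\<lambda>_. 0" and y' = "\<lambda>_. 0" and C = C])
      show "continuous_on {0..t} \<mu>" by (rule continuous_on_subset[OF c(1)]) auto
      show "\<mu> 0 = 0" using sol by (simp add: stein_gaussian_system_def)
      fix s assume s: "0 < s" "s < t"
      have "(\<mu> has_vector_derivative G s *v \<mu> s) (at s within {0..})"
        using d(1)[of s] s by (simp add: G_def matrix_algebra matrix_vector_mult_diff_rdistrib)
      thus "(\<mu> has_vector_derivative G s *v \<mu> s) (at s)" by (rule has_vector_derivative_within_atLeast_0[OF _ s(1)])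
      have "norm (G s *v \<mu> s) \<le> norm (G s) * norm (\<mu> s)" by (rule norm_matrix_vector_le)
      also have "\<dots> \<le> C * norm (\<mu> s)" using C[of s] s by (intro mult_right_mono) auto
      finally show "norm (G s *v \<mu> s - 0) \<le> C * norm (\<mu> s - 0)" by simp
    qed auto
  qed
  have "stein_lyapunov_equation A Q \<Sigma>0 \<Sigma>"
    unfolding stein_lyapunov_equation_def
  proof (intro conjI allI impI)
    show "\<Sigma> 0 = \<Sigma>0" using sol by (simp add: stein_gaussian_system_def)
    fix t :: real assume t: "0 \<le> t"
    show "(\<Sigma> has_vector_derivative 2 *\<^sub>R Sym (\<Sigma> t ** A ** (mat 1 - \<Sigma> t ** matrix_inv Q))) (at t within {0..})"
      using d(2)[OF t] unfolding zero[OF t] stein_cov_rhs_centered .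
  qed
  thus "(\<forall>t\<ge>0. \<mu> t = 0) \<and> stein_lyapunov_equation A Q \<Sigma>0 \<Sigma>" using zero by blast
next
  assume lyap: "(\<forall>t\<ge>0. \<mu> t = 0) \<and> stein_lyapunov_equation A Q \<Sigma>0 \<Sigma>"
  hence zero: "\<mu> t = 0" if "0 \<le> t" for t using that by blast
  show "stein_gaussian_system A 0 Q 0 \<Sigma>0 \<mu> \<Sigma>"
    unfolding stein_gaussian_system_def
  proof (intro conjI allI impI)
    show "\<mu> 0 = 0" "\<Sigma> 0 = \<Sigma>0" using lyap by (auto simp: stein_lyapunov_equation_def)
    fix t :: real assume t: "0 \<le> t"
    have "(\<mu> has_vector_derivative 0) (at t within {0..})"
      using t by (intro has_vector_derivative_transform[of t "{0..}" \<mu> "\<lambda>_. 0"]) (auto simp: zero)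
    thus "(\<mu> has_vector_derivative ((mat 1 - matrix_inv Q ** \<Sigma> t) ** A) *v \<mu> t
          - bilinear_kernel A (\<mu> t) (\<mu> t) *\<^sub>R (matrix_inv Q *v (\<mu> t - 0))) (at t within {0..})"
      by (simp add: zero[OF t] matrix_algebra)
    show "(\<Sigma> has_vector_derivative 2 *\<^sub>R Sym (\<Sigma> t ** A) - 2 *\<^sub>R Sym (\<Sigma> t ** A ** (\<Sigma> t + outer (\<mu> t) (\<mu> t - 0)) ** matrix_inv Q)) (at t within {0..})"
      unfolding zero[OF t] stein_cov_rhs_centered using lyap t by (simp add: stein_lyapunov_equation_def)
  qed
qed

lemma stein_lyapunov_unique:
  assumes "stein_lyapunov_equation A Q \<Sigma>0 \<Sigma>" "stein_lyapunov_equation A Q \<Sigma>0 \<Sigma>'" "0 \<le> t"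
  shows "\<Sigma>' t = \<Sigma> t"
proof -
  have "stein_gaussian_system A 0 Q 0 \<Sigma>0 (\<lambda>_. 0) \<Sigma>" "stein_gaussian_system A 0 Q 0 \<Sigma>0 (\<lambda>_. 0) \<Sigma>'"
    using assms by (simp_all add: stein_system_centered_iff)
  from stein_system_unique[OF this assms(3)] show ?thesis by simp
qed

lemma is_diagonal_iff_diag: "is_diagonal M \<longleftrightarrow> M = diag (\<lambda>i. M $ i $ i)"
  by (auto simp: is_diagonal_def diag_def vec_eq_iff)

lemma diag_eq_sum: "diag f = (\<Sum>i\<in>UNIV. f i *\<^sub>R diag (\<lambda>j. if j = i then 1 else 0))"
proof -
  have "(\<Sum>k\<in>UNIV. f k * (if i = j then if i = k then 1 else 0 else 0)) = (if i = j then f i else 0)" for i j :: 'a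
  proof -
    have "(\<Sum>k\<in>UNIV. f k * (if i = j then if i = k then 1 else 0 else 0)) = (\<Sum>k\<in>UNIV. if k = i then (if i = j then f i else 0) else 0)"
      by (rule sum.cong) auto
    thus ?thesis by simp
  qed
  thus ?thesis by (simp add: vec_eq_iff diag_def)
qed

lemma mat_exp_diag: "mat_exp (diag c) = diag (\<lambda>i. exp (c i))"
proof -
  have pow: "((\<lambda>N. diag c ** N) ^^ k) (mat 1) = diag (\<lambda>i. c i ^ k)" for k
    by (induction k) (simp_all add: diag_1[symmetric] diag_mult_diag)
  have "(\<lambda>k. \<Sum>i\<in>UNIV. (c i ^ k /\<^sub>R fact k) *\<^sub>R diag (\<lambda>j. if j = i then 1 else 0))
     sums (\<Sum>i\<in>UNIV. exp (c i) *\<^sub>R diag (\<lambda>j. if j = i then 1 else 0))"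
    by (intro sums_sum sums_scaleR_left exp_converges)
  also have "(\<lambda>k. \<Sum>i\<in>UNIV. (c i ^ k /\<^sub>R fact k) *\<^sub>R diag (\<lambda>j. if j = i then 1 else 0))
    = (\<lambda>k. (1 / fact k) *\<^sub>R ((\<lambda>N. diag c ** N) ^^ k) (mat 1))"
    unfolding pow by (subst (2) diag_eq_sum) (simp add: scaleR_sum_right divide_inverse)
  also have "(\<Sum>i\<in>UNIV. exp (c i) *\<^sub>R diag (\<lambda>j. if j = i then 1 else 0)) = diag (\<lambda>i. exp (c i))"
    by (rule diag_eq_sum[symmetric])
  finally show ?thesis unfolding mat_exp_def by (rule sums_unique[symmetric])
qed

context
  fixes V :: "real^'n^'n"
  assumes V: "invertible V"
begin

text \<open>The matrices diagonalized by \<open>V\<close> form a commutative algebra with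
  entrywise operations.\<close>

definition diag_in_basis :: "('n \<Rightarrow> real) \<Rightarrow> real^'n^'n" where
  "diag_in_basis f = V ** diag f ** matrix_inv V"

lemma diag_in_basis_mult: "diag_in_basis f ** diag_in_basis g = diag_in_basis (\<lambda>i. f i * g i)"
proof -
  have "diag_in_basis f ** diag_in_basis g = V ** diag f ** (matrix_inv V ** V) ** diag g ** matrix_inv V"
    by (simp only: diag_in_basis_def matrix_mul_assoc)
  also have "\<dots> = V ** (diag f ** diag g) ** matrix_inv V" by (simp add: matrix_inv_inverse[OF V] matrix_mul_assoc)
  finally show ?thesis by (simp add: diag_in_basis_def diag_mult_diag)
qed

lemma diag_in_basis_1: "diag_in_basis (\<lambda>_. 1) = mat 1"
  by (simp add: diag_in_basis_def diag_1 matrix_inv_inverse[OF V])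

lemma diag_in_basis_eq_sum: "diag_in_basis f = (\<Sum>i\<in>UNIV. f i *\<^sub>R diag_in_basis (\<lambda>j. if j = i then 1 else 0))"
proof -
  have l: "linear (\<lambda>M. V ** M ** matrix_inv V)"
    by (rule linearI) (simp_all add: matrix_algebra)
  show ?thesis unfolding diag_in_basis_def
    by (subst diag_eq_sum) (simp add: linear_sum[OF l] linear_scale[OF l])
qed

lemma diag_in_basis_diff: "diag_in_basis f - diag_in_basis g = diag_in_basis (\<lambda>i. f i - g i)"
  by (subst (1 2 3) diag_in_basis_eq_sum) (simp add: sum_subtractf scaleR_diff_left)

lemma diag_in_basis_add: "diag_in_basis f + diag_in_basis g = diag_in_basis (\<lambda>i. f i + g i)"
  by (subst (1 2 3) diag_in_basis_eq_sum) (simp add: sum.distrib scaleR_add_left)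

lemma diag_in_basis_inv:
  assumes "\<And>i. f i \<noteq> 0"
  shows "invertible (diag_in_basis f)" "matrix_inv (diag_in_basis f) = diag_in_basis (\<lambda>i. 1 / f i)"
  using matrix_inv_unique[of "diag_in_basis f" "diag_in_basis (\<lambda>i. 1 / f i)"] assms
  by (simp_all add: diag_in_basis_mult diag_in_basis_1)

lemma diag_in_basis_symmetric_mult:
  assumes "transpose (diag_in_basis f) = diag_in_basis f" "transpose (diag_in_basis g) = diag_in_basis g"
  shows "transpose (diag_in_basis (\<lambda>i. f i * g i)) = diag_in_basis (\<lambda>i. f i * g i)"
proof -
  have "transpose (diag_in_basis f ** diag_in_basis g) = diag_in_basis g ** diag_in_basis f"
    by (simp only: matrix_transpose_mul assms)
  thus ?thesis by (simp add: diag_in_basis_mult mult.commute)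
qed

lemma diag_in_basis_derivative:
  assumes "\<And>i. ((\<lambda>t. f t i) has_real_derivative f' i) (at t within S)"
  shows "((\<lambda>t. diag_in_basis (f t)) has_vector_derivative diag_in_basis f') (at t within S)"
  by (subst (1 2) diag_in_basis_eq_sum)
    (intro has_vector_derivative_sum bounded_linear.has_vector_derivative[OF bounded_linear_scaleR_left]
      assms[unfolded has_real_derivative_iff_has_vector_derivative])

lemma diag_in_basis_positive:
  assumes "diag_in_basis f \<in> Sym_plus"
  shows "0 < f i"
proof -
  let ?v = "V *v axis i 1"
  have "matrix_inv V *v ?v = axis i 1" using matrix_inv_inverse[OF V] by (simp add: matrix_vector_mul_assoc)
  hence nz: "?v \<noteq> 0" by (metis axis_eq_0_iff matrix_vector_mult_0_right zero_neq_one)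
  have "diag f *v axis i 1 = f i *\<^sub>R (axis i 1 :: real^'n)" by (simp add: vec_eq_iff diag_mult_vec axis_def)
  hence "diag_in_basis f *v ?v = f i *\<^sub>R ?v"
    using \<open>matrix_inv V *v ?v = axis i 1\<close>
    by (simp only: diag_in_basis_def matrix_vector_mul_assoc[symmetric] matrix_vector_mult_scaleR)
  hence "0 < f i * (?v \<bullet> ?v)" using Sym_plusD(2)[OF assms nz] by simp
  thus ?thesis using inner_ge_zero[of ?v] by (auto simp: zero_less_mult_iff)
qed

lemma is_diagonal_in_basis:
  assumes "is_diagonal (matrix_inv V ** M ** V)"
  shows "M = diag_in_basis (\<lambda>i. (matrix_inv V ** M ** V) $ i $ i)"
proof -
  have "V ** (matrix_inv V ** M ** V) ** matrix_inv V = (V ** matrix_inv V) ** M ** (V ** matrix_inv V)"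
    by (simp only: matrix_mul_assoc)
  thus ?thesis using assms[unfolded is_diagonal_iff_diag] matrix_inv_inverse[OF V] by (simp add: diag_in_basis_def)
qed

text \<open>Commuting with \<open>V\<close> means that \<open>V\<close> has nonzero entries only
  where \<open>a i = a j\<close>, so \<open>V\<close> commutes with every function of the diagonal
  matrix as well.\<close>

lemma diag_commuting_in_basis:
  assumes "diag a ** V = V ** diag a"
  shows "diag (\<lambda>i. h (a i)) = diag_in_basis (\<lambda>i. h (a i))"
proof -
  have "a i * V $ i $ j = V $ i $ j * a j" for i j
    using arg_cong[OF assms, of "\<lambda>M. M $ i $ j"] by (simp only: diag_mult mult_diag)
  hence "h (a i) * V $ i $ j = V $ i $ j * h (a j)" for i j
    by (metis mult.commute mult_cancel_left)
  hence comm: "diag (\<lambda>i. h (a i)) ** V = V ** diag (\<lambda>i. h (a i))" by (simp add: vec_eq_iff diag_mult mult_diag)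
  have "diag (\<lambda>i. h (a i)) = diag (\<lambda>i. h (a i)) ** V ** matrix_inv V"
    using matrix_inv_inverse(1)[OF V] by (simp add: matrix_mul_assoc[symmetric])
  thus ?thesis unfolding comm by (simp add: diag_in_basis_def)
qed

end

text \<open>In the basis \<open>V\<close> all matrices are diagonal and the equation decouples
  into the logistic equations \<open>\<sigma>' = 2 a \<sigma> (1 - \<sigma> / q)\<close>, whose
  reciprocals \<open>y = 1 / \<sigma>\<close> satisfy the linear equations \<open>y' = - 2 a (y -
  1 / q)\<close>. All matrices involved arise from commuting symmetric matrices by sums, products
  and inverses and are therefore symmetric, so that the symmetrization in the equation has no
  effect on them. Uniqueness identifies the given solution with this one.\<close>

lemma stein_lyapunov_closed_form:
  fixes A Q \<Sigma>0 V :: "real^'n^'n"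
  assumes A: "A \<in> Sym_plus" and \<Sigma>0: "\<Sigma>0 \<in> Sym_plus" and Q: "Q \<in> Sym_plus"
    and dA: "is_diagonal A" and V: "invertible V"
    and dS: "is_diagonal (matrix_inv V ** \<Sigma>0 ** V)" and dQ: "is_diagonal (matrix_inv V ** Q ** V)"
    and comm: "A ** V = V ** A" and sol: "stein_lyapunov_equation A Q \<Sigma>0 \<Sigma>" and t: "0 \<le> t"
  shows "\<Sigma> t ** Q = Q ** \<Sigma> t" "invertible (\<Sigma> t)"
    "matrix_inv (\<Sigma> t) = matrix_inv Q + mat_exp ((- 2 * t) *\<^sub>R A) ** (matrix_inv \<Sigma>0 - matrix_inv Q)"
proof -
  let ?D = "diag_in_basis V"
  note mult = diag_in_basis_mult[OF V] and symm = diag_in_basis_symmetric_mult[OF V]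
  define a where "a i = A $ i $ i" for i
  define s where "s i = (matrix_inv V ** \<Sigma>0 ** V) $ i $ i" for i
  define q where "q i = (matrix_inv V ** Q ** V) $ i $ i" for i
  have Aa: "A = diag a" using dA unfolding is_diagonal_iff_diag a_def .
  have fA: "diag (\<lambda>i. h (a i)) = ?D (\<lambda>i. h (a i))" for h
    by (rule diag_commuting_in_basis[OF V]) (use comm Aa in simp)
  have AD: "A = ?D a" using fA[of "\<lambda>x. x"] Aa by simp
  have SD: "\<Sigma>0 = ?D s" unfolding s_def by (rule is_diagonal_in_basis[OF V dS])
  have QD: "Q = ?D q" unfolding q_def by (rule is_diagonal_in_basis[OF V dQ])
  have a: "0 < a i" for i using diag_in_basis_positive[OF V, of a i] A AD by simp
  have s: "0 < s i" for i using diag_in_basis_positive[OF V, of s i] \<Sigma>0 SD by simp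
  have q: "0 < q i" for i using diag_in_basis_positive[OF V, of q i] Q QD by simp
  define y where "y t i = 1 / q i + exp (- 2 * t * a i) * (1 / s i - 1 / q i)" for t i
  have y: "0 < y t i" if "0 \<le> t" for t i
  proof -
    have E: "0 < exp (- 2 * t * a i)" "exp (- 2 * t * a i) \<le> 1" using that a[of i] by auto
    have "y t i = (1 - exp (- 2 * t * a i)) / q i + exp (- 2 * t * a i) / s i"
      by (simp add: y_def diff_divide_distrib right_diff_distrib)
    also have "\<dots> > 0" using E s[of i] q[of i] by (intro add_nonneg_pos divide_nonneg_pos divide_pos_pos) auto
    finally show ?thesis .
  qed
  have Qi: "matrix_inv Q = ?D (\<lambda>i. 1 / q i)" unfolding QD by (rule diag_in_basis_inv[OF V]) (use q in \<open>simp add: less_imp_neq[symmetric]\<close>)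
  have Si: "matrix_inv \<Sigma>0 = ?D (\<lambda>i. 1 / s i)" unfolding SD by (rule diag_in_basis_inv[OF V]) (use s in \<open>simp add: less_imp_neq[symmetric]\<close>)
  have Ex: "mat_exp ((- 2 * t) *\<^sub>R A) = ?D (\<lambda>i. exp (- 2 * t * a i))" for t
  proof -
    have "(- 2 * t) *\<^sub>R A = diag (\<lambda>i. - 2 * t * a i)" by (simp add: Aa diag_def vec_eq_iff)
    thus ?thesis using fA[of "\<lambda>x. exp (- 2 * t * x)"] by (simp add: mat_exp_diag)
  qed
  have Y: "?D (y t) = matrix_inv Q + mat_exp ((- 2 * t) *\<^sub>R A) ** (matrix_inv \<Sigma>0 - matrix_inv Q)" for t
    unfolding Qi Si Ex by (simp add: mult diag_in_basis_add[OF V] diag_in_basis_diff[OF V] y_def[abs_def])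
  define S where "S t = ?D (\<lambda>i. 1 / y t i)" for t
  have Sinv: "invertible (S t)" "matrix_inv (S t) = ?D (y t)" if "0 \<le> t" for t
  proof -
    have "1 / y t i \<noteq> 0" for i using y[OF that, of i] by simp
    from diag_in_basis_inv[OF V, of "\<lambda>i. 1 / y t i", OF this]
    show "invertible (S t)" "matrix_inv (S t) = ?D (y t)" unfolding S_def by simp_all
  qed
  have symA: "transpose (?D a) = ?D a" using Sym_plusD(1)[OF A] AD by simp
  have symQi: "transpose (?D (\<lambda>i. 1 / q i)) = ?D (\<lambda>i. 1 / q i)" using Sym_plusD(1)[OF Sym_plus_matrix_inv[OF Q]] Qi by simp
  have symSi: "transpose (?D (\<lambda>i. 1 / s i)) = ?D (\<lambda>i. 1 / s i)" using Sym_plusD(1)[OF Sym_plus_matrix_inv[OF \<Sigma>0]] Si by simp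
  have symY: "transpose (?D (y t)) = ?D (y t)" for t
  proof -
    have "transpose (?D (\<lambda>i. exp (- 2 * t * a i))) = ?D (\<lambda>i. exp (- 2 * t * a i))"
      using fA[of "\<lambda>x. exp (- 2 * t * x)"] by (metis transpose_diag)
    moreover have "transpose (?D (\<lambda>i. 1 / s i - 1 / q i)) = ?D (\<lambda>i. 1 / s i - 1 / q i)"
      unfolding diag_in_basis_diff[OF V, symmetric] by (simp add: matrix_algebra symQi symSi)
    ultimately have "transpose (?D (\<lambda>i. exp (- 2 * t * a i) * (1 / s i - 1 / q i))) = ?D (\<lambda>i. exp (- 2 * t * a i) * (1 / s i - 1 / q i))"
      by (rule symm)
    moreover have "?D (y t) = ?D (\<lambda>i. 1 / q i) + ?D (\<lambda>i. exp (- 2 * t * a i) * (1 / s i - 1 / q i))"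
      by (simp add: diag_in_basis_add[OF V] y_def[abs_def])
    ultimately show ?thesis by (simp add: matrix_algebra symQi)
  qed
  have symS: "transpose (S t) = S t" if "0 \<le> t" for t
  proof -
    have yz: "y t i \<noteq> 0" for i using y[OF that, of i] by simp
    have "S t = matrix_inv (?D (y t))" unfolding S_def by (rule diag_in_basis_inv(2)[OF V yz, symmetric])
    thus ?thesis using transpose_matrix_inv[OF diag_in_basis_inv(1)[OF V yz]] symY by simp
  qed
  have "stein_lyapunov_equation A Q \<Sigma>0 S"
    unfolding stein_lyapunov_equation_def
  proof (intro conjI allI impI)
    have "y 0 = (\<lambda>i. 1 / s i)" by (simp add: y_def[abs_def])
    thus "S 0 = \<Sigma>0" unfolding S_def SD by simp
    fix t :: real assume t: "0 \<le> t"
    define \<sigma> where "\<sigma> i = 1 / y t i" for i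
    have yi: "0 < y t i" for i by (rule y[OF t])
    have St: "S t = ?D \<sigma>" by (simp add: S_def \<sigma>_def[abs_def])
    have "S t ** A = ?D (\<lambda>i. \<sigma> i * a i)" unfolding St AD by (rule mult)
    moreover have "mat 1 - S t ** matrix_inv Q = ?D (\<lambda>i. 1 - \<sigma> i * (1 / q i))"
      unfolding St Qi mult diag_in_basis_1[OF V, symmetric] diag_in_basis_diff[OF V] ..
    ultimately have X: "S t ** A ** (mat 1 - S t ** matrix_inv Q) = ?D (\<lambda>i. (\<sigma> i * a i) * (1 - \<sigma> i * (1 / q i)))"
      by (simp only: mult)
    have "transpose (?D (\<lambda>i. \<sigma> i * a i)) = ?D (\<lambda>i. \<sigma> i * a i)" using symS[OF t] St symA by (intro symm) auto
    moreover have "transpose (?D (\<lambda>i. 1 - \<sigma> i * (1 / q i))) = ?D (\<lambda>i. 1 - \<sigma> i * (1 / q i))"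
    proof -
      have "transpose (?D (\<lambda>i. \<sigma> i * (1 / q i))) = ?D (\<lambda>i. \<sigma> i * (1 / q i))" using symS[OF t] St symQi by (intro symm) auto
      thus ?thesis unfolding diag_in_basis_diff[OF V, symmetric] diag_in_basis_1[OF V] by (simp add: matrix_algebra)
    qed
    ultimately have "transpose (?D (\<lambda>i. (\<sigma> i * a i) * (1 - \<sigma> i * (1 / q i)))) = ?D (\<lambda>i. (\<sigma> i * a i) * (1 - \<sigma> i * (1 / q i)))"
      by (rule symm)
    hence rhs: "2 *\<^sub>R Sym (S t ** A ** (mat 1 - S t ** matrix_inv Q)) = ?D (\<lambda>i. 2 * ((\<sigma> i * a i) * (1 - \<sigma> i * (1 / q i))))"
      unfolding X two_Sym by (simp add: diag_in_basis_add[OF V] mult.assoc)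
    show "(S has_vector_derivative 2 *\<^sub>R Sym (S t ** A ** (mat 1 - S t ** matrix_inv Q))) (at t within {0..})"
      unfolding rhs unfolding S_def
    proof (rule diag_in_basis_derivative[OF V])
      fix i
      have dy: "((\<lambda>t. y t i) has_real_derivative (- 2 * a i) * (y t i - 1 / q i)) (at t within {0..})"
        unfolding y_def using s[of i] q[of i] by (auto intro!: derivative_eq_intros simp: algebra_simps)
      have "((\<lambda>t. 1 / y t i) has_real_derivative - ((- 2 * a i) * (y t i - 1 / q i)) / (y t i * y t i)) (at t within {0..})"
        using DERIV_divide[OF DERIV_const dy, of 1] yi[of i] by simp
      moreover have "- ((- 2 * a i) * (y t i - 1 / q i)) / (y t i * y t i) = 2 * ((\<sigma> i * a i) * (1 - \<sigma> i * (1 / q i)))"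
        using yi[of i] q[of i] by (simp add: \<sigma>_def field_simps)
      ultimately show "((\<lambda>t. 1 / y t i) has_real_derivative 2 * ((\<sigma> i * a i) * (1 - \<sigma> i * (1 / q i)))) (at t within {0..})"
        by simp
    qed
  qed
  from stein_lyapunov_unique[OF this sol t] have eq: "\<Sigma> t = S t" .
  show "\<Sigma> t ** Q = Q ** \<Sigma> t" unfolding eq S_def QD by (simp add: mult mult.commute)
  show "invertible (\<Sigma> t)" unfolding eq by (rule Sinv(1)[OF t])
  show "matrix_inv (\<Sigma> t) = matrix_inv Q + mat_exp ((- 2 * t) *\<^sub>R A) ** (matrix_inv \<Sigma>0 - matrix_inv Q)"
    unfolding eq Sinv(2)[OF t] by (rule Y)
qed

section \<open>Quadratic interpolation\<close>

text \<open>A quadratic function is determined by its values at the points \<open>0\<close>,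
  \<open>e\<^sub>i\<close> and \<open>e\<^sub>i + e\<^sub>j\<close>. Extracting coefficients from
  these values commutes with differentiation in time.\<close>

definition quad_coeff :: "(real^'n \<Rightarrow> real) \<Rightarrow> 'n \<Rightarrow> 'n \<Rightarrow> real" where
  "quad_coeff g i j = (g (axis i 1 + axis j 1) - g (axis i 1) - g (axis j 1) + g 0) / 2"

definition lin_coeff :: "(real^'n \<Rightarrow> real) \<Rightarrow> 'n \<Rightarrow> real" where
  "lin_coeff g i = g (axis i 1) - g 0 - quad_coeff g i i"

definition interpolant :: "(real^'n \<Rightarrow> real) \<Rightarrow> real^'n \<Rightarrow> real" where
  "interpolant g x = g 0 + (\<Sum>i\<in>UNIV. lin_coeff g i * x $ i) + (\<Sum>i\<in>UNIV. \<Sum>j\<in>UNIV. quad_coeff g i j * (x $ i * x $ j))"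

definition quadratic :: "(real^'n \<Rightarrow> real) \<Rightarrow> bool" where
  "quadratic g \<longleftrightarrow> (\<exists>c l S. transpose S = S \<and> (\<forall>x. g x = c + l \<bullet> x + x \<bullet> (S *v x)))"

lemma inner_matrix_axis: "axis i 1 \<bullet> (S *v axis j 1) = (S :: real^'n^'n) $ i $ j"
  by (simp add: inner_axis' matrix_vector_mult_basis column_def)

lemma quadratic_coeffs:
  fixes S :: "real^'n^'n"
  assumes S: "transpose S = S" and g: "\<And>x. g x = c + l \<bullet> x + x \<bullet> (S *v x)"
  shows "quad_coeff g i j = S $ i $ j" "lin_coeff g i = l $ i"
proof -
  have sym: "S $ i $ j = S $ j $ i" for i j using S by (metis (no_types) transpose_def vec_lambda_beta)
  have q: "quad_coeff g i j = S $ i $ j" for i j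
    using sym[of i j] by (simp add: quad_coeff_def g matrix_algebra matrix_vector_right_distrib inner_add_left inner_add_right inner_matrix_axis inner_axis)
  show "quad_coeff g i j = S $ i $ j" by (rule q)
  show "lin_coeff g i = l $ i" unfolding lin_coeff_def q by (simp add: g inner_matrix_axis inner_axis matrix_algebra)
qed

lemma interpolant_quadratic:
  assumes "quadratic g"
  shows "interpolant g x = g x"
proof -
  obtain c l S where S: "transpose S = S" and g: "\<And>x. g x = c + l \<bullet> x + x \<bullet> (S *v x)"
    using assms unfolding quadratic_def by blast
  have "(\<Sum>i\<in>UNIV. \<Sum>j\<in>UNIV. S $ i $ j * (x $ i * x $ j)) = x \<bullet> (S *v x)"
    by (simp add: inner_vec_def matrix_vector_mult_def sum_distrib_left ac_simps)
  thus ?thesis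
    unfolding interpolant_def quadratic_coeffs[OF S g] by (simp add: g inner_vec_def[of l] matrix_algebra)
qed

lemma quadratic_interpolant: "quadratic (interpolant g)"
proof -
  let ?S = "\<chi> i j. quad_coeff g i j" and ?l = "\<chi> i. lin_coeff g i"
  have "transpose ?S = ?S" by (simp add: transpose_def vec_eq_iff quad_coeff_def add.commute)
  moreover have "interpolant g x = g 0 + ?l \<bullet> x + x \<bullet> (?S *v x)" for x
    by (simp add: interpolant_def inner_vec_def matrix_vector_mult_def sum_distrib_left ac_simps)
  ultimately show ?thesis unfolding quadratic_def by blast
qed

lemma quadratic_const: "quadratic (\<lambda>_. c)"
  unfolding quadratic_def by (intro exI[of _ c] exI[of _ 0]) (simp add: matrix_algebra)

lemma quadratic_add:
  assumes "quadratic f" "quadratic g"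
  shows "quadratic (\<lambda>x. f x + g x)"
proof -
  obtain c l S c' l' S' where "transpose S = S" "\<And>x. f x = c + l \<bullet> x + x \<bullet> (S *v x)"
    "transpose S' = S'" "\<And>x. g x = c' + l' \<bullet> x + x \<bullet> (S' *v x)"
    using assms unfolding quadratic_def by blast
  thus ?thesis unfolding quadratic_def
    by (intro exI[of _ "c + c'"] exI[of _ "l + l'"] exI[of _ "S + S'"])
      (simp add: matrix_algebra matrix_vector_mult_add_rdistrib inner_add_left inner_add_right)
qed

lemma quadratic_cmult:
  assumes "quadratic f"
  shows "quadratic (\<lambda>x. a * f x)"
proof -
  obtain c l S where "transpose S = S" "\<And>x. f x = c + l \<bullet> x + x \<bullet> (S *v x)"
    using assms unfolding quadratic_def by blast
  thus ?thesis unfolding quadratic_def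
    by (intro exI[of _ "a * c"] exI[of _ "a *\<^sub>R l"] exI[of _ "a *\<^sub>R S"])
      (simp add: matrix_algebra scaleR_matrix_vector_assoc[symmetric] algebra_simps)
qed

lemma quadratic_affine_form:
  fixes P M :: "real^'n^'n"
  assumes M: "transpose M = M"
  shows "quadratic (\<lambda>x. (P *v x + v) \<bullet> (M *v (P *v x + v)))"
proof -
  have P: "(P *v x) \<bullet> z = x \<bullet> (transpose P *v z)" for x z
    by (subst inner_commute, subst inner_matrix_vector) (simp add: inner_commute)
  have "(P *v x + v) \<bullet> (M *v (P *v x + v))
    = v \<bullet> (M *v v) + (2 *\<^sub>R (transpose P *v (M *v v))) \<bullet> x + x \<bullet> ((transpose P ** M ** P) *v x)" for x
  proof -
    have "v \<bullet> (M *v (P *v x)) = (P *v x) \<bullet> (M *v v)"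
      using inner_matrix_vector[of v M "P *v x"] M by (simp only: inner_commute)
    hence "(P *v x + v) \<bullet> (M *v (P *v x + v)) = v \<bullet> (M *v v) + 2 * ((P *v x) \<bullet> (M *v v)) + (P *v x) \<bullet> (M *v (P *v x))"
      by (simp only: matrix_vector_right_distrib inner_add_left inner_add_right)
    thus ?thesis
      unfolding P by (simp only: matrix_vector_mul_assoc[symmetric] inner_scaleR_right inner_commute[of _ x])
  qed
  moreover have "transpose (transpose P ** M ** P) = transpose P ** M ** P"
    by (simp add: matrix_transpose_mul M matrix_mul_assoc)
  ultimately show ?thesis unfolding quadratic_def by blast
qed

lemma quadratic_compose_affine:
  fixes P :: "real^'n^'n"
  assumes "quadratic g"
  shows "quadratic (\<lambda>x. g (P *v x + v))"
proof -
  obtain c l S where S: "transpose S = S" and g: "\<And>x. g x = c + l \<bullet> x + x \<bullet> (S *v x)"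
    using assms unfolding quadratic_def by blast
  have "quadratic (\<lambda>x. c + l \<bullet> (P *v x + v))"
    unfolding quadratic_def
    by (intro exI[of _ "c + l \<bullet> v"] exI[of _ "transpose P *v l"] exI[of _ 0])
      (simp add: inner_add_right inner_matrix_vector[of l P] matrix_algebra del: transpose_matrix_vector)
  from quadratic_add[OF this quadratic_affine_form[OF S]] show ?thesis by (simp add: g)
qed

lemma interpolant_linear:
  "interpolant (\<lambda>x. c - a * f x - h x) x = c - a * interpolant f x - interpolant h x"
proof -
  have q: "quad_coeff (\<lambda>x. c - a * f x - h x) i j = - a * quad_coeff f i j - quad_coeff h i j" for i j
    by (simp add: quad_coeff_def field_simps)
  have l: "lin_coeff (\<lambda>x. c - a * f x - h x) i = - a * lin_coeff f i - lin_coeff h i" for i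
    unfolding lin_coeff_def q by (simp add: algebra_simps)
  show ?thesis unfolding interpolant_def q l
    by (simp add: left_diff_distrib sum_subtractf sum_negf sum_distrib_left mult.assoc algebra_simps)
qed

lemma interpolant_derivatives:
  assumes "\<And>z. ((\<lambda>s. \<phi> s z) has_real_derivative D z) (at t)"
  shows "((\<lambda>s. quad_coeff (\<phi> s) i j) has_real_derivative quad_coeff D i j) (at t)"
    "((\<lambda>s. lin_coeff (\<phi> s) i) has_real_derivative lin_coeff D i) (at t)"
    "((\<lambda>s. interpolant (\<phi> s) x) has_real_derivative interpolant D x) (at t)"
proof -
  show q: "((\<lambda>s. quad_coeff (\<phi> s) i j) has_real_derivative quad_coeff D i j) (at t)" for i j
    unfolding quad_coeff_def by (intro DERIV_cdivide DERIV_add DERIV_diff assms)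
  show l: "((\<lambda>s. lin_coeff (\<phi> s) i) has_real_derivative lin_coeff D i) (at t)" for i
    unfolding lin_coeff_def by (intro DERIV_diff assms q)
  show "((\<lambda>s. interpolant (\<phi> s) x) has_real_derivative interpolant D x) (at t)"
    unfolding interpolant_def by (intro DERIV_add DERIV_sum DERIV_cmult_right assms q l)
qed

lemma continuous_on_interpolant:
  assumes "\<And>z. continuous_on T (\<lambda>s. \<phi> s z)"
  shows "continuous_on T (\<lambda>s. quad_coeff (\<phi> s) i j)" "continuous_on T (\<lambda>s. lin_coeff (\<phi> s) i)"
    "continuous_on T (\<lambda>s. interpolant (\<phi> s) x)"
  unfolding interpolant_def lin_coeff_def quad_coeff_def by (auto intro!: continuous_intros assms)

lemma has_vector_derivative_vecI:
  fixes f :: "real \<Rightarrow> real^'n"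
  assumes "\<And>i. ((\<lambda>t. f t $ i) has_real_derivative D $ i) (at t)"
  shows "(f has_vector_derivative D) (at t)"
proof -
  have e: "v = (\<Sum>i\<in>UNIV. v $ i *\<^sub>R axis i 1)" for v :: "real^'n"
    using basis_expansion[of v] by (simp add: scalar_mult_eq_scaleR)
  have "((\<lambda>t. \<Sum>i\<in>UNIV. f t $ i *\<^sub>R (axis i 1 :: real^'n)) has_vector_derivative (\<Sum>i\<in>UNIV. D $ i *\<^sub>R axis i 1)) (at t)"
    by (intro has_vector_derivative_sum bounded_linear.has_vector_derivative[OF bounded_linear_scaleR_left]
      assms[unfolded has_real_derivative_iff_has_vector_derivative])
  thus ?thesis by (simp only: e[symmetric])
qed

lemma has_vector_derivative_matrixI:
  fixes f :: "real \<Rightarrow> real^'n^'m"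
  assumes "\<And>i j. ((\<lambda>t. f t $ i $ j) has_real_derivative D $ i $ j) (at t)"
  shows "(f has_vector_derivative D) (at t)"
proof -
  have e: "M = (\<Sum>i\<in>UNIV. outer (axis i 1) (M $ i))" for M :: "real^'n^'m"
  proof -
    have "(\<Sum>k\<in>UNIV. (axis k 1 :: real^'m) $ i * M $ k $ j) = M $ i $ j" for i j
    proof -
      have "(\<Sum>k\<in>UNIV. (axis k 1 :: real^'m) $ i * M $ k $ j) = (\<Sum>k\<in>UNIV. if k = i then M $ i $ j else 0)"
        by (rule sum.cong) (auto simp: axis_def)
      thus ?thesis by simp
    qed
    thus ?thesis by (simp add: vec_eq_iff outer_def)
  qed
  have "((\<lambda>t. \<Sum>i\<in>UNIV. outer (axis i 1) (f t $ i)) has_vector_derivative (\<Sum>i\<in>UNIV. outer (axis i 1) (D $ i))) (at t)"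
    by (intro has_vector_derivative_sum
      bounded_linear.has_vector_derivative[OF bounded_bilinear.bounded_linear_right[OF bounded_bilinear_outer]]
      has_vector_derivative_vecI assms)
  thus ?thesis by (simp only: e[symmetric])
qed

section \<open>The accelerated flow\<close>

text \<open>Since \<open>\<alpha>\<close> is nonnegative, \<open>\<psi>\<^sup>2\<close> is
  nonincreasing. This replaces an integrating factor, which would presuppose that
  \<open>\<alpha>\<close> is integrable.\<close>

lemma damped_zero:
  fixes \<psi> :: "real \<Rightarrow> real"
  assumes "0 \<le> T" "continuous_on {0..T} \<psi>" "\<psi> 0 = 0"
    and der: "\<And>t. 0 < t \<Longrightarrow> t < T \<Longrightarrow> (\<psi> has_real_derivative - \<alpha> t * \<psi> t) (at t)"
    and \<alpha>: "\<And>t. 0 \<le> t \<Longrightarrow> 0 \<le> \<alpha> t"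
  shows "\<psi> T = 0"
proof -
  have "\<psi> T * \<psi> T \<le> \<psi> 0 * \<psi> 0 * exp (0 * (T - 0))"
  proof (rule gronwall[OF \<open>0 \<le> T\<close>])
    show "continuous_on {0..T} (\<lambda>t. \<psi> t * \<psi> t)" by (intro continuous_intros assms)
    fix t assume t: "0 < t" "t < T"
    show "((\<lambda>t. \<psi> t * \<psi> t) has_real_derivative (- \<alpha> t * \<psi> t) * \<psi> t + (- \<alpha> t * \<psi> t) * \<psi> t) (at t)"
      by (rule DERIV_mult[OF der[OF t] der[OF t]])
    show "(- \<alpha> t * \<psi> t) * \<psi> t + (- \<alpha> t * \<psi> t) * \<psi> t \<le> 0 * (\<psi> t * \<psi> t)"
      using \<alpha>[of t] t by (simp add: mult.assoc)
  qed
  hence "\<psi> T * \<psi> T \<le> 0" by (simp add: assms(3))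
  thus ?thesis by (metis mult_eq_0_iff order_antisym zero_le_square)
qed

text \<open>As for the Stein gradient flow, the velocity field is affine and the density stays
  Gaussian. Along the characteristics \<open>X\<close> the potential \<open>\<phi> t x = \<Phi> t
  (X t x)\<close> then satisfies \<open>\<phi>' = c - \<alpha> \<phi> - h\<close>, where
  \<open>c\<close> does not depend on \<open>x\<close> and \<open>h\<close> is quadratic in
  \<open>x\<close>. Subtracting from \<open>\<phi>\<close> its quadratic interpolant removes
  \<open>c\<close> and \<open>h\<close>, so the difference solves \<open>\<psi>' = - \<alpha>
  \<psi>\<close> with \<open>\<psi> 0 = 0\<close> and vanishes. Thus the potential is quadratic,
  and its coefficients, centered at the mean, are \<open>\<nu>\<close> and
  \<open>S\<close>.\<close>

theorem accelerated_flow_gaussian: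
  fixes A Q \<Sigma>0 :: "real^'n^'n"
  assumes A: "A \<in> Sym_plus" and \<Sigma>0: "\<Sigma>0 \<in> Sym_plus" and Q: "Q \<in> Sym_plus"
    and \<alpha>: "\<And>t. 0 \<le> t \<Longrightarrow> 0 \<le> \<alpha> t"
    and flow: "accelerated_stein_gradient_flow (bilinear_kernel A) (KL_first_variation (gaussian b Q)) \<alpha> (gaussian \<mu>0 \<Sigma>0) \<rho> \<Phi>"
  shows "\<exists>\<mu> \<Sigma> \<nu> S. accelerated_gaussian_system A b Q \<alpha> \<mu>0 \<Sigma>0 \<mu> \<Sigma> \<nu> S \<and>
           (\<forall>t\<ge>0. \<Sigma> t \<in> Sym_plus \<and> \<rho> t = gaussian (\<mu> t) (\<Sigma> t))"
proof -
  note As = Sym_plusD(1)[OF A] and Qs = Sym_plusD(1)[OF Sym_plus_matrix_inv[OF Q]]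
  let ?K = "bilinear_kernel A" and ?\<delta> = "KL_first_variation (gaussian b Q)"
  define F where "F t = kernel_field ?K (\<rho> t) (\<Phi> t)" for t
  obtain c0 where init: "\<rho> 0 = gaussian \<mu>0 \<Sigma>0" and \<Phi>0: "\<And>x. \<Phi> 0 x = c0"
    and smooth: "\<And>t. 0 \<le> t \<Longrightarrow> smooth_on UNIV (\<Phi> t)"
    and c\<rho>: "continuous_on ({0..} \<times> UNIV) (\<lambda>(t, x). \<rho> t x)" and c\<Phi>: "continuous_on ({0..} \<times> UNIV) (\<lambda>(t, x). \<Phi> t x)"
    and d\<rho>: "(\<lambda>(t, x). \<rho> t x) differentiable_on ({0<..} \<times> UNIV)" and d\<Phi>: "(\<lambda>(t, x). \<Phi> t x) differentiable_on ({0<..} \<times> UNIV)"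
    and int: "\<And>t x. 0 \<le> t \<Longrightarrow> integrable lborel (\<lambda>y. (?K x y * \<rho> t y) *\<^sub>R grad (\<Phi> t) y)"
    and cF: "continuous_on ({0..} \<times> UNIV) (\<lambda>(t, x). F t x)"
    and pde: "\<And>t x. 0 < t \<Longrightarrow> ((\<lambda>s. \<rho> s x) has_real_derivative - divergence (\<lambda>z. \<rho> t z *\<^sub>R F t z) x) (at t)"
    and pde\<Phi>: "\<And>t. 0 < t \<Longrightarrow> \<exists>c. \<forall>x. ((\<lambda>s. \<Phi> s x) has_real_derivative
        c - \<alpha> t * \<Phi> t x - (\<integral>y. ?K y x * (grad (\<Phi> t) y \<bullet> grad (\<Phi> t) x) * \<rho> t y \<partial>lborel) - ?\<delta> (\<rho> t) x) (at t)"
    using flow unfolding accelerated_stein_gradient_flow_def F_def by auto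
  have open0: "open ({0<..} \<times> UNIV :: (real \<times> (real^'n)) set)" by (intro open_Times) auto
  have diff: "(\<lambda>(t, x). \<rho> t x) differentiable (at (t, x))" "(\<lambda>(t, x). \<Phi> t x) differentiable (at (t, x))" if "0 < t" for t x
    using d\<rho> d\<Phi> that unfolding differentiable_on_def by (auto simp: at_within_open[OF _ open0])
  have aff: "F t x = F t 0 + linear_part (F t) *v x" if "0 \<le> t" for t x
    unfolding F_def by (rule kernel_field_linear_part[OF int[OF that]])
  obtain P p \<mu> \<Sigma> where P0: "P 0 = mat 1" and p0: "p 0 = 0"
    and dP: "\<And>t. 0 \<le> t \<Longrightarrow> (P has_vector_derivative linear_part (F t) ** P t) (at t within {0..})"
    and dp: "\<And>t. 0 \<le> t \<Longrightarrow> (p has_vector_derivative linear_part (F t) *v p t + F t 0) (at t within {0..})"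
    and iP: "\<And>t. 0 \<le> t \<Longrightarrow> invertible (P t)"
    and m0: "\<mu> 0 = \<mu>0" and S0: "\<Sigma> 0 = \<Sigma>0"
    and d\<mu>: "\<And>t. 0 \<le> t \<Longrightarrow> (\<mu> has_vector_derivative F t (\<mu> t)) (at t within {0..})"
    and d\<Sigma>: "\<And>t. 0 \<le> t \<Longrightarrow> (\<Sigma> has_vector_derivative linear_part (F t) ** \<Sigma> t + \<Sigma> t ** transpose (linear_part (F t))) (at t within {0..})"
    and SP: "\<And>t. 0 \<le> t \<Longrightarrow> \<Sigma> t \<in> Sym_plus" and \<rho>: "\<And>t. 0 \<le> t \<Longrightarrow> \<rho> t = gaussian (\<mu> t) (\<Sigma> t)"
  proof (rule gaussian_transport[OF c\<rho> diff(1) pde cF aff init \<Sigma>0], assumption+)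
    fix P p \<mu> \<Sigma>
    assume "P 0 = mat 1" "p 0 = 0"
      "\<And>t. 0 \<le> t \<Longrightarrow> (P has_vector_derivative linear_part (F t) ** P t) (at t within {0..})"
      "\<And>t. 0 \<le> t \<Longrightarrow> (p has_vector_derivative linear_part (F t) *v p t + F t 0) (at t within {0..})"
      "\<And>t. 0 \<le> t \<Longrightarrow> invertible (P t)"
      "\<mu> 0 = \<mu>0" "\<Sigma> 0 = \<Sigma>0"
      "\<And>t. 0 \<le> t \<Longrightarrow> (\<mu> has_vector_derivative F t (\<mu> t)) (at t within {0..})"
      "\<And>t. 0 \<le> t \<Longrightarrow> (\<Sigma> has_vector_derivative linear_part (F t) ** \<Sigma> t + \<Sigma> t ** transpose (linear_part (F t))) (at t within {0..})"
      "\<And>t. 0 \<le> t \<Longrightarrow> \<Sigma> t \<in> Sym_plus" "\<And>t. 0 \<le> t \<Longrightarrow> \<rho> t = gaussian (\<mu> t) (\<Sigma> t)"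
    thus thesis by (rule that)
  qed
  have grad_has: "(\<Phi> t has_derivative (\<lambda>h. grad (\<Phi> t) x \<bullet> h)) (at x)" if t: "0 \<le> t" for t x
  proof -
    have "C_k_on 1 UNIV (\<Phi> t)" using smooth[OF t] by (simp only: smooth_on_def)
    then obtain g where "(\<Phi> t has_derivative (\<lambda>h. \<Sum>e\<in>Basis. (h \<bullet> e) * g e x)) (at x)" by auto
    moreover have "(\<lambda>h. \<Sum>e\<in>Basis. (h \<bullet> e) * g e x) = (\<lambda>h. (\<Sum>e\<in>Basis. g e x *\<^sub>R e) \<bullet> h)"
      by (simp add: inner_sum_left inner_sum_right inner_commute mult.commute fun_eq_iff)
    ultimately have d: "(\<Phi> t has_derivative (\<lambda>h. (\<Sum>e\<in>Basis. g e x *\<^sub>R e) \<bullet> h)) (at x)" by simp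
    show ?thesis unfolding grad_eqI[OF d] by (rule d)
  qed
  have quad_int: "(\<integral>y. ?K y x * (grad (\<Phi> t) y \<bullet> grad (\<Phi> t) x) * \<rho> t y \<partial>lborel) = F t x \<bullet> grad (\<Phi> t) x" if t: "0 \<le> t" for t x
  proof -
    have Ksym: "?K y x = ?K x y" for y
      using inner_matrix_vector[of y A x] As by (simp add: bilinear_kernel_def inner_commute)
    have "F t x \<bullet> grad (\<Phi> t) x = (\<integral>y. ((?K x y * \<rho> t y) *\<^sub>R grad (\<Phi> t) y) \<bullet> grad (\<Phi> t) x \<partial>lborel)"
      unfolding F_def kernel_field_def by (rule integral_inner_left[OF int[OF t], symmetric])
    thus ?thesis by (simp add: Ksym ac_simps)
  qed
  have "\<forall>t. \<exists>c. 0 < t \<longrightarrow> (\<forall>x. ((\<lambda>s. \<Phi> s x) has_real_derivative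
        c - \<alpha> t * \<Phi> t x - F t x \<bullet> grad (\<Phi> t) x - ?\<delta> (\<rho> t) x) (at t))"
  proof
    fix t
    show "\<exists>c. 0 < t \<longrightarrow> (\<forall>x. ((\<lambda>s. \<Phi> s x) has_real_derivative
        c - \<alpha> t * \<Phi> t x - F t x \<bullet> grad (\<Phi> t) x - ?\<delta> (\<rho> t) x) (at t))"
    proof (cases "0 < t")
      case True
      from pde\<Phi>[OF True] show ?thesis by (simp only: quad_int[OF less_imp_le[OF True]] True simp_thms)
    qed simp
  qed
  from choice[OF this] obtain c where \<Phi>t: "\<And>t x. 0 < t \<Longrightarrow> ((\<lambda>s. \<Phi> s x) has_real_derivative
        c t - \<alpha> t * \<Phi> t x - F t x \<bullet> grad (\<Phi> t) x - ?\<delta> (\<rho> t) x) (at t)" by blast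
  define X where "X t x = P t *v x + p t" for t x
  have dX: "((\<lambda>t. X t x) has_vector_derivative F t (X t x)) (at t within {0..})" if t: "0 \<le> t" for t x
  proof -
    have "((\<lambda>s. P s *v x) has_vector_derivative (linear_part (F t) ** P t) *v x) (at t within {0..})"
      by (rule bounded_linear.has_vector_derivative[OF bounded_bilinear.bounded_linear_left[OF bounded_bilinear_matrix_vector_mult] dP[OF t]])
    from has_vector_derivative_add[OF this dp[OF t]]
    show ?thesis unfolding aff[OF t, of "X t x"]
      by (simp add: X_def[abs_def] matrix_vector_right_distrib matrix_vector_mul_assoc ac_simps)
  qed
  have cX: "continuous_on {0..} (\<lambda>t. X t x)" for x by (rule has_vector_derivative_continuous_on[OF dX]) simp
  define \<phi> where "\<phi> t x = \<Phi> t (X t x)" for t x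
  have c\<phi>: "continuous_on {0..} (\<lambda>t. \<phi> t x)" for x
  proof -
    have "continuous_on {0..} (\<lambda>t. (\<lambda>(t, x). \<Phi> t x) (t, X t x))"
      by (rule continuous_on_compose2[OF c\<Phi>]) (auto intro!: continuous_intros cX)
    thus ?thesis by (simp add: \<phi>_def)
  qed
  have \<phi>t: "((\<lambda>s. \<phi> s x) has_real_derivative c t - \<alpha> t * \<phi> t x - ?\<delta> (\<rho> t) (X t x)) (at t)" if t: "0 < t" for t x
  proof -
    obtain D where D: "((\<lambda>(t, x). \<Phi> t x) has_derivative D) (at (t, X t x))"
      using diff(2)[OF t] unfolding differentiable_def by blast
    have lD: "linear D" by (rule has_derivative_linear[OF D])
    have "((\<lambda>z. (t, z)) has_derivative (\<lambda>h. (0, h))) (at (X t x))" by (auto intro!: derivative_eq_intros)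
    from has_derivative_compose[OF this, of "\<lambda>(t, x). \<Phi> t x" D] D
    have "(\<Phi> t has_derivative (\<lambda>h. D (0, h))) (at (X t x))" by simp
    from has_derivative_unique[OF this grad_has] t
    have Dx: "D (0, h) = grad (\<Phi> t) (X t x) \<bullet> h" for h by (simp add: fun_eq_iff)
    have "((\<lambda>r. (r, X t x)) has_derivative (\<lambda>h. (h, 0))) (at t)" by (auto intro!: derivative_eq_intros)
    from has_derivative_compose[OF this, of "\<lambda>(t, x). \<Phi> t x" D] D
    have "((\<lambda>s. \<Phi> s (X t x)) has_derivative (\<lambda>h. D (h, 0))) (at t)" by simp
    from has_derivative_unique[OF this \<Phi>t[OF t, of "X t x", unfolded has_field_derivative_def]]
    have "(\<lambda>h. D (h, 0)) = (*) (c t - \<alpha> t * \<Phi> t (X t x) - F t (X t x) \<bullet> grad (\<Phi> t) (X t x) - ?\<delta> (\<rho> t) (X t x))" .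
    from fun_cong[OF this, of 1]
    have Dt: "D (1, 0) = c t - \<alpha> t * \<Phi> t (X t x) - F t (X t x) \<bullet> grad (\<Phi> t) (X t x) - ?\<delta> (\<rho> t) (X t x)" by simp
    have "((\<lambda>s. (s, X s x)) has_derivative (\<lambda>h. h *\<^sub>R (1, F t (X t x)))) (at t)"
      using has_derivative_Pair[OF has_derivative_ident has_vector_derivative_within_atLeast_0[OF dX[OF less_imp_le[OF t]] t, unfolded has_vector_derivative_def]]
      by simp
    from has_derivative_compose[OF this, of "\<lambda>(t, x). \<Phi> t x" D] D
    have "((\<lambda>s. \<phi> s x) has_derivative (\<lambda>h. D (h *\<^sub>R (1, F t (X t x))))) (at t)" by (simp add: \<phi>_def)
    moreover have "D (h *\<^sub>R (1, F t (X t x))) = (D (1, 0) + D (0, F t (X t x))) * h" for h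
      using linear_add[OF lD, of "(1, 0)" "(0, F t (X t x))"] linear_scale[OF lD, of h "(1, F t (X t x))"] by simp
    ultimately have "((\<lambda>s. \<phi> s x) has_real_derivative D (1, 0) + D (0, F t (X t x))) (at t)"
      by (simp add: has_field_derivative_def)
    moreover have "D (1, 0) + D (0, F t (X t x)) = c t - \<alpha> t * \<phi> t x - ?\<delta> (\<rho> t) (X t x)"
      unfolding Dt Dx by (simp add: \<phi>_def inner_commute)
    ultimately show ?thesis by (simp only:)
  qed
  have quad_KL: "quadratic (?\<delta> (\<rho> t))" if t: "0 \<le> t" for t
  proof -
    obtain k where k: "\<And>x. ?\<delta> (\<rho> t) x = k - (1/2) * ((x - \<mu> t) \<bullet> (matrix_inv (\<Sigma> t) *v (x - \<mu> t))) + (1/2) * ((x - b) \<bullet> (matrix_inv Q *v (x - b)))"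
      using KL_first_variation_gaussian[OF SP[OF t] Q, of b "\<mu> t"] unfolding \<rho>[OF t] by blast
    have f: "quadratic (\<lambda>x. (x - m) \<bullet> (M *v (x - m)))" if "transpose M = M" for m and M :: "real^'n^'n"
      using quadratic_affine_form[OF that, of "mat 1" "- m"] by simp
    have "quadratic (\<lambda>x. (k + (- (1/2)) * ((x - \<mu> t) \<bullet> (matrix_inv (\<Sigma> t) *v (x - \<mu> t)))) + (1/2) * ((x - b) \<bullet> (matrix_inv Q *v (x - b))))"
      by (intro quadratic_add quadratic_const quadratic_cmult f Qs Sym_plusD(1)[OF Sym_plus_matrix_inv[OF SP[OF t]]])
    thus ?thesis by (simp add: k[abs_def])
  qed
  have \<phi>_quad: "quadratic (\<phi> t)" if t: "0 \<le> t" for t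
  proof -
    have "\<phi> t x - interpolant (\<phi> t) x = 0" for x
    proof (rule damped_zero[OF t, where \<alpha> = \<alpha>, OF _ _ _ \<alpha>])
      have "continuous_on {0..} (\<lambda>t. \<phi> t x - interpolant (\<phi> t) x)" by (intro continuous_on_diff c\<phi> continuous_on_interpolant)
      thus "continuous_on {0..t} (\<lambda>t. \<phi> t x - interpolant (\<phi> t) x)" by (rule continuous_on_subset) auto
      have "\<phi> 0 = (\<lambda>_. c0)" by (simp add: fun_eq_iff \<phi>_def \<Phi>0)
      thus "\<phi> 0 x - interpolant (\<phi> 0) x = 0" by (simp add: interpolant_quadratic[OF quadratic_const])
      fix s assume s: "0 < s" "s < t"
      have q: "interpolant (\<lambda>z. ?\<delta> (\<rho> s) (X s z)) x = ?\<delta> (\<rho> s) (X s x)"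
        unfolding X_def by (rule interpolant_quadratic[OF quadratic_compose_affine[OF quad_KL]]) (use s in simp)
      have "((\<lambda>s. \<phi> s x - interpolant (\<phi> s) x) has_real_derivative (c s - \<alpha> s * \<phi> s x - ?\<delta> (\<rho> s) (X s x))
        - interpolant (\<lambda>z. c s - \<alpha> s * \<phi> s z - ?\<delta> (\<rho> s) (X s z)) x) (at s)"
        by (intro DERIV_diff \<phi>t interpolant_derivatives s(1))
      thus "((\<lambda>t. \<phi> t x - interpolant (\<phi> t) x) has_real_derivative - \<alpha> s * (\<phi> s x - interpolant (\<phi> s) x)) (at s)"
        unfolding interpolant_linear q by (simp add: algebra_simps)
    qed
    hence "\<phi> t = interpolant (\<phi> t)" by (simp add: fun_eq_iff)
    thus ?thesis using quadratic_interpolant by metis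
  qed
  have \<Phi>_quad: "quadratic (\<Phi> t)" if t: "0 \<le> t" for t
  proof -
    have "\<Phi> t y = \<phi> t (matrix_inv (P t) *v y + - (matrix_inv (P t) *v p t))" for y
      using matrix_inv_inverse(1)[OF iP[OF t]]
      by (simp add: \<phi>_def X_def matrix_vector_right_distrib matrix_algebra matrix_vector_mul_assoc)
    hence "\<Phi> t = (\<lambda>y. \<phi> t (matrix_inv (P t) *v y + - (matrix_inv (P t) *v p t)))" by (rule ext)
    thus ?thesis using quadratic_compose_affine[OF \<phi>_quad[OF t]] by metis
  qed
  define S where "S t = (\<chi> i j. quad_coeff (\<Phi> t) i j)" for t
  define \<beta> where "\<beta> t = (\<chi> i. lin_coeff (\<Phi> t) i)" for t
  define \<nu> where "\<nu> t = \<beta> t + 2 *\<^sub>R (S t *v \<mu> t)" for t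
  have Ss: "transpose (S t) = S t" for t
    by (simp add: S_def transpose_def vec_eq_iff quad_coeff_def add.commute)
  have \<Phi>x: "\<Phi> t x = \<Phi> t 0 + \<beta> t \<bullet> x + x \<bullet> (S t *v x)" if t: "0 \<le> t" for t x
    using interpolant_quadratic[OF \<Phi>_quad[OF t], of x]
    by (simp add: interpolant_def \<beta>_def S_def inner_vec_def matrix_vector_mult_def sum_distrib_left ac_simps)
  have grad\<Phi>: "grad (\<Phi> t) x = \<beta> t + 2 *\<^sub>R (S t *v x)" if t: "0 \<le> t" for t x
  proof (rule grad_eqI)
    have "\<Phi> t = (\<lambda>x. (\<Phi> t 0 + \<beta> t \<bullet> x) + (x - 0) \<bullet> (S t *v (x - 0)))"
    proof
      fix x show "\<Phi> t x = (\<Phi> t 0 + \<beta> t \<bullet> x) + (x - 0) \<bullet> (S t *v (x - 0))" using \<Phi>x[OF t, of x] by simp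
    qed
    moreover have "((\<lambda>x. (\<Phi> t 0 + \<beta> t \<bullet> x) + (x - 0) \<bullet> (S t *v (x - 0))) has_derivative
      (\<lambda>h. (0 + \<beta> t \<bullet> h) + (2 *\<^sub>R (S t *v (x - 0))) \<bullet> h)) (at x)"
      by (intro has_derivative_add has_derivative_const quadratic_has_derivative Ss
        bounded_linear.has_derivative[OF bounded_linear_inner_right has_derivative_ident])
    ultimately show "(\<Phi> t has_derivative (\<lambda>h. (\<beta> t + 2 *\<^sub>R (S t *v x)) \<bullet> h)) (at x)"
      by (simp add: inner_add_left)
  qed
  have F_K: "F t x = ?K x (\<mu> t) *\<^sub>R \<nu> t + (2 *\<^sub>R S t) *v (\<Sigma> t *v (A *v x))" if t: "0 \<le> t" for t x
    unfolding F_def \<rho>[OF t]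
  proof (rule kernel_field_gaussian[OF As SP[OF t] _ int[OF t, unfolded \<rho>[OF t]]])
    show "grad (\<Phi> t) y = (2 *\<^sub>R S t) *v (y - \<mu> t) + \<nu> t" for y
      by (simp add: grad\<Phi>[OF t] \<nu>_def matrix_algebra scaleR_matrix_vector_assoc[symmetric] scaleR_diff_right)
  qed
  define W where "W t = outer (\<nu> t) (A *v \<mu> t) + 2 *\<^sub>R (S t ** \<Sigma> t ** A)" for t
  have FW: "F t x = \<nu> t + W t *v x" if t: "0 \<le> t" for t x
  proof -
    have "?K x (\<mu> t) = (A *v \<mu> t) \<bullet> x + 1" by (simp add: bilinear_kernel_def inner_commute)
    thus ?thesis unfolding F_K[OF t] W_def
      by (simp add: matrix_vector_mult_add_rdistrib outer_mult_vector scaleR_left_distrib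
        bounded_bilinear.scaleR_left[OF bounded_bilinear_matrix_mult]
        scaleR_matrix_vector_assoc[symmetric] matrix_vector_mul_assoc matrix_mul_assoc)
  qed
  note lin = linear_part_affine[OF FW]
  have c\<Phi>x: "continuous_on {0..} (\<lambda>t. \<Phi> t x)" for x
  proof -
    have "continuous_on {0..} (\<lambda>t. (\<lambda>(t, x). \<Phi> t x) (t, x))"
      by (rule continuous_on_compose2[OF c\<Phi>]) (auto intro!: continuous_intros)
    thus ?thesis by simp
  qed
  have c\<mu>: "continuous_on {0..} \<mu>" by (rule has_vector_derivative_continuous_on[OF d\<mu>]) simp
  have c\<Sigma>: "continuous_on {0..} \<Sigma>" by (rule has_vector_derivative_continuous_on[OF d\<Sigma>]) simp
  have cS: "continuous_on {0..} S" unfolding S_def by (intro continuous_on_vec_lambda continuous_on_interpolant c\<Phi>x)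
  have c\<beta>: "continuous_on {0..} \<beta>" unfolding \<beta>_def by (intro continuous_on_vec_lambda continuous_on_interpolant c\<Phi>x)
  have c\<nu>: "continuous_on {0..} \<nu>" unfolding \<nu>_def
    by (intro continuous_intros c\<beta> bounded_bilinear.continuous_on[OF bounded_bilinear_matrix_vector_mult] cS c\<mu>)
  have q0: "S 0 = 0" "\<beta> 0 = 0"
    by (simp_all add: S_def \<beta>_def vec_eq_iff quad_coeff_def lin_coeff_def \<Phi>0)
  \<comment> \<open>Coefficients are finite combinations of values at fixed points, so their time derivatives are the
    coefficients of the right-hand side of the equation for the potential.\<close>
  have coeffs: "(S has_vector_derivative - (\<alpha> t *\<^sub>R S t) - (transpose (W t) ** S t + S t ** W t) - (1/2) *\<^sub>R (matrix_inv Q - matrix_inv (\<Sigma> t))) (at t)"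
    "(\<beta> has_vector_derivative - (\<alpha> t *\<^sub>R \<beta> t) - (transpose (W t) *v \<beta> t + 2 *\<^sub>R (S t *v \<nu> t)) - (matrix_inv (\<Sigma> t) *v \<mu> t - matrix_inv Q *v b)) (at t)"
    if t: "0 < t" for t
  proof -
    have t0: "0 \<le> t" using t by simp
    define D where "D x = c t - \<alpha> t * \<Phi> t x - F t x \<bullet> grad (\<Phi> t) x - ?\<delta> (\<rho> t) x" for x
    let ?Si = "matrix_inv (\<Sigma> t)" and ?Qi = "matrix_inv Q"
    have Sis: "transpose ?Si = ?Si" by (rule Sym_plusD(1)[OF Sym_plus_matrix_inv[OF SP[OF t0]]])
    obtain k where k: "\<And>x. ?\<delta> (\<rho> t) x = k - (1/2) * ((x - \<mu> t) \<bullet> (?Si *v (x - \<mu> t))) + (1/2) * ((x - b) \<bullet> (?Qi *v (x - b)))"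
      using KL_first_variation_gaussian[OF SP[OF t0] Q, of b "\<mu> t"] unfolding \<rho>[OF t0] by blast
    define S' where "S' = - (\<alpha> t *\<^sub>R S t) - (transpose (W t) ** S t + S t ** W t) - (1/2) *\<^sub>R (?Qi - ?Si)"
    define \<beta>' where "\<beta>' = - (\<alpha> t *\<^sub>R \<beta> t) - (transpose (W t) *v \<beta> t + 2 *\<^sub>R (S t *v \<nu> t)) - (?Si *v \<mu> t - ?Qi *v b)"
    have S's: "transpose S' = S'"
      unfolding S'_def by (simp add: matrix_algebra Ss Sis Qs add.commute)
    have symv: "x \<bullet> (M *v y) = (M *v x) \<bullet> y" if "transpose M = M" for M :: "real^'n^'n" and x y
      using inner_matrix_vector[of x M y] that by simp
    have sq: "(x - m) \<bullet> (M *v (x - m)) = x \<bullet> (M *v x) - 2 * ((M *v m) \<bullet> x) + m \<bullet> (M *v m)" if "transpose M = M" for M :: "real^'n^'n" and m x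
      using symv[OF that, of m x] symv[OF that, of x m]
      by (simp add: matrix_vector_mult_diff_distrib inner_diff_left inner_diff_right inner_commute)
    have cross: "F t x \<bullet> grad (\<Phi> t) x = \<nu> t \<bullet> \<beta> t + (transpose (W t) *v \<beta> t + 2 *\<^sub>R (S t *v \<nu> t)) \<bullet> x
       + x \<bullet> ((transpose (W t) ** S t + S t ** W t) *v x)" for x
    proof -
      have 1: "(W t *v x) \<bullet> \<beta> t = (transpose (W t) *v \<beta> t) \<bullet> x"
        using inner_matrix_vector[of "\<beta> t" "W t" x] by (simp only: inner_commute)
      have 2: "\<nu> t \<bullet> (S t *v x) = (S t *v \<nu> t) \<bullet> x" by (rule symv[OF Ss])
      have 3: "(W t *v x) \<bullet> (S t *v x) = x \<bullet> ((transpose (W t) ** S t) *v x)"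
        using inner_matrix_vector[of "S t *v x" "W t" x] by (simp only: inner_commute matrix_vector_mul_assoc)
      have 4: "(W t *v x) \<bullet> (S t *v x) = x \<bullet> ((S t ** W t) *v x)"
        using symv[OF Ss, of x t "W t *v x"] by (simp add: inner_commute matrix_vector_mul_assoc)
      have "F t x \<bullet> grad (\<Phi> t) x = \<nu> t \<bullet> \<beta> t + (W t *v x) \<bullet> \<beta> t + 2 * (\<nu> t \<bullet> (S t *v x)) + ((W t *v x) \<bullet> (S t *v x) + (W t *v x) \<bullet> (S t *v x))"
        unfolding FW[OF t0] grad\<Phi>[OF t0] by (simp add: inner_add_left inner_add_right)
      also have "\<dots> = \<nu> t \<bullet> \<beta> t + (transpose (W t) *v \<beta> t) \<bullet> x + 2 * ((S t *v \<nu> t) \<bullet> x)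
          + (x \<bullet> ((transpose (W t) ** S t) *v x) + x \<bullet> ((S t ** W t) *v x))"
        using 1 2 3 4 by linarith
      finally show ?thesis by (simp only: inner_add_left inner_add_right inner_scaleR_left matrix_vector_mult_add_rdistrib)
    qed
    have D: "D x = (c t - \<alpha> t * \<Phi> t 0 - \<nu> t \<bullet> \<beta> t - k + (1/2) * (\<mu> t \<bullet> (?Si *v \<mu> t)) - (1/2) * (b \<bullet> (?Qi *v b))) + \<beta>' \<bullet> x + x \<bullet> (S' *v x)" for x
    proof -
      have b': "\<beta>' \<bullet> x = - (\<alpha> t * (\<beta> t \<bullet> x)) - (transpose (W t) *v \<beta> t + 2 *\<^sub>R (S t *v \<nu> t)) \<bullet> x - ((?Si *v \<mu> t) \<bullet> x - (?Qi *v b) \<bullet> x)"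
        unfolding \<beta>'_def by (simp only: inner_diff_left inner_minus_left inner_scaleR_left)
      have s': "x \<bullet> (S' *v x) = - (\<alpha> t * (x \<bullet> (S t *v x))) - x \<bullet> ((transpose (W t) ** S t + S t ** W t) *v x)
          - (1/2) * (x \<bullet> (?Qi *v x) - x \<bullet> (?Si *v x))"
        unfolding S'_def by (simp only: matrix_vector_mult_diff_rdistrib inner_diff_right
          bounded_bilinear.minus_left[OF bounded_bilinear_matrix_vector_mult] inner_minus_right
          bounded_bilinear.scaleR_left[OF bounded_bilinear_matrix_vector_mult] inner_scaleR_right)
      show ?thesis
        unfolding D_def cross k sq[OF Sis] sq[OF Qs] b' s' \<Phi>x[OF t0, of x] by (simp add: algebra_simps)
    qed
    have der: "((\<lambda>s. \<Phi> s x) has_real_derivative D x) (at t)" for x unfolding D_def by (rule \<Phi>t[OF t])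
    note co = quadratic_coeffs[OF S's D]
    show "(S has_vector_derivative - (\<alpha> t *\<^sub>R S t) - (transpose (W t) ** S t + S t ** W t) - (1/2) *\<^sub>R (?Qi - ?Si)) (at t)"
      unfolding S'_def[symmetric]
      using interpolant_derivatives(1)[where \<phi> = \<Phi>, OF der] by (intro has_vector_derivative_matrixI) (simp add: S_def co)
    show "(\<beta> has_vector_derivative - (\<alpha> t *\<^sub>R \<beta> t) - (transpose (W t) *v \<beta> t + 2 *\<^sub>R (S t *v \<nu> t)) - (?Si *v \<mu> t - ?Qi *v b)) (at t)"
      unfolding \<beta>'_def[symmetric]
      using interpolant_derivatives(2)[where \<phi> = \<Phi>, OF der] by (intro has_vector_derivative_vecI) (simp add: \<beta>_def co)
  qed
  have "accelerated_gaussian_system A b Q \<alpha> \<mu>0 \<Sigma>0 \<mu> \<Sigma> \<nu> S"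
    unfolding accelerated_gaussian_system_def
  proof (intro conjI allI impI m0 S0 c\<mu> c\<Sigma> c\<nu> cS q0)
    show "\<nu> 0 = 0" by (simp add: \<nu>_def q0 matrix_algebra)
    fix t :: real assume t: "0 < t"
    have t0: "0 \<le> t" using t by simp
    note \<Sigma>s = Sym_plusD(1)[OF SP[OF t0]]
    have \<mu>': "(\<mu> has_vector_derivative W t *v \<mu> t + \<nu> t) (at t)"
      using has_vector_derivative_within_atLeast_0[OF d\<mu>[OF t0] t] by (simp add: FW[OF t0] add.commute)
    have W\<mu>: "W t *v \<mu> t + \<nu> t = 2 *\<^sub>R ((S t ** \<Sigma> t ** A) *v \<mu> t) + (\<mu> t \<bullet> (A *v \<mu> t) + 1) *\<^sub>R \<nu> t"
      by (simp add: W_def matrix_vector_mult_add_rdistrib outer_mult_vector scaleR_left_distrib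
        scaleR_matrix_vector_assoc[symmetric] inner_commute)
    show "(\<mu> has_vector_derivative 2 *\<^sub>R ((S t ** \<Sigma> t ** A) *v \<mu> t) + (\<mu> t \<bullet> (A *v \<mu> t) + 1) *\<^sub>R \<nu> t) (at t)"
      using \<mu>' unfolding W\<mu> .
    have o: "outer (\<nu> t) (\<mu> t) ** A = outer (\<nu> t) (A *v \<mu> t)" by (simp only: outer_matrix_mult As)
    have Wt: "transpose (W t) = outer (A *v \<mu> t) (\<nu> t) + 2 *\<^sub>R (A ** \<Sigma> t ** S t)"
      by (simp add: W_def matrix_algebra transpose_outer As Ss \<Sigma>s)
    have "W t ** \<Sigma> t + \<Sigma> t ** transpose (W t) = Sym (outer (\<nu> t) (\<mu> t) ** A ** \<Sigma> t)
          + Sym (\<Sigma> t ** A ** (2 *\<^sub>R (\<Sigma> t ** S t) + outer (\<mu> t) (\<nu> t)))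
          + 2 *\<^sub>R Sym (\<Sigma> t ** A ** \<Sigma> t ** S t)"
    proof -
      have e1: "outer (\<nu> t) (\<mu> t) ** A ** \<Sigma> t = outer (\<nu> t) (\<Sigma> t *v (A *v \<mu> t))"
        unfolding o by (simp only: outer_matrix_mult \<Sigma>s)
      have e2: "\<Sigma> t ** A ** (2 *\<^sub>R (\<Sigma> t ** S t) + outer (\<mu> t) (\<nu> t)) = 2 *\<^sub>R (\<Sigma> t ** A ** \<Sigma> t ** S t) + outer (\<Sigma> t *v (A *v \<mu> t)) (\<nu> t)"
        by (simp add: matrix_algebra matrix_mult_outer)
      have e3: "W t ** \<Sigma> t = outer (\<nu> t) (\<Sigma> t *v (A *v \<mu> t)) + 2 *\<^sub>R (S t ** \<Sigma> t ** A ** \<Sigma> t)"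
        unfolding W_def by (simp add: outer_matrix_mult \<Sigma>s matrix_algebra del: transpose_matrix_vector)
      have e4: "\<Sigma> t ** transpose (W t) = outer (\<Sigma> t *v (A *v \<mu> t)) (\<nu> t) + 2 *\<^sub>R (\<Sigma> t ** A ** \<Sigma> t ** S t)"
        unfolding Wt by (simp add: matrix_algebra matrix_mult_outer)
      show ?thesis
        unfolding e1 e2 e3 e4
        by (simp add: Sym_def matrix_algebra transpose_outer As Ss \<Sigma>s scaleR_add_right scaleR_2[symmetric])
          (simp add: vec_eq_iff)
    qed
    thus "(\<Sigma> has_vector_derivative Sym (outer (\<nu> t) (\<mu> t) ** A ** \<Sigma> t)
          + Sym (\<Sigma> t ** A ** (2 *\<^sub>R (\<Sigma> t ** S t) + outer (\<mu> t) (\<nu> t)))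
          + 2 *\<^sub>R Sym (\<Sigma> t ** A ** \<Sigma> t ** S t)) (at t)"
      using has_vector_derivative_within_atLeast_0[OF d\<Sigma>[OF t0] t] by (simp add: lin(1)[OF t0])
    have two: "transpose (W t) ** S t + S t ** W t = 2 *\<^sub>R Sym (S t ** outer (\<nu> t) (\<mu> t) ** A) + 4 *\<^sub>R Sym (S t ** S t ** \<Sigma> t ** A)"
    proof -
      have e: "S t ** W t = S t ** outer (\<nu> t) (\<mu> t) ** A + 2 *\<^sub>R (S t ** S t ** \<Sigma> t ** A)"
        unfolding W_def o[symmetric] by (simp add: matrix_algebra)
      have "transpose (W t) ** S t = transpose (S t ** W t)" by (simp only: matrix_transpose_mul Ss)
      hence "transpose (W t) ** S t + S t ** W t = 2 *\<^sub>R Sym (S t ** W t)" by (simp add: two_Sym add.commute)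
      also have "\<dots> = 2 *\<^sub>R Sym (S t ** outer (\<nu> t) (\<mu> t) ** A) + 2 *\<^sub>R (2 *\<^sub>R Sym (S t ** S t ** \<Sigma> t ** A))"
        unfolding e two_Sym by (simp add: matrix_algebra scaleR_add_right)
      finally show ?thesis by simp
    qed
    show "(S has_vector_derivative - (\<alpha> t *\<^sub>R S t) - 2 *\<^sub>R Sym (S t ** outer (\<nu> t) (\<mu> t) ** A)
          - 4 *\<^sub>R Sym (S t ** S t ** \<Sigma> t ** A) - (1/2) *\<^sub>R (matrix_inv Q - matrix_inv (\<Sigma> t))) (at t)"
      using coeffs(1)[OF t] unfolding two by (simp add: diff_diff_eq add.assoc)
    have "((\<lambda>t. S t *v \<mu> t) has_vector_derivative S t *v (W t *v \<mu> t + \<nu> t)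
       + (- (\<alpha> t *\<^sub>R S t) - (transpose (W t) ** S t + S t ** W t) - (1/2) *\<^sub>R (matrix_inv Q - matrix_inv (\<Sigma> t))) *v \<mu> t) (at t)"
      by (rule bounded_bilinear.has_vector_derivative[OF bounded_bilinear_matrix_vector_mult coeffs(1)[OF t] \<mu>'])
    from has_vector_derivative_add[OF coeffs(2)[OF t] bounded_linear.has_vector_derivative[OF bounded_linear_scaleR_right[of 2] this]]
    have "(\<nu> has_vector_derivative (- (\<alpha> t *\<^sub>R \<beta> t) - (transpose (W t) *v \<beta> t + 2 *\<^sub>R (S t *v \<nu> t)) - (matrix_inv (\<Sigma> t) *v \<mu> t - matrix_inv Q *v b))
      + 2 *\<^sub>R (S t *v (W t *v \<mu> t + \<nu> t)
       + (- (\<alpha> t *\<^sub>R S t) - (transpose (W t) ** S t + S t ** W t) - (1/2) *\<^sub>R (matrix_inv Q - matrix_inv (\<Sigma> t))) *v \<mu> t)) (at t)"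
      unfolding \<nu>_def[abs_def] .
    moreover have "(- (\<alpha> t *\<^sub>R \<beta> t) - (transpose (W t) *v \<beta> t + 2 *\<^sub>R (S t *v \<nu> t)) - (matrix_inv (\<Sigma> t) *v \<mu> t - matrix_inv Q *v b))
      + 2 *\<^sub>R (S t *v (W t *v \<mu> t + \<nu> t)
       + (- (\<alpha> t *\<^sub>R S t) - (transpose (W t) ** S t + S t ** W t) - (1/2) *\<^sub>R (matrix_inv Q - matrix_inv (\<Sigma> t))) *v \<mu> t)
      = - (\<alpha> t *\<^sub>R \<nu> t) - transpose (W t) *v \<nu> t - matrix_inv Q *v (\<mu> t - b)"
    proof -
      have n: "\<beta> t = \<nu> t - 2 *\<^sub>R (S t *v \<mu> t)" by (simp add: \<nu>_def)
      define V where "V = transpose (W t)"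
      have m: "(- (\<alpha> t *\<^sub>R S t) - (V ** S t + S t ** W t) - (1/2) *\<^sub>R (matrix_inv Q - matrix_inv (\<Sigma> t))) *v \<mu> t
        = - (\<alpha> t *\<^sub>R (S t *v \<mu> t)) - (V *v (S t *v \<mu> t) + S t *v (W t *v \<mu> t)) - (1/2) *\<^sub>R (matrix_inv Q *v \<mu> t - matrix_inv (\<Sigma> t) *v \<mu> t)"
        by (simp only: matrix_vector_mult_diff_rdistrib matrix_vector_mult_add_rdistrib
          bounded_bilinear.minus_left[OF bounded_bilinear_matrix_vector_mult]
          bounded_bilinear.scaleR_left[OF bounded_bilinear_matrix_vector_mult] matrix_vector_mul_assoc)
      have v: "V *v \<beta> t = V *v \<nu> t - 2 *\<^sub>R (V *v (S t *v \<mu> t))"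
        unfolding n by (simp only: matrix_vector_mult_diff_distrib matrix_vector_mult_scaleR)
      show ?thesis unfolding V_def[symmetric] m v
        by (simp add: n matrix_vector_right_distrib matrix_vector_mult_diff_distrib scaleR_add_right scaleR_diff_right)
    qed
    moreover have "transpose (W t) *v \<nu> t = 2 *\<^sub>R ((A ** \<Sigma> t ** S t) *v \<nu> t) + (norm (\<nu> t))\<^sup>2 *\<^sub>R (A *v \<mu> t)"
      unfolding Wt by (simp add: matrix_vector_mult_add_rdistrib outer_mult_vector
        scaleR_matrix_vector_assoc[symmetric] power2_norm_eq_inner)
    ultimately show "(\<nu> has_vector_derivative - (\<alpha> t *\<^sub>R \<nu> t) - 2 *\<^sub>R ((A ** \<Sigma> t ** S t) *v \<nu> t)
          - (norm (\<nu> t))\<^sup>2 *\<^sub>R (A *v \<mu> t) - matrix_inv Q *v (\<mu> t - b)) (at t)"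
      by (simp add: diff_diff_eq add.assoc)
  qed
  thus ?thesis using SP \<rho> by blast
qed

theorem theorem5p1:
  fixes A Q \<Sigma>0 :: "real^'n^'n" and \<mu>0 b :: "real^'n"
    and K :: "real^'n \<Rightarrow> real^'n \<Rightarrow> real" and \<rho>0 \<rho>star :: "real^'n \<Rightarrow> real" and \<gamma> :: real
  assumes "A \<in> Sym_plus" and "\<Sigma>0 \<in> Sym_plus" and "Q \<in> Sym_plus"
  defines "K \<equiv> bilinear_kernel A"
    and "\<rho>0 \<equiv> gaussian \<mu>0 \<Sigma>0"
    and "\<rho>star \<equiv> gaussian b Q"
    and "\<gamma> \<equiv> lambda_min (stein_rate_matrix A b Q)"
  shows
    \<comment> \<open>1. The flow stays Gaussian.\<close>
    "(\<forall>\<rho>. stein_gradient_flow K (KL_first_variation \<rho>star) \<rho>0 \<rho> \<longrightarrow>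
        (\<exists>\<mu> \<Sigma>. stein_gaussian_system A b Q \<mu>0 \<Sigma>0 \<mu> \<Sigma> \<and>
           (\<forall>t\<ge>0. \<Sigma> t \<in> Sym_plus \<and> \<rho> t = gaussian (\<mu> t) (\<Sigma> t))))
     \<and>
     \<comment> \<open>2. Well-posedness of the system and convergence.\<close>
     (\<exists>\<mu> \<Sigma>. stein_gaussian_system A b Q \<mu>0 \<Sigma>0 \<mu> \<Sigma> \<and> (\<forall>t\<ge>0. \<Sigma> t \<in> Sym_plus) \<and>
        (\<forall>\<mu>' \<Sigma>'. stein_gaussian_system A b Q \<mu>0 \<Sigma>0 \<mu>' \<Sigma>' \<longrightarrow>
           (\<forall>t\<ge>0. \<mu>' t = \<mu> t \<and> \<Sigma>' t = \<Sigma> t)) \<and>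
        (\<forall>\<epsilon>>0. (\<lambda>t. norm (\<mu> t - b)) \<in> O[at_top](\<lambda>t. exp (- 2 * (\<gamma> - \<epsilon>) * t)) \<and>
                (\<lambda>t. norm (\<Sigma> t - Q)) \<in> O[at_top](\<lambda>t. exp (- 2 * (\<gamma> - \<epsilon>) * t))))
     \<and>
     (\<forall>\<rho>. stein_gradient_flow K (KL_first_variation \<rho>star) \<rho>0 \<rho> \<longrightarrow>
        converges_weakly \<rho> \<rho>star at_top)
     \<and>
     \<gamma> > lambda_min A / (K b b + 2 * lambda_min A * lambda_max Q)
     \<and>
     \<comment> \<open>3. The centered case and the closed form solution.\<close>
     (\<mu>0 = 0 \<and> b = 0 \<longrightarrow>
        (\<forall>\<mu> \<Sigma>. stein_gaussian_system A b Q \<mu>0 \<Sigma>0 \<mu> \<Sigma> \<longleftrightarrow>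
           (\<forall>t\<ge>0. \<mu> t = 0) \<and> stein_lyapunov_equation A Q \<Sigma>0 \<Sigma>) \<and>
        (\<forall>V :: real^'n^'n.
           \<Sigma>0 ** Q = Q ** \<Sigma>0 \<and> is_diagonal A \<and> invertible V \<and>
           is_diagonal (matrix_inv V ** \<Sigma>0 ** V) \<and> is_diagonal (matrix_inv V ** Q ** V) \<and>
           A ** V = V ** A \<longrightarrow>
           (\<forall>\<Sigma>. stein_lyapunov_equation A Q \<Sigma>0 \<Sigma> \<longrightarrow>
              (\<forall>t\<ge>0. \<Sigma> t ** Q = Q ** \<Sigma> t \<and> invertible (\<Sigma> t) \<and>
                 matrix_inv (\<Sigma> t) =
                   matrix_inv Q
                     + mat_exp ((- 2 * t) *\<^sub>R A) ** (matrix_inv \<Sigma>0 - matrix_inv Q)))))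
     \<and>
     \<comment> \<open>4. The accelerated flow stays Gaussian.\<close>
     (\<forall>\<alpha> \<rho> \<Phi>. (\<forall>t\<ge>0. \<alpha> t \<ge> 0) \<and>
        accelerated_stein_gradient_flow K (KL_first_variation \<rho>star) \<alpha> \<rho>0 \<rho> \<Phi> \<longrightarrow>
        (\<exists>\<mu> \<Sigma> \<nu> S. accelerated_gaussian_system A b Q \<alpha> \<mu>0 \<Sigma>0 \<mu> \<Sigma> \<nu> S \<and>
           (\<forall>t\<ge>0. \<Sigma> t \<in> Sym_plus \<and> \<rho> t = gaussian (\<mu> t) (\<Sigma> t))))"
proof (intro conjI)
  note A = assms(1) and \<Sigma>0 = assms(2) and Q = assms(3)
  have unfolded: "K = bilinear_kernel A" "\<rho>0 = gaussian \<mu>0 \<Sigma>0" "\<rho>star = gaussian b Q"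
    "\<gamma> = lambda_min (stein_rate_matrix A b Q)"
    by (simp_all add: K_def \<rho>0_def \<rho>star_def \<gamma>_def)
  show "\<forall>\<rho>. stein_gradient_flow K (KL_first_variation \<rho>star) \<rho>0 \<rho> \<longrightarrow>
        (\<exists>\<mu> \<Sigma>. stein_gaussian_system A b Q \<mu>0 \<Sigma>0 \<mu> \<Sigma> \<and>
           (\<forall>t\<ge>0. \<Sigma> t \<in> Sym_plus \<and> \<rho> t = gaussian (\<mu> t) (\<Sigma> t)))"
    unfolding unfolded
  proof (intro allI impI)
    fix \<rho> assume flow: "stein_gradient_flow (bilinear_kernel A) (KL_first_variation (gaussian b Q)) (gaussian \<mu>0 \<Sigma>0) \<rho>"
    show "\<exists>\<mu> \<Sigma>. stein_gaussian_system A b Q \<mu>0 \<Sigma>0 \<mu> \<Sigma> \<and> (\<forall>t\<ge>0. \<Sigma> t \<in> Sym_plus \<and> \<rho> t = gaussian (\<mu> t) (\<Sigma> t))"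
      by (rule stein_flow_gaussian[OF A \<Sigma>0 Q flow]) blast
  qed
  obtain \<mu> \<Sigma> where sol: "stein_gaussian_system A b Q \<mu>0 \<Sigma>0 \<mu> \<Sigma>"
    by (rule stein_system_exists[OF A \<Sigma>0 Q])
  note conv = stein_system_convergence[OF A \<Sigma>0 Q sol]
  show "\<exists>\<mu> \<Sigma>. stein_gaussian_system A b Q \<mu>0 \<Sigma>0 \<mu> \<Sigma> \<and> (\<forall>t\<ge>0. \<Sigma> t \<in> Sym_plus) \<and>
        (\<forall>\<mu>' \<Sigma>'. stein_gaussian_system A b Q \<mu>0 \<Sigma>0 \<mu>' \<Sigma>' \<longrightarrow>
           (\<forall>t\<ge>0. \<mu>' t = \<mu> t \<and> \<Sigma>' t = \<Sigma> t)) \<and>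
        (\<forall>\<epsilon>>0. (\<lambda>t. norm (\<mu> t - b)) \<in> O[at_top](\<lambda>t. exp (- 2 * (\<gamma> - \<epsilon>) * t)) \<and>
                (\<lambda>t. norm (\<Sigma> t - Q)) \<in> O[at_top](\<lambda>t. exp (- 2 * (\<gamma> - \<epsilon>) * t)))"
    unfolding unfolded
  proof (intro exI[of _ \<mu>] exI[of _ \<Sigma>] conjI[OF sol] conjI[of "\<forall>t\<ge>0. \<Sigma> t \<in> Sym_plus"]
      conjI[of "\<forall>\<mu>' \<Sigma>'. _ \<mu>' \<Sigma>'"] allI impI)
    show "\<Sigma> t \<in> Sym_plus" if "0 \<le> t" for t by (rule stein_system_Sym_plus[OF A \<Sigma>0 Q sol that])
    show "\<mu>' t = \<mu> t \<and> \<Sigma>' t = \<Sigma> t" if "stein_gaussian_system A b Q \<mu>0 \<Sigma>0 \<mu>' \<Sigma>'" "0 \<le> t" for \<mu>' \<Sigma>' t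
      by (rule stein_system_unique[OF sol that])
    show "(\<lambda>t. norm (\<mu> t - b)) \<in> O[at_top](\<lambda>t. exp (- 2 * (lambda_min (stein_rate_matrix A b Q) - \<epsilon>) * t)) \<and>
        (\<lambda>t. norm (\<Sigma> t - Q)) \<in> O[at_top](\<lambda>t. exp (- 2 * (lambda_min (stein_rate_matrix A b Q) - \<epsilon>) * t))"
      if "0 < \<epsilon>" for \<epsilon> using conv(3,4)[OF that] by (rule conjI)
  qed
  show "\<forall>\<rho>. stein_gradient_flow K (KL_first_variation \<rho>star) \<rho>0 \<rho> \<longrightarrow> converges_weakly \<rho> \<rho>star at_top"
    unfolding unfolded
  proof (intro allI impI)
    fix \<rho> assume flow: "stein_gradient_flow (bilinear_kernel A) (KL_first_variation (gaussian b Q)) (gaussian \<mu>0 \<Sigma>0) \<rho>"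
    show "converges_weakly \<rho> (gaussian b Q) at_top"
    proof (rule stein_flow_gaussian[OF A \<Sigma>0 Q flow])
      fix \<mu> \<Sigma>
      assume sol: "stein_gaussian_system A b Q \<mu>0 \<Sigma>0 \<mu> \<Sigma>" and S: "\<And>t. 0 \<le> t \<Longrightarrow> \<Sigma> t \<in> Sym_plus"
        and \<rho>: "\<And>t. 0 \<le> t \<Longrightarrow> \<rho> t = gaussian (\<mu> t) (\<Sigma> t)"
      show ?thesis
        by (rule gaussian_converges_weakly[OF Q S stein_system_convergence(1,2)[OF A \<Sigma>0 Q sol] \<rho>])
    qed
  qed
  show "lambda_min A / (K b b + 2 * lambda_min A * lambda_max Q) < \<gamma>"
    unfolding unfolded by (rule rate_lower_bound[OF A Q])
  show "\<mu>0 = 0 \<and> b = 0 \<longrightarrow>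
        (\<forall>\<mu> \<Sigma>. stein_gaussian_system A b Q \<mu>0 \<Sigma>0 \<mu> \<Sigma> \<longleftrightarrow>
           (\<forall>t\<ge>0. \<mu> t = 0) \<and> stein_lyapunov_equation A Q \<Sigma>0 \<Sigma>) \<and>
        (\<forall>V :: real^'n^'n.
           \<Sigma>0 ** Q = Q ** \<Sigma>0 \<and> is_diagonal A \<and> invertible V \<and>
           is_diagonal (matrix_inv V ** \<Sigma>0 ** V) \<and> is_diagonal (matrix_inv V ** Q ** V) \<and>
           A ** V = V ** A \<longrightarrow>
           (\<forall>\<Sigma>. stein_lyapunov_equation A Q \<Sigma>0 \<Sigma> \<longrightarrow>
              (\<forall>t\<ge>0. \<Sigma> t ** Q = Q ** \<Sigma> t \<and> invertible (\<Sigma> t) \<and>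
                 matrix_inv (\<Sigma> t) =
                   matrix_inv Q
                     + mat_exp ((- 2 * t) *\<^sub>R A) ** (matrix_inv \<Sigma>0 - matrix_inv Q))))"
  proof (intro impI conjI allI)
    assume "\<mu>0 = 0 \<and> b = 0"
    hence [simp]: "\<mu>0 = 0" "b = 0" by auto
    fix \<mu> \<Sigma>
    show "stein_gaussian_system A b Q \<mu>0 \<Sigma>0 \<mu> \<Sigma> \<longleftrightarrow> (\<forall>t\<ge>0. \<mu> t = 0) \<and> stein_lyapunov_equation A Q \<Sigma>0 \<Sigma>"
      using stein_system_centered_iff by simp
  next
    fix V :: "real^'n^'n" and \<Sigma> and t :: real
    assume V: "\<Sigma>0 ** Q = Q ** \<Sigma>0 \<and> is_diagonal A \<and> invertible V \<and>
           is_diagonal (matrix_inv V ** \<Sigma>0 ** V) \<and> is_diagonal (matrix_inv V ** Q ** V) \<and> A ** V = V ** A"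
      and sol: "stein_lyapunov_equation A Q \<Sigma>0 \<Sigma>" and t: "0 \<le> t"
    show "\<Sigma> t ** Q = Q ** \<Sigma> t" "invertible (\<Sigma> t)"
      "matrix_inv (\<Sigma> t) = matrix_inv Q + mat_exp ((- 2 * t) *\<^sub>R A) ** (matrix_inv \<Sigma>0 - matrix_inv Q)"
      using stein_lyapunov_closed_form[OF A \<Sigma>0 Q _ _ _ _ _ sol t, of V] V by blast+
  qed
  show "\<forall>\<alpha> \<rho> \<Phi>. (\<forall>t\<ge>0. \<alpha> t \<ge> 0) \<and>
        accelerated_stein_gradient_flow K (KL_first_variation \<rho>star) \<alpha> \<rho>0 \<rho> \<Phi> \<longrightarrow>
        (\<exists>\<mu> \<Sigma> \<nu> S. accelerated_gaussian_system A b Q \<alpha> \<mu>0 \<Sigma>0 \<mu> \<Sigma> \<nu> S \<and>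
           (\<forall>t\<ge>0. \<Sigma> t \<in> Sym_plus \<and> \<rho> t = gaussian (\<mu> t) (\<Sigma> t)))"
    unfolding unfolded by (intro allI impI) (rule accelerated_flow_gaussian[OF A \<Sigma>0 Q], auto)
qed

end
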